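(* Let $k$ be a field, let $d>1$ and $n>1$ be integers, let $S=k[x_1,\ldots,x_d]$, $\mathfrak n=(x_1,\ldots,x_d)\subset S$, and $R_{d,n}:=S/\mathfrak n^n$ with canonical module $\omega_{R_{d,n}}$. Then $$\beta_{1}(\omega_{R_{d,n}})-\beta_0(\omega_{R_{d,n}})=\operatorname{rank}_{S}\big(\operatorname{Syz}_{d-1}(R_{d,n})\big)\geq d-1 .$$
   Context: Betti numbers $\beta_i(\omega_{R_{d,n}})=\dim_k\operatorname{Tor}_i^{R_{d,n}}(k,\omega_{R_{d,n}})$ are taken over the artinian local ring $R_{d,n}$. $\operatorname{Syz}_{d-1}(R_{d,n})$ denotes the $(d-1)$-st syzygy module of $R_{d,n}$ regarded as an $S$-module: if $\cdots\to F_1\xrightarrow{f_1}F_0\xrightarrow{f_0} R_{d,n}\to 0$ is the minimal graded free resolution over $S$, then $\operatorname{Syz}_i(R_{d,n})=\ker(f_{i-1})$ for $i\ge 1$. The rank is the rank as an $S$-module. *)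

theory Defs
  imports
    "HOL-Algebra.Ideal_Product"
    "HOL-Algebra.QuotRing"
    "HOL-Algebra.Free_Abelian_Groups"
    "HOL-Library.Poly_Mapping"
    "HOL-Library.Cardinality"
    "Jordan_Normal_Form.VS_Connect"
begin

section \<open>Modules over commutative rings\<close>

text \<open>The fields \<open>mult\<close> and \<open>one\<close> of a module record play no role; they are filled
  with dummies.\<close>

definition regular_module :: "'r ring \<Rightarrow> ('r, 'r) module" where
  "regular_module R =
    \<lparr>carrier = carrier R, mult = mult R, one = \<one>\<^bsub>R\<^esub>, ring.zero = \<zero>\<^bsub>R\<^esub>, add = add R,
     smult = mult R\<rparr>"

definition restrict_scalars :: "('s \<Rightarrow> 'r) \<Rightarrow> ('r, 'm) module \<Rightarrow> ('s, 'm) module" where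
  "restrict_scalars \<phi> M =
    \<lparr>carrier = carrier M, mult = mult M, one = \<one>\<^bsub>M\<^esub>, ring.zero = \<zero>\<^bsub>M\<^esub>, add = add M,
     smult = (\<lambda>s x. \<phi> s \<odot>\<^bsub>M\<^esub> x)\<rparr>"

definition quot_module :: "('r, 'm) module \<Rightarrow> 'm set \<Rightarrow> ('r, 'm set) module" where
  "quot_module M N =
    \<lparr>carrier = a_rcosets\<^bsub>M\<^esub> N, mult = (\<lambda>_ _. N), one = N, ring.zero = N, add = set_add M,
     smult = (\<lambda>r X. \<Union>x\<in>X. N +>\<^bsub>M\<^esub> (r \<odot>\<^bsub>M\<^esub> x))\<rparr>"

definition ideal_smult :: "'r ring \<Rightarrow> 'r set \<Rightarrow> ('r, 'm) module \<Rightarrow> 'm set" where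
  "ideal_smult R I M =
    LinearCombinations.module.span R M {a \<odot>\<^bsub>M\<^esub> x | a x. a \<in> I \<and> x \<in> carrier M}"

text \<open>Rank of a module over an integral domain.  It is only used for modules where the
  sizes of the independent sets are bounded (submodules of free modules of finite rank).\<close>

definition module_rank :: "'r ring \<Rightarrow> ('r, 'm) module \<Rightarrow> nat" where
  "module_rank R M =
    (GREATEST r. \<exists>B. finite B \<and> card B = r \<and> B \<subseteq> carrier M \<and>
       \<not> LinearCombinations.module.lin_dep R M B)"

text \<open>HOL cannot quantify over modules of all types inside a formula, so the test modules
  have elements in the type of the ring.  They include the ring itself with its ideals as
  submodules, so by Baer's criterion this is injectivity in the full sense.\<close>

definition injective_module :: "'r ring \<Rightarrow> ('r, 'm) module \<Rightarrow> bool" where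
  "injective_module R E \<longleftrightarrow> Module.module R E \<and>
    (\<forall>(B :: ('r, 'r) module) A h.
       Module.module R B \<and> LinearCombinations.submodule R A B \<and>
       h \<in> LinearCombinations.module_hom R (B\<lparr>carrier := A\<rparr>) E \<longrightarrow>
       (\<exists>h' \<in> LinearCombinations.module_hom R B E. \<forall>x\<in>A. h' x = h x))"

definition injective_hull :: "'r ring \<Rightarrow> ('r, 'a) module \<Rightarrow> ('r, 'm) module \<Rightarrow> bool" where
  "injective_hull R K E \<longleftrightarrow> injective_module R E \<and>
    (\<exists>\<iota> \<in> LinearCombinations.module_hom R K E. inj_on \<iota> (carrier K) \<and>
       (\<forall>N. LinearCombinations.submodule R N E \<and> N \<noteq> {\<zero>\<^bsub>E\<^esub>} \<longrightarrow>
          N \<inter> \<iota> ` carrier K \<noteq> {\<zero>\<^bsub>E\<^esub>}))"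


section \<open>Tensor products\<close>

text \<open>The tensor product is the free abelian group on pairs modulo the usual relations.\<close>

definition tensor_gens :: "('r, 'a) module \<Rightarrow> ('r, 'm) module \<Rightarrow> ('a \<times> 'm \<Rightarrow>\<^sub>0 int) monoid" where
  "tensor_gens A M = free_Abelian_group (carrier A \<times> carrier M)"

definition tensor_rels ::
  "'r ring \<Rightarrow> ('r, 'a) module \<Rightarrow> ('r, 'm) module \<Rightarrow> ('a \<times> 'm \<Rightarrow>\<^sub>0 int) set" where
  "tensor_rels R A M = generate (tensor_gens A M)
     ({frag_of (a \<oplus>\<^bsub>A\<^esub> a', x) - frag_of (a, x) - frag_of (a', x) | a a' x.
         a \<in> carrier A \<and> a' \<in> carrier A \<and> x \<in> carrier M} \<union>
      {frag_of (a, x \<oplus>\<^bsub>M\<^esub> x') - frag_of (a, x) - frag_of (a, x') | a x x'.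
         a \<in> carrier A \<and> x \<in> carrier M \<and> x' \<in> carrier M} \<union>
      {frag_of (r \<odot>\<^bsub>A\<^esub> a, x) - frag_of (a, r \<odot>\<^bsub>M\<^esub> x) | r a x.
         r \<in> carrier R \<and> a \<in> carrier A \<and> x \<in> carrier M})"

definition tensor ::
  "'r ring \<Rightarrow> ('r, 'a) module \<Rightarrow> ('r, 'm) module \<Rightarrow> ('r, ('a \<times> 'm \<Rightarrow>\<^sub>0 int) set) module" where
  "tensor R A M = (let F = tensor_gens A M; K = tensor_rels R A M in
    \<lparr>carrier = rcosets\<^bsub>F\<^esub> K, mult = (\<lambda>_ _. K), one = K, ring.zero = K, add = set_mult F,
     smult = (\<lambda>r X. \<Union>z\<in>X. K #>\<^bsub>F\<^esub> frag_extend (\<lambda>(a, x). frag_of (r \<odot>\<^bsub>A\<^esub> a, x)) z)\<rparr>)"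

text \<open>The map \<open>id \<otimes> g : A \<otimes> M \<rightarrow> A \<otimes> N\<close>.\<close>

definition tensor_map ::
  "'r ring \<Rightarrow> ('r, 'a) module \<Rightarrow> ('r, 'm) module \<Rightarrow> ('m \<Rightarrow> 'm) \<Rightarrow>
   ('a \<times> 'm \<Rightarrow>\<^sub>0 int) set \<Rightarrow> ('a \<times> 'm \<Rightarrow>\<^sub>0 int) set" where
  "tensor_map R A N g X =
    (\<Union>z\<in>X. tensor_rels R A N #>\<^bsub>tensor_gens A N\<^esub> frag_extend (\<lambda>(a, x). frag_of (a, g x)) z)"


section \<open>Free resolutions, syzygies and Tor\<close>

abbreviation free_module :: "'r ring \<Rightarrow> nat \<Rightarrow> ('r, nat \<Rightarrow> 'r) module" where
  "free_module R b \<equiv> LinearCombinations.ring.func_space R {..<b}"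

text \<open>A resolution \<open>\<cdots> \<rightarrow> R\<^bsup>b 1\<^esup> \<rightarrow> R\<^bsup>b 0\<^esup> \<rightarrow> M \<rightarrow> 0\<close> by free modules of finite
  rank.  The map \<open>\<epsilon>\<close> is \<open>f\<^sub>0\<close>, and \<open>f i\<close> is the map from
  \<open>R\<^bsup>b i\<^esup>\<close> to \<open>R\<^bsup>b (i - 1)\<^esup>\<close> for \<open>i \<ge> 1\<close>; the value \<open>f 0\<close> is not used.\<close>

definition free_resolution ::
  "'r ring \<Rightarrow> ('r, 'm) module \<Rightarrow> (nat \<Rightarrow> nat) \<Rightarrow> ((nat \<Rightarrow> 'r) \<Rightarrow> 'm) \<Rightarrow>
   (nat \<Rightarrow> (nat \<Rightarrow> 'r) \<Rightarrow> (nat \<Rightarrow> 'r)) \<Rightarrow> bool" where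
  "free_resolution R M b \<epsilon> f \<longleftrightarrow>
     Module.module R M \<and>
     \<epsilon> \<in> LinearCombinations.module_hom R (free_module R (b 0)) M \<and>
     (\<forall>i\<ge>1. f i \<in> LinearCombinations.module_hom R (free_module R (b i)) (free_module R (b (i - 1)))) \<and>
     \<epsilon> ` carrier (free_module R (b 0)) = carrier M \<and>
     f 1 ` carrier (free_module R (b 1)) = a_kernel (free_module R (b 0)) M \<epsilon> \<and>
     (\<forall>i\<ge>1. f (i + 1) ` carrier (free_module R (b (i + 1))) =
        a_kernel (free_module R (b i)) (free_module R (b (i - 1))) (f i))"

text \<open>The \<open>i\<close>-th syzygy module is the kernel of the map out of \<open>R\<^bsup>b (i - 1)\<^esup>\<close>,
  for \<open>i \<ge> 1\<close>.\<close>

definition syzygy ::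
  "'r ring \<Rightarrow> ('r, 'm) module \<Rightarrow> (nat \<Rightarrow> nat) \<Rightarrow> ((nat \<Rightarrow> 'r) \<Rightarrow> 'm) \<Rightarrow>
   (nat \<Rightarrow> (nat \<Rightarrow> 'r) \<Rightarrow> (nat \<Rightarrow> 'r)) \<Rightarrow> nat \<Rightarrow> ('r, nat \<Rightarrow> 'r) module" where
  "syzygy R M b \<epsilon> f i = (free_module R (b (i - 1)))\<lparr>carrier :=
     (if i = 1 then a_kernel (free_module R (b 0)) M \<epsilon>
      else a_kernel (free_module R (b (i - 1))) (free_module R (b (i - 2))) (f (i - 1)))\<rparr>"

text \<open>\<open>Tor\<^sub>i(A, M)\<close>, computed from a free resolution \<open>(b, f)\<close> of \<open>M\<close>: the \<open>i\<close>-th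
  homology of \<open>\<cdots> \<rightarrow> A \<otimes> R\<^bsup>b 1\<^esup> \<rightarrow> A \<otimes> R\<^bsup>b 0\<^esup> \<rightarrow> 0\<close>.\<close>

definition Tor ::
  "'r ring \<Rightarrow> ('r, 'a) module \<Rightarrow> (nat \<Rightarrow> nat) \<Rightarrow> (nat \<Rightarrow> (nat \<Rightarrow> 'r) \<Rightarrow> (nat \<Rightarrow> 'r)) \<Rightarrow>
   nat \<Rightarrow> ('r, ('a \<times> (nat \<Rightarrow> 'r) \<Rightarrow>\<^sub>0 int) set set) module" where
  "Tor R A b f i =
    (let C = (\<lambda>j. tensor R A (free_module R (b j)));
         \<delta> = (\<lambda>j. tensor_map R A (free_module R (b (j - 1))) (f j))
     in quot_module
          ((C i)\<lparr>carrier := (if i = 0 then carrier (C 0) else a_kernel (C i) (C (i - 1)) (\<delta> i))\<rparr>)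
          (\<delta> (i + 1) ` carrier (C (i + 1))))"


section \<open>The ring \<open>S/\<nn>\<^sup>n\<close>\<close>

text \<open>The polynomial ring \<open>S\<close> over \<open>'k\<close> in the variables \<open>'v\<close> is \<open>class_ring\<close> on this
  type.\<close>

type_synonym ('v, 'k) mpoly = "('v \<Rightarrow>\<^sub>0 nat) \<Rightarrow>\<^sub>0 'k"

definition max_ideal :: "('v::finite, 'k::field) mpoly set" where
  "max_ideal = Idl\<^bsub>class_ring\<^esub>
     range (\<lambda>v. Poly_Mapping.single (Poly_Mapping.single v 1) 1)"

definition max_ideal_pow :: "nat \<Rightarrow> ('v::finite, 'k::field) mpoly set" where
  "max_ideal_pow n = max_ideal [^]\<^bsub>ideals_set class_ring\<^esub> n"

definition truncated_ring :: "nat \<Rightarrow> ('v::finite, 'k::field) mpoly set ring" where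
  "truncated_ring n = class_ring Quot max_ideal_pow n"

definition proj :: "nat \<Rightarrow> ('v::finite, 'k::field) mpoly \<Rightarrow> ('v, 'k) mpoly set" where
  "proj n p = max_ideal_pow n +>\<^bsub>class_ring\<^esub> p"

definition truncated_ring_module ::
  "nat \<Rightarrow> (('v::finite, 'k::field) mpoly, ('v, 'k) mpoly set) module" where
  "truncated_ring_module n = restrict_scalars (proj n) (regular_module (truncated_ring n))"

text \<open>The residue field \<open>'k\<close> as a module over \<open>S/\<nn>\<^sup>n\<close>: a coset acts through the common
  constant coefficient of its elements (for \<open>n \<ge> 1\<close>).\<close>

definition residue_module :: "nat \<Rightarrow> (('v::finite, 'k::field) mpoly set, 'k) module" where
  "residue_module n = restrict_scalars
     (\<lambda>X. the_elem ((\<lambda>p. Poly_Mapping.lookup p 0) ` X)) (regular_module class_ring)"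

text \<open>The canonical module of an artinian local ring is the injective hull of its residue
  field; it is unique up to isomorphism.\<close>

definition canonical_module :: "nat \<Rightarrow> (('v::finite, 'k::field) mpoly set, 'm) module \<Rightarrow> bool" where
  "canonical_module n \<omega> \<longleftrightarrow> injective_hull (truncated_ring n) (residue_module n) \<omega>"

definition k_dim :: "nat \<Rightarrow> (('v::finite, 'k::field) mpoly set, 'm) module \<Rightarrow> nat" where
  "k_dim n M = vectorspace.dim class_ring
     (restrict_scalars (\<lambda>c::'k. proj n (Poly_Mapping.single 0 c)) M)"

text \<open>The \<open>i\<close>-th Betti number over \<open>S/\<nn>\<^sup>n\<close> of the module resolved by \<open>(b, f)\<close>.\<close>

definition betti ::
  "nat \<Rightarrow> (nat \<Rightarrow> nat) \<Rightarrow>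
   (nat \<Rightarrow> (nat \<Rightarrow> ('v::finite, 'k::field) mpoly set) \<Rightarrow> (nat \<Rightarrow> ('v, 'k) mpoly set)) \<Rightarrow>
   nat \<Rightarrow> nat" where
  "betti n b f i = k_dim n (Tor (truncated_ring n) (residue_module n) b f i)"


section \<open>Minimal graded free resolutions over \<open>S\<close>\<close>

definition homogeneous :: "int \<Rightarrow> ('v::finite, 'k::field) mpoly \<Rightarrow> bool" where
  "homogeneous t p \<longleftrightarrow>
     (\<forall>m \<in> Poly_Mapping.keys p. int (\<Sum>v\<in>UNIV. Poly_Mapping.lookup m v) = t)"

text \<open>Degree \<open>t\<close> part of the direct sum of the \<open>S(-a j)\<close> for \<open>j < b\<close>.\<close>

definition free_component ::
  "nat \<Rightarrow> (nat \<Rightarrow> int) \<Rightarrow> int \<Rightarrow> (nat \<Rightarrow> ('v::finite, 'k::field) mpoly) set" where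
  "free_component b a t =
     {x \<in> carrier (free_module class_ring b). \<forall>j<b. homogeneous (t - a j) (x j)}"

text \<open>Here \<open>a i j\<close> is the degree of the \<open>j\<close>-th basis element of the \<open>i\<close>-th free module.
  All maps are homogeneous of degree \<open>0\<close>.\<close>

definition minimal_graded_free_resolution ::
  "nat \<Rightarrow> (nat \<Rightarrow> nat) \<Rightarrow> (nat \<Rightarrow> nat \<Rightarrow> int) \<Rightarrow>
   ((nat \<Rightarrow> ('v::finite, 'k::field) mpoly) \<Rightarrow> ('v, 'k) mpoly set) \<Rightarrow>
   (nat \<Rightarrow> (nat \<Rightarrow> ('v, 'k) mpoly) \<Rightarrow> (nat \<Rightarrow> ('v, 'k) mpoly)) \<Rightarrow> bool" where
  "minimal_graded_free_resolution n b a \<epsilon> f \<longleftrightarrow>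
     free_resolution class_ring (truncated_ring_module n) b \<epsilon> f \<and>
     (\<forall>t. \<epsilon> ` free_component (b 0) (a 0) t \<subseteq> proj n ` {p. homogeneous t p}) \<and>
     (\<forall>i\<ge>1. \<forall>t. f i ` free_component (b i) (a i) t \<subseteq> free_component (b (i - 1)) (a (i - 1)) t) \<and>
     (\<forall>i\<ge>1. f i ` carrier (free_module class_ring (b i)) \<subseteq>
        ideal_smult class_ring max_ideal (free_module class_ring (b (i - 1))))"

end

theory Submission
  imports Defs
    "HOL-Library.Function_Algebras"
    "HOL-Computational_Algebra.Formal_Power_Series"
begin

text \<open>Let \<open>R = S/\<nn>\<^sup>n\<close>, with maximal ideal \<open>m\<close>, and let \<open>h\<^sub>j\<close> be the number of monomials of degree
  \<open>j\<close>.  Both sides of the equation are \<open>d h\<^bsub>n-1\<^esub> - h\<^bsub>n-1\<^esub> - h\<^bsub>n-2\<^esub>\<close>.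

  A \<open>k\<close>-linear form on \<open>\<omega>\<close> that does not vanish on the socle makes \<open>\<omega>\<close> the dual of \<open>R\<close>.  If
  \<open>K\<close> is the kernel of \<open>R\<^sup>c \<rightarrow> \<omega>\<close>, then \<open>\<beta>\<^sub>1 - \<beta>\<^sub>0 = dim (K / m K) - c\<close>, and by duality
  this reduces to the dimension of \<open>Hom\<^sub>R (m, R)\<close>, that is, of the space of tuples with
  \<open>x\<^sub>w r\<^sub>v = x\<^sub>v r\<^sub>w\<close>; up to socle elements these are the tuples \<open>r\<^sub>v = x\<^sub>v q\<close>.

  Over \<open>S\<close>, the Koszul complex shows that the minimal resolution of \<open>R\<close> is linear after the first
  step.  So the Hilbert function of each syzygy module determines that of the next one,
  and the rank of \<open>Syz\<^bsub>d-1\<^esub>\<close> is the growth rate of its Hilbert function.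

  The bound follows since \<open>h\<^bsub>n-1\<^esub> - h\<^bsub>n-2\<^esub>\<close> counts the monomials of degree \<open>n - 1\<close> in
  \<open>d - 1\<close> variables, which include \<open>d - 1\<close> pure powers.\<close>

section \<open>Finite-dimensional subspaces\<close>

text \<open>The resolution of \<omega> need not be minimal, so its Betti numbers are not its ranks
  \<open>c\<close>. The rank of the first reduced differential enters both numbers with the same
  sign and cancels in the difference, which is \<open>c 1 - c 0\<close> minus the rank of the second
  one. The number of generators of K is read off the same two matrices. Hom (m, R) enters because m
  R^c / m K is the tensor product of m and \<omega>, whose dual is Hom (m, Hom (\<omega>, \<omega>))
  = Hom (m, R). Over R, elements are represented by polynomials, compared modulo
  \<open>\<nn>\<^sup>n\<close> or truncated below degree n; all dimensions then become counts of
  monomials. The rank is found without a fraction field. Combinations of r independent elements with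
  coefficients of degree at most N fill a space of dimension r D(N), where D(N) counts the monomials
  of degree at most N. Since D(N + s) / D(N) tends to 1, every fixed shift of degree, such as the
  one caused by a common denominator, disappears in the limit.\<close>

text \<open>A separate locale keeps the new names apart from the global interpretation of
  \<open>vector_space\<close> for real vector spaces.\<close>

locale vecspace = vector_space scale
  for scale :: "'a::field \<Rightarrow> 'b::ab_group_add \<Rightarrow> 'b"
begin

text \<open>Asked of sets, so that every subset inherits it. The tuple spaces used later are
  infinite-dimensional, where \<open>dim\<close> can fall back to 0, so each count carries this
  assumption.\<close>

definition fd :: "'b set \<Rightarrow> bool" where
  "fd V \<longleftrightarrow> (\<exists>B. finite B \<and> V \<subseteq> span B)"

lemma fdI: "finite B \<Longrightarrow> V \<subseteq> span B \<Longrightarrow> fd V"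
  by (auto simp: fd_def)

lemma fd_subset: "fd V \<Longrightarrow> W \<subseteq> V \<Longrightarrow> fd W"
  by (auto simp: fd_def)

lemma fd_independent_finite: "fd V \<Longrightarrow> B \<subseteq> V \<Longrightarrow> independent B \<Longrightarrow> finite B"
  unfolding fd_def using independent_span_bound by (meson order_trans)

lemma fd_basis:
  assumes "subspace V" "fd V"
  obtains B where "finite B" "B \<subseteq> V" "independent B" "span B = V" "card B = dim V"
  by (metis assms basis_exists fd_independent_finite span_subspace)

lemma fd_basis_extend:
  assumes "subspace V" "fd V" "B \<subseteq> V" "independent B"
  obtains C where "finite C" "B \<subseteq> C" "C \<subseteq> V" "independent C" "span C = V" "card C = dim V"
  by (metis assms basis_card_eq_dim fd_independent_finite maximal_independent_subset_extend
      span_subspace)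

lemma dim_mono_fd:
  assumes "fd W" "V \<subseteq> W"
  shows "dim V \<le> dim W"
proof -
  obtain B where B: "B \<subseteq> W" "independent B" "W \<subseteq> span B" "card B = dim W"
    using basis_exists by metis
  have "finite B" using fd_independent_finite assms(1) B by blast
  then show ?thesis using dim_le_card[of V B] B assms(2) by auto
qed

lemma dim_zero_space [simp]: "dim {0} = 0"
  using dim_le_card[of "{0}" "{}"] by simp

end

lemma vecspace_field: "vecspace ((*) :: 'a::field \<Rightarrow> 'a \<Rightarrow> 'a)"
  by unfold_locales (auto simp: algebra_simps)

locale vecspace_pair = vs1: vecspace s1 + vs2: vecspace s2
  for s1 :: "'a::field \<Rightarrow> 'b::ab_group_add \<Rightarrow> 'b" and s2 :: "'a \<Rightarrow> 'c::ab_group_add \<Rightarrow> 'c"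
begin

sublocale vector_space_pair s1 s2 ..

lemma fd_image:
  assumes "Vector_Spaces.linear s1 s2 f" "vs1.fd V"
  shows "vs2.fd (f ` V)"
proof -
  interpret Vector_Spaces.linear s1 s2 f by fact
  obtain B where "finite B" "V \<subseteq> vs1.span B" using assms(2) vs1.fd_def by blast
  then show ?thesis
    by (intro vs2.fdI[of "f ` B"]) (auto simp: span_image)
qed

text \<open>A basis of the kernel is extended to a basis of \<open>V\<close>; the new vectors map
  bijectively to a basis of the image. The statement is relative to \<open>V\<close> because the
  ambient space may have infinite dimension.\<close>

lemma rank_nullity_fd:
  assumes lin: "Vector_Spaces.linear s1 s2 f" and V: "vs1.subspace V" "vs1.fd V"
  shows "vs1.dim V = vs1.dim {x \<in> V. f x = 0} + vs2.dim (f ` V)"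
proof -
  interpret Vector_Spaces.linear s1 s2 f by fact
  let ?K = "{x \<in> V. f x = 0}"
  have K: "vs1.subspace ?K"
    using V(1) by (auto simp: vs1.subspace_def zero add scale)
  have fdK: "vs1.fd ?K" by (rule vs1.fd_subset[OF V(2)]) auto
  obtain B where B: "finite B" "B \<subseteq> ?K" "vs1.independent B" "vs1.span B = ?K" "card B = vs1.dim ?K"
    by (rule vs1.fd_basis[OF K fdK])
  obtain C where C: "finite C" "B \<subseteq> C" "C \<subseteq> V" "vs1.independent C" "vs1.span C = V"
      "card C = vs1.dim V"
    by (rule vs1.fd_basis_extend[OF V _ B(3)]) (use B(2) in auto)
  let ?D = "C - B"
  have inj: "inj_on f (vs1.span ?D)"
  proof (subst inj_on_iff_eq_0[OF vs1.subspace_span], intro ballI impI)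
    fix x assume x: "x \<in> vs1.span ?D" "f x = 0"
    then have "x \<in> V" using vs1.span_mono[of ?D C] C by auto
    then have "x \<in> vs1.span B" using x B(4) by auto
    then have "\<exists>u. x = (\<Sum>v\<in>B. s1 (u v) v)"
      using vs1.span_finite[OF B(1)] by auto
    then obtain u where u: "x = (\<Sum>v\<in>B. s1 (u v) v)" by auto
    have "\<exists>w. x = (\<Sum>v\<in>?D. s1 (w v) v)"
      using vs1.span_finite[of ?D] C(1) x by auto
    then obtain w where w: "x = (\<Sum>v\<in>?D. s1 (w v) v)" by auto
    \<comment> \<open>A kernel element has one expansion over \<open>B\<close> and one over
      \<open>C - B\<close>; their difference is a relation on the basis \<open>C\<close>.\<close>
    let ?g = "\<lambda>v. if v \<in> B then u v else - w v"
    have "(\<Sum>v\<in>C. s1 (?g v) v) = (\<Sum>v\<in>B. s1 (?g v) v) + (\<Sum>v\<in>?D. s1 (?g v) v)"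
      using C(1,2) B(1) by (subst sum.subset_diff[of B C]) (auto simp: add.commute)
    also have "(\<Sum>v\<in>B. s1 (?g v) v) = x" using u by simp
    also have "(\<Sum>v\<in>?D. s1 (?g v) v) = - x" by (simp add: w sum_negf)
    finally have "(\<Sum>v\<in>C. s1 (?g v) v) = 0" by simp
    then have "\<forall>v\<in>C. ?g v = 0"
      using vs1.independentD[OF C(4,1) subset_refl, of ?g] by auto
    then have "\<forall>v\<in>B. u v = 0" using C(2) by force
    then show "x = 0" using u by simp
  qed
  have ind: "vs2.independent (f ` ?D)"
    using independent_injective_image[OF vs1.independent_mono[OF C(4)] inj] by auto
  have "f ` V \<subseteq> vs2.span (f ` ?D)"
  proof (clarify)
    fix x assume "x \<in> V"
    then have "f x \<in> vs2.span (f ` C)" using C(5) span_image by auto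
    also have "\<dots> \<subseteq> vs2.span (f ` ?D)"
    proof (rule vs2.span_minimal)
      show "f ` C \<subseteq> vs2.span (f ` ?D)"
      proof clarify
        fix c assume "c \<in> C"
        show "f c \<in> vs2.span (f ` ?D)"
        proof (cases "c \<in> B")
          case True
          then have "f c = 0" using B(2) by auto
          then show ?thesis by (simp add: vs2.span_zero)
        next
          case False
          then show ?thesis using \<open>c \<in> C\<close> by (auto intro: vs2.span_base)
        qed
      qed
    qed (rule vs2.subspace_span)
    finally show "f x \<in> vs2.span (f ` ?D)" .
  qed
  then have "vs2.dim (f ` V) = card (f ` ?D)"
    using C ind by (intro vs2.dim_unique[OF _ _ ind refl]) auto
  also have "\<dots> = card ?D"
    by (rule card_image, rule inj_on_subset[OF inj]) (auto intro: vs1.span_base)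
  also have "\<dots> = card C - card B" using B(1) C(2) by (simp add: card_Diff_subset)
  finally show ?thesis using B(5) C(6) C(1,2) card_mono[of C B] by simp
qed

lemma dim_image_inj_fd:
  assumes "Vector_Spaces.linear s1 s2 f" "vs1.subspace V" "vs1.fd V" "\<And>x. x \<in> V \<Longrightarrow> f x = 0 \<Longrightarrow> x = 0"
  shows "vs2.dim (f ` V) = vs1.dim V"
proof -
  have "{x \<in> V. f x = 0} = {0}"
    using assms linear_0[OF assms(1)] vs1.subspace_0 by auto
  then show ?thesis using rank_nullity_fd[OF assms(1-3)] by simp
qed

text \<open>Both kernels of \<open>f\<close>, on \<open>V\<close> and on the preimage, cancel.\<close>

lemma dim_preimage_fd:
  assumes lin: "Vector_Spaces.linear s1 s2 f" and V: "vs1.subspace V" "vs1.fd V"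
    and W: "vs2.subspace W" "W \<subseteq> f ` V"
  shows "vs1.dim V + vs2.dim W = vs1.dim {x \<in> V. f x \<in> W} + vs2.dim (f ` V)"
proof -
  let ?P = "{x \<in> V. f x \<in> W}"
  have P: "vs1.subspace ?P"
    using V(1) W(1) unfolding vs1.subspace_def vs2.subspace_def
    by (auto simp: linear_0[OF lin] linear_add[OF lin] linear_scale[OF lin])
  have "f ` ?P = W" using W(2) by auto
  moreover have "{x \<in> ?P. f x = 0} = {x \<in> V. f x = 0}"
    using vs2.subspace_0[OF W(1)] by auto
  ultimately have "vs1.dim ?P = vs1.dim {x \<in> V. f x = 0} + vs2.dim W"
    using rank_nullity_fd[OF lin P vs1.fd_subset[OF V(2)]] by auto
  then show ?thesis using rank_nullity_fd[OF lin V] by simp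
qed

end

text \<open>Each functional lowers the dimension by at most 1, since its image lies in the
  one-dimensional field.\<close>

lemma (in vecspace) dim_le_cut:
  assumes "finite G" "\<And>g. g \<in> G \<Longrightarrow> Vector_Spaces.linear scale (*) (\<phi> g)" "subspace U" "fd U"
  shows "dim U \<le> dim {u \<in> U. \<forall>g\<in>G. \<phi> g u = 0} + card G"
  using assms
proof (induction G arbitrary: U)
  case empty
  then show ?case by simp
next
  case (insert g G)
  interpret k: vecspace "(*) :: 'a \<Rightarrow> 'a \<Rightarrow> 'a" by (rule vecspace_field)
  interpret p: vecspace_pair scale "(*) :: 'a \<Rightarrow> 'a \<Rightarrow> 'a" ..
  let ?U = "{u \<in> U. \<phi> g u = 0}"
  interpret l: Vector_Spaces.linear scale "(*)" "\<phi> g" using insert.prems by auto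
  have U: "subspace ?U"
    using insert.prems(2) by (auto simp: subspace_def l.zero l.add l.scale)
  have "k.dim (\<phi> g ` U) \<le> card {1 :: 'a}"
  proof (rule k.dim_le_card)
    show "\<phi> g ` U \<subseteq> k.span {1}"
      using k.span_scale[OF k.span_base[of 1 "{1}"]] by auto
  qed simp
  then have "dim U \<le> dim ?U + 1"
    using p.rank_nullity_fd[OF l.linear_axioms insert.prems(2,3)] by simp
  also have "dim ?U \<le> dim {u \<in> ?U. \<forall>g\<in>G. \<phi> g u = 0} + card G"
    using insert.prems U fd_subset[OF insert.prems(3)] by (intro insert.IH) auto
  also have "{u \<in> ?U. \<forall>g\<in>G. \<phi> g u = 0} = {u \<in> U. \<forall>h\<in>insert g G. \<phi> h u = 0}" by auto
  finally show ?case using insert.hyps by simp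
qed

text \<open>The pairing may be degenerate on the right, but its radical N lies in \<open>Z\<close>.
  Three cuts give dim U \<le> dim Z^\<bottom> + dim Z - dim N, then dim Z^\<bottom> \<le> dim W -
  dim Z, and dim W \<le> dim N + dim U. Chained together they leave room only for equality.\<close>

lemma (in vecspace_pair) dim_orthogonal:
  fixes B :: "'b \<Rightarrow> 'c \<Rightarrow> 'a"
  assumes lin1: "\<And>w. Vector_Spaces.linear s1 (*) (\<lambda>u. B u w)"
    and lin2: "\<And>u. Vector_Spaces.linear s2 (*) (B u)"
    and U: "vs1.subspace U" "vs1.fd U" and W: "vs2.subspace W" "vs2.fd W"
    and Z: "vs2.subspace Z" "Z \<subseteq> W"
    and left: "\<And>u. u \<in> U \<Longrightarrow> (\<And>w. w \<in> W \<Longrightarrow> B u w = 0) \<Longrightarrow> u = 0"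
    and right: "\<And>w. w \<in> W \<Longrightarrow> (\<And>u. u \<in> U \<Longrightarrow> B u w = 0) \<Longrightarrow> w \<in> Z"
  shows "vs2.dim W = vs2.dim Z + vs1.dim {u \<in> U. \<forall>z\<in>Z. B u z = 0}"
proof -
  interpret k: vecspace "(*) :: 'a \<Rightarrow> 'a \<Rightarrow> 'a" by (rule vecspace_field)
  have B0: "B u 0 = 0" and Badd: "B u (x + y) = B u x + B u y" and Bsc: "B u (s2 c x) = c * B u x" for u x y c
  proof -
    interpret Vector_Spaces.linear s2 "(*)" "B u" by (rule lin2)
    show "B u 0 = 0" "B u (x + y) = B u x + B u y" "B u (s2 c x) = c * B u x"
      by (auto simp: zero add scale)
  qed
  have B0': "B 0 w = 0" and Badd': "B (x + y) w = B x w + B y w" and Bsc': "B (s1 c x) w = c * B x w" for w x y c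
  proof -
    interpret Vector_Spaces.linear s1 "(*)" "\<lambda>u. B u w" by (rule lin1)
    show "B 0 w = 0" "B (x + y) w = B x w + B y w" "B (s1 c x) w = c * B x w"
      using zero add scale by auto
  qed
  have span_ann: "B u z = 0" if "\<forall>g\<in>G. B u g = 0" "z \<in> vs2.span G" for u z G
    using that(2)
    by (induction rule: vs2.span_induct_alt) (use that(1) in \<open>auto simp: B0 Badd Bsc\<close>)
  have span_ann': "B u z = 0" if "\<forall>g\<in>G. B g z = 0" "u \<in> vs1.span G" for u z G
    using that(2)
    by (induction rule: vs1.span_induct_alt) (use that(1) in \<open>auto simp: B0' Badd' Bsc'\<close>)
  let ?N = "{w \<in> W. \<forall>u\<in>U. B u w = 0}"
  let ?O = "{u \<in> U. \<forall>z\<in>Z. B u z = 0}"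
  have N: "vs2.subspace ?N" using W(1) by (auto simp: vs2.subspace_def B0 Badd Bsc)
  have NZ: "?N \<subseteq> Z" using right by auto
  have fdZ: "vs2.fd Z" and fdN: "vs2.fd ?N" by (rule vs2.fd_subset[OF W(2)]; use Z in auto)+
  obtain Nb where Nb: "finite Nb" "Nb \<subseteq> ?N" "vs2.independent Nb" "vs2.span Nb = ?N" "card Nb = vs2.dim ?N"
    by (rule vs2.fd_basis[OF N fdN])
  obtain Zb where Zb: "finite Zb" "Nb \<subseteq> Zb" "Zb \<subseteq> Z" "vs2.independent Zb" "vs2.span Zb = Z" "card Zb = vs2.dim Z"
    by (rule vs2.fd_basis_extend[OF Z(1) fdZ subset_trans[OF Nb(2) NZ] Nb(3)])
  obtain Wb where Wb: "finite Wb" "Zb \<subseteq> Wb" "Wb \<subseteq> W" "vs2.independent Wb" "vs2.span Wb = W" "card Wb = vs2.dim W"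
    by (rule vs2.fd_basis_extend[OF W subset_trans[OF Zb(3) Z(2)] Zb(4)])
  obtain Ub where Ub: "finite Ub" "Ub \<subseteq> U" "vs1.independent Ub" "vs1.span Ub = U" "card Ub = vs1.dim U"
    by (rule vs1.fd_basis[OF U])
  \<comment> \<open>The vectors of \<open>Nb\<close> pair to 0 with all of \<open>U\<close>, so
    \<open>Z\<close> imposes only the conditions from \<open>Zb - Nb\<close>.\<close>
  have "vs1.dim U \<le> vs1.dim {u \<in> U. \<forall>g\<in>Zb - Nb. B u g = 0} + card (Zb - Nb)"
    using Zb(1) by (intro vs1.dim_le_cut lin1 U) auto
  also have "{u \<in> U. \<forall>g\<in>Zb - Nb. B u g = 0} = ?O"
  proof (intro Collect_cong conj_cong refl iffI ballI)
    fix u z assume u: "u \<in> U" "\<forall>g\<in>Zb - Nb. B u g = 0" and "z \<in> Z"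
    have "\<forall>g\<in>Zb. B u g = 0" using u Nb(2) by blast
    then show "B u z = 0" using span_ann[of Zb u z] \<open>z \<in> Z\<close> Zb(5) by auto
  qed (use Zb(3) in auto)
  finally have 1: "vs1.dim U \<le> vs1.dim ?O + (vs2.dim Z - vs2.dim ?N)"
    using Nb(1,5) Zb(2,6) by (simp add: card_Diff_subset)
  have O: "vs1.subspace ?O" using U(1) by (auto simp: vs1.subspace_def B0' Badd' Bsc')
  \<comment> \<open>A vector orthogonal to \<open>Z\<close> and to \<open>Wb - Zb\<close> is
    orthogonal to all of \<open>W\<close>, hence 0 by \<open>left\<close>.\<close>
  have "vs1.dim ?O \<le> vs1.dim {u \<in> ?O. \<forall>g\<in>Wb - Zb. B u g = 0} + card (Wb - Zb)"
    using Wb(1) by (intro vs1.dim_le_cut lin1 O vs1.fd_subset[OF U(2)]) auto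
  also have "{u \<in> ?O. \<forall>g\<in>Wb - Zb. B u g = 0} \<subseteq> {0}"
  proof clarify
    fix u assume u: "u \<in> U" "\<forall>z\<in>Z. B u z = 0" "\<forall>g\<in>Wb - Zb. B u g = 0"
    then have "\<forall>g\<in>Wb. B u g = 0" using Zb(3) by blast
    then show "u = 0" using span_ann[of Wb u] Wb(5) left[OF u(1)] by auto
  qed
  then have "vs1.dim {u \<in> ?O. \<forall>g\<in>Wb - Zb. B u g = 0} = 0"
    using vs1.dim_le_card[of _ "{}"] by auto
  finally have 2: "vs1.dim ?O \<le> vs2.dim W - vs2.dim Z"
    using Zb(1,6) Wb(2,6) by (simp add: card_Diff_subset)
  have "vs2.dim W \<le> vs2.dim {w \<in> W. \<forall>u\<in>Ub. B u w = 0} + card Ub"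
    using Ub(1) by (intro vs2.dim_le_cut[of Ub B] lin2 W) auto
  also have "{w \<in> W. \<forall>u\<in>Ub. B u w = 0} = ?N"
  proof (intro Collect_cong conj_cong refl iffI ballI)
    fix w u assume "\<forall>u\<in>Ub. B u w = 0" "u \<in> U"
    then show "B u w = 0" using span_ann'[of Ub w u] Ub(4) by auto
  next
    fix w u assume "\<forall>u\<in>U. B u w = 0" "u \<in> Ub"
    then show "B u w = 0" using vs1.span_base[of u Ub] Ub(4) by auto
  qed
  finally have 3: "vs2.dim W \<le> vs2.dim ?N + vs1.dim U" using Ub(5) by simp
  have 4: "vs2.dim ?N \<le> vs2.dim Z" "vs2.dim Z \<le> vs2.dim W"
    using vs2.dim_mono_fd[OF fdZ NZ] vs2.dim_mono_fd[OF W(2) Z(2)] by auto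
  show ?thesis using 1 2 3 4 by linarith
qed

section \<open>Monomials\<close>

definition mdeg :: "('v::finite \<Rightarrow>\<^sub>0 nat) \<Rightarrow> nat" where
  "mdeg m = (\<Sum>v\<in>UNIV. Poly_Mapping.lookup m v)"

lemma mdeg_zero [simp]: "mdeg 0 = 0"
  by (simp add: mdeg_def)

lemma mdeg_add [simp]: "mdeg (m + m') = mdeg m + mdeg m'"
  by (simp add: mdeg_def lookup_add sum.distrib)

lemma mdeg_single [simp]: "mdeg (Poly_Mapping.single v k) = k"
  by (simp add: mdeg_def lookup_single when_def)

lemma lookup_le_mdeg: "Poly_Mapping.lookup m v \<le> mdeg m"
  unfolding mdeg_def by (rule member_le_sum) auto

lemma mdeg_eq_0_iff [simp]: "mdeg m = 0 \<longleftrightarrow> m = 0"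
proof
  assume "mdeg m = 0"
  then show "m = 0" unfolding mdeg_def by (intro poly_mapping_eqI) simp
qed simp

lemma finite_mdeg_le [simp, intro]: "finite {m :: 'v::finite \<Rightarrow>\<^sub>0 nat. mdeg m \<le> t}"
proof (rule finite_imageD)
  show "finite (Poly_Mapping.lookup ` {m :: 'v \<Rightarrow>\<^sub>0 nat. mdeg m \<le> t})"
  proof (rule finite_subset)
    show "Poly_Mapping.lookup ` {m :: 'v \<Rightarrow>\<^sub>0 nat. mdeg m \<le> t} \<subseteq> (UNIV \<rightarrow>\<^sub>E {..t})"
      using lookup_le_mdeg order_trans by (fastforce simp: PiE_def)
  qed (simp add: finite_PiE)
qed (auto intro!: inj_onI poly_mapping_eqI)

lemma finite_mdeg_less [simp, intro]: "finite {m :: 'v::finite \<Rightarrow>\<^sub>0 nat. mdeg m < t}"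
  by (rule finite_subset[OF _ finite_mdeg_le[of t]]) auto

lemma finite_mdeg_eq [simp, intro]: "finite {m :: 'v::finite \<Rightarrow>\<^sub>0 nat. mdeg m = t}"
  by (rule finite_subset[OF _ finite_mdeg_le[of t]]) auto

lemma single_dvdE:
  fixes m :: "'v \<Rightarrow>\<^sub>0 nat"
  assumes "Poly_Mapping.lookup m v > 0"
  obtains m' where "m = Poly_Mapping.single v (Suc 0) + m'"
proof
  show "m = Poly_Mapping.single v (Suc 0) + (m - Poly_Mapping.single v (Suc 0))"
    using assms by (intro poly_mapping_eqI) (auto simp: lookup_add lookup_minus lookup_single when_def)
qed

text \<open>The Hilbert function of the polynomial ring in the variables \<open>A\<close>. A general
  \<open>A\<close> allows induction on the variables, and the final bound drops one of them.\<close>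

definition hnum :: "'v::finite set \<Rightarrow> nat \<Rightarrow> nat" where
  "hnum A j = card {m :: 'v \<Rightarrow>\<^sub>0 nat. mdeg m = j \<and> Poly_Mapping.keys m \<subseteq> A}"

abbreviation hilb :: "'v::finite itself \<Rightarrow> nat \<Rightarrow> nat" where
  "hilb _ \<equiv> hnum (UNIV :: 'v set)"

lemma monomials_insert:
  assumes "v \<notin> A"
  shows "{m :: 'v::finite \<Rightarrow>\<^sub>0 nat. mdeg m = j \<and> Poly_Mapping.keys m \<subseteq> insert v A} =
    {m. mdeg m = j \<and> Poly_Mapping.keys m \<subseteq> A} \<union>
    (+) (Poly_Mapping.single v (Suc 0)) ` {m. Suc (mdeg m) = j \<and> Poly_Mapping.keys m \<subseteq> insert v A}"
  (is "?L = ?R")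
proof
  show "?L \<subseteq> ?R"
  proof
    fix m assume m: "m \<in> ?L"
    show "m \<in> ?R"
    proof (cases "Poly_Mapping.lookup m v = 0")
      case True
      then have "v \<notin> Poly_Mapping.keys m" by (simp add: in_keys_iff)
      then show ?thesis using m by auto
    next
      case False
      then obtain m' where m': "m = Poly_Mapping.single v (Suc 0) + m'" by (auto elim: single_dvdE)
      have "Poly_Mapping.keys m' \<subseteq> Poly_Mapping.keys m"
        by (auto simp: m' in_keys_iff lookup_add)
      then show ?thesis using m m' by auto
    qed
  qed
  show "?R \<subseteq> ?L"
    using keys_add by (fastforce split: if_splits)
qed

text \<open>Pascal's rule: a monomial either avoids \<open>v\<close> or is the product of
  \<open>v\<close> with a unique monomial of degree one less.\<close>

lemma hnum_insert:
  fixes A :: "'v::finite set"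
  assumes "v \<notin> A"
  shows "hnum (insert v A) j = hnum A j + (if j = 0 then 0 else hnum (insert v A) (j - 1))"
proof -
  define M where "M j = {m :: 'v \<Rightarrow>\<^sub>0 nat. mdeg m = j \<and> Poly_Mapping.keys m \<subseteq> insert v A}" for j
  define N where "N = {m :: 'v \<Rightarrow>\<^sub>0 nat. mdeg m = j \<and> Poly_Mapping.keys m \<subseteq> A}"
  define M' where "M' = {m :: 'v \<Rightarrow>\<^sub>0 nat. Suc (mdeg m) = j \<and> Poly_Mapping.keys m \<subseteq> insert v A}"
  have fin: "finite (M j)" for j
    unfolding M_def by (rule finite_subset[OF _ finite_mdeg_eq[of j]]) blast
  have fin': "finite N"
    unfolding N_def by (rule finite_subset[OF _ finite_mdeg_eq[of j]]) blast
  have M': "M' = (if j = 0 then {} else M (j - 1))"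
    by (cases j) (simp_all add: M'_def M_def)
  have "N \<inter> (+) (Poly_Mapping.single v (Suc 0)) ` M' = {}"
  proof (rule ccontr)
    assume "N \<inter> (+) (Poly_Mapping.single v (Suc 0)) ` M' \<noteq> {}"
    then obtain m where "Poly_Mapping.single v (Suc 0) + m \<in> N" by blast
    then have "v \<notin> Poly_Mapping.keys (Poly_Mapping.single v (Suc 0) + m)"
      using assms unfolding N_def by blast
    then show False by (simp add: in_keys_iff lookup_add)
  qed
  moreover have "M j = N \<union> (+) (Poly_Mapping.single v (Suc 0)) ` M'"
    unfolding M_def N_def M'_def by (rule monomials_insert[OF assms])
  ultimately have "card (M j) = card N + card ((+) (Poly_Mapping.single v (Suc 0)) ` M')"
    using fin' fin by (simp add: card_Un_disjoint M')
  also have "card ((+) (Poly_Mapping.single v (Suc 0)) ` M') = card M'"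
    by (rule card_image) (simp add: inj_on_def)
  finally have "card (M j) = card N + card M'" .
  moreover have "hnum (insert v A) i = card (M i)" for i
    unfolding hnum_def M_def ..
  moreover have "hnum A j = card N" unfolding hnum_def N_def ..
  ultimately show ?thesis unfolding M' by simp
qed

lemma hnum_empty: "hnum {} j = (if j = 0 then 1 else 0)"
proof -
  have "{m :: 'a \<Rightarrow>\<^sub>0 nat. mdeg m = j \<and> Poly_Mapping.keys m \<subseteq> {}} = (if j = 0 then {0} else {})"
    by auto
  then show ?thesis by (simp add: hnum_def)
qed

lemma hnum_0 [simp]: "hnum A 0 = 1"
proof -
  have "{m :: 'a \<Rightarrow>\<^sub>0 nat. mdeg m = 0 \<and> Poly_Mapping.keys m \<subseteq> A} = {0}" by auto
  then show ?thesis by (simp add: hnum_def)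
qed

text \<open>Adjoining a variable divides the Hilbert series by 1 - X, by Pascal's rule. The product
  form stays within integer coefficients.\<close>

lemma fps_hnum: "(1 - fps_X) ^ card A * Abs_fps (\<lambda>j. of_nat (hnum A j)) = (1 :: int fps)"
  using finite[of A]
proof (induction A rule: finite_induct)
  case empty
  have "Abs_fps (\<lambda>j. of_nat (hnum {} j)) = (1 :: int fps)" by (rule fps_ext) (simp add: hnum_empty)
  then show ?case by simp
next
  case (insert v A)
  have "(1 - fps_X) * Abs_fps (\<lambda>j. of_nat (hnum (insert v A) j)) = Abs_fps (\<lambda>j. of_nat (hnum A j) :: int)"
  proof (rule fps_ext)
    fix j
    show "fps_nth ((1 - fps_X) * Abs_fps (\<lambda>j. of_nat (hnum (insert v A) j))) j =
        fps_nth (Abs_fps (\<lambda>j. of_nat (hnum A j) :: int)) j"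
      using hnum_insert[of v A j] insert.hyps by (simp add: left_diff_distrib)
  qed
  moreover have "(1 - fps_X) ^ card (insert v A) * F = (1 - fps_X) ^ card A * ((1 - fps_X) * F)"
    for F :: "int fps"
    using insert.hyps by (simp add: power_Suc2 mult.assoc del: power_Suc)
  ultimately show ?case using insert.IH by (simp only:)
qed

text \<open>The closed form of the cumulative counts is what makes their growth rate accessible
  later.\<close>

lemma sum_hnum: "(\<Sum>j\<le>t. hnum A j) = (t + card A) choose card A"
  using finite[of A]
proof (induction A arbitrary: t rule: finite_induct)
  case empty
  show ?case by (simp add: hnum_empty sum.delta')
next
  case (insert v A)
  show ?case
  proof (induction t)
    case 0
    show ?case by simp
  next
    case (Suc t)
    \<comment> \<open>The new variable absorbs the missing degree, so exact degree \<open>t\<close>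
      with it amounts to degree at most \<open>t\<close> without it.\<close>
    have h: "hnum (insert v A) t = (\<Sum>j\<le>t. hnum A j)" for t
      by (induction t) (use hnum_insert[of v A] insert.hyps in \<open>simp_all\<close>)
    show ?case using Suc insert.IH[of "Suc t"] insert.hyps h[of "Suc t"] by simp
  qed
qed

lemma hnum_ge_card:
  assumes "j > 0"
  shows "card A \<le> hnum A j"
proof -
  have "card A = card ((\<lambda>v. Poly_Mapping.single v j) ` A)"
  proof (rule card_image[symmetric], rule inj_onI)
    fix v w assume "Poly_Mapping.single v j = Poly_Mapping.single w j"
    then have "Poly_Mapping.lookup (Poly_Mapping.single v j) v = Poly_Mapping.lookup (Poly_Mapping.single w j) v"
      by simp
    then show "v = w" using assms by (simp add: lookup_single when_def split: if_splits)
  qed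
  also have "\<dots> \<le> hnum A j"
    unfolding hnum_def
  proof (rule card_mono)
    show "finite {m. mdeg m = j \<and> Poly_Mapping.keys m \<subseteq> A}"
      by (rule finite_subset[OF _ finite_mdeg_eq[of j]]) blast
    show "(\<lambda>v. Poly_Mapping.single v j) ` A \<subseteq> {m. mdeg m = j \<and> Poly_Mapping.keys m \<subseteq> A}"
      using assms by (simp add: image_subset_iff)
  qed
  finally show ?thesis .
qed

lemma card_mdeg_eq: "card {m :: 'v::finite \<Rightarrow>\<^sub>0 nat. mdeg m = t} = hilb TYPE('v) t"
  by (simp add: hnum_def)

lemma card_mdeg_less: "card {m :: 'v::finite \<Rightarrow>\<^sub>0 nat. mdeg m < t} = (\<Sum>j<t. hilb TYPE('v) j)"
proof -
  have "{m :: 'v \<Rightarrow>\<^sub>0 nat. mdeg m < t} = (\<Union>j\<in>{..<t}. {m. mdeg m = j})" by auto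
  then show ?thesis
    using card_UN_disjoint[of "{..<t}" "\<lambda>j. {m :: 'v \<Rightarrow>\<^sub>0 nat. mdeg m = j}"]
    by (simp add: card_mdeg_eq disjoint_iff)
qed

lemma card_mdeg_le: "card {m :: 'v::finite \<Rightarrow>\<^sub>0 nat. mdeg m \<le> t} = (t + CARD('v)) choose CARD('v)"
proof -
  have "{m :: 'v \<Rightarrow>\<^sub>0 nat. mdeg m \<le> t} = {m. mdeg m < Suc t}" by auto
  then show ?thesis
    unfolding sum_hnum[symmetric] by (simp only: card_mdeg_less lessThan_Suc_atMost)
qed

section \<open>Polynomials\<close>

lemma lookup_single_mult:
  "Poly_Mapping.lookup (Poly_Mapping.single a c * p) (a + m) = c * Poly_Mapping.lookup p m"
  for p :: "'a::cancel_comm_monoid_add \<Rightarrow>\<^sub>0 'b::comm_ring_1"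
proof -
  have "Poly_Mapping.lookup (Poly_Mapping.single a c * p) (a + m) =
     (\<Sum>l. (c when a = l) * (\<Sum>q. Poly_Mapping.lookup p q when a + m = l + q))"
    by (simp add: lookup_mult lookup_single)
  also have "\<dots> = (\<Sum>l. c * (\<Sum>q. Poly_Mapping.lookup p q when a + m = l + q) when a = l)"
    by (intro Sum_any.cong) (simp add: when_def)
  also have "\<dots> = c * Poly_Mapping.lookup p m"
    by simp
  finally show ?thesis .
qed

lemma lookup_single_mult_eq_0:
  "(\<And>m. k \<noteq> a + m) \<Longrightarrow> Poly_Mapping.lookup (Poly_Mapping.single a c * p) k = 0"
  for p :: "'a::cancel_comm_monoid_add \<Rightarrow>\<^sub>0 'b::comm_ring_1"
proof -
  assume *: "\<And>m. k \<noteq> a + m"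
  have **: "(c when a = l) * (\<Sum>q. Poly_Mapping.lookup p q when k = l + q) = 0" for l
    using * by (cases "a = l") simp_all
  have "Poly_Mapping.lookup (Poly_Mapping.single a c * p) k =
     (\<Sum>l. (c when a = l) * (\<Sum>q. Poly_Mapping.lookup p q when k = l + q))"
    by (simp add: lookup_mult lookup_single)
  also have "\<dots> = 0" by (simp add: **)
  finally show ?thesis .
qed

lemma lookup_const_mult [simp]:
  "Poly_Mapping.lookup (Poly_Mapping.single 0 c * p) m = c * Poly_Mapping.lookup p m"
  for p :: "'a::cancel_comm_monoid_add \<Rightarrow>\<^sub>0 'b::comm_ring_1"
  using lookup_single_mult[of 0 c p m] by simp

abbreviation var :: "'v \<Rightarrow> ('v::finite, 'k::field) mpoly" where
  "var v \<equiv> Poly_Mapping.single (Poly_Mapping.single v (Suc 0)) 1"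

lemma lookup_var_mult [simp]:
  "Poly_Mapping.lookup (var v * p) (Poly_Mapping.single v (Suc 0) + m) = Poly_Mapping.lookup p m"
  using lookup_single_mult[of "Poly_Mapping.single v (Suc 0)" 1 p m] by simp

lemma lookup_var_mult_eq_0:
  "Poly_Mapping.lookup m v = 0 \<Longrightarrow> Poly_Mapping.lookup (var v * p) m = 0"
  by (rule lookup_single_mult_eq_0) (auto simp: lookup_add)

text \<open>Restriction to a set of monomials serves for truncation, for homogeneous components, for
  distributing monomials among the variables and for the Koszul contraction.\<close>

lift_definition rst :: "'a set \<Rightarrow> ('a \<Rightarrow>\<^sub>0 'b::zero) \<Rightarrow> ('a \<Rightarrow>\<^sub>0 'b)" is
  "\<lambda>A p m. if m \<in> A then p m else 0"
  by (rule finite_subset) auto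

lemma lookup_rst [simp]: "Poly_Mapping.lookup (rst A p) m = (if m \<in> A then Poly_Mapping.lookup p m else 0)"
  by transfer simp

lemma rst_zero [simp]: "rst A 0 = 0"
  by (rule poly_mapping_eqI) simp

lemma rst_add: "rst A (p + q) = rst A p + rst A (q :: 'a \<Rightarrow>\<^sub>0 'b::comm_monoid_add)"
  by (rule poly_mapping_eqI) (simp add: lookup_add)

lemma rst_diff: "rst A (p - q) = rst A p - rst A (q :: 'a \<Rightarrow>\<^sub>0 'b::ab_group_add)"
  by (rule poly_mapping_eqI) (simp add: lookup_minus)

lemma rst_const_mult: "rst A (Poly_Mapping.single 0 c * p) = Poly_Mapping.single 0 c * rst A p"
  for p :: "'a::cancel_comm_monoid_add \<Rightarrow>\<^sub>0 'b::comm_ring_1"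
  by (rule poly_mapping_eqI) simp

text \<open>The ideal \<open>\<nn>\<^sup>n\<close>, described by its monomials.\<close>

definition ideal_ge :: "nat \<Rightarrow> ('v::finite, 'k::field) mpoly set" where
  "ideal_ge n = {p. \<forall>m. mdeg m < n \<longrightarrow> Poly_Mapping.lookup p m = 0}"

lemma ideal_geI: "(\<And>m. mdeg m < n \<Longrightarrow> Poly_Mapping.lookup p m = 0) \<Longrightarrow> p \<in> ideal_ge n"
  by (simp add: ideal_ge_def)

lemma ideal_geD: "p \<in> ideal_ge n \<Longrightarrow> mdeg m < n \<Longrightarrow> Poly_Mapping.lookup p m = 0"
  by (simp add: ideal_ge_def)

lemma ideal_ge_zero [simp, intro]: "0 \<in> ideal_ge n"
  and ideal_ge_add: "p \<in> ideal_ge n \<Longrightarrow> q \<in> ideal_ge n \<Longrightarrow> p + q \<in> ideal_ge n"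
  and ideal_ge_diff: "p \<in> ideal_ge n \<Longrightarrow> q \<in> ideal_ge n \<Longrightarrow> p - q \<in> ideal_ge n"
  and ideal_ge_uminus: "p \<in> ideal_ge n \<Longrightarrow> - p \<in> ideal_ge n"
  by (auto simp: ideal_ge_def lookup_add lookup_minus)

lemma ideal_ge_sum: "(\<And>i. i \<in> I \<Longrightarrow> f i \<in> ideal_ge n) \<Longrightarrow> sum f I \<in> ideal_ge n"
  by (induction I rule: infinite_finite_induct) (auto intro: ideal_ge_add)

lemma ideal_ge_mult2:
  assumes "p \<in> ideal_ge a" "q \<in> ideal_ge b"
  shows "p * q \<in> ideal_ge (a + b)"
proof (rule ideal_geI, rule ccontr)
  fix m assume m: "mdeg m < a + b" "Poly_Mapping.lookup (p * q) m \<noteq> 0"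
  then have "m \<in> Poly_Mapping.keys (p * q)" by (simp add: in_keys_iff)
  then obtain k l where "m = k + l" "k \<in> Poly_Mapping.keys p" "l \<in> Poly_Mapping.keys q"
    using keys_mult[of p q] by auto
  then have "a \<le> mdeg k" "b \<le> mdeg l"
    using ideal_geD[OF assms(1), of k] ideal_geD[OF assms(2), of l] by (auto simp: in_keys_iff not_less[symmetric])
  then show False using m \<open>m = k + l\<close> by simp
qed

lemma ideal_ge_mult: "p \<in> ideal_ge n \<Longrightarrow> r * p \<in> ideal_ge n"
  using ideal_ge_mult2[of r 0 p n] by (auto simp: ideal_ge_def)

lemma var_in_ideal_ge: "var v \<in> ideal_ge 1"
  by (rule ideal_geI) (auto simp add: lookup_single when_def dest: arg_cong[of _ _ mdeg])

lemma diff_rst_in_ideal_ge: "p - rst {m. mdeg m < n} p \<in> ideal_ge n"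
  by (rule ideal_geI) (simp add: lookup_minus)

lemma rst_eq_0_iff: "rst {m. mdeg m < n} p = 0 \<longleftrightarrow> p \<in> ideal_ge n"
  by (auto simp: ideal_ge_def poly_mapping_eq_iff fun_eq_iff)

text \<open>Each monomial goes to some variable occurring in it.\<close>

lemma ideal_ge_Suc_decompose:
  assumes "p \<in> ideal_ge (Suc n)"
  obtains q where "p = (\<Sum>v\<in>UNIV. var v * q v)" "\<And>v. q v \<in> ideal_ge n"
proof -
  define c where "c m = (SOME v. Poly_Mapping.lookup m v > 0)" for m :: "'a \<Rightarrow>\<^sub>0 nat"
  have c: "Poly_Mapping.lookup m (c m) > 0" if "m \<noteq> 0" for m
  proof -
    have "\<exists>v. Poly_Mapping.lookup m v > 0" using that by (auto simp: poly_mapping_eq_iff fun_eq_iff)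
    then show ?thesis unfolding c_def by (rule someI_ex)
  qed
  \<comment> \<open>One factor x_v is removed from each monomial assigned to
    \<open>v\<close>.\<close>
  define q :: "'a \<Rightarrow> ('a, 'b) mpoly"
    where "q v = Poly_Mapping.map_key ((+) (Poly_Mapping.single v (Suc 0))) (rst {m. c m = v} p)" for v
  have inj: "inj ((+) (Poly_Mapping.single v (Suc 0)) :: ('a \<Rightarrow>\<^sub>0 nat) \<Rightarrow> _)" for v by (auto simp: inj_on_def)
  have lq: "Poly_Mapping.lookup (q v) m = Poly_Mapping.lookup (rst {m. c m = v} p) (Poly_Mapping.single v (Suc 0) + m)" for v m
    unfolding q_def using inj[of v] by (simp add: map_key.rep_eq)
  have "p = (\<Sum>v\<in>UNIV. var v * q v)"
  proof (rule poly_mapping_eqI)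
    fix m
    have "Poly_Mapping.lookup (var v * q v) m = (if v = c m then Poly_Mapping.lookup p m else 0)" for v
    proof (cases "Poly_Mapping.lookup m v > 0")
      case True
      then obtain m' where "m = Poly_Mapping.single v (Suc 0) + m'" by (rule single_dvdE)
      then show ?thesis using lq[of v m'] by auto
    next
      case False
      \<comment> \<open>The choice \<open>c 0\<close> is arbitrary; it does no harm because
        \<open>p\<close> has no constant term.\<close>
      then have "v = c m \<Longrightarrow> m = 0" using c by fastforce
      then show ?thesis
        using False lookup_var_mult_eq_0[of m v "q v"] ideal_geD[OF assms, of 0] by auto
    qed
    then show "Poly_Mapping.lookup p m = Poly_Mapping.lookup (\<Sum>v\<in>UNIV. var v * q v) m"
      by (simp add: lookup_sum sum.delta)
  qed
  moreover have "q v \<in> ideal_ge n" for v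
    using ideal_geD[OF assms] by (intro ideal_geI) (simp add: lq)
  ultimately show ?thesis using that by blast
qed

section \<open>Tuples of polynomials as vector spaces\<close>

text \<open>The index type stays free: it is instantiated by coordinates, by variables, by pairs of
  both, by \<open>unit\<close> for a single polynomial, and by vectors for families of
  coefficients.\<close>

definition fscale :: "'k::field \<Rightarrow> ('i \<Rightarrow> ('v::finite, 'k) mpoly) \<Rightarrow> 'i \<Rightarrow> ('v, 'k) mpoly" where
  "fscale c x = (\<lambda>i. Poly_Mapping.single 0 c * x i)"

lemma vecspace_fscale: "vecspace (fscale :: 'k::field \<Rightarrow> ('i \<Rightarrow> ('v::finite, 'k) mpoly) \<Rightarrow> _)"
proof unfold_locales
  fix a b :: 'k and x y :: "'i \<Rightarrow> ('v, 'k) mpoly"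
  show "fscale a (x + y) = fscale a x + fscale a y" by (simp add: fscale_def fun_eq_iff algebra_simps)
  show "fscale (a + b) x = fscale a x + fscale b x"
    by (simp add: fscale_def fun_eq_iff single_add algebra_simps)
  show "fscale a (fscale b x) = fscale (a * b) x"
    by (simp add: fscale_def fun_eq_iff mult.assoc[symmetric] mult_single)
  show "fscale 1 x = x" by (simp add: fscale_def fun_eq_iff)
qed

interpretation fs: vecspace fscale by (rule vecspace_fscale)
interpretation fp: vecspace_pair fscale fscale ..

text \<open>For finite \<open>P\<close> this is the span of the monomial vectors x^m e_i with
  \<open>(i, m) \<in> P\<close>, so that dimensions become cardinalities.\<close>

definition coord_space :: "('i \<times> ('v \<Rightarrow>\<^sub>0 nat)) set \<Rightarrow> ('i \<Rightarrow> ('v::finite, 'k::field) mpoly) set" where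
  "coord_space P = {x. \<forall>i m. Poly_Mapping.lookup (x i) m \<noteq> 0 \<longrightarrow> (i, m) \<in> P}"

lemma coord_space_subspace [intro, simp]:
  "fs.subspace (coord_space P :: ('i \<Rightarrow> ('v::finite, 'k::field) mpoly) set)"
proof (rule fs.subspaceI)
  show "0 \<in> coord_space P" by (simp add: coord_space_def)
next
  fix x y :: "'i \<Rightarrow> ('v, 'k) mpoly" assume xy: "x \<in> coord_space P" "y \<in> coord_space P"
  have "(i, m) \<in> P" if "Poly_Mapping.lookup (x i) m + Poly_Mapping.lookup (y i) m \<noteq> 0" for i m
    using that xy unfolding coord_space_def by (cases "Poly_Mapping.lookup (x i) m = 0") auto
  then show "x + y \<in> coord_space P" by (simp add: coord_space_def lookup_add)
next
  fix c and x :: "'i \<Rightarrow> ('v, 'k) mpoly" assume "x \<in> coord_space P"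
  then show "fscale c x \<in> coord_space P" by (simp add: coord_space_def fscale_def)
qed

lemma coord_space_mono: "P \<subseteq> Q \<Longrightarrow> coord_space P \<subseteq> coord_space Q"
  by (auto simp: coord_space_def)

lemma coord_space_basis:
  fixes P :: "('i \<times> ('v::finite \<Rightarrow>\<^sub>0 nat)) set"
  defines "e \<equiv> \<lambda>(i, m) j. if i = j then Poly_Mapping.single m 1 else (0 :: ('v, 'k::field) mpoly)"
  assumes "finite P"
  shows "fs.independent (e ` P)" "coord_space P = fs.span (e ` P)" "inj_on e P"
proof -
  have le: "Poly_Mapping.lookup (e q i) m = (if q = (i, m) then 1 else 0)" for q i m
    by (cases q) (auto simp: e_def lookup_single when_def)
  show inj: "inj_on e P"
  proof (rule inj_onI)
    fix q r assume "e q = e r"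
    then have "Poly_Mapping.lookup (e q (fst q)) (snd q) = Poly_Mapping.lookup (e r (fst q)) (snd q)" by simp
    then show "q = r" by (simp add: le split: if_splits)
  qed
  have exp: "Poly_Mapping.lookup ((\<Sum>q\<in>P. fscale (g q) (e q)) i) m = (if (i, m) \<in> P then g (i, m) else 0)" for g i m
  proof -
    have "Poly_Mapping.lookup ((\<Sum>q\<in>P. fscale (g q) (e q)) i) m = (\<Sum>q\<in>P. g q * (if q = (i, m) then 1 else 0))"
      using \<open>finite P\<close> by (induction P rule: finite_induct) (auto simp: lookup_add fscale_def le)
    also have "\<dots> = (\<Sum>q\<in>P. if q = (i, m) then g (i, m) else 0)" by (intro sum.cong) auto
    finally show ?thesis using \<open>finite P\<close> by (simp add: sum.delta)
  qed
  show "fs.independent (e ` P)"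
  proof (rule fs.independent_if_scalars_zero)
    fix g :: "('i \<Rightarrow> ('v, 'k) mpoly) \<Rightarrow> 'k" and x assume "(\<Sum>x\<in>e ` P. fscale (g x) x) = 0" "x \<in> e ` P"
    then have "(\<Sum>q\<in>P. fscale (g (e q)) (e q)) = 0" by (simp add: sum.reindex[OF inj])
    then have "(if (i, m) \<in> P then g (e (i, m)) else 0) = 0" for i m
      using exp[of "\<lambda>q. g (e q)" i m] by simp
    then show "g x = 0" using \<open>x \<in> e ` P\<close> by (metis imageE surj_pair)
  qed (use \<open>finite P\<close> in simp)
  show "coord_space P = fs.span (e ` P)"
  proof
    show "fs.span (e ` P) \<subseteq> coord_space P"
      by (rule fs.span_minimal[OF _ coord_space_subspace]) (auto simp: coord_space_def le split: if_splits)
    show "coord_space P \<subseteq> fs.span (e ` P)"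
    proof
      fix x :: "'i \<Rightarrow> ('v, 'k) mpoly" assume x: "x \<in> coord_space P"
      have "x = (\<Sum>q\<in>P. fscale (Poly_Mapping.lookup (x (fst q)) (snd q)) (e q))"
        using x by (intro ext poly_mapping_eqI) (auto simp: exp coord_space_def)
      also have "\<dots> \<in> fs.span (e ` P)"
        by (intro fs.span_sum fs.span_scale fs.span_base) auto
      finally show "x \<in> fs.span (e ` P)" .
    qed
  qed
qed

lemma dim_coord_space:
  assumes "finite P"
  shows "fs.dim (coord_space P :: ('i \<Rightarrow> ('v::finite, 'k::field) mpoly) set) = card P"
    "fs.fd (coord_space P :: ('i \<Rightarrow> ('v::finite, 'k::field) mpoly) set)"
proof -
  note b = coord_space_basis[OF assms, where 'k='k]
  show "fs.dim (coord_space P :: ('i \<Rightarrow> ('v::finite, 'k::field) mpoly) set) = card P"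
    unfolding b(2) by (simp only: fs.dim_span_eq_card_independent[OF b(1)] card_image[OF b(3)])
  show "fs.fd (coord_space P :: ('i \<Rightarrow> ('v::finite, 'k::field) mpoly) set)"
    unfolding b(2) by (rule fs.fdI[OF finite_imageI[OF assms] order.refl])
qed

lemma linear_fscaleI:
  assumes "\<And>x y. f (x + y) = f x + f y" "\<And>c x. f (fscale c x) = fscale c (f x)"
  shows "Vector_Spaces.linear fscale fscale f"
  by (intro Vector_Spaces.linear.intro module_hom.intro module_hom_axioms.intro
      fs.vector_space_axioms fs.module_axioms assms)

section \<open>Dimension count over a faithful dual pairing\<close>

lemma linear_functionalI:
  fixes f :: "('i \<Rightarrow> ('v::finite, 'k::field) mpoly) \<Rightarrow> 'k"
  assumes "\<And>x y. f (x + y) = f x + f y" "\<And>c x. f (fscale c x) = c * f x"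
  shows "Vector_Spaces.linear fscale (*) f"
proof -
  interpret k: vecspace "(*) :: 'k \<Rightarrow> 'k \<Rightarrow> 'k" by (rule vecspace_field)
  show ?thesis
    by (intro Vector_Spaces.linear.intro module_hom.intro module_hom_axioms.intro
        fs.vector_space_axioms fs.module_axioms k.vector_space_axioms k.module_axioms assms)
qed

section \<open>Free modules over S and normal forms modulo powers of the maximal ideal\<close>

definition smul :: "('v::finite, 'k::field) mpoly \<Rightarrow> ('i \<Rightarrow> ('v, 'k) mpoly) \<Rightarrow> 'i \<Rightarrow> ('v, 'k) mpoly" where
  "smul r x = (\<lambda>i. r * x i)"

lemma smul_add_right: "smul r (x + y) = smul r x + smul r y"
  and smul_diff_right: "smul r (x - y) = smul r x - smul r y"
  and smul_add_left: "smul (r + s) x = smul r x + smul s x"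
  and smul_diff_left: "smul (r - s) x = smul r x - smul s x"
  and smul_smul: "smul r (smul s x) = smul (r * s) x"
  and smul_zero [simp]: "smul r 0 = 0" "smul 0 x = 0"
  and smul_one [simp]: "smul 1 x = x"
  and smul_fscale: "smul r (fscale k x) = fscale k (smul r x)"
  and smul_const: "smul (Poly_Mapping.single 0 k * r) x = fscale k (smul r x)"
  by (auto simp: smul_def fscale_def fun_eq_iff algebra_simps)

lemma smul_sum:
  fixes f :: "'j \<Rightarrow> 'i \<Rightarrow> ('v::finite, 'k::field) mpoly"
  shows "smul r (sum f I) = (\<Sum>i\<in>I. smul r (f i))"
  by (rule infinite_finite_induct[of "\<lambda>I. smul r (sum f I) = (\<Sum>i\<in>I. smul r (f i))"])
    (simp_all add: smul_add_right)

lemma smul_const_eq: "smul (Poly_Mapping.single 0 k) x = fscale k x"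
  using smul_const[of k 1 x] by simp

text \<open>S^c, extended by 0 beyond the rank, so that addition is the pointwise addition of
  functions.\<close>

definition free :: "nat \<Rightarrow> (nat \<Rightarrow> ('v::finite, 'k::field) mpoly) set" where
  "free c = {x. \<forall>i\<ge>c. x i = 0}"

definition free_ge :: "nat \<Rightarrow> nat \<Rightarrow> (nat \<Rightarrow> ('v::finite, 'k::field) mpoly) set" where
  "free_ge c n = {x \<in> free c. \<forall>i. x i \<in> ideal_ge n}"

lemma free_zero [simp]: "0 \<in> free c"
  and free_add: "x \<in> free c \<Longrightarrow> y \<in> free c \<Longrightarrow> x + y \<in> free c"
  and free_diff: "x \<in> free c \<Longrightarrow> y \<in> free c \<Longrightarrow> x - y \<in> free c"
  and free_smul: "x \<in> free c \<Longrightarrow> smul r x \<in> free c"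
  and free_fscale: "x \<in> free c \<Longrightarrow> fscale k x \<in> free c"
  by (auto simp: free_def smul_def fscale_def)

lemma free_sum: "(\<And>i. i \<in> I \<Longrightarrow> f i \<in> free c) \<Longrightarrow> sum f I \<in> free c"
  by (induction I rule: infinite_finite_induct) (auto intro: free_add)

lemma free_ge_zero [simp]: "0 \<in> free_ge c n"
  and free_ge_add: "x \<in> free_ge c n \<Longrightarrow> y \<in> free_ge c n \<Longrightarrow> x + y \<in> free_ge c n"
  and free_ge_diff: "x \<in> free_ge c n \<Longrightarrow> y \<in> free_ge c n \<Longrightarrow> x - y \<in> free_ge c n"
  and free_ge_smul: "x \<in> free_ge c n \<Longrightarrow> smul r x \<in> free_ge c n"
  and free_ge_smul_ideal: "r \<in> ideal_ge n \<Longrightarrow> y \<in> free c \<Longrightarrow> smul r y \<in> free_ge c n"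
  by (auto simp: free_ge_def free_add free_diff free_smul ideal_ge_add ideal_ge_diff)
    (auto simp: smul_def ideal_ge_mult mult.commute[of r "y i" for i])

abbreviation trunc :: "nat \<Rightarrow> ('v::finite, 'k::field) mpoly \<Rightarrow> ('v, 'k) mpoly" where
  "trunc n \<equiv> rst {m. mdeg m < n}"

text \<open>A complement of \<open>free_ge c n\<close> in \<open>free c\<close>, that is, the normal
  forms of R^c. A submodule of R^c is measured by intersecting its preimage in S^c with this
  space.\<close>

definition free_lt :: "nat \<Rightarrow> nat \<Rightarrow> (nat \<Rightarrow> ('v::finite, 'k::field) mpoly) set" where
  "free_lt c n = coord_space ({..<c} \<times> {m. mdeg m < n})"

lemma free_lt_subset: "free_lt c n \<subseteq> free c"
  by (fastforce simp: free_lt_def free_def coord_space_def intro!: poly_mapping_eqI)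

lemma trunc_in_free_lt: "x \<in> free c \<Longrightarrow> (\<lambda>i. trunc n (x i)) \<in> free_lt c n"
  by (auto simp: free_lt_def free_def coord_space_def not_less[symmetric] split: if_splits)

lemma trunc_id: "x \<in> free_lt c n \<Longrightarrow> (\<lambda>i. trunc n (x i)) = x"
  by (fastforce simp: free_lt_def coord_space_def intro!: ext poly_mapping_eqI)

lemma diff_trunc_in_free_ge: "x \<in> free c \<Longrightarrow> x - (\<lambda>i. trunc n (x i)) \<in> free_ge c n"
  by (auto simp: free_ge_def free_def diff_rst_in_ideal_ge)

lemma free_lt_ge_eq_0: "x \<in> free_lt c n \<Longrightarrow> x \<in> free_ge c n \<Longrightarrow> x = 0"
proof (rule ext)
  fix i
  assume x: "x \<in> free_lt c n" "x \<in> free_ge c n"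
  have "trunc n (x i) = 0" using x(2) by (simp add: rst_eq_0_iff free_ge_def)
  then show "x i = 0 i" using fun_cong[OF trunc_id[OF x(1)], of i] by simp
qed

lemma linear_trunc: "Vector_Spaces.linear fscale fscale (\<lambda>x i. trunc n (x i))"
  by (rule linear_fscaleI) (auto simp: fun_eq_iff rst_add fscale_def rst_const_mult)

abbreviation num_lt :: "'v::finite itself \<Rightarrow> nat \<Rightarrow> nat" where
  "num_lt _ n \<equiv> \<Sum>j<n. hilb TYPE('v) j"

lemma dim_free_lt:
  "fs.dim (free_lt c n :: (nat \<Rightarrow> ('v::finite, 'k::field) mpoly) set) = c * num_lt TYPE('v) n"
  "fs.fd (free_lt c n :: (nat \<Rightarrow> ('v::finite, 'k::field) mpoly) set)"
  "fs.subspace (free_lt c n :: (nat \<Rightarrow> ('v::finite, 'k::field) mpoly) set)"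
  unfolding free_lt_def
  by (simp_all add: dim_coord_space card_cartesian_product card_mdeg_less)

text \<open>A \<open>k\<close>-linear functional on \<open>S\<^sup>c\<close> such that \<open>(r, x) \<mapsto> \<lambda>(r x)\<close> has left kernel
  \<open>\<nn>\<^sup>n\<close>.  Its right kernel \<open>rker\<close> then makes \<open>S\<^sup>c / rker\<close> a copy of the canonical
  module of \<open>S / \<nn>\<^sup>n\<close>.\<close>

locale dual_pairing =
  fixes n c :: nat and lam :: "(nat \<Rightarrow> ('v::finite, 'k::field) mpoly) \<Rightarrow> 'k"
  assumes n: "n \<ge> 2" and card_v: "CARD('v) \<ge> 2"
    and lam_add: "lam (x + y) = lam x + lam y"
    and lam_scale: "lam (fscale k x) = k * lam x"
    and lam_ge: "x \<in> free_ge c n \<Longrightarrow> lam x = 0"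
    and faithful: "(\<And>x. x \<in> free c \<Longrightarrow> lam (smul r x) = 0) \<Longrightarrow> r \<in> ideal_ge n"
begin

definition rker :: "(nat \<Rightarrow> ('v, 'k) mpoly) set" where
  "rker = {x \<in> free c. \<forall>r. lam (smul r x) = 0}"

text \<open>The preimage in S^c of m K, where K is the image of \<open>rker\<close> in R^c. Adding
  \<open>free_ge c n\<close> makes it a union of cosets.\<close>

definition mrker :: "(nat \<Rightarrow> ('v, 'k) mpoly) set" where
  "mrker = {x \<in> free c. \<exists>y. (\<forall>v. y v \<in> rker) \<and> x - (\<Sum>v\<in>UNIV. smul (var v) (y v)) \<in> free_ge c n}"

lemma lam_0 [simp]: "lam 0 = 0"
  using lam_scale[of 0 0] by simp

lemma lam_diff: "lam (x - y) = lam x - lam y"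
  using lam_add[of "x - y" y] by simp

lemma lam_sum:
  fixes f :: "'j \<Rightarrow> nat \<Rightarrow> ('v, 'k) mpoly"
  shows "lam (sum f I) = (\<Sum>i\<in>I. lam (f i))"
  by (rule infinite_finite_induct[of "\<lambda>I. lam (sum f I) = (\<Sum>i\<in>I. lam (f i))"])
    (simp_all add: lam_add)

lemma lam_cong_left: "r - s \<in> ideal_ge n \<Longrightarrow> x \<in> free c \<Longrightarrow> lam (smul r x) = lam (smul s x)"
  using lam_ge[OF free_ge_smul_ideal[of "r - s" n x c]] by (simp add: smul_diff_left lam_diff)

lemma lam_cong_right: "x - y \<in> free_ge c n \<Longrightarrow> lam (smul r x) = lam (smul r y)"
  using lam_ge[OF free_ge_smul[of "x - y" c n r]] by (simp add: smul_diff_right lam_diff)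

lemma rker_free: "x \<in> rker \<Longrightarrow> x \<in> free c"
  by (simp add: rker_def)

lemma rkerD: "x \<in> rker \<Longrightarrow> lam (smul r x) = 0"
  by (simp add: rker_def)

lemma rker_add: "x \<in> rker \<Longrightarrow> y \<in> rker \<Longrightarrow> x + y \<in> rker"
  and rker_zero [simp]: "0 \<in> rker"
  and rker_fscale: "x \<in> rker \<Longrightarrow> fscale k x \<in> rker"
  by (auto simp: rker_def free_add smul_add_right lam_add free_fscale smul_fscale lam_scale)

lemma free_ge_rker: "x \<in> free_ge c n \<Longrightarrow> x \<in> rker"
  using lam_ge[OF free_ge_smul] by (auto simp: rker_def free_ge_def)

lemma free_ge_mrker: "x \<in> free_ge c n \<Longrightarrow> x \<in> mrker"
  unfolding mrker_def by (auto simp: free_ge_def intro!: exI[of _ "\<lambda>_. 0"])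

lemma mrker_add: assumes "x \<in> mrker" "x' \<in> mrker" shows "x + x' \<in> mrker"
proof -
  obtain y y' where y: "\<forall>v. y v \<in> rker" "x - (\<Sum>v\<in>UNIV. smul (var v) (y v)) \<in> free_ge c n"
      "\<forall>v. y' v \<in> rker" "x' - (\<Sum>v\<in>UNIV. smul (var v) (y' v)) \<in> free_ge c n"
    using assms by (auto simp: mrker_def)
  have "x + x' - (\<Sum>v\<in>UNIV. smul (var v) (y v + y' v)) =
     (x - (\<Sum>v\<in>UNIV. smul (var v) (y v))) + (x' - (\<Sum>v\<in>UNIV. smul (var v) (y' v)))"
    by (simp add: smul_add_right sum.distrib)
  also have "\<dots> \<in> free_ge c n" using y by (intro free_ge_add) auto
  finally show ?thesis using y(1,3) assms
    unfolding mrker_def by (auto simp: free_add intro!: exI[of _ "\<lambda>v. y v + y' v"] rker_add)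
qed

lemma mrker_fscale: assumes "x \<in> mrker" shows "fscale k x \<in> mrker"
proof -
  obtain y where y: "\<forall>v. y v \<in> rker" "x - (\<Sum>v\<in>UNIV. smul (var v) (y v)) \<in> free_ge c n"
    using assms by (auto simp: mrker_def)
  have "smul (Poly_Mapping.single 0 k) (x - (\<Sum>v\<in>UNIV. smul (var v) (y v))) \<in> free_ge c n"
    by (rule free_ge_smul[OF y(2)])
  also have "smul (Poly_Mapping.single 0 k) (x - (\<Sum>v\<in>UNIV. smul (var v) (y v))) =
     fscale k x - (\<Sum>v\<in>UNIV. smul (var v) (fscale k (y v)))"
    by (simp add: smul_diff_right smul_sum smul_fscale smul_const_eq)
  finally have "\<exists>y. (\<forall>v. y v \<in> rker) \<and> fscale k x - (\<Sum>v\<in>UNIV. smul (var v) (y v)) \<in> free_ge c n"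
    by (rule exI[of _ "\<lambda>v. fscale k (y v)", OF conjI[rotated]]) (simp add: y(1) rker_fscale)
  then show ?thesis using assms unfolding mrker_def by (simp add: free_fscale)
qed

lemma mrker_cong: assumes "x - x' \<in> free_ge c n" "x' \<in> mrker" shows "x \<in> mrker"
  using mrker_add[OF free_ge_mrker[OF assms(1)] assms(2)] by simp

lemma subspace_rker: "fs.subspace rker"
  by (auto intro!: fs.subspaceI rker_add rker_fscale)

lemma subspace_mrker: "fs.subspace mrker"
  by (rule fs.subspaceI) (auto intro: mrker_add mrker_fscale free_ge_mrker)

text \<open>The pairing makes R^c / K dual to R, so both have the same dimension. The index type
  \<open>unit\<close> presents R itself as a space of tuples, and its orthogonal condition against
  \<open>rker\<close> is void.\<close>

lemma dim_rker: "fs.dim (rker \<inter> free_lt c n) + num_lt TYPE('v) n = c * num_lt TYPE('v) n"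
proof -
  let ?U = "coord_space (UNIV \<times> {m. mdeg m < n}) :: (unit \<Rightarrow> ('v, 'k) mpoly) set"
  let ?W = "free_lt c n :: (nat \<Rightarrow> ('v, 'k) mpoly) set"
  have "fs.dim ?W = fs.dim (rker \<inter> ?W) +
      fs.dim {u \<in> ?U. \<forall>z\<in>rker \<inter> ?W. lam (smul (u ()) z) = 0}"
  proof (rule fp.dim_orthogonal)
    show "Vector_Spaces.linear fscale (*) (\<lambda>u :: unit \<Rightarrow> _. lam (smul (u ()) w))" for w
      by (rule linear_functionalI)
        (auto simp: smul_add_left lam_add fscale_def[of _ "_ :: unit \<Rightarrow> _"] smul_const lam_scale)
    show "Vector_Spaces.linear fscale (*) (\<lambda>w. lam (smul (u ()) w))" for u :: "unit \<Rightarrow> _"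
      by (rule linear_functionalI) (auto simp: smul_add_right lam_add smul_fscale lam_scale)
    show "fs.subspace (rker \<inter> ?W)" by (intro fs.subspace_inter subspace_rker dim_free_lt)
    fix u :: "unit \<Rightarrow> ('v, 'k) mpoly" assume u: "u \<in> ?U" "\<And>w. w \<in> ?W \<Longrightarrow> lam (smul (u ()) w) = 0"
    have "lam (smul (u ()) x) = 0" if "x \<in> free c" for x
      using lam_cong_right[OF diff_trunc_in_free_ge[OF that]] u(2)[OF trunc_in_free_lt[OF that]] by simp
    then have "u () \<in> ideal_ge n" by (rule faithful)
    then show "u = 0" using u(1)
      by (auto simp: coord_space_def ideal_ge_def fun_eq_iff intro!: poly_mapping_eqI)
  next
    fix w assume w: "w \<in> ?W" "\<And>u :: unit \<Rightarrow> _. u \<in> ?U \<Longrightarrow> lam (smul (u ()) w) = 0"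
    have "w \<in> free c" using w(1) free_lt_subset by auto
    moreover have "lam (smul r w) = 0" for r
    proof -
      have "(\<lambda>_. trunc n r) \<in> ?U" by (auto simp: coord_space_def split: if_splits)
      from w(2)[OF this] show ?thesis
        using lam_cong_left[OF diff_rst_in_ideal_ge \<open>w \<in> free c\<close>, of r] by simp
    qed
    ultimately show "w \<in> rker \<inter> ?W" using w(1) by (simp add: rker_def)
  qed (use dim_free_lt in \<open>auto intro!: dim_coord_space finite_cartesian_product\<close>)
  also have "{u \<in> ?U. \<forall>z\<in>rker \<inter> ?W. lam (smul (u ()) z) = 0} = ?U"
    by (auto simp: rker_def)
  also have "fs.dim ?U = num_lt TYPE('v) n"
    by (simp add: dim_coord_space card_cartesian_product card_mdeg_less)
  finally show ?thesis by (simp add: dim_free_lt)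
qed

text \<open>The tuples \<open>(r\<^sub>v)\<close> with \<open>r\<^sub>v \<equiv> x\<^sub>v q\<close> up to the socle: these are the
  \<open>R\<close>-linear maps from the maximal ideal to \<open>R\<close>, given by their values on the variables.\<close>

definition hom_space :: "('v \<Rightarrow> ('v, 'k) mpoly) set" where
  "hom_space = {u \<in> coord_space (UNIV \<times> {m. mdeg m < n}).
     \<exists>q. (\<forall>m. mdeg m \<ge> n - 2 \<longrightarrow> Poly_Mapping.lookup q m = 0) \<and>
       (\<forall>v. trunc (n - 1) (u v) = var v * q)}"

lemma lookup_var_mult_ge:
  assumes "\<forall>m. mdeg m \<ge> n - 2 \<longrightarrow> Poly_Mapping.lookup q m = 0" "mdeg m \<ge> n - 1"
  shows "Poly_Mapping.lookup (var v * q) m = 0"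
proof (cases "Poly_Mapping.lookup m v > 0")
  case True
  then obtain m' where "m = Poly_Mapping.single v (Suc 0) + m'" by (rule single_dvdE)
  then show ?thesis using assms n by auto
qed (simp add: lookup_var_mult_eq_0)

text \<open>Truncation below degree n - 1 has the arbitrary socle tuples as its kernel, which give
  the first summand. Its image consists of the tuples x_v q with q of degree below n - 2, which give
  the second.\<close>

lemma dim_hom_space: "fs.dim hom_space = CARD('v) * hilb TYPE('v) (n - 1) + num_lt TYPE('v) (n - 2)"
proof -
  let ?U = "coord_space (UNIV \<times> {m. mdeg m < n}) :: ('v \<Rightarrow> ('v, 'k) mpoly) set"
  let ?Q = "coord_space (UNIV \<times> {m. mdeg m < n - 2}) :: (unit \<Rightarrow> ('v, 'k) mpoly) set"
  let ?tr = "\<lambda>u v. trunc (n - 1) (u v) :: ('v, 'k) mpoly"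
  let ?mu = "\<lambda>(q :: unit \<Rightarrow> ('v, 'k) mpoly) v. var v * q ()"
  have sub: "fs.subspace hom_space"
  proof (rule fs.subspaceI)
    show "0 \<in> hom_space"
      unfolding hom_space_def
      by (auto intro!: exI[of _ 0] fs.subspace_0)
  next
    fix u u' assume "u \<in> hom_space" "u' \<in> hom_space"
    then obtain q q' where q: "u \<in> ?U" "u' \<in> ?U"
        "\<forall>m. mdeg m \<ge> n - 2 \<longrightarrow> Poly_Mapping.lookup q m = 0"
        "\<forall>m. mdeg m \<ge> n - 2 \<longrightarrow> Poly_Mapping.lookup q' m = 0"
        "\<forall>v. trunc (n - 1) (u v) = var v * q" "\<forall>v. trunc (n - 1) (u' v) = var v * q'"
      unfolding hom_space_def by auto
    then show "u + u' \<in> hom_space"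
      unfolding hom_space_def
      by (auto intro!: exI[of _ "q + q'"] fs.subspace_add simp: lookup_add rst_add distrib_left)
  next
    fix k u assume "u \<in> hom_space"
    then obtain q where q: "u \<in> ?U"
        "\<forall>m. mdeg m \<ge> n - 2 \<longrightarrow> Poly_Mapping.lookup q m = 0"
        "\<forall>v. trunc (n - 1) (u v) = var v * q"
      unfolding hom_space_def by auto
    have "fscale k u \<in> ?U" using q(1) by (simp add: fs.subspace_scale)
    moreover have "trunc (n - 1) (fscale k u v) = var v * (Poly_Mapping.single 0 k * q)" for v
      using q(3) by (simp add: fscale_def rst_const_mult mult.left_commute)
    ultimately show "fscale k u \<in> hom_space"
      unfolding hom_space_def using q(2)
      by (intro CollectI conjI exI[of _ "Poly_Mapping.single 0 k * q"]) auto
  qed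
  have fdU: "fs.fd ?U" by (intro dim_coord_space finite_cartesian_product) auto
  have "fs.dim hom_space = fs.dim {u \<in> hom_space. ?tr u = 0} + fs.dim (?tr ` hom_space)"
    by (rule fp.rank_nullity_fd[OF linear_trunc sub fs.fd_subset[OF fdU]]) (auto simp: hom_space_def)
  also have "{u \<in> hom_space. ?tr u = 0} = coord_space (UNIV \<times> {m. mdeg m = n - 1})"
  proof (intro equalityI subsetI)
    fix u assume u: "u \<in> {u \<in> hom_space. ?tr u = 0}"
    have "mdeg m = n - 1" if "Poly_Mapping.lookup (u v) m \<noteq> 0" for v m
    proof -
      have "mdeg m < n" using u that by (auto simp: hom_space_def coord_space_def)
      moreover have "\<not> mdeg m < n - 1"
      proof
        assume "mdeg m < n - 1"
        then have "Poly_Mapping.lookup (u v) m = Poly_Mapping.lookup (?tr u v) m" by simp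
        also have "?tr u v = 0" using u by (simp add: fun_eq_iff)
        finally show False using that by simp
      qed
      ultimately show ?thesis by simp
    qed
    then show "u \<in> coord_space (UNIV \<times> {m. mdeg m = n - 1})" by (auto simp: coord_space_def)
  next
    fix u :: "'v \<Rightarrow> ('v, 'k) mpoly" assume u: "u \<in> coord_space (UNIV \<times> {m. mdeg m = n - 1})"
    have "u \<in> ?U" using u n coord_space_mono[of "UNIV \<times> {m. mdeg m = n - 1}" "UNIV \<times> {m. mdeg m < n}"] by force
    moreover have "trunc (n - 1) (u v) = 0" for v
      using u by (fastforce intro!: poly_mapping_eqI simp: coord_space_def)
    ultimately show "u \<in> {u \<in> hom_space. ?tr u = 0}"
      by (auto simp: hom_space_def fun_eq_iff intro!: exI[of _ 0])
  qed
  also have "fs.dim (coord_space (UNIV \<times> {m. mdeg m = n - 1}) :: ('v \<Rightarrow> ('v, 'k) mpoly) set) =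
      CARD('v) * hilb TYPE('v) (n - 1)"
    by (simp add: dim_coord_space card_cartesian_product card_mdeg_eq)
  also have "?tr ` hom_space = ?mu ` ?Q"
  proof (intro equalityI subsetI)
    fix w assume "w \<in> ?tr ` hom_space"
    then obtain q where q: "\<forall>m. mdeg m \<ge> n - 2 \<longrightarrow> Poly_Mapping.lookup q m = 0" "w = (\<lambda>v. var v * q)"
      by (auto simp: hom_space_def)
    have "(\<lambda>_. q) \<in> ?Q" using q(1) by (auto simp: coord_space_def not_le[symmetric])
    then have "?mu (\<lambda>_. q) \<in> ?mu ` ?Q" by (rule imageI)
    then show "w \<in> ?mu ` ?Q" using q(2) by simp
  next
    fix w assume "w \<in> ?mu ` ?Q"
    then obtain q where q: "q \<in> ?Q" "w = (\<lambda>v. var v * q ())" by auto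
    have q': "\<forall>m. mdeg m \<ge> n - 2 \<longrightarrow> Poly_Mapping.lookup (q ()) m = 0"
      using q(1) by (auto simp: coord_space_def not_le[symmetric])
    have w0: "Poly_Mapping.lookup (w v) m = 0" if "mdeg m \<ge> n - 1" for v m
      using lookup_var_mult_ge[OF q' that] q(2) by simp
    have tr: "?tr w = w" using w0 by (auto simp: fun_eq_iff not_le[symmetric] intro!: poly_mapping_eqI)
    have "mdeg m < n" if "Poly_Mapping.lookup (w v) m \<noteq> 0" for v m
      using w0[of m v] that n by (cases "n - 1 \<le> mdeg m") auto
    then have "w \<in> ?U" by (auto simp: coord_space_def)
    moreover have "trunc (n - 1) (w v) = var v * q ()" for v using fun_cong[OF tr, of v] q(2) by simp
    ultimately have "w \<in> hom_space"
      using q' unfolding hom_space_def by blast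
    then show "w \<in> ?tr ` hom_space" using tr by (metis (mono_tags, lifting) imageI)
  qed
  also have "fs.dim (?mu ` ?Q) = fs.dim ?Q"
  proof (rule fp.dim_image_inj_fd)
    show "Vector_Spaces.linear fscale fscale ?mu"
      by (rule linear_fscaleI) (auto simp: fun_eq_iff distrib_left fscale_def mult.left_commute)
    show "fs.fd ?Q" by (intro dim_coord_space finite_cartesian_product) auto
    fix q assume "?mu q = 0"
    then have "var v * q () = 0" for v by (simp add: fun_eq_iff)
    \<comment> \<open>A single coordinate determines q, because multiplication by a variable is
      injective.\<close>
    then have "Poly_Mapping.lookup (q ()) m = 0" for m
      using lookup_var_mult(1)[of undefined "q ()" m] by simp
    then show "q = 0" by (auto simp: fun_eq_iff intro!: poly_mapping_eqI)
  qed auto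
  also have "fs.dim ?Q = num_lt TYPE('v) (n - 2)"
    by (simp add: dim_coord_space card_cartesian_product card_mdeg_less)
  finally show ?thesis .
qed

end

lemma trunc_cong: "p - p' \<in> ideal_ge n \<Longrightarrow> trunc n p = trunc n p'"
  using rst_diff[of "{m. mdeg m < n}" p p'] rst_eq_0_iff[of n "p - p'"] by simp

lemma lookup_sum_var_mult_single:
  fixes p :: "'v::finite \<Rightarrow> ('v, 'k::field) mpoly"
  shows "Poly_Mapping.lookup (\<Sum>w\<in>UNIV. var w * p w) (Poly_Mapping.single v (Suc 0)) = Poly_Mapping.lookup (p v) 0"
proof -
  have "Poly_Mapping.lookup (var w * p w) (Poly_Mapping.single v (Suc 0)) =
      (if w = v then Poly_Mapping.lookup (p v) 0 else 0)" for w
    using lookup_var_mult[of v "p v" 0] lookup_var_mult_eq_0[of "Poly_Mapping.single v (Suc 0)" w "p w"]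
    by (auto simp: lookup_single)
  then show ?thesis by (simp add: lookup_sum)
qed

text \<open>Exactness of the Koszul complex at its first spot, modulo \<open>\<nn>\<^sup>n\<close>.\<close>

lemma proportional_to_variables:
  fixes u :: "'v::finite \<Rightarrow> ('v, 'k::field) mpoly"
  assumes n: "n \<ge> 2" and card: "CARD('v) \<ge> 2"
    and u: "\<And>v w. var w * u v - var v * u w \<in> ideal_ge n"
  obtains q where "\<forall>m. mdeg m \<ge> n - 2 \<longrightarrow> Poly_Mapping.lookup q m = 0"
    "\<forall>v. trunc (n - 1) (u v) = var v * q"
proof -
  obtain v0 :: 'v where True by simp
  \<comment> \<open>q is the quotient of \<open>u v0\<close> by its own variable, cut off where the
    relations no longer control it.\<close>
  define q where "q = rst {m. mdeg m < n - 2} (Poly_Mapping.map_key ((+) (Poly_Mapping.single v0 (Suc 0))) (u v0))"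
  have inj: "inj ((+) (Poly_Mapping.single v0 (Suc 0)) :: ('v \<Rightarrow>\<^sub>0 nat) \<Rightarrow> _)" by (auto simp: inj_on_def)
  have lq: "Poly_Mapping.lookup q m = (if mdeg m < n - 2 then Poly_Mapping.lookup (u v0) (Poly_Mapping.single v0 (Suc 0) + m) else 0)" for m
    using inj by (simp add: q_def map_key.rep_eq)
  have eq: "Poly_Mapping.lookup (var w * u v) m = Poly_Mapping.lookup (var v * u w) m" if "mdeg m < n" for v w m
    using ideal_geD[OF u that, of w v] by (simp add: lookup_minus)
  have q0: "\<forall>m. mdeg m \<ge> n - 2 \<longrightarrow> Poly_Mapping.lookup q m = 0" by (simp add: lq)
  have "trunc (n - 1) (u v) = var v * q" for v
  proof (rule poly_mapping_eqI)
    fix m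
    show "Poly_Mapping.lookup (trunc (n - 1) (u v)) m = Poly_Mapping.lookup (var v * q) m"
    proof (cases "Poly_Mapping.lookup m v = 0")
      case True
      obtain w where w: "w \<noteq> v"
      proof -
        have "\<not> (UNIV :: 'v set) \<subseteq> {v}" using card card_mono[of "{v}" "UNIV :: 'v set"] by auto
        then show ?thesis using that by auto
      qed
      \<comment> \<open>Compare the coefficients of x_w m: the right side contributes none, as x_v
        does not divide this monomial. Here a second variable is needed.\<close>
      have "Poly_Mapping.lookup (u v) m = 0" if "mdeg m < n - 1"
      proof -
        have "Poly_Mapping.lookup (var w * u v) (Poly_Mapping.single w (Suc 0) + m) =
            Poly_Mapping.lookup (var v * u w) (Poly_Mapping.single w (Suc 0) + m)"
          using that by (intro eq) simp
        also have "\<dots> = 0"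
          using True w by (intro lookup_var_mult_eq_0) (simp add: lookup_add lookup_single)
        finally show ?thesis by simp
      qed
      then show ?thesis using lookup_var_mult_eq_0[OF True, of q] by simp
    next
      case False
      then obtain m' where m: "m = Poly_Mapping.single v (Suc 0) + m'" by (auto elim: single_dvdE)
      have "Poly_Mapping.lookup (u v) m = Poly_Mapping.lookup q m'" if "mdeg m < n - 1"
      proof -
        have d: "mdeg m' < n - 2" using that m by simp
        \<comment> \<open>Read in two ways, this monomial lets the relation between \<open>v\<close>
          and \<open>v0\<close> carry the coefficient of \<open>u v\<close> over to
          \<open>u v0\<close>.\<close>
        have e: "Poly_Mapping.single v0 (Suc 0) + m = Poly_Mapping.single v (Suc 0) + (Poly_Mapping.single v0 (Suc 0) + m')"
          by (simp add: m add.left_commute)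
        have "Poly_Mapping.lookup (u v) m = Poly_Mapping.lookup (var v0 * u v) (Poly_Mapping.single v0 (Suc 0) + m)"
          by simp
        also have "\<dots> = Poly_Mapping.lookup (var v * u v0) (Poly_Mapping.single v0 (Suc 0) + m)"
          using that by (intro eq) simp
        also have "\<dots> = Poly_Mapping.lookup (u v0) (Poly_Mapping.single v0 (Suc 0) + m')"
          unfolding e by simp
        finally show ?thesis using d by (simp add: lq)
      qed
      moreover have "Poly_Mapping.lookup q m' = 0" if "\<not> mdeg m < n - 1"
        using that m q0 by auto
      ultimately show ?thesis by (simp add: m)
    qed
  qed
  then show ?thesis using that q0 by blast
qed

section \<open>The tensor product of m with the canonical module, and its dual\<close>

context dual_pairing
begin

definition slice :: "('v \<times> nat \<Rightarrow> ('v, 'k) mpoly) \<Rightarrow> 'v \<Rightarrow> nat \<Rightarrow> ('v, 'k) mpoly" where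
  "slice y v = (\<lambda>i. y (v, i))"

text \<open>Modulo \<open>\<nn>\<^sup>n\<close> this is the surjection of d copies of R^c onto m
  R^c. Indexing by pairs keeps its domain a space of tuples.\<close>

definition euler :: "('v \<times> nat \<Rightarrow> ('v, 'k) mpoly) \<Rightarrow> nat \<Rightarrow> ('v, 'k) mpoly" where
  "euler y = (\<Sum>v\<in>UNIV. smul (var v) (slice y v))"

abbreviation tuples :: "('v \<times> nat \<Rightarrow> ('v, 'k) mpoly) set" where
  "tuples \<equiv> coord_space ((UNIV \<times> {..<c}) \<times> {m. mdeg m < n})"

lemma slice_add: "slice (x + y) v = slice x v + slice y v"
  and slice_fscale: "slice (fscale k x) v = fscale k (slice x v)"
  by (auto simp: slice_def fscale_def)

lemma euler_apply: "euler y i = (\<Sum>v\<in>UNIV. var v * y (v, i))"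
proof -
  have "(\<Sum>v\<in>A. smul (var v) (slice y v)) i = (\<Sum>v\<in>A. var v * y (v, i))" for A :: "'v set"
    by (rule infinite_finite_induct[of "\<lambda>A. (\<Sum>v\<in>A. smul (var v) (slice y v)) i = (\<Sum>v\<in>A. var v * y (v, i))"])
      (simp_all add: smul_def slice_def)
  then show ?thesis by (simp add: euler_def)
qed

lemma slice_in: "y \<in> tuples \<Longrightarrow> slice y v \<in> free_lt c n"
  by (auto simp: slice_def free_lt_def coord_space_def)

lemma slice_free: "y \<in> tuples \<Longrightarrow> slice y v \<in> free c"
  using slice_in free_lt_subset by blast

lemma euler_free: "y \<in> tuples \<Longrightarrow> euler y \<in> free c"
  unfolding euler_def by (intro free_sum free_smul slice_free)

lemma trunc_euler_mrker_iff:
  assumes "y \<in> tuples"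
  shows "(\<lambda>i. trunc n (euler y i)) \<in> mrker \<longleftrightarrow> euler y \<in> mrker"
  using mrker_cong[of "euler y" "\<lambda>i. trunc n (euler y i)"] mrker_cong[of "\<lambda>i. trunc n (euler y i)" "euler y"]
    diff_trunc_in_free_ge[OF euler_free[OF assms], of n]
    free_ge_diff[OF free_ge_zero diff_trunc_in_free_ge[OF euler_free[OF assms], of n]]
  by auto

text \<open>The tuples whose image lies in m K are the kernel of the map onto m R^c / m K, so their
  orthogonal space is the dual of that quotient, namely Hom (m, R). Orthogonality to the Koszul
  relations forces x_w u_v = x_v u_w in R. Conversely, u_v = x_v q up to the socle, and the socle
  part is killed because after subtracting elements of \<open>rker\<close> the entries have no
  constant term.\<close>

lemma hom_space_orthogonal:
  "{u \<in> coord_space (UNIV \<times> {m. mdeg m < n}). \<forall>y\<in>{y \<in> tuples. (\<lambda>i. trunc n (euler y i)) \<in> mrker}.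
     (\<Sum>v\<in>UNIV. lam (smul (u v) (slice y v))) = 0} = hom_space" (is "?L = _")
proof (intro equalityI subsetI)
  fix u assume u: "u \<in> hom_space"
  then obtain q where q: "\<forall>v. trunc (n - 1) (u v) = var v * q" by (auto simp: hom_space_def)
  have "(\<Sum>v\<in>UNIV. lam (smul (u v) (slice y v))) = 0"
    if y: "y \<in> tuples" "(\<lambda>i. trunc n (euler y i)) \<in> mrker" for y
  proof -
    have "euler y \<in> mrker" using y trunc_euler_mrker_iff by simp
    then obtain k where k: "\<And>v. k v \<in> rker" "euler y - (\<Sum>v\<in>UNIV. smul (var v) (k v)) \<in> free_ge c n"
      by (auto simp: mrker_def)
    define w where "w v = slice y v - k v" for v
    have wf: "w v \<in> free c" for v unfolding w_def by (intro free_diff slice_free y rker_free k)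
    have W: "(\<Sum>v\<in>UNIV. smul (var v) (w v)) \<in> free_ge c n"
      using k(2) by (simp add: w_def euler_def smul_diff_right sum_subtractf)
    have Wi: "(\<Sum>v\<in>UNIV. smul (var v) (w v)) i = (\<Sum>v\<in>UNIV. var v * w v i)" for i
    proof -
      have "(\<Sum>v\<in>A. smul (var v) (w v)) i = (\<Sum>v\<in>A. var v * w v i)" for A :: "'v set"
        by (rule infinite_finite_induct[of "\<lambda>A. (\<Sum>v\<in>A. smul (var v) (w v)) i = (\<Sum>v\<in>A. var v * w v i)"])
          (simp_all add: smul_def)
      then show ?thesis .
    qed
    \<comment> \<open>The constant term of w_v is the coefficient of x_v in the sum of all x_v w_v,
      and this sum starts in degree n \<ge> 2.\<close>
    have w1: "w v i \<in> ideal_ge 1" for v i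
    proof (rule ideal_geI)
      fix m :: "'v \<Rightarrow>\<^sub>0 nat" assume "mdeg m < 1"
      then have "m = 0" by simp
      have "(\<Sum>v\<in>UNIV. var v * w v i) \<in> ideal_ge n" using W by (auto simp: free_ge_def Wi)
      then have "Poly_Mapping.lookup (\<Sum>v\<in>UNIV. var v * w v i) (Poly_Mapping.single v (Suc 0)) = 0"
        using n by (intro ideal_geD) auto
      then show "Poly_Mapping.lookup (w v i) m = 0"
        using lookup_sum_var_mult_single[of "\<lambda>v. w v i" v] \<open>m = 0\<close> by simp
    qed
    have "lam (smul (u v) (slice y v)) = lam (smul q (smul (var v) (w v)))" for v
    proof -
      have "lam (smul (u v) (slice y v)) = lam (smul (u v) (w v)) + lam (smul (u v) (k v))"
        by (simp add: w_def smul_diff_right lam_diff)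
      also have "lam (smul (u v) (k v)) = 0" by (rule rkerD[OF k(1)])
      also have "smul (u v) (w v) = smul (u v - trunc (n - 1) (u v)) (w v) + smul (var v * q) (w v)"
        using q by (simp add: smul_add_left[symmetric])
      \<comment> \<open>The socle part of \<open>u v\<close> has order n - 1 and \<open>w v\<close>
        has order 1.\<close>
      also have "smul (u v - trunc (n - 1) (u v)) (w v) \<in> free_ge c n"
      proof -
        have "(u v - trunc (n - 1) (u v)) * w v i \<in> ideal_ge n" for i
          using ideal_ge_mult2[OF diff_rst_in_ideal_ge[of "u v" "n - 1"] w1[of v i]] n by simp
        then show ?thesis using free_smul[OF wf[of v]] by (simp add: free_ge_def smul_def)
      qed
      then have "lam (smul (u v - trunc (n - 1) (u v)) (w v) + smul (var v * q) (w v)) = lam (smul (var v * q) (w v))"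
        using lam_ge by (simp add: lam_add)
      finally show ?thesis by (simp add: smul_smul mult.commute)
    qed
    then have "(\<Sum>v\<in>UNIV. lam (smul (u v) (slice y v))) = lam (smul q (\<Sum>v\<in>UNIV. smul (var v) (w v)))"
      by (simp add: smul_sum lam_sum)
    also have "\<dots> = 0" by (rule lam_ge[OF free_ge_smul[OF W]])
    finally show ?thesis .
  qed
  then show "u \<in> ?L" using u by (auto simp: hom_space_def)
next
  fix u assume u: "u \<in> ?L"
  have "var w * u v - var v * u w \<in> ideal_ge n" for v w
  proof (cases "v = w")
    case False
    show ?thesis
    proof (rule faithful)
      fix x :: "nat \<Rightarrow> ('v, 'k) mpoly" assume x: "x \<in> free c"
      define t where "t a = (\<lambda>i. trunc n (smul (var a) x i))" for a
      \<comment> \<open>The Koszul relation between x_v and x_w, applied to the vector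
        \<open>x\<close> and truncated: its Euler sum vanishes modulo
        \<open>\<nn>\<^sup>n\<close>.\<close>
      define y where "y = (\<lambda>(a, i). if a = v then t w i else if a = w then - t v i else 0)"
      have t: "t a \<in> free_lt c n" for a unfolding t_def by (intro trunc_in_free_lt free_smul x)
      have tge: "smul (var a) x - t a \<in> free_ge c n" for a
        unfolding t_def by (intro diff_trunc_in_free_ge free_smul x)
      have y: "y \<in> tuples"
        using t by (auto simp: y_def coord_space_def free_lt_def split: if_splits)
      have sl: "slice y a = (if a = v then t w else if a = w then - t v else 0)" for a
        by (auto simp: slice_def y_def fun_eq_iff)
      have sum2: "(\<Sum>a\<in>UNIV. h a (slice y a)) = h v (t w) + h w (- t v)"
        if "\<And>a. h a 0 = 0" for h :: "'v \<Rightarrow> (nat \<Rightarrow> ('v, 'k) mpoly) \<Rightarrow> 'x::comm_monoid_add"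
      proof -
        have "(\<Sum>a\<in>UNIV. h a (slice y a)) = (\<Sum>a\<in>{v, w}. h a (slice y a))"
          by (rule sum.mono_neutral_right) (auto simp: sl that)
        then show ?thesis using False by (simp add: sl)
      qed
      have "euler y = smul (var v) (t w) + smul (var w) (- t v)"
        unfolding euler_def by (rule sum2[of "\<lambda>a. smul (var a)"]) simp
      also have "\<dots> = smul (var w) (smul (var v) x - t v) - smul (var v) (smul (var w) x - t w)"
        by (simp add: fun_eq_iff smul_def algebra_simps)
      also have "\<dots> \<in> free_ge c n" by (intro free_ge_diff free_ge_smul tge)
      finally have "euler y \<in> mrker" by (rule free_ge_mrker)
      then have "(\<Sum>a\<in>UNIV. lam (smul (u a) (slice y a))) = 0"
        using u y trunc_euler_mrker_iff[OF y] by auto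
      moreover have "(\<Sum>a\<in>UNIV. lam (smul (u a) (slice y a))) = lam (smul (u v) (t w)) + lam (smul (u w) (- t v))"
        by (rule sum2[of "\<lambda>a x. lam (smul (u a) x)"]) simp
      moreover have "lam (smul (u w) (- t v)) = - lam (smul (u w) (t v))"
        using lam_diff[of 0 "smul (u w) (t v)"] smul_diff_right[of "u w" 0 "t v"] by simp
      moreover have "lam (smul (u a) (t b)) = lam (smul (u a) (smul (var b) x))" for a b
        by (rule lam_cong_right[OF tge, symmetric])
      ultimately show "lam (smul (var w * u v - var v * u w) x) = 0"
        by (simp add: smul_diff_left lam_diff smul_smul mult.commute)
    qed
  qed simp
  then obtain q where "\<forall>m. mdeg m \<ge> n - 2 \<longrightarrow> Poly_Mapping.lookup q m = 0"
      "\<forall>v. trunc (n - 1) (u v) = var v * q"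
    using proportional_to_variables[OF n card_v] by metis
  then show "u \<in> hom_space" using u unfolding hom_space_def by blast
qed

text \<open>The right side is m R^c in normal form; surjectivity is the splitting of a polynomial
  without constant term along the variables.\<close>

lemma trunc_euler_image:
  "(\<lambda>y i. trunc n (euler y i)) ` tuples = coord_space ({..<c} \<times> {m. 0 < mdeg m \<and> mdeg m < n})" (is "?L = ?R")
proof (intro equalityI subsetI)
  fix x assume "x \<in> ?L"
  then obtain y where y: "y \<in> tuples" "x = (\<lambda>i. trunc n (euler y i))" by auto
  have x: "x \<in> free_lt c n" unfolding y(2) by (intro trunc_in_free_lt euler_free y)
  have "Poly_Mapping.lookup (x i) 0 = 0" for i
    unfolding y(2) by (simp add: euler_apply lookup_sum lookup_var_mult_eq_0)
  then show "x \<in> ?R" using x by (auto simp: free_lt_def coord_space_def intro!: gr0I)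
next
  fix x assume x: "x \<in> ?R"
  have "\<exists>q. x i = (\<Sum>v\<in>UNIV. var v * q v)" for i
  proof -
    have "Poly_Mapping.lookup (x i) m = 0" if "mdeg m < Suc 0" for m
    proof (rule ccontr)
      assume "Poly_Mapping.lookup (x i) m \<noteq> 0"
      then have "(i, m) \<in> {..<c} \<times> {m. 0 < mdeg m \<and> mdeg m < n}"
        using x unfolding coord_space_def by blast
      then show False using that by simp
    qed
    then have "x i \<in> ideal_ge (Suc 0)" by (rule ideal_geI)
    then show ?thesis by (rule ideal_ge_Suc_decompose) blast
  qed
  then have "\<exists>q. \<forall>i. x i = (\<Sum>v\<in>UNIV. var v * q i v)" by (intro choice allI)
  then obtain q where q: "\<And>i. x i = (\<Sum>v\<in>UNIV. var v * q i v)" by blast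
  define y where "y = (\<lambda>(v, i). if i < c then trunc n (q i v) else 0)"
  have y: "y \<in> tuples" by (auto simp: y_def coord_space_def split: if_splits)
  have "trunc n (euler y i) = x i" for i
  proof (cases "i < c")
    case True
    have "x i - euler y i = (\<Sum>v\<in>UNIV. var v * (q i v - trunc n (q i v)))"
      using True by (simp add: q euler_apply y_def sum_subtractf right_diff_distrib)
    also have "\<dots> \<in> ideal_ge n" by (intro ideal_ge_sum ideal_ge_mult diff_rst_in_ideal_ge)
    finally have "trunc n (euler y i) = trunc n (x i)" by (rule trunc_cong[symmetric])
    also have "\<dots> = x i"
    proof (rule poly_mapping_eqI)
      fix m show "Poly_Mapping.lookup (trunc n (x i)) m = Poly_Mapping.lookup (x i) m"
        using x by (cases "Poly_Mapping.lookup (x i) m = 0") (auto simp: coord_space_def)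
    qed
    finally show ?thesis .
  next
    case False
    then have "Poly_Mapping.lookup (x i) m = 0" for m using x by (auto simp: coord_space_def)
    then have "x i = 0" by (intro poly_mapping_eqI) simp
    moreover have "euler y i = 0" using False by (simp add: euler_apply y_def)
    ultimately show ?thesis by simp
  qed
  then have "x = (\<lambda>i. trunc n (euler y i))" by simp
  then show "x \<in> ?L" using y by blast
qed

lemma mrker_no_constant: "x \<in> mrker \<Longrightarrow> Poly_Mapping.lookup (x i) 0 = 0"
proof -
  assume "x \<in> mrker"
  then obtain y where "x - (\<Sum>v\<in>UNIV. smul (var v) (y v)) \<in> free_ge c n" by (auto simp: mrker_def)
  then have "x i - (\<Sum>v\<in>UNIV. smul (var v) (y v)) i \<in> ideal_ge n" by (simp add: free_ge_def)
  moreover have "(\<Sum>v\<in>A. smul (var v) (y v)) i = (\<Sum>v\<in>A. var v * y v i)" for A :: "'v set"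
    by (rule infinite_finite_induct[of "\<lambda>A. (\<Sum>v\<in>A. smul (var v) (y v)) i = (\<Sum>v\<in>A. var v * y v i)"])
      (simp_all add: smul_def)
  ultimately have "Poly_Mapping.lookup (x i - (\<Sum>v\<in>UNIV. var v * y v i)) 0 = 0"
    using n by (intro ideal_geD) auto
  then show ?thesis by (simp add: lookup_minus lookup_sum lookup_var_mult_eq_0)
qed

text \<open>Let D = dim R. Duality gives dim K = (c - 1) D. The map onto m R^c, of dimension c (D -
  1), gives dim (m K) = c (D - 1) - dim Hom (m, R). Hence dim K - dim (m K) - c = dim Hom (m, R) -
  D, and the terms of D below degree n - 2 cancel.\<close>

theorem dim_rker_mrker:
  "int (fs.dim (rker \<inter> free_lt c n)) - int (fs.dim (mrker \<inter> free_lt c n)) - int c =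
   int (CARD('v)) * int (hilb TYPE('v) (n - 1)) - int (hilb TYPE('v) (n - 1)) - int (hilb TYPE('v) (n - 2))"
proof -
  let ?phi = "\<lambda>y i. trunc n (euler y i)"
  let ?U = "coord_space (UNIV \<times> {m. mdeg m < n}) :: ('v \<Rightarrow> ('v, 'k) mpoly) set"
  let ?Z = "{y \<in> tuples. ?phi y \<in> mrker}"
  let ?B = "\<lambda>u y. \<Sum>v\<in>UNIV. lam (smul (u v) (slice y v))"
  have fdY: "fs.fd tuples" by (intro dim_coord_space finite_cartesian_product) auto
  have lin: "Vector_Spaces.linear fscale fscale ?phi"
  proof (rule linear_fscaleI)
    fix x y k
    show "?phi (x + y) = ?phi x + ?phi y"
      by (simp add: fun_eq_iff euler_apply distrib_left sum.distrib rst_add)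
    show "?phi (fscale k x) = fscale k (?phi x)"
      by (simp add: fun_eq_iff euler_apply fscale_def rst_const_mult[symmetric] sum_distrib_left mult.left_commute)
  qed
  have phi_lt: "?phi y \<in> free_lt c n" if "y \<in> tuples" for y
    by (intro trunc_in_free_lt euler_free that)
  have Z: "fs.subspace ?Z"
    using subspace_mrker coord_space_subspace lin
    by (intro fs.subspaceI)
      (auto simp: fp.linear_0[OF lin] fp.linear_add[OF lin] fp.linear_scale[OF lin] fs.subspace_0
         fs.subspace_add fs.subspace_scale)
  have 1: "fs.dim tuples = fs.dim ?Z + fs.dim {u \<in> ?U. \<forall>z\<in>?Z. ?B u z = 0}"
  proof (rule fp.dim_orthogonal)
    show "Vector_Spaces.linear fscale (*) (\<lambda>u. ?B u y)" for y
      by (rule linear_functionalI)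
        (simp_all add: smul_add_left lam_add sum.distrib fscale_def[of _ "_ :: 'v \<Rightarrow> _"] smul_const lam_scale sum_distrib_left)
    show "Vector_Spaces.linear fscale (*) (?B u)" for u
      by (rule linear_functionalI)
        (simp_all add: slice_add slice_fscale smul_add_right lam_add sum.distrib smul_fscale lam_scale sum_distrib_left)
    show "fs.fd ?U" by (intro dim_coord_space finite_cartesian_product) auto
    fix u assume u: "u \<in> ?U" "\<And>y. y \<in> tuples \<Longrightarrow> ?B u y = 0"
    have "u v \<in> ideal_ge n" for v
    proof (rule faithful)
      fix x :: "nat \<Rightarrow> ('v, 'k) mpoly" assume x: "x \<in> free c"
      \<comment> \<open>The test tuple has \<open>x\<close> in slot \<open>v\<close> only, which
        reduces nondegeneracy to \<open>faithful\<close>.\<close>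
      define y where "y = (\<lambda>(a, i). if a = v then trunc n (x i) else 0)"
      have y: "y \<in> tuples"
        using trunc_in_free_lt[OF x, of n] by (auto simp: y_def coord_space_def free_lt_def split: if_splits)
      have sl: "slice y a = (if a = v then (\<lambda>i. trunc n (x i)) else 0)" for a
        by (auto simp: slice_def y_def fun_eq_iff)
      have "?B u y = (\<Sum>a\<in>UNIV. if a = v then lam (smul (u v) (\<lambda>i. trunc n (x i))) else 0)"
        by (intro sum.cong) (auto simp: sl)
      then have "lam (smul (u v) (\<lambda>i. trunc n (x i))) = 0" using u(2)[OF y] by simp
      then show "lam (smul (u v) x) = 0"
        using lam_cong_right[OF diff_trunc_in_free_ge[OF x]] by simp
    qed
    then have "Poly_Mapping.lookup (u v) m = 0" for v m
      using u(1) by (cases "mdeg m < n") (auto simp: coord_space_def ideal_ge_def)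
    then show "u = 0" by (auto simp: fun_eq_iff intro!: poly_mapping_eqI)
  next
    fix y assume y: "y \<in> tuples" "\<And>u. u \<in> ?U \<Longrightarrow> ?B u y = 0"
    have "slice y v \<in> rker" for v
    proof -
      have "lam (smul r (slice y v)) = 0" for r
      proof -
        have "(\<lambda>a. if a = v then trunc n r else 0) \<in> ?U" by (auto simp: coord_space_def split: if_splits)
        from y(2)[OF this] have "?B (\<lambda>a. if a = v then trunc n r else 0) y = 0" .
        also have "?B (\<lambda>a. if a = v then trunc n r else 0) y = (\<Sum>a\<in>UNIV. if a = v then lam (smul (trunc n r) (slice y v)) else 0)"
          by (intro sum.cong) auto
        finally show ?thesis
          using lam_cong_left[OF diff_rst_in_ideal_ge slice_free[OF y(1)], of r] by simp
      qed
      then show ?thesis using slice_free[OF y(1)] by (simp add: rker_def)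
    qed
    then have "euler y \<in> mrker"
      unfolding mrker_def using euler_free[OF y(1)] by (auto simp: euler_def intro!: exI[of _ "slice y"])
    then show "y \<in> ?Z" using y(1) trunc_euler_mrker_iff by auto
  qed (use Z fdY in auto)
  have sub: "mrker \<inter> free_lt c n \<subseteq> ?phi ` tuples"
    unfolding trunc_euler_image using mrker_no_constant
    by (auto simp: free_lt_def coord_space_def intro!: gr0I)
  have "fs.dim tuples + fs.dim (mrker \<inter> free_lt c n) =
      fs.dim {y \<in> tuples. ?phi y \<in> mrker \<inter> free_lt c n} + fs.dim (?phi ` tuples)"
    by (rule fp.dim_preimage_fd[OF lin _ fdY _ sub]) (auto intro!: fs.subspace_inter subspace_mrker dim_free_lt)
  also have "{y \<in> tuples. ?phi y \<in> mrker \<inter> free_lt c n} = ?Z" using phi_lt by auto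
  also have "fs.dim (?phi ` tuples) = c * (num_lt TYPE('v) n - 1)"
  proof -
    have "{m :: 'v \<Rightarrow>\<^sub>0 nat. 0 < mdeg m \<and> mdeg m < n} = {m. mdeg m < n} - {0}" by (auto intro!: gr0I)
    then have "card {m :: 'v \<Rightarrow>\<^sub>0 nat. 0 < mdeg m \<and> mdeg m < n} = num_lt TYPE('v) n - 1"
      using n card_mdeg_less[of n, where 'v='v] by (simp add: card_Diff_singleton)
    moreover have "finite {m :: 'v \<Rightarrow>\<^sub>0 nat. 0 < mdeg m \<and> mdeg m < n}"
      by (rule finite_subset[OF _ finite_mdeg_less[of n]]) auto
    ultimately show ?thesis
      unfolding trunc_euler_image by (simp add: dim_coord_space card_cartesian_product)
  qed
  finally have 2: "fs.dim tuples + fs.dim (mrker \<inter> free_lt c n) = fs.dim ?Z + c * (num_lt TYPE('v) n - 1)" .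
  have 3: "fs.dim tuples = fs.dim ?Z + (CARD('v) * hilb TYPE('v) (n - 1) + num_lt TYPE('v) (n - 2))"
    using 1 unfolding hom_space_orthogonal dim_hom_space .
  obtain n' where n': "n = Suc (Suc n')" using n by (metis Suc_le_D numeral_2_eq_2 Suc_le_mono)
  have 4: "num_lt TYPE('v) n = num_lt TYPE('v) (n - 2) + hilb TYPE('v) (n - 2) + hilb TYPE('v) (n - 1)"
    by (simp add: n')
  have "num_lt TYPE('v) n \<ge> 1" using n by (intro order_trans[OF _ member_le_sum[of 0]]) auto
  then have 5: "c * (num_lt TYPE('v) n - 1) + c = c * num_lt TYPE('v) n"
    by (cases "num_lt TYPE('v) n") auto
  show ?thesis using 2 3 4 5 dim_rker by (simp add: of_nat_mult[symmetric] del: of_nat_mult)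
qed

end

section \<open>The Koszul complex\<close>

text \<open>An arbitrary order of the variables. It fixes the Koszul signs and the least variable in
  the contraction, and later a monomial order.\<close>

definition vidx :: "'v::finite \<Rightarrow> nat" where
  "vidx = (SOME f. inj f)"

lemma inj_vidx: "inj (vidx :: 'v::finite \<Rightarrow> nat)"
proof -
  have "\<exists>f :: 'v \<Rightarrow> nat. inj f"
    using finite_imp_inj_to_nat_seg[of "UNIV :: 'v set"] by auto
  then show ?thesis unfolding vidx_def by (rule someI_ex)
qed

lemma vidx_eq_iff [simp]: "vidx v = vidx w \<longleftrightarrow> v = w"
  using inj_vidx by (auto dest: injD)

lemma ex_min_vidx: "A \<noteq> {} \<Longrightarrow> \<exists>u\<in>A. \<forall>w\<in>A. vidx u \<le> vidx w"
  using ex_has_least_nat[of "\<lambda>v. v \<in> A" _ vidx] by blast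

definition ksgn :: "'v::finite \<Rightarrow> 'v set \<Rightarrow> 'k::field" where
  "ksgn v I = (- 1) ^ card {w \<in> I. vidx w < vidx v}"

lemma ksgn_insert:
  assumes "w \<notin> I" "w \<noteq> v"
  shows "ksgn v (insert w I) = (if vidx w < vidx v then - ksgn v I else ksgn v I)"
proof -
  have "{x \<in> insert w I. vidx x < vidx v} =
      (if vidx w < vidx v then insert w {x \<in> I. vidx x < vidx v} else {x \<in> I. vidx x < vidx v})"
    by auto
  then show ?thesis using assms by (simp add: ksgn_def)
qed

lemma ksgn_least: "(\<And>w. w \<in> I \<Longrightarrow> vidx v \<le> vidx w) \<Longrightarrow> ksgn v I = 1"
proof -
  assume "\<And>w. w \<in> I \<Longrightarrow> vidx v \<le> vidx w"
  then have *: "{w \<in> I. vidx w < vidx v} = {}" by (auto simp: not_less)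
  show ?thesis unfolding ksgn_def * by simp
qed

definition kpoly :: "'v::finite \<Rightarrow> 'v set \<Rightarrow> ('v, 'k::field) mpoly" where
  "kpoly v I = Poly_Mapping.single 0 (ksgn v I) * var v"

text \<open>The Koszul differential read on coefficients: \<open>z I\<close> is the coefficient of
  e_I, and e_J with J = insert v I contributes x_v e_I up to sign. All exterior degrees are treated
  at once, with coefficients in S^c.\<close>

definition kdiff :: "('v::finite set \<Rightarrow> nat \<Rightarrow> ('v, 'k::field) mpoly) \<Rightarrow> 'v set \<Rightarrow> nat \<Rightarrow> ('v, 'k) mpoly" where
  "kdiff z I = (\<Sum>v\<in>- I. smul (kpoly v I) (z (insert v I)))"

lemma sum_fun_apply: "(\<Sum>a\<in>A. f a) i = (\<Sum>a\<in>A. f a i)"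
  for f :: "'a \<Rightarrow> 'i \<Rightarrow> 'b::comm_monoid_add"
  by (rule infinite_finite_induct[of "\<lambda>A. (\<Sum>a\<in>A. f a) i = (\<Sum>a\<in>A. f a i)"]) simp_all

lemma kdiff_diff: "kdiff (\<lambda>I. x I - y I) I = kdiff x I - kdiff y I"
  by (simp add: kdiff_def smul_diff_right sum_subtractf)

lemma lookup_kpoly_mult:
  "Poly_Mapping.lookup (kpoly v I * p) m =
     (if Poly_Mapping.lookup m v = 0 then 0 else ksgn v I * Poly_Mapping.lookup p (m - Poly_Mapping.single v (Suc 0)))"
proof (cases "Poly_Mapping.lookup m v = 0")
  case True
  then show ?thesis using lookup_var_mult_eq_0[of m v p] by (simp add: kpoly_def mult.assoc)
next
  case False
  then obtain m' where "m = Poly_Mapping.single v (Suc 0) + m'" by (auto elim: single_dvdE)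
  then show ?thesis using False by (simp add: kpoly_def mult.assoc)
qed

lemma lookup_kdiff:
  "Poly_Mapping.lookup (kdiff z I j) m =
    (\<Sum>v\<in>- I. if Poly_Mapping.lookup m v = 0 then 0
       else ksgn v I * Poly_Mapping.lookup (z (insert v I) j) (m - Poly_Mapping.single v (Suc 0)))"
  unfolding kdiff_def sum_fun_apply lookup_sum
  by (simp add: smul_def lookup_kpoly_mult)

text \<open>Removing v and then w has the opposite sign of removing w and then v. The pairs are
  split by their order, so that the argument also holds in characteristic 2.\<close>

lemma kdiff_kdiff: "kdiff (kdiff z) I = 0"
proof -
  define g where "g = (\<lambda>(v, w). smul (kpoly v I * kpoly w (insert v I)) (z (insert w (insert v I))))"
  define L where "L = {p :: 'a \<times> 'a. fst p \<notin> I \<and> snd p \<notin> I \<and> vidx (fst p) < vidx (snd p)}"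
  have anti: "g (w, v) = - g (v, w)" if "(v, w) \<in> L" for v w
  proof -
    have *: "v \<notin> I" "w \<notin> I" "vidx v < vidx w" "v \<noteq> w" using that by (auto simp: L_def)
    have "kpoly w I * kpoly v (insert w I) = - (kpoly v I * kpoly w (insert v I) :: ('a, 'b) mpoly)"
      using * by (simp add: kpoly_def ksgn_insert single_uminus)
    then show ?thesis
      by (simp add: g_def insert_commute[of v w] smul_def fun_eq_iff)
  qed
  have "kdiff (kdiff z) I = (\<Sum>v\<in>- I. \<Sum>w\<in>- insert v I. g (v, w))"
    unfolding kdiff_def[of "kdiff z"] by (simp add: kdiff_def smul_sum smul_smul g_def)
  also have "\<dots> = (\<Sum>p\<in>(SIGMA v:- I. - insert v I). g p)"
    by (simp add: sum.Sigma case_prod_unfold)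
  also have "(SIGMA v:- I. - insert v I) = L \<union> prod.swap ` L"
  proof (intro equalityI subsetI)
    fix p assume "p \<in> (SIGMA v:- I. - insert v I)"
    then have p: "fst p \<notin> I" "snd p \<notin> I" "fst p \<noteq> snd p" by auto
    then have "vidx (fst p) < vidx (snd p) \<or> vidx (snd p) < vidx (fst p)"
      using vidx_eq_iff[of "fst p" "snd p"] by linarith
    then show "p \<in> L \<union> prod.swap ` L"
    proof
      assume "vidx (snd p) < vidx (fst p)"
      then have "prod.swap p \<in> L" using p by (simp add: L_def)
      then show ?thesis by (metis UnI2 image_eqI swap_swap)
    qed (use p in \<open>simp add: L_def\<close>)
  qed (auto simp: L_def)
  also have "(\<Sum>p\<in>L \<union> prod.swap ` L. g p) = (\<Sum>p\<in>L. g p) + (\<Sum>p\<in>prod.swap ` L. g p)"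
    by (rule sum.union_disjoint) (auto simp: L_def)
  also have "(\<Sum>p\<in>prod.swap ` L. g p) = (\<Sum>p\<in>L. - g p)"
    by (subst sum.reindex) (auto intro!: sum.cong simp: anti)
  finally show ?thesis by (simp only: sum_negf add.right_inverse)
qed

definition kmin :: "'v::finite set \<Rightarrow> 'v" where
  "kmin J = (SOME u. u \<in> J \<and> (\<forall>w\<in>J. vidx u \<le> vidx w))"

lemma kmin: "J \<noteq> {} \<Longrightarrow> kmin J \<in> J \<and> (\<forall>w\<in>J. vidx (kmin J) \<le> vidx w)"
  unfolding kmin_def by (rule someI_ex) (use ex_min_vidx[of J] in blast)

lemma kmin_eqI: "u \<in> J \<Longrightarrow> (\<And>w. w \<in> J \<Longrightarrow> vidx u \<le> vidx w) \<Longrightarrow> kmin J = u"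
  using kmin[of J] by (metis empty_iff vidx_eq_iff order_antisym)

text \<open>The contracting homotopy divides \<open>x\<^sup>\<alpha> e\<^sub>I\<close> by the least variable \<open>x\<^sub>u\<close> of
  \<open>supp \<alpha> \<union> I\<close> and multiplies by \<open>e\<^sub>u\<close>, provided that \<open>u \<notin> I\<close>; otherwise the result is
  \<open>0\<close>.\<close>

definition kcontract :: "('v::finite set \<Rightarrow> nat \<Rightarrow> ('v, 'k::field) mpoly) \<Rightarrow> 'v set \<Rightarrow> nat \<Rightarrow> ('v, 'k) mpoly" where
  "kcontract z J j = (if J = {} then 0 else
     rst {m. \<forall>w. vidx w < vidx (kmin J) \<longrightarrow> Poly_Mapping.lookup m w = 0}
       (Poly_Mapping.map_key ((+) (Poly_Mapping.single (kmin J) (Suc 0))) (z (J - {kmin J}) j)))"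

lemma lookup_kcontract:
  "J \<noteq> {} \<Longrightarrow> Poly_Mapping.lookup (kcontract z J j) m =
    (if \<forall>w. vidx w < vidx (kmin J) \<longrightarrow> Poly_Mapping.lookup m w = 0
     then Poly_Mapping.lookup (z (J - {kmin J}) j) (Poly_Mapping.single (kmin J) (Suc 0) + m) else 0)"
proof -
  have inj: "inj ((+) (Poly_Mapping.single v (Suc 0)) :: ('a \<Rightarrow>\<^sub>0 nat) \<Rightarrow> _)" for v by (auto simp: inj_on_def)
  show "J \<noteq> {} \<Longrightarrow> ?thesis" by (auto simp: kcontract_def map_key.rep_eq inj)
qed

lemma single_add_diff:
  "Poly_Mapping.lookup m v \<noteq> 0 \<Longrightarrow> Poly_Mapping.single v (Suc 0) + (m - Poly_Mapping.single v (Suc 0)) = (m :: 'v \<Rightarrow>\<^sub>0 nat)"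
  by (intro poly_mapping_eqI) (auto simp: lookup_add lookup_minus lookup_single when_def)

text \<open>The coefficient of x^m e_I is compared by means of the least variable u of supp m
  \<union> I. The monomial x^0 e_\<emptyset> has no such variable; it carries the only homology of
  the complex, and \<open>const\<close> excludes it.\<close>

theorem kdiff_kcontract:
  fixes z :: "'v::finite set \<Rightarrow> nat \<Rightarrow> ('v, 'k::field) mpoly"
  assumes dz: "\<And>I. kdiff z I = 0" and const: "\<And>j. Poly_Mapping.lookup (z {} j) 0 = 0"
  shows "kdiff (kcontract z) I = z I"
proof (intro ext poly_mapping_eqI)
  fix j and m :: "'v \<Rightarrow>\<^sub>0 nat"
  let ?e = "\<lambda>v. Poly_Mapping.single v (Suc 0) :: 'v \<Rightarrow>\<^sub>0 nat"
  define A where "A = {v. Poly_Mapping.lookup m v \<noteq> 0} \<union> I"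
  show "Poly_Mapping.lookup (kdiff (kcontract z) I j) m = Poly_Mapping.lookup (z I j) m"
  proof (cases "A = {}")
    case True
    then have "I = {}" "m = 0" by (auto simp: A_def intro!: poly_mapping_eqI)
    then show ?thesis by (simp add: lookup_kdiff const)
  next
    case False
    from ex_min_vidx[OF this] obtain u where u0: "u \<in> A" and u1: "\<forall>w\<in>A. vidx u \<le> vidx w" by (elim bexE)
    note u = u0 bspec[OF u1]
    have low: "Poly_Mapping.lookup m w = 0" if "vidx w < vidx u" for w
    proof -
      have "w \<notin> A" using u(2)[of w] that by auto
      then show ?thesis by (simp add: A_def)
    qed
    show ?thesis
    proof (cases "u \<in> I")
      case False
      then have mu: "Poly_Mapping.lookup m u \<noteq> 0" using u(1) by (auto simp: A_def)
      \<comment> \<open>Only v = u contributes. For any other v the least element of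
        \<open>insert v I\<close> exceeds u, while u still divides the remaining monomial, so that
        the contraction gives 0.\<close>
      have "(if Poly_Mapping.lookup m v = 0 then 0
         else ksgn v I * Poly_Mapping.lookup (kcontract z (insert v I) j) (m - ?e v)) =
         (if v = u then Poly_Mapping.lookup (z I j) m else 0)" if "v \<in> - I" for v
      proof (cases "Poly_Mapping.lookup m v = 0 \<or> v = u")
        case True
        have "kmin (insert u I) = u" using u(2) by (intro kmin_eqI) (auto simp: A_def)
        moreover have "ksgn u I = (1 :: 'k)" using u(2) by (intro ksgn_least) (auto simp: A_def)
        ultimately show ?thesis using True mu low False
          by (auto simp: lookup_kcontract lookup_minus single_add_diff)
      next
        case False
        let ?u = "kmin (insert v I)"
        have "?u \<in> insert v I" using kmin[of "insert v I"] by auto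
        moreover have "?u \<noteq> u" using \<open>?u \<in> insert v I\<close> False \<open>u \<notin> I\<close> by auto
        ultimately have "vidx u < vidx ?u"
          using u(2)[of ?u] False vidx_eq_iff[of u ?u] by (auto simp: A_def le_less)
        moreover have "Poly_Mapping.lookup (m - ?e v) u \<noteq> 0"
          using mu False by (simp add: lookup_minus lookup_single)
        ultimately have "Poly_Mapping.lookup (kcontract z (insert v I) j) (m - ?e v) = 0"
          by (auto simp: lookup_kcontract)
        then show ?thesis using False by simp
      qed
      then have "Poly_Mapping.lookup (kdiff (kcontract z) I j) m = (\<Sum>v\<in>- I. if v = u then Poly_Mapping.lookup (z I j) m else 0)"
        unfolding lookup_kdiff by (intro sum.cong) auto
      then show ?thesis using False by simp
    next
      case True
      let ?J = "I - {u}"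
      have kI: "kmin (insert v I) = u" if "v \<in> A" for v
        using u(2) that True by (intro kmin_eqI) (auto simp: A_def)
      \<comment> \<open>The cycle condition at \<open>I - {u}\<close> and the monomial x_u x^m has
        the wanted coefficient as its term for u. The other terms match those of the contraction,
        and u < v supplies the minus sign.\<close>
      have "0 = Poly_Mapping.lookup (kdiff z ?J j) (?e u + m)" by (simp add: dz)
      also have "\<dots> = (\<Sum>v\<in>- ?J. if Poly_Mapping.lookup (?e u + m) v = 0 then 0
         else ksgn v ?J * Poly_Mapping.lookup (z (insert v ?J) j) (?e u + m - ?e v))"
        by (rule lookup_kdiff)
      also have "- ?J = insert u (- I)" using True by auto
      also have "(\<Sum>v\<in>insert u (- I). if Poly_Mapping.lookup (?e u + m) v = 0 then 0
         else ksgn v ?J * Poly_Mapping.lookup (z (insert v ?J) j) (?e u + m - ?e v)) =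
         ksgn u ?J * Poly_Mapping.lookup (z (insert u ?J) j) m +
         (\<Sum>v\<in>- I. if Poly_Mapping.lookup (?e u + m) v = 0 then 0
         else ksgn v ?J * Poly_Mapping.lookup (z (insert v ?J) j) (?e u + m - ?e v))"
        using True by (subst sum.insert) (auto simp: lookup_add)
      also have "ksgn u ?J = (1 :: 'k)" using u(2) by (intro ksgn_least) (auto simp: A_def)
      also have "insert u ?J = I" using True by auto
      also have "(\<Sum>v\<in>- I. if Poly_Mapping.lookup (?e u + m) v = 0 then 0
         else ksgn v ?J * Poly_Mapping.lookup (z (insert v ?J) j) (?e u + m - ?e v)) =
        (\<Sum>v\<in>- I. - (if Poly_Mapping.lookup m v = 0 then 0
          else ksgn v I * Poly_Mapping.lookup (kcontract z (insert v I) j) (m - ?e v)))"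
      proof (rule sum.cong[OF refl])
        fix v assume v: "v \<in> - I"
        then have vu: "v \<noteq> u" using True by auto
        then have lv: "Poly_Mapping.lookup (?e u + m) v = Poly_Mapping.lookup m v"
          by (simp add: lookup_add lookup_single)
        show "(if Poly_Mapping.lookup (?e u + m) v = 0 then 0
         else ksgn v ?J * Poly_Mapping.lookup (z (insert v ?J) j) (?e u + m - ?e v)) =
          - (if Poly_Mapping.lookup m v = 0 then 0
          else ksgn v I * Poly_Mapping.lookup (kcontract z (insert v I) j) (m - ?e v))"
        proof (cases "Poly_Mapping.lookup m v = 0")
          case False
          then have "v \<in> A" by (auto simp: A_def)
          then have "vidx u < vidx v" using u(2)[of v] vu by (auto simp: le_less)
          then have "ksgn v I = - (ksgn v ?J :: 'k)"
            using ksgn_insert[of u ?J v] True vu by (simp add: insert_absorb)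
          moreover have "?e u + (m - ?e v) = ?e u + m - ?e v"
            using False vu by (intro poly_mapping_eqI) (auto simp: lookup_add lookup_minus lookup_single when_def)
          moreover have "insert v I - {u} = insert v ?J" using vu by auto
          ultimately show ?thesis using False lv kI[OF \<open>v \<in> A\<close>] low
            by (auto simp: lookup_kcontract lookup_minus)
        qed (simp add: lv)
      qed
      also have "\<dots> = - Poly_Mapping.lookup (kdiff (kcontract z) I j) m"
        unfolding lookup_kdiff by (simp add: sum_negf)
      finally show ?thesis by simp
    qed
  qed
qed

section \<open>Linearity of the minimal resolution\<close>

text \<open>The augmentation is eliminated: R is cyclic, so the free module of index 0 is S with its
  generator in degree 0, and the image of \<open>F 1\<close> is \<open>\<nn>\<^sup>n\<close>.
  Minimality appears as the absence of constant terms in the images.\<close>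

locale graded_resolution =
  fixes n :: nat and b :: "nat \<Rightarrow> nat" and a :: "nat \<Rightarrow> nat \<Rightarrow> int"
    and F :: "nat \<Rightarrow> (nat \<Rightarrow> ('v::finite, 'k::field) mpoly) \<Rightarrow> nat \<Rightarrow> ('v, 'k) mpoly"
  assumes n: "n \<ge> 1"
    and F_add: "F i (x + y) = F i x + F i y"
    and F_smul: "F i (smul r x) = smul r (F i x)"
    and F_free: "i \<ge> 1 \<Longrightarrow> F i x \<in> free (b (i - 1))"
    and F_graded: "i \<ge> 1 \<Longrightarrow> x \<in> coord_space {(j, m). j < b i \<and> int (mdeg m) + a i j = t} \<Longrightarrow>
      F i x \<in> coord_space {(j, m). j < b (i - 1) \<and> int (mdeg m) + a (i - 1) j = t}"
    and F_minimal: "i \<ge> 1 \<Longrightarrow> Poly_Mapping.lookup (F i x j) 0 = 0"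
    and b0: "b 0 = 1" and a0: "a 0 0 = 0"
    and exact1: "F 1 ` free (b 1) = free_ge 1 n"
    and exact: "i \<ge> 1 \<Longrightarrow> F (i + 1) ` free (b (i + 1)) = {x \<in> free (b i). F i x = 0}"
begin

definition gfree :: "nat \<Rightarrow> int \<Rightarrow> (nat \<Rightarrow> ('v, 'k) mpoly) set" where
  "gfree i t = coord_space {(j, m). j < b i \<and> int (mdeg m) + a i j = t}"

text \<open>The \<open>i\<close>-th syzygy module, for \<open>i \<ge> 1\<close>.\<close>

definition syz :: "nat \<Rightarrow> (nat \<Rightarrow> ('v, 'k) mpoly) set" where
  "syz i = F i ` free (b i)"

definition comp :: "nat \<Rightarrow> int \<Rightarrow> (nat \<Rightarrow> ('v, 'k) mpoly) \<Rightarrow> nat \<Rightarrow> ('v, 'k) mpoly" where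
  "comp i t x = (\<lambda>j. if j < b i then rst {m. int (mdeg m) + a i j = t} (x j) else 0)"

lemma F_0 [simp]: "F i 0 = 0"
  using F_smul[of i 0 0] by simp

lemma F_diff: "F i (x - y) = F i x - F i y"
  using F_add[of i "x - y" y] by simp

lemma F_sum:
  fixes f :: "'j \<Rightarrow> nat \<Rightarrow> ('v, 'k) mpoly"
  shows "F i (sum f I) = (\<Sum>j\<in>I. F i (f j))"
  by (rule infinite_finite_induct[of "\<lambda>I. F i (sum f I) = (\<Sum>j\<in>I. F i (f j))"]) (simp_all add: F_add)

lemma F_fscale: "F i (fscale k x) = fscale k (F i x)"
  using F_smul[of i "Poly_Mapping.single 0 k" x] by (simp add: smul_const_eq)

lemma linear_F: "Vector_Spaces.linear fscale fscale (F i)"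
  by (rule linear_fscaleI) (simp_all add: F_add F_fscale)

lemma gfree_free: "x \<in> gfree i t \<Longrightarrow> x \<in> free (b i)"
  by (fastforce simp: gfree_def coord_space_def free_def intro!: poly_mapping_eqI)

lemma gfree_zero [simp]: "0 \<in> gfree i t"
  and gfree_diff: "x \<in> gfree i t \<Longrightarrow> y \<in> gfree i t \<Longrightarrow> x - y \<in> gfree i t"
  and gfree_sum: "(\<And>s. s \<in> I \<Longrightarrow> f s \<in> gfree i t) \<Longrightarrow> sum f I \<in> gfree i t"
  unfolding gfree_def
  by (rule fs.subspace_0 fs.subspace_diff fs.subspace_sum, auto)+

lemma comp_gfree: "comp i t x \<in> gfree i t"
  by (auto simp: comp_def gfree_def coord_space_def split: if_splits)

lemma comp_id: "x \<in> gfree i t \<Longrightarrow> comp i s x = (if s = t then x else 0)"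
proof -
  assume x: "x \<in> gfree i t"
  have "Poly_Mapping.lookup (x j) m = 0" if "\<not> (j < b i \<and> int (mdeg m) + a i j = t)" for j m
    using x that unfolding gfree_def coord_space_def by blast
  then show ?thesis
    by (auto simp: comp_def fun_eq_iff intro!: poly_mapping_eqI)
qed

lemma comp_add: "comp i t (x + y) = comp i t x + comp i t y"
  by (auto simp: comp_def fun_eq_iff rst_add)

lemma comp_sum:
  fixes f :: "'j \<Rightarrow> nat \<Rightarrow> ('v, 'k) mpoly"
  shows "comp i t (sum f I) = (\<Sum>j\<in>I. comp i t (f j))"
proof -
  have 0: "comp i t 0 = 0" by (auto simp: comp_def fun_eq_iff)
  show ?thesis
    by (rule infinite_finite_induct[of "\<lambda>I. comp i t (sum f I) = (\<Sum>j\<in>I. comp i t (f j))"])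
      (simp_all add: comp_add 0)
qed

definition degs :: "nat \<Rightarrow> (nat \<Rightarrow> ('v, 'k) mpoly) \<Rightarrow> int set" where
  "degs i x = (\<Union>j\<in>{..<b i}. (\<lambda>m. int (mdeg m) + a i j) ` Poly_Mapping.keys (x j))"

lemma finite_degs [simp]: "finite (degs i x)"
  by (simp add: degs_def)

lemma sum_comp:
  assumes x: "x \<in> free (b i)" and D: "finite D" "degs i x \<subseteq> D"
  shows "(\<Sum>t\<in>D. comp i t x) = x"
proof (intro ext poly_mapping_eqI)
  fix j m
  have "Poly_Mapping.lookup ((\<Sum>t\<in>D. comp i t x) j) m =
     (\<Sum>t\<in>D. if t = int (mdeg m) + a i j then (if j < b i then Poly_Mapping.lookup (x j) m else 0) else 0)"
    unfolding sum_fun_apply lookup_sum by (intro sum.cong) (auto simp: comp_def)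
  also have "\<dots> = (if int (mdeg m) + a i j \<in> D \<and> j < b i then Poly_Mapping.lookup (x j) m else 0)"
    using D(1) by (simp add: sum.delta)
  also have "\<dots> = Poly_Mapping.lookup (x j) m"
  proof (cases "Poly_Mapping.lookup (x j) m = 0")
    case False
    then have "j < b i" using x by (auto simp: free_def not_less[symmetric])
    moreover from this have "int (mdeg m) + a i j \<in> degs i x"
      unfolding degs_def using False by (intro UN_I[of j] imageI) (auto simp: in_keys_iff)
    ultimately show ?thesis using D(2) by auto
  qed simp
  finally show "Poly_Mapping.lookup ((\<Sum>t\<in>D. comp i t x) j) m = Poly_Mapping.lookup (x j) m" .
qed

lemma F_gfree: "i \<ge> 1 \<Longrightarrow> x \<in> gfree i t \<Longrightarrow> F i x \<in> gfree (i - 1) t"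
  using F_graded unfolding gfree_def by blast

lemma F_comp:
  assumes "i \<ge> 1" "x \<in> free (b i)"
  shows "F i (comp i t x) = comp (i - 1) t (F i x)"
proof -
  \<comment> \<open>\<open>t\<close> is inserted because it need not occur among the degrees of
    \<open>x\<close>.\<close>
  let ?D = "insert t (degs i x)"
  have "comp (i - 1) t (F i x) = comp (i - 1) t (F i (\<Sum>s\<in>?D. comp i s x))"
    using sum_comp[OF assms(2), of ?D] by (simp add: subset_insertI)
  also have "\<dots> = (\<Sum>s\<in>?D. comp (i - 1) t (F i (comp i s x)))" by (simp only: F_sum comp_sum)
  also have "\<dots> = (\<Sum>s\<in>?D. if s = t then F i (comp i t x) else 0)"
    unfolding comp_id[OF F_gfree[OF assms(1) comp_gfree]] by (intro sum.cong refl) auto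
  also have "\<dots> = F i (comp i t x)" by (simp add: sum.delta)
  finally show ?thesis by simp
qed

lemma syz_free: "i \<ge> 1 \<Longrightarrow> x \<in> syz i \<Longrightarrow> x \<in> free (b (i - 1))"
  using F_free by (auto simp: syz_def)

lemma syz_zero [simp]: "0 \<in> syz i"
  and syz_add: "x \<in> syz i \<Longrightarrow> y \<in> syz i \<Longrightarrow> x + y \<in> syz i"
  and syz_smul: "x \<in> syz i \<Longrightarrow> smul r x \<in> syz i"
  and syz_fscale: "x \<in> syz i \<Longrightarrow> fscale k x \<in> syz i"
proof -
  show "0 \<in> syz i" unfolding syz_def using free_zero F_0 by (metis imageI)
  show "x \<in> syz i \<Longrightarrow> y \<in> syz i \<Longrightarrow> x + y \<in> syz i"
    unfolding syz_def by (auto simp: F_add[symmetric] intro!: imageI free_add)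
  show "x \<in> syz i \<Longrightarrow> smul r x \<in> syz i"
    unfolding syz_def by (auto simp: F_smul[symmetric] intro!: imageI free_smul)
  show "x \<in> syz i \<Longrightarrow> fscale k x \<in> syz i"
    unfolding syz_def by (auto simp: F_fscale[symmetric] intro!: imageI free_fscale)
qed

lemma subspace_syz: "fs.subspace (syz i)"
  by (rule fs.subspaceI) (auto intro: syz_add syz_fscale)

lemma syz_Suc: "i \<ge> 1 \<Longrightarrow> syz (Suc i) = {x \<in> free (b i). F i x = 0}"
  using exact[of i] by (simp add: syz_def)

lemma syz_1: "syz 1 = free_ge 1 n"
  using exact1 by (simp add: syz_def)

lemma syz_no_constant: "i \<ge> 1 \<Longrightarrow> x \<in> syz i \<Longrightarrow> Poly_Mapping.lookup (x j) 0 = 0"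
  using F_minimal by (auto simp: syz_def)

text \<open>Any preimage serves after passing to its component of degree \<open>t\<close>, since the
  differential preserves degrees.\<close>

lemma graded_lift:
  assumes "i \<ge> 1" "y \<in> syz i" "y \<in> gfree (i - 1) t"
  obtains x where "x \<in> gfree i t" "F i x = y"
proof -
  obtain x where x: "x \<in> free (b i)" "y = F i x" using assms(2) by (auto simp: syz_def)
  have "F i (comp i t x) = y" using F_comp[OF assms(1) x(1)] comp_id[OF assms(3)] x(2) by simp
  then show ?thesis using that comp_gfree by blast
qed

lemma F_kdiff: "F i (kdiff z I) = kdiff (\<lambda>J. F i (z J)) I"
  unfolding kdiff_def by (simp only: F_sum F_smul)

text \<open>Degrees are those of the coefficients, with e_J not counted; hence the contraction
  lowers them by one and the differential raises them by one.\<close>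

lemma kcontract_gfree:
  assumes "\<And>J. z J \<in> gfree i t"
  shows "kcontract z J \<in> gfree i (t - 1)"
proof (cases "J = {}")
  case True
  then have "kcontract z J = 0" by (auto simp: kcontract_def fun_eq_iff)
  then show ?thesis by simp
next
  case False
  show ?thesis unfolding gfree_def coord_space_def
  proof (clarify, goal_cases)
    case (1 j m)
    then have "Poly_Mapping.lookup (z (J - {kmin J}) j) (Poly_Mapping.single (kmin J) (Suc 0) + m) \<noteq> 0"
      using False by (simp add: lookup_kcontract split: if_splits)
    then have "(j, Poly_Mapping.single (kmin J) (Suc 0) + m) \<in> {(j, m). j < b i \<and> int (mdeg m) + a i j = t}"
      using assms[of "J - {kmin J}"] unfolding gfree_def coord_space_def by blast
    then show ?case by auto
  qed
qed

lemma smul_kpoly_gfree: "x \<in> gfree i t \<Longrightarrow> smul (kpoly v I) x \<in> gfree i (t + 1)"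
proof -
  assume x: "x \<in> gfree i t"
  show ?thesis unfolding gfree_def coord_space_def
  proof (clarify, goal_cases)
    case (1 j m)
    then have *: "Poly_Mapping.lookup m v \<noteq> 0" "Poly_Mapping.lookup (x j) (m - Poly_Mapping.single v (Suc 0)) \<noteq> 0"
      by (auto simp: smul_def lookup_kpoly_mult split: if_splits)
    then have "(j, m - Poly_Mapping.single v (Suc 0)) \<in> {(j, m). j < b i \<and> int (mdeg m) + a i j = t}"
      using x unfolding gfree_def coord_space_def by blast
    moreover have "mdeg m = Suc (mdeg (m - Poly_Mapping.single v (Suc 0)))"
      using arg_cong[OF single_add_diff[OF *(1)], of mdeg] by simp
    ultimately show ?case by auto
  qed
qed

lemma kdiff_gfree: "(\<And>J. z J \<in> gfree i t) \<Longrightarrow> kdiff z I \<in> gfree i (t + 1)"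
  unfolding kdiff_def by (intro gfree_sum smul_kpoly_gfree) auto

text \<open>The Koszul homology of the \<open>i\<close>-th syzygy module vanishes in all coefficient degrees from
  \<open>n + i\<close> on.  For \<open>i = 1\<close> this is seen in \<open>S\<close>; a cycle over the next syzygy module is
  pushed down and lifted back, using that its entries lie in \<open>\<nn> F\<^sub>i\<close>.\<close>

theorem koszul_syz:
  assumes "i \<ge> 1" "t \<ge> int (n + i)"
    and "\<And>I. z I \<in> syz i" "\<And>I. z I \<in> gfree (i - 1) t" "\<And>I. kdiff z I = 0"
  shows "\<exists>y. (\<forall>I. y I \<in> syz i \<and> y I \<in> gfree (i - 1) (t - 1)) \<and> (\<forall>I. kdiff y I = z I)"
  using assms
proof (induction i arbitrary: t z rule: nat_induct_at_least)
  case base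
  let ?y = "kcontract z"
  have y: "?y I \<in> gfree 0 (t - 1)" for I
    using base.prems(3) by (intro kcontract_gfree) simp
  have "kdiff ?y I = z I" for I
    using base.prems syz_no_constant[of 1] by (intro kdiff_kcontract) auto
  moreover have "?y I \<in> syz 1" for I
  proof -
    have "?y I \<in> free 1" using gfree_free[OF y[of I]] b0 by simp
    \<comment> \<open>Here t - 1 \<ge> n, so the contraction is still in
      \<open>\<nn>\<^sup>n\<close>; this is where the bound on \<open>t\<close> originates.\<close>
    moreover have "Poly_Mapping.lookup (?y I j) m = 0" if "mdeg m < n" for j m
    proof (rule ccontr)
      assume "Poly_Mapping.lookup (?y I j) m \<noteq> 0"
      then have "(j, m) \<in> {(j, m). j < b 0 \<and> int (mdeg m) + a 0 j = t - 1}"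
        using y[of I] unfolding gfree_def coord_space_def by blast
      then show False using that a0 b0 base.prems(1) by auto
    qed
    ultimately show ?thesis unfolding syz_1 free_ge_def by (auto intro: ideal_geI)
  qed
  ultimately show ?case using y by (intro exI[of _ ?y]) simp
next
  case (Suc i)
  let ?y = "kcontract z"
  have y: "?y I \<in> gfree i (t - 1)" for I
    using Suc.prems(3) by (intro kcontract_gfree) simp
  have dy: "kdiff ?y I = z I" for I
    using Suc.prems syz_no_constant[of "Suc i"] by (intro kdiff_kcontract) auto
  let ?w = "\<lambda>I. F i (?y I)"
  \<comment> \<open>The contraction taken in the free module need not consist of syzygies. Its image
    under \<open>F i\<close> is a cycle over \<open>syz i\<close>, because \<open>z\<close> is
    killed by \<open>F i\<close>, and the bound on the degree drops by one just as the index
    does.\<close>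
  have "\<exists>u. (\<forall>I. u I \<in> syz i \<and> u I \<in> gfree (i - 1) (t - 1 - 1)) \<and> (\<forall>I. kdiff u I = ?w I)"
  proof (rule Suc.IH)
    show "?w I \<in> syz i" for I unfolding syz_def using gfree_free[OF y] by (rule imageI)
    show "?w I \<in> gfree (i - 1) (t - 1)" for I by (rule F_gfree[OF Suc.hyps y])
    have "kdiff ?w I = F i (z I)" for I using F_kdiff[of i ?y I] dy by simp
    then show "kdiff ?w I = 0" for I using Suc.prems(2) syz_Suc[OF Suc.hyps] by auto
  qed (use Suc.prems(1) in simp)
  then obtain u where u: "\<And>I. u I \<in> syz i" "\<And>I. u I \<in> gfree (i - 1) (t - 2)" "\<And>I. kdiff u I = ?w I"
    by auto
  have "\<exists>x. x \<in> gfree i (t - 2) \<and> F i x = u I" for I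
    by (rule graded_lift[OF Suc.hyps u(1) u(2)]) blast
  then have "\<exists>v. \<forall>I. v I \<in> gfree i (t - 2) \<and> F i (v I) = u I" by (intro choice allI)
  then obtain v where v: "\<And>I. v I \<in> gfree i (t - 2)" "\<And>I. F i (v I) = u I" by blast
  \<comment> \<open>Subtracting the boundary of \<open>v\<close> cancels the image under
    \<open>F i\<close>, and it does not change the Koszul boundary.\<close>
  let ?x = "\<lambda>I. ?y I - kdiff v I"
  have "kdiff v I \<in> gfree i (t - 2 + 1)" for I by (rule kdiff_gfree[OF v(1)])
  then have dv: "kdiff v I \<in> gfree i (t - 1)" for I by simp
  have x: "?x I \<in> gfree i (t - 1)" for I by (rule gfree_diff[OF y dv])
  have "F i (?x I) = 0" for I by (simp add: F_diff F_kdiff v(2) u(3))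
  then have xs: "?x I \<in> syz (Suc i)" for I
    unfolding syz_Suc[OF Suc.hyps] using gfree_free[OF x] by simp
  have dx: "kdiff ?x I = z I" for I
  proof -
    have "kdiff ?x I = kdiff ?y I - kdiff (kdiff v) I" by (rule kdiff_diff)
    then show ?thesis by (simp only: dy kdiff_kdiff diff_zero)
  qed
  show ?case
    unfolding diff_Suc_1 by (rule exI[of _ ?x]) (intro conjI allI x xs dx)
qed

section \<open>Degrees of the generators of the syzygies\<close>

definition unit_vec :: "nat \<Rightarrow> nat \<Rightarrow> ('v, 'k) mpoly" where
  "unit_vec j = (\<lambda>i. if i = j then 1 else 0)"

lemma lookup_unit_vec: "Poly_Mapping.lookup (unit_vec j i) m = (if i = j \<and> m = 0 then 1 else 0)"
  by (simp add: unit_vec_def lookup_one when_def)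

lemma unit_vec_gfree: "j < b i \<Longrightarrow> unit_vec j \<in> gfree i (a i j)"
  by (auto simp: gfree_def coord_space_def lookup_unit_vec)

text \<open>Otherwise a basis vector would be a syzygy with a constant entry, against
  minimality.\<close>

lemma F_unit_vec_nonzero:
  assumes "i \<ge> 1" "j < b i"
  shows "F i (unit_vec j) \<noteq> 0"
proof
  assume "F i (unit_vec j) = 0"
  then have "unit_vec j \<in> syz (Suc i)"
    unfolding syz_Suc[OF assms(1)] using gfree_free[OF unit_vec_gfree[OF assms(2)]] by simp
  from syz_no_constant[OF _ this, of j] show False by (simp add: lookup_unit_vec)
qed

lemma F_unit_vec_syz: "j < b i \<Longrightarrow> F i (unit_vec j) \<in> syz i"
  unfolding syz_def using gfree_free[OF unit_vec_gfree] by (intro imageI) auto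

text \<open>Every step raises the least degree by at least one: the entries of a syzygy lie in
  \<nn>, and the basis vectors they multiply have degree at least that of the previous
  syzygies.\<close>

lemma syz_low_degree:
  assumes "i \<ge> 1" "x \<in> syz i" "x \<in> gfree (i - 1) t" "t < int (n + i) - 1"
  shows "x = 0"
  using assms
proof (induction i arbitrary: t x rule: nat_induct_at_least)
  case base
  have "Poly_Mapping.lookup (x j) m = 0" for j m
  proof (rule ccontr)
    assume "Poly_Mapping.lookup (x j) m \<noteq> 0"
    moreover from this have "(j, m) \<in> {(j, m). j < b 0 \<and> int (mdeg m) + a 0 j = t}"
      using base.prems(2) unfolding gfree_def coord_space_def by auto
    ultimately show False
      using base.prems(1,3) a0 b0 ideal_geD[of "x j" n m] by (auto simp: syz_1[unfolded One_nat_def] free_ge_def)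
  qed
  then show ?case by (auto simp: fun_eq_iff intro!: poly_mapping_eqI)
next
  case (Suc i)
  have "Poly_Mapping.lookup (x j) m = 0" for j m
  proof (rule ccontr)
    assume nz: "Poly_Mapping.lookup (x j) m \<noteq> 0"
    moreover from this have jm: "(j, m) \<in> {(j, m). j < b i \<and> int (mdeg m) + a i j = t}"
      using Suc.prems(2) unfolding gfree_def coord_space_def by auto
    moreover have "m \<noteq> 0" using syz_no_constant[OF _ Suc.prems(1), of j] nz by auto
    then have "mdeg m \<ge> 1" by (metis mdeg_eq_0_iff less_one not_le)
    moreover have "a i j \<ge> int (n + i) - 1"
    proof (rule ccontr)
      assume "\<not> a i j \<ge> int (n + i) - 1"
      \<comment> \<open>A basis vector of too small a degree would have its image among the syzygies
        already shown to vanish.\<close>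
      then have "F i (unit_vec j) = 0"
        using jm by (intro Suc.IH[OF F_unit_vec_syz F_gfree[OF Suc.hyps unit_vec_gfree]]) auto
      then show False using F_unit_vec_nonzero[OF Suc.hyps] jm by auto
    qed
    ultimately show False using Suc.prems(3) by auto
  qed
  then show ?case by (auto simp: fun_eq_iff intro!: poly_mapping_eqI)
qed

text \<open>The lower bound is \<open>syz_low_degree\<close>. A generator of larger degree would be
  a Koszul boundary by \<open>koszul_syz\<close>, so it would lie in \<nn> times the syzygy module,
  against minimality.\<close>

theorem linear_resolution:
  assumes i: "i \<ge> 1" and j: "j < b i"
  shows "a i j = int (n + i) - 1"
proof (rule antisym)
  have Fe: "F i (unit_vec j) \<in> syz i" "F i (unit_vec j) \<in> gfree (i - 1) (a i j)"
    by (rule F_unit_vec_syz[OF j], rule F_gfree[OF i unit_vec_gfree[OF j]])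
  show "int (n + i) - 1 \<le> a i j"
  proof (rule ccontr)
    assume "\<not> ?thesis"
    then show False using syz_low_degree[OF i Fe] F_unit_vec_nonzero[OF i j] by auto
  qed
  show "a i j \<le> int (n + i) - 1"
  proof (rule ccontr)
    assume less: "\<not> a i j \<le> int (n + i) - 1"
    \<comment> \<open>The generator is placed at the empty index set; it is a cycle because
      \<open>kdiff\<close> only reads nonempty ones.\<close>
    define z where "z = (\<lambda>I :: 'v set. if I = {} then F i (unit_vec j) else 0)"
    have dz: "kdiff z I = 0" for I
      unfolding kdiff_def by (simp add: z_def)
    have "\<exists>y. (\<forall>I. y I \<in> syz i \<and> y I \<in> gfree (i - 1) (a i j - 1)) \<and> (\<forall>I. kdiff y I = z I)"
      using less Fe by (intro koszul_syz i dz) (auto simp: z_def)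
    then obtain y where y: "\<And>I. y I \<in> syz i" "\<And>I. kdiff y I = z I" by blast
    have "\<exists>w. w \<in> free (b i) \<and> F i w = y {v}" for v using y(1)[of "{v}"] by (auto simp: syz_def)
    then have "\<exists>w. \<forall>v. w v \<in> free (b i) \<and> F i (w v) = y {v}" by (intro choice allI)
    then obtain w where w: "\<And>v. w v \<in> free (b i)" "\<And>v. F i (w v) = y {v}" by blast
    \<comment> \<open>The boundary at the empty set writes the generator through x_v times syzygies;
      lifted, it gives a relation with constant term 1 in coordinate \<open>j\<close>.\<close>
    let ?s = "\<Sum>v\<in>UNIV. smul (kpoly v {}) (w v)"
    have "F i ?s = kdiff y {}" by (simp add: kdiff_def F_sum F_smul w)
    also have "\<dots> = F i (unit_vec j)" by (simp add: y z_def)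
    finally have "F i (unit_vec j - ?s) = 0" by (simp add: F_diff)
    moreover have "unit_vec j - ?s \<in> free (b i)"
      by (intro free_diff free_sum free_smul w gfree_free[OF unit_vec_gfree[OF j]])
    ultimately have "unit_vec j - ?s \<in> syz (Suc i)" by (simp add: syz_Suc[OF i])
    from syz_no_constant[OF _ this, of j]
    have "Poly_Mapping.lookup (unit_vec j j) 0 - Poly_Mapping.lookup (?s j) 0 = 0" by (simp add: lookup_minus)
    moreover have "Poly_Mapping.lookup (?s j) 0 = 0"
      unfolding sum_fun_apply lookup_sum by (simp add: smul_def lookup_kpoly_mult)
    ultimately show False by (simp add: lookup_unit_vec)
  qed
qed

end

section \<open>Hilbert function of the syzygies\<close>

lemma nth_one_minus_X_power: "fps_nth ((1 - fps_X) ^ d :: int fps) i = (- 1) ^ i * int (d choose i)"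
proof (induction d arbitrary: i)
  case 0
  show ?case by (cases i) auto
next
  case (Suc d)
  have "fps_nth ((1 - fps_X) ^ Suc d :: int fps) i =
      fps_nth ((1 - fps_X) ^ d) i - (if i = 0 then 0 else fps_nth ((1 - fps_X) ^ d) (i - 1))"
    by (simp add: left_diff_distrib)
  also have "\<dots> = (- 1) ^ i * int (Suc d choose i)"
    by (cases i) (simp_all add: Suc algebra_simps)
  finally show ?case .
qed

text \<open>The numbers \<open>X i e\<close> play the role of \<open>dim (Syz\<^sub>i)\<close> in degree \<open>n + i - 1 + e\<close>.  Multiplying
  their generating function by \<open>(1 - Z)\<^sup>d\<close> turns the recursion into a shift, so that for
  \<open>i = d - 1\<close> only the two top coefficients of \<open>(1 - Z)\<^sup>d (\<Sum>j<n. h j Z\<^sup>j)\<close> are left.\<close>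

lemma hilbert_recursion:
  fixes X :: "nat \<Rightarrow> nat \<Rightarrow> int"
  defines "h \<equiv> hilb TYPE('v::finite)" and "d \<equiv> CARD('v)"
  assumes d: "d \<ge> 2" and n: "n \<ge> 2"
    and X1: "\<And>e. X 1 e = int (h (n + e))"
    and XS: "\<And>i e. i \<ge> 1 \<Longrightarrow> X (Suc i) e = X i 0 * int (h (Suc e)) - X i (Suc e)"
  shows "X (d - 1) e = (int d * int (h (n - 1)) - int (h (n - 2))) * int (h e)
      - int (h (n - 1)) * (if e = 0 then 0 else int (h (e - 1)))"
proof -
  define H where "H = Abs_fps (\<lambda>j. int (h j))"
  define Q where "Q = ((1 - fps_X) ^ d :: int fps)"
  define p where "p i = Q * Abs_fps (X i)" for i
  define P where "P = Q * Abs_fps (\<lambda>j. if j < n then int (h j) else 0)"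
  have QH: "Q * H = 1"
    using fps_hnum[of "UNIV :: 'v set"] by (simp add: Q_def H_def h_def d_def)
  have h0: "h 0 = 1" by (simp add: h_def)
  \<comment> \<open>As \<open>Q * H = 1\<close>, the free module contributes only a constant, which
    disappears when coefficients at \<open>Suc e\<close> are compared.\<close>
  have shift: "fps_nth (p (Suc i)) e = - fps_nth (p i) (Suc e)" if "i \<ge> 1" for i e
  proof -
    have "fps_X * Abs_fps (X (Suc i)) = fps_const (X i 0) * H - Abs_fps (X i)"
    proof (rule fps_ext)
      fix k
      show "fps_nth (fps_X * Abs_fps (X (Suc i))) k = fps_nth (fps_const (X i 0) * H - Abs_fps (X i)) k"
        by (cases k) (simp_all add: H_def h0 XS[OF that])
    qed
    from arg_cong[OF this, of "\<lambda>f. Q * f"]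
    have "Q * (fps_X * Abs_fps (X (Suc i))) = fps_const (X i 0) * (Q * H) - p i"
      by (simp add: p_def right_diff_distrib mult.left_commute)
    then have "fps_X * p (Suc i) = fps_const (X i 0) - p i"
      by (simp add: QH p_def mult.left_commute)
    from arg_cong[OF this, of "\<lambda>f. fps_nth f (Suc e)"] show ?thesis by simp
  qed
  have p: "fps_nth (p (Suc i)) e = (- 1) ^ i * fps_nth (p 1) (e + i)" for i e
    by (induction i arbitrary: e) (simp_all add: shift)
  \<comment> \<open>The series H is its part below n plus X^n times the series of
    \<open>X 1\<close>; multiplied by \<open>Q\<close> the sum is 1, which has no coefficients from
    n on.\<close>
  have p1: "fps_nth (p 1) e = - fps_nth P (n + e)" for e
  proof -
    have "fps_X ^ n * Abs_fps (X 1) + Abs_fps (\<lambda>j. if j < n then int (h j) else 0) = H"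
      by (rule fps_ext) (auto simp: H_def X1[unfolded One_nat_def] fps_X_power_mult_nth)
    then have "Q * (fps_X ^ n * Abs_fps (X 1)) + P = 1"
      unfolding P_def by (simp add: QH distrib_left[symmetric])
    then have "fps_X ^ n * p 1 + P = 1" by (simp add: p_def mult.left_commute)
    from arg_cong[OF this, of "\<lambda>f. fps_nth f (n + e)"] show ?thesis
      using n by (simp add: fps_X_power_mult_nth)
  qed
  have Pnth: "fps_nth P m = (\<Sum>i\<in>{i. i \<le> d \<and> i \<le> m \<and> m - i < n}. (- 1) ^ i * int (d choose i) * int (h (m - i)))" for m
  proof -
    have "fps_nth P m = (\<Sum>i=0..m. (- 1) ^ i * int (d choose i) * (if m - i < n then int (h (m - i)) else 0))"
      by (simp add: P_def fps_mult_nth Q_def nth_one_minus_X_power)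
    also have "\<dots> = (\<Sum>i\<in>{i. i \<le> d \<and> i \<le> m \<and> m - i < n}. (- 1) ^ i * int (d choose i) * (if m - i < n then int (h (m - i)) else 0))"
      by (rule sum.mono_neutral_right) auto
    also have "\<dots> = (\<Sum>i\<in>{i. i \<le> d \<and> i \<le> m \<and> m - i < n}. (- 1) ^ i * int (d choose i) * int (h (m - i)))"
      by (rule sum.cong) auto
    finally show ?thesis .
  qed
  obtain d' where d': "d = Suc (Suc d')" using d by (metis Suc_le_D numeral_2_eq_2 Suc_le_mono)
  obtain n' where n': "n = Suc (Suc n')" using n by (metis Suc_le_D numeral_2_eq_2 Suc_le_mono)
  \<comment> \<open>After d - 2 shifts, coefficient e of \<open>p (d - 1)\<close> is, up to sign,
    coefficient n + e + d - 2 of \<open>P\<close>. Since \<open>P\<close> has degree n + d - 1, only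
    e = 0 and e = 1 survive.\<close>
  have pe: "fps_nth (p (d - 1)) e = (if e = 0 then int d * int (h (n - 1)) - int (h (n - 2)) else
      if e = 1 then - int (h (n - 1)) else 0)" for e
  proof -
    have pP: "fps_nth (p (d - 1)) e = - ((- 1) ^ d') * fps_nth P (n + (e + d'))"
      using p[of d' e] by (simp add: d' p1[unfolded One_nat_def])
    consider "e = 0" | "e = 1" | "e \<ge> 2" by linarith
    then show ?thesis
    proof cases
      case 1
      have S: "{i. i \<le> d \<and> i \<le> n + (0 + d') \<and> n + (0 + d') - i < n} = {Suc d', Suc (Suc d')}"
        using n by (auto simp: d')
      show ?thesis unfolding pP unfolding 1 Pnth S
        by (simp add: d' n' algebra_simps flip: power_add)
    next
      case 2
      have S: "{i. i \<le> d \<and> i \<le> n + (1 + d') \<and> n + (1 + d') - i < n} = {Suc (Suc d')}"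
        using n by (auto simp: d')
      show ?thesis unfolding pP unfolding 2 Pnth S
        by (simp add: d' n' algebra_simps flip: power_add)
    next
      case 3
      then have S: "{i. i \<le> d \<and> i \<le> n + (e + d') \<and> n + (e + d') - i < n} = {}"
        by (auto simp: d')
      show ?thesis unfolding pP Pnth S using 3 by simp
    qed
  qed
  have "p (d - 1) = fps_const (int d * int (h (n - 1)) - int (h (n - 2))) - fps_const (int (h (n - 1))) * fps_X"
    by (rule fps_ext) (auto simp: pe simp del: One_nat_def)
  moreover have "Abs_fps (X (d - 1)) = p (d - 1) * H"
    using QH by (simp add: p_def mult.commute mult.left_commute)
  ultimately have "Abs_fps (X (d - 1)) =
      (fps_const (int d * int (h (n - 1)) - int (h (n - 2))) - fps_const (int (h (n - 1))) * fps_X) * H"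
    by simp
  from arg_cong[OF this, of "\<lambda>f. fps_nth f e"] show ?thesis
    by (simp add: H_def left_diff_distrib mult.assoc)
qed

section \<open>Dimensions of graded and filtered pieces of the syzygies\<close>

context graded_resolution
begin

lemma finite_low_monomials: "finite {(j, m :: 'v \<Rightarrow>\<^sub>0 nat). j < b i \<and> int (mdeg m) + a i j \<le> t}"
proof (rule finite_subset)
  show "{(j, m :: 'v \<Rightarrow>\<^sub>0 nat). j < b i \<and> int (mdeg m) + a i j \<le> t} \<subseteq>
      (SIGMA j:{..<b i}. {m. mdeg m \<le> nat (t - a i j)})"
    by auto
qed auto

lemma fd_gfree: "fs.fd (gfree i t)"
  unfolding gfree_def by (intro dim_coord_space finite_subset[OF _ finite_low_monomials[of i t]]) auto

lemma subspace_gfree: "fs.subspace (gfree i t)"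
  by (simp add: gfree_def)

text \<open>The degree is normalised so that \<open>e = 0\<close> is the degree of the
  generators.\<close>

definition sdim :: "nat \<Rightarrow> nat \<Rightarrow> nat" where
  "sdim i e = fs.dim (syz i \<inter> gfree (i - 1) (int (n + i) - 1 + int e))"

lemma dim_gfree:
  assumes "i \<ge> 1"
  shows "fs.dim (gfree i (int (n + i) - 1 + int e)) = b i * hilb TYPE('v) e"
proof -
  have "{(j, m :: 'v \<Rightarrow>\<^sub>0 nat). j < b i \<and> int (mdeg m) + a i j = int (n + i) - 1 + int e} =
      {..<b i} \<times> {m. mdeg m = e}"
    using linear_resolution[OF assms] by auto
  then show ?thesis by (simp add: gfree_def dim_coord_space card_cartesian_product card_mdeg_eq)
qed

lemma dim_gfree_syz:
  assumes i: "i \<ge> 1"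
  shows "fs.dim (gfree i t) = fs.dim (syz (Suc i) \<inter> gfree i t) + fs.dim (syz i \<inter> gfree (i - 1) t)"
proof -
  have "fs.dim (gfree i t) = fs.dim {x \<in> gfree i t. F i x = 0} + fs.dim (F i ` gfree i t)"
    by (rule fp.rank_nullity_fd[OF linear_F subspace_gfree fd_gfree])
  also have "{x \<in> gfree i t. F i x = 0} = syz (Suc i) \<inter> gfree i t"
    using gfree_free by (auto simp: syz_Suc[OF i])
  also have "F i ` gfree i t = syz i \<inter> gfree (i - 1) t"
  proof (intro equalityI subsetI)
    fix y assume "y \<in> F i ` gfree i t"
    then show "y \<in> syz i \<inter> gfree (i - 1) t"
      using F_gfree[OF i] gfree_free by (auto simp: syz_def)
  next
    fix y assume "y \<in> syz i \<inter> gfree (i - 1) t"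
    then obtain x where "x \<in> gfree i t" "F i x = y" using graded_lift[OF i] by blast
    then show "y \<in> F i ` gfree i t" by blast
  qed
  finally show ?thesis .
qed

lemma sdim_0: assumes i: "i \<ge> 1" shows "sdim i 0 = b i"
proof -
  have "syz (Suc i) \<inter> gfree i (int (n + i) - 1) = {0}"
    using syz_low_degree[of "Suc i" _ "int (n + i) - 1"] by auto
  then show ?thesis
    using dim_gfree_syz[OF i, of "int (n + i) - 1"] dim_gfree[OF i, of 0] by (simp add: sdim_def)
qed

lemma sdim_Suc: assumes i: "i \<ge> 1" shows "sdim (Suc i) e + sdim i (Suc e) = b i * hilb TYPE('v) (Suc e)"
proof -
  \<comment> \<open>The generating degree rises by one from \<open>i\<close> to
    \<open>Suc i\<close>, so position \<open>e\<close> there is position \<open>Suc e\<close>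
    here.\<close>
  have "int (n + Suc i) - 1 + int e = int (n + i) - 1 + int (Suc e)" by simp
  then show ?thesis
    using dim_gfree_syz[OF i, of "int (n + i) - 1 + int (Suc e)"] dim_gfree[OF i, of "Suc e"]
    unfolding sdim_def diff_Suc_1 by presburger
qed

lemma sdim_1: "sdim 1 e = hilb TYPE('v) (n + e)"
proof -
  have "syz 1 \<inter> gfree 0 (int (n + e)) = coord_space ({0} \<times> {m. mdeg m = n + e})"
  proof (intro equalityI subsetI)
    fix x assume "x \<in> syz 1 \<inter> gfree 0 (int (n + e))"
    then show "x \<in> coord_space ({0} \<times> {m. mdeg m = n + e})"
      using b0 a0 unfolding gfree_def coord_space_def by fastforce
  next
    fix x :: "nat \<Rightarrow> ('v, 'k) mpoly" assume x: "x \<in> coord_space ({0} \<times> {m. mdeg m = n + e})"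
    have g: "x \<in> gfree 0 (int (n + e))"
      using x b0 a0 unfolding gfree_def coord_space_def by fastforce
    moreover have "x j \<in> ideal_ge n" for j
    proof (rule ideal_geI, rule ccontr)
      fix m :: "'v \<Rightarrow>\<^sub>0 nat" assume "mdeg m < n" "Poly_Mapping.lookup (x j) m \<noteq> 0"
      then have "(j, m) \<in> {0} \<times> {m. mdeg m = n + e}" using x unfolding coord_space_def by blast
      then show False using \<open>mdeg m < n\<close> by simp
    qed
    ultimately show "x \<in> syz 1 \<inter> gfree 0 (int (n + e))"
      unfolding syz_1 free_ge_def using gfree_free[OF g] b0 by simp
  qed
  then show ?thesis
    by (simp add: sdim_def dim_coord_space card_cartesian_product card_mdeg_eq)
qed

text \<open>A filtration instead of single degrees, because the independent families and the
  denominators in the rank argument are not homogeneous.\<close>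

definition flt :: "nat \<Rightarrow> int \<Rightarrow> (nat \<Rightarrow> ('v, 'k) mpoly) set" where
  "flt i t = coord_space {(j, m). j < b i \<and> int (mdeg m) + a i j \<le> t}"

lemma fd_flt: "fs.fd (flt i t)"
  unfolding flt_def by (intro dim_coord_space finite_low_monomials)

lemma subspace_flt: "fs.subspace (flt i t)"
  by (simp add: flt_def)

lemma degs_flt: "x \<in> flt i t \<Longrightarrow> s \<in> degs i x \<Longrightarrow> s \<le> t"
  unfolding flt_def coord_space_def degs_def by (auto simp: in_keys_iff)

lemma gfree_flt: "gfree i t \<subseteq> flt i t"
  unfolding gfree_def flt_def by (rule coord_space_mono) auto

lemma flt_mono: "s \<le> t \<Longrightarrow> flt i s \<subseteq> flt i t"
  unfolding flt_def by (rule coord_space_mono) auto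

lemma comp_syz: "i \<ge> 1 \<Longrightarrow> x \<in> syz i \<Longrightarrow> comp (i - 1) t x \<in> syz i"
  unfolding syz_def using F_comp[symmetric] gfree_free[OF comp_gfree] by blast

lemma linear_comp: "Vector_Spaces.linear fscale fscale (comp i t)"
  by (rule linear_fscaleI) (auto simp: comp_add, auto simp: comp_def fscale_def fun_eq_iff rst_const_mult)

text \<open>Taking the component of degree \<open>t\<close> has the previous filtration step as its
  kernel, and it maps onto the graded piece because the syzygy module contains the components of its
  elements.\<close>

lemma dim_syz_flt_step:
  assumes i: "i \<ge> 1"
  shows "fs.dim (syz i \<inter> flt (i - 1) t) = fs.dim (syz i \<inter> flt (i - 1) (t - 1)) + fs.dim (syz i \<inter> gfree (i - 1) t)"
proof -
  let ?V = "syz i \<inter> flt (i - 1) t"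
  have "fs.dim ?V = fs.dim {x \<in> ?V. comp (i - 1) t x = 0} + fs.dim (comp (i - 1) t ` ?V)"
    by (rule fp.rank_nullity_fd[OF linear_comp fs.subspace_inter[OF subspace_syz subspace_flt]
          fs.fd_subset[OF fd_flt]]) auto
  also have "{x \<in> ?V. comp (i - 1) t x = 0} = syz i \<inter> flt (i - 1) (t - 1)"
  proof (intro equalityI subsetI)
    fix x assume x: "x \<in> {x \<in> ?V. comp (i - 1) t x = 0}"
    have "(j, m) \<in> {(j, m). j < b (i - 1) \<and> int (mdeg m) + a (i - 1) j \<le> t - 1}"
      if nz: "Poly_Mapping.lookup (x j) m \<noteq> 0" for j m
    proof -
      have "(j, m) \<in> {(j, m). j < b (i - 1) \<and> int (mdeg m) + a (i - 1) j \<le> t}"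
        using x nz unfolding flt_def coord_space_def by blast
      moreover have "int (mdeg m) + a (i - 1) j \<noteq> t"
      proof
        assume eq: "int (mdeg m) + a (i - 1) j = t"
        have "Poly_Mapping.lookup (comp (i - 1) t x j) m = 0" using x by simp
        then show False using eq nz calculation by (simp add: comp_def)
      qed
      ultimately show ?thesis by auto
    qed
    then show "x \<in> syz i \<inter> flt (i - 1) (t - 1)" using x unfolding flt_def coord_space_def by blast
  next
    fix x assume x: "x \<in> syz i \<inter> flt (i - 1) (t - 1)"
    have "Poly_Mapping.lookup (comp (i - 1) t x j) m = 0" for j m
    proof (rule ccontr)
      assume nz: "Poly_Mapping.lookup (comp (i - 1) t x j) m \<noteq> 0"
      then have *: "int (mdeg m) + a (i - 1) j = t" "Poly_Mapping.lookup (x j) m \<noteq> 0"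
        by (auto simp: comp_def split: if_splits)
      then have "(j, m) \<in> {(j, m). j < b (i - 1) \<and> int (mdeg m) + a (i - 1) j \<le> t - 1}"
        using x unfolding flt_def coord_space_def by blast
      then show False using * by auto
    qed
    then have "comp (i - 1) t x = 0" by (auto simp: fun_eq_iff intro!: poly_mapping_eqI)
    moreover have "x \<in> flt (i - 1) t" using x flt_mono[of "t - 1" t "i - 1"] by auto
    ultimately show "x \<in> {x \<in> ?V. comp (i - 1) t x = 0}" using x by simp
  qed
  also have "comp (i - 1) t ` ?V = syz i \<inter> gfree (i - 1) t"
  proof (intro equalityI subsetI)
    fix y assume "y \<in> comp (i - 1) t ` ?V"
    then show "y \<in> syz i \<inter> gfree (i - 1) t" using comp_syz[OF i] comp_gfree by auto
  next
    fix y assume y: "y \<in> syz i \<inter> gfree (i - 1) t"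
    then have "y = comp (i - 1) t y" using comp_id[of y "i - 1" t t] by simp
    moreover have "y \<in> ?V" using y gfree_flt by auto
    ultimately show "y \<in> comp (i - 1) t ` ?V" by (rule image_eqI)
  qed
  finally show ?thesis .
qed

lemma dim_syz_flt:
  assumes i: "i \<ge> 1"
  shows "fs.dim (syz i \<inter> flt (i - 1) (int (n + i) - 1 + int N)) = (\<Sum>e\<le>N. sdim i e)"
proof (induction N)
  case 0
  have "syz i \<inter> flt (i - 1) (int (n + i) - 1 - 1) = {0}"
  proof (intro equalityI subsetI)
    fix x assume x: "x \<in> syz i \<inter> flt (i - 1) (int (n + i) - 1 - 1)"
    have "x = (\<Sum>t\<in>degs (i - 1) x. comp (i - 1) t x)"
      using x syz_free[OF i] by (intro sum_comp[symmetric]) auto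
    also have "\<dots> = 0"
    proof (rule sum.neutral, rule ballI)
      fix t assume "t \<in> degs (i - 1) x"
      then have "t < int (n + i) - 1" using degs_flt x by fastforce
      then show "comp (i - 1) t x = 0"
        using x by (intro syz_low_degree[OF i comp_syz[OF i] comp_gfree]) auto
    qed
    finally show "x \<in> {0}" by simp
  qed (simp add: fs.subspace_0[OF subspace_flt])
  then show ?case using dim_syz_flt_step[OF i, of "int (n + i) - 1"] by (simp add: sdim_def)
next
  case (Suc N)
  have "int (n + i) - 1 + int (Suc N) - 1 = int (n + i) - 1 + int N" by simp
  then show ?case
    using dim_syz_flt_step[OF i, of "int (n + i) - 1 + int (Suc N)"] Suc
    by (simp only: sum.atMost_Suc sdim_def[of i "Suc N"])
qed

text \<open>Summing the two-term formula of \<open>hilbert_recursion\<close> turns it into two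
  cumulative counts, one shifted by a degree. With \<open>Suc N\<close> no subtraction of indices is
  needed.\<close>

theorem dim_syz_flt_hilb:
  fixes N :: nat
  defines "d \<equiv> CARD('v)" and "h \<equiv> hilb TYPE('v)" and "D \<equiv> \<lambda>t :: nat. \<Sum>j\<le>t. hilb TYPE('v) j"
  assumes d: "d \<ge> 2" and n: "n \<ge> 2"
  shows "int (fs.dim (syz (d - 1) \<inter> flt (d - 1 - 1) (int (n + (d - 1)) - 1 + int (Suc N)))) =
     (int d * int (h (n - 1)) - int (h (n - 2))) * int (D (Suc N)) - int (h (n - 1)) * int (D N)"
proof -
  let ?A = "int d * int (h (n - 1)) - int (h (n - 2))"
  have "int (sdim (d - 1) e) = ?A * int (h e) - int (h (n - 1)) * (if e = 0 then 0 else int (h (e - 1)))" for e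
    unfolding d_def h_def
  proof (rule hilbert_recursion[where X = "\<lambda>i e. int (sdim i e)"])
    fix i e :: nat assume i: "i \<ge> 1"
    show "int (sdim (Suc i) e) = int (sdim i 0) * int (hilb TYPE('v) (Suc e)) - int (sdim i (Suc e))"
      using arg_cong[OF sdim_Suc[OF i, of e], of int] by (simp add: sdim_0[OF i])
  qed (use d n sdim_1 in \<open>simp_all add: d_def\<close>)
  then have "int (\<Sum>e\<le>Suc N. sdim (d - 1) e) =
      (\<Sum>e\<le>Suc N. ?A * int (h e) - int (h (n - 1)) * (if e = 0 then 0 else int (h (e - 1))))" by simp
  also have "\<dots> = ?A * (\<Sum>e\<le>Suc N. int (h e)) - int (h (n - 1)) * (\<Sum>e\<le>Suc N. if e = 0 then 0 else int (h (e - 1)))"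
    by (simp only: sum_subtractf sum_distrib_left)
  also have "(\<Sum>e\<le>Suc N. if e = 0 then 0 else int (h (e - 1))) = (\<Sum>e\<le>N. int (h e))"
    by (subst sum.atMost_Suc_shift) simp
  finally show ?thesis
    using d dim_syz_flt[of "d - 1" "Suc N"] by (simp add: D_def h_def)
qed

end

section \<open>The polynomial ring is a domain\<close>

text \<open>The monomials are renamed into \<open>nat \<Rightarrow>\<^sub>0 nat\<close>, which carries a linear order.\<close>

definition mren :: "('v::finite \<Rightarrow>\<^sub>0 nat) \<Rightarrow> (nat \<Rightarrow>\<^sub>0 nat)" where
  "mren m = (\<Sum>v\<in>UNIV. Poly_Mapping.single (vidx v) (Poly_Mapping.lookup m v))"

lemma lookup_mren: "Poly_Mapping.lookup (mren m) (vidx v) = Poly_Mapping.lookup m v"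
  by (simp add: mren_def lookup_sum lookup_single when_def)

lemma inj_mren: "inj mren"
  by (rule injI, rule poly_mapping_eqI) (metis lookup_mren)

lemma mren_add: "mren (m + m') = mren m + mren m'"
  by (simp add: mren_def lookup_add single_add sum.distrib)

lemma poly_as_sum: "p = (\<Sum>k\<in>Poly_Mapping.keys p. Poly_Mapping.single k (Poly_Mapping.lookup p k))"
proof (rule poly_mapping_eqI)
  fix m
  have "(\<Sum>k\<in>Poly_Mapping.keys p. Poly_Mapping.lookup p k when k = m) =
      (\<Sum>k\<in>Poly_Mapping.keys p. if k = m then Poly_Mapping.lookup p m else 0)"
    by (rule sum.cong) (auto simp: when_def)
  then show "Poly_Mapping.lookup p m =
      Poly_Mapping.lookup (\<Sum>k\<in>Poly_Mapping.keys p. Poly_Mapping.single k (Poly_Mapping.lookup p k)) m"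
    by (simp add: lookup_sum lookup_single sum.delta in_keys_iff)
qed

text \<open>The product of the leading terms, in the order pulled back along \<open>mren\<close>,
  cannot cancel.\<close>

lemma mpoly_mult_nonzero:
  fixes p q :: "('v::finite, 'k::field) mpoly"
  assumes "p \<noteq> 0" "q \<noteq> 0"
  shows "p * q \<noteq> 0"
proof -
  have "\<exists>k\<in>Poly_Mapping.keys p. \<forall>l\<in>Poly_Mapping.keys p. mren l \<le> mren k" if "p \<noteq> 0" for p :: "('v, 'k) mpoly"
  proof -
    have "Max (mren ` Poly_Mapping.keys p) \<in> mren ` Poly_Mapping.keys p" using that by (intro Max_in) auto
    then obtain k where "k \<in> Poly_Mapping.keys p" "mren k = Max (mren ` Poly_Mapping.keys p)" by auto
    then show ?thesis by (intro bexI[of _ k]) auto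
  qed
  from this[OF assms(1)] this[OF assms(2)] obtain k l where
    k: "k \<in> Poly_Mapping.keys p" "\<And>m. m \<in> Poly_Mapping.keys p \<Longrightarrow> mren m \<le> mren k" and
    l: "l \<in> Poly_Mapping.keys q" "\<And>m. m \<in> Poly_Mapping.keys q \<Longrightarrow> mren m \<le> mren l" by blast
  have "Poly_Mapping.lookup (p * q) (k + l) =
      (\<Sum>k'\<in>Poly_Mapping.keys p. Poly_Mapping.lookup (Poly_Mapping.single k' (Poly_Mapping.lookup p k') * q) (k + l))"
    by (subst poly_as_sum[of p]) (simp add: sum_distrib_right lookup_sum)
  also have "\<dots> = (\<Sum>k'\<in>Poly_Mapping.keys p. if k' = k then Poly_Mapping.lookup p k * Poly_Mapping.lookup q l else 0)"
  proof (rule sum.cong[OF refl])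
    fix k' assume k': "k' \<in> Poly_Mapping.keys p"
    show "Poly_Mapping.lookup (Poly_Mapping.single k' (Poly_Mapping.lookup p k') * q) (k + l) =
        (if k' = k then Poly_Mapping.lookup p k * Poly_Mapping.lookup q l else 0)"
    proof (cases "k' = k")
      case False
      have "Poly_Mapping.lookup (Poly_Mapping.single k' (Poly_Mapping.lookup p k') * q) (k + l) = 0"
      proof (cases "\<exists>l'. k + l = k' + l'")
        case True
        then obtain l' where l': "k + l = k' + l'" by blast
        have "mren k' < mren k" using k(2)[OF k'] False injD[OF inj_mren, of k' k] by (auto simp: le_less)
        moreover have "mren k + mren l = mren k' + mren l'" using l' by (simp flip: mren_add)
        ultimately have "\<not> mren l' \<le> mren l"
          using add_less_le_mono[of "mren k'" "mren k" "mren l'" "mren l"] by auto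
        then have "l' \<notin> Poly_Mapping.keys q" using l(2) by blast
        then show ?thesis unfolding l' lookup_single_mult by (simp add: in_keys_iff)
      qed (intro lookup_single_mult_eq_0, blast)
      then show ?thesis using False by simp
    qed (simp add: lookup_single_mult)
  qed
  also have "\<dots> = Poly_Mapping.lookup p k * Poly_Mapping.lookup q l" using k(1) by (simp add: sum.delta)
  finally have "Poly_Mapping.lookup (p * q) (k + l) \<noteq> 0" using k(1) l(1) by (simp add: in_keys_iff)
  then show ?thesis by auto
qed

lemma mpoly_prod_nonzero:
  fixes f :: "'j \<Rightarrow> ('v::finite, 'k::field) mpoly"
  shows "finite I \<Longrightarrow> (\<And>i. i \<in> I \<Longrightarrow> f i \<noteq> 0) \<Longrightarrow> prod f I \<noteq> 0"
  by (induction I rule: finite_induct) (auto simp: mpoly_mult_nonzero)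

lemma smul_eq_0_iff: "smul s x = 0 \<longleftrightarrow> s = 0 \<or> x = 0"
  using mpoly_mult_nonzero by (fastforce simp: smul_def fun_eq_iff)

section \<open>Rank\<close>

text \<open>The coefficients form a tuple indexed by the vectors of \<open>B\<close> themselves; so
  \<open>coord_space\<close> bounds their degrees and this map is linear over the field.\<close>

definition lincomb_of :: "(nat \<Rightarrow> ('v::finite, 'k::field) mpoly) set \<Rightarrow>
    ((nat \<Rightarrow> ('v, 'k) mpoly) \<Rightarrow> ('v, 'k) mpoly) \<Rightarrow> nat \<Rightarrow> ('v, 'k) mpoly" where
  "lincomb_of B p = (\<Sum>x\<in>B. smul (p x) x)"

definition free_family :: "(nat \<Rightarrow> ('v::finite, 'k::field) mpoly) set \<Rightarrow> bool" where
  "free_family B \<longleftrightarrow> finite B \<and> (\<forall>p. lincomb_of B p = 0 \<longrightarrow> (\<forall>x\<in>B. p x = 0))"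

lemma linear_lincomb_of:
  fixes B :: "(nat \<Rightarrow> ('v::finite, 'k::field) mpoly) set"
  shows "Vector_Spaces.linear fscale fscale (lincomb_of B)"
proof (rule linear_fscaleI)
  fix x y :: "(nat \<Rightarrow> ('v, 'k) mpoly) \<Rightarrow> ('v, 'k) mpoly" and c
  show "lincomb_of B (x + y) = lincomb_of B x + lincomb_of B y"
    by (simp add: lincomb_of_def smul_add_left sum.distrib)
  show "lincomb_of B (fscale c x) = fscale c (lincomb_of B x)"
    unfolding lincomb_of_def smul_const_eq[symmetric, of c "\<Sum>x\<in>B. smul (p x) x" for p] smul_sum
    by (simp add: smul_smul fscale_def)
qed

definition nmon_le :: "'v::finite itself \<Rightarrow> nat \<Rightarrow> nat" where
  "nmon_le _ t = (\<Sum>j\<le>t. hilb TYPE('v) j)"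

lemma nmon_le_pos: "nmon_le TYPE('v::finite) t > 0"
  unfolding nmon_le_def sum_hnum by simp

text \<open>The counts grow polynomially, so consecutive quotients tend to 1; a shift by
  \<open>c\<close> multiplies \<open>c\<close> such quotients.\<close>

lemma nmon_le_ratio: "(\<lambda>N. real (nmon_le TYPE('v::finite) (N + c)) / real (nmon_le TYPE('v) N)) \<longlonglongrightarrow> 1"
proof (induction c)
  case 0
  have "real (nmon_le TYPE('v) N) / real (nmon_le TYPE('v) N) = 1" for N
    using nmon_le_pos[of N, where 'v='v] by simp
  then show ?case by simp
next
  case (Suc c)
  let ?D = "\<lambda>N. real (nmon_le TYPE('v) N)"
  have nz: "?D N \<noteq> 0" for N using nmon_le_pos[of N, where 'v='v] by simp
  have step: "?D (Suc M) / ?D M = 1 + real CARD('v) * inverse (real (Suc M))" for M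
  proof -
    \<comment> \<open>The absorption identity for binomial coefficients, brought to the form in
      which \<open>sum_hnum\<close> states the counts.\<close>
    have "Suc M * (Suc M + CARD('v) choose CARD('v)) = Suc (M + CARD('v)) * (M + CARD('v) choose CARD('v))"
      using Suc_times_binomial[of M "M + CARD('v)"] binomial_symmetric[of M "M + CARD('v)"]
        binomial_symmetric[of "Suc M" "Suc M + CARD('v)"] by simp
    then have "real (Suc M) * ?D (Suc M) = real (Suc (M + CARD('v))) * ?D M"
      unfolding nmon_le_def sum_hnum by (metis of_nat_mult)
    then show ?thesis using nz[of M] by (simp add: field_simps)
  qed
  have "(\<lambda>M. ?D (Suc M) / ?D M) \<longlonglongrightarrow> 1 + real CARD('v) * 0"
    unfolding step by (intro tendsto_intros LIMSEQ_inverse_real_of_nat)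
  then have "(\<lambda>N. ?D (Suc (N + c)) / ?D (N + c)) \<longlonglongrightarrow> 1"
    by (subst LIMSEQ_ignore_initial_segment[where k = c]) simp_all
  from tendsto_mult[OF this Suc]
  have "(\<lambda>N. ?D (Suc (N + c)) / ?D (N + c) * (?D (N + c) / ?D N)) \<longlonglongrightarrow> 1" by (simp only: mult_1)
  moreover have "?D (Suc (N + c)) / ?D (N + c) * (?D (N + c) / ?D N) = ?D (N + Suc c) / ?D N" for N
    using nz[of "N + c"] by simp
  ultimately show ?case by (simp only:)
qed

text \<open>Divided by \<open>nmon_le N\<close>, the inequality passes to the limit, in which all
  shifts of the argument are lost.\<close>

lemma growth_le:
  fixes A B :: int and r E :: nat
  assumes "\<And>N. int r * int (nmon_le TYPE('v::finite) N) \<le>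
      A * int (nmon_le TYPE('v) (Suc (N + E))) - B * int (nmon_le TYPE('v) (N + E))"
  shows "int r \<le> A - B"
proof -
  let ?D = "\<lambda>N. real (nmon_le TYPE('v) N)"
  have "(\<lambda>N. of_int A * (?D (N + Suc E) / ?D N) - of_int B * (?D (N + E) / ?D N)) \<longlonglongrightarrow> of_int A * 1 - of_int B * 1"
    by (intro tendsto_intros nmon_le_ratio)
  moreover have "real r \<le> of_int A * (?D (N + Suc E) / ?D N) - of_int B * (?D (N + E) / ?D N)" for N
  proof -
    have "real_of_int (int r * int (nmon_le TYPE('v) N)) \<le>
      real_of_int (A * int (nmon_le TYPE('v) (Suc (N + E))) - B * int (nmon_le TYPE('v) (N + E)))"
      using assms by (simp only: of_int_le_iff)
    then have "real r * ?D N \<le> of_int A * ?D (N + Suc E) - of_int B * ?D (N + E)" by simp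
    moreover have "?D N > 0" using nmon_le_pos[of N, where 'v='v] by simp
    ultimately show ?thesis by (simp add: field_simps)
  qed
  ultimately have "real r \<le> of_int A * 1 - of_int B * 1"
    by (intro LIMSEQ_le_const) auto
  then have "real_of_int (int r) \<le> real_of_int (A - B)" by simp
  then show ?thesis by (simp only: of_int_le_iff)
qed

lemma growth_ge:
  fixes A B :: int and r C :: nat
  assumes "\<And>N. A * int (nmon_le TYPE('v::finite) (Suc N)) - B * int (nmon_le TYPE('v) N) \<le>
      int r * int (nmon_le TYPE('v) (N + C))"
  shows "A - B \<le> int r"
proof -
  let ?D = "\<lambda>N. real (nmon_le TYPE('v) N)"
  have l1: "(\<lambda>N. of_int A * (?D (N + 1) / ?D N) - of_int B * (?D (N + 0) / ?D N)) \<longlonglongrightarrow> of_int A * 1 - of_int B * 1"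
    by (intro tendsto_intros nmon_le_ratio)
  have l2: "(\<lambda>N. real r * (?D (N + C) / ?D N)) \<longlonglongrightarrow> real r * 1"
    by (intro tendsto_intros nmon_le_ratio)
  have "of_int A * (?D (N + 1) / ?D N) - of_int B * (?D (N + 0) / ?D N) \<le> real r * (?D (N + C) / ?D N)" for N
  proof -
    have "real_of_int (A * int (nmon_le TYPE('v) (Suc N)) - B * int (nmon_le TYPE('v) N)) \<le>
        real_of_int (int r * int (nmon_le TYPE('v) (N + C)))"
      using assms by (simp only: of_int_le_iff)
    then have "of_int A * ?D (N + 1) - of_int B * ?D N \<le> real r * ?D (N + C)" by simp
    then have "(of_int A * ?D (N + 1) - of_int B * ?D N) / ?D N \<le> real r * ?D (N + C) / ?D N"
      by (intro divide_right_mono) auto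
    then show ?thesis using nmon_le_pos[of N, where 'v='v] by (simp add: diff_divide_distrib)
  qed
  then have "of_int A * 1 - of_int B * 1 \<le> real r * 1"
    by (intro LIMSEQ_le[OF l1 l2]) auto
  then have "real_of_int (A - B) \<le> real_of_int (int r)" by simp
  then show ?thesis by (simp only: of_int_le_iff)
qed

lemma dim_coord_le:
  "finite B \<Longrightarrow> fs.dim (coord_space (B \<times> {m. mdeg m \<le> N}) :: ('i \<Rightarrow> ('v::finite, 'k::field) mpoly) set) =
     card B * nmon_le TYPE('v) N"
  by (simp add: dim_coord_space card_cartesian_product card_mdeg_le nmon_le_def sum_hnum)

lemma fd_coord_le:
  "finite B \<Longrightarrow> fs.fd (coord_space (B \<times> {m. mdeg m \<le> N}) :: ('i \<Rightarrow> ('v::finite, 'k::field) mpoly) set)"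
  by (intro dim_coord_space finite_cartesian_product) auto

lemma free_family_dependent:
  assumes B: "free_family B" and dep: "\<not> free_family (insert x B)"
  shows "\<exists>s p. s \<noteq> 0 \<and> smul s x = lincomb_of B p"
proof -
  have fin: "finite B" using B by (simp add: free_family_def)
  have x: "x \<notin> B" using B dep by (auto simp: insert_absorb)
  obtain p where p: "lincomb_of (insert x B) p = 0" "\<not> (\<forall>y\<in>insert x B. p y = 0)"
    using dep fin by (auto simp: free_family_def)
  have *: "smul (p x) x + lincomb_of B p = 0" using p(1) fin x by (simp add: lincomb_of_def)
  have "p x \<noteq> 0"
  proof
    assume "p x = 0"
    then have "lincomb_of B p = 0" using * by simp
    then have "\<forall>y\<in>B. p y = 0" using B by (simp add: free_family_def)
    then show False using p(2) \<open>p x = 0\<close> by simp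
  qed
  moreover have "smul (p x) x = lincomb_of B (\<lambda>y. - p y)"
  proof -
    have neg: "lincomb_of B (\<lambda>y. - p y) = - lincomb_of B p"
      unfolding lincomb_of_def sum_negf[symmetric]
      by (intro sum.cong) (auto simp: smul_def fun_eq_iff)
    show ?thesis using * by (simp only: eq_neg_iff_add_eq_0 neg)
  qed
  ultimately show ?thesis by blast
qed

section \<open>Independent families of syzygies\<close>

context graded_resolution
begin

text \<open>Independence makes \<open>lincomb_of B\<close> injective on coefficients of degree at
  most N, and the image lies in a filtration step whose level exceeds N by a constant. Comparing
  growth rates gives the bound.\<close>

lemma free_family_card_le:
  assumes d: "CARD('v) \<ge> 2" and n: "n \<ge> 2"
    and B: "free_family B" "B \<subseteq> syz (CARD('v) - 1)"
  shows "int (card B) \<le> (int CARD('v) * int (hilb TYPE('v) (n - 1)) - int (hilb TYPE('v) (n - 2))) - int (hilb TYPE('v) (n - 1))"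
proof -
  define i where "i = CARD('v) - 1"
  have i: "i \<ge> 1" using d by (simp add: i_def)
  have fin: "finite B" using B by (simp add: free_family_def)
  obtain E where E: "\<And>x. x \<in> B \<Longrightarrow> x \<in> flt (i - 1) (int E)"
  proof -
    have "\<exists>E. x \<in> flt (i - 1) (int E)" if "x \<in> B" for x
    proof -
      have xf: "x \<in> free (b (i - 1))" using that B(2) syz_free[OF i] by (auto simp: i_def)
      define e where "e = Max (degs (i - 1) x)"
      have e: "\<And>t. t \<in> degs (i - 1) x \<Longrightarrow> t \<le> e" unfolding e_def by (rule Max_ge[OF finite_degs])
      have "(j, m) \<in> {(j, m). j < b (i - 1) \<and> int (mdeg m) + a (i - 1) j \<le> int (nat e)}"
        if nz: "Poly_Mapping.lookup (x j) m \<noteq> 0" for j m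
      proof -
        have j: "j < b (i - 1)" using xf nz by (auto simp: free_def not_less[symmetric])
        then have "int (mdeg m) + a (i - 1) j \<in> degs (i - 1) x"
          unfolding degs_def using nz by (intro UN_I[of j] imageI) (auto simp: in_keys_iff)
        from e[OF this] show ?thesis using j by auto
      qed
      then show ?thesis unfolding flt_def coord_space_def by blast
    qed
    then obtain e where e: "\<And>x. x \<in> B \<Longrightarrow> x \<in> flt (i - 1) (int (e x))" by metis
    have "x \<in> flt (i - 1) (int (\<Sum>x\<in>B. e x))" if "x \<in> B" for x
      using flt_mono[of "int (e x)" "int (\<Sum>x\<in>B. e x)" "i - 1"] e[OF that] member_le_sum[of x B e] that fin
      by (auto simp del: of_nat_sum)
    then show ?thesis using that by blast
  qed
  show ?thesis
  proof (rule growth_le[where E = E and 'v = 'v])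
    fix N
    let ?C = "coord_space (B \<times> {m. mdeg m \<le> N}) :: ((nat \<Rightarrow> ('v, 'k) mpoly) \<Rightarrow> ('v, 'k) mpoly) set"
    \<comment> \<open>Any level from N + E on contains the combinations; this one has the form
      counted by \<open>dim_syz_flt_hilb\<close>.\<close>
    let ?T = "int (n + i) - 1 + int (Suc (N + E))"
    have "lincomb_of B ` ?C \<subseteq> syz i \<inter> flt (i - 1) ?T"
    proof clarify
      fix p assume p: "p \<in> ?C"
      have "smul (p x) x \<in> syz i \<inter> flt (i - 1) ?T" if "x \<in> B" for x
      proof -
        have "smul (p x) x \<in> syz i" using that B(2) by (auto intro: syz_smul simp: i_def)
        moreover have "smul (p x) x \<in> flt (i - 1) ?T"
          unfolding flt_def coord_space_def
        proof (clarify, goal_cases)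
          case (1 j m)
          then have "m \<in> Poly_Mapping.keys (p x * x j)" by (simp add: smul_def in_keys_iff)
          then obtain k l where kl: "m = k + l" "k \<in> Poly_Mapping.keys (p x)" "l \<in> Poly_Mapping.keys (x j)"
            using keys_mult[of "p x" "x j"] by auto
          have "(x, k) \<in> B \<times> {m. mdeg m \<le> N}"
            using p kl(2) unfolding coord_space_def by (auto simp: in_keys_iff)
          moreover have "(j, l) \<in> {(j, m). j < b (i - 1) \<and> int (mdeg m) + a (i - 1) j \<le> int E}"
            using E[OF that] kl(3) unfolding flt_def coord_space_def by (auto simp: in_keys_iff)
          ultimately show ?case using n i by (auto simp: kl(1))
        qed
        ultimately show ?thesis by blast
      qed
      then show "lincomb_of B p \<in> syz i \<inter> flt (i - 1) ?T"
        unfolding lincomb_of_def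
        by (intro fs.subspace_sum fs.subspace_inter subspace_syz subspace_flt) auto
    qed
    then have "fs.dim (lincomb_of B ` ?C) \<le> fs.dim (syz i \<inter> flt (i - 1) ?T)"
      by (intro fs.dim_mono_fd fs.fd_subset[OF fd_flt[of "i - 1" ?T]]) auto
    moreover have "fs.dim (lincomb_of B ` ?C) = fs.dim ?C"
    proof (rule fp.dim_image_inj_fd[OF linear_lincomb_of])
      fix p assume p: "p \<in> ?C" "lincomb_of B p = 0"
      have "p x = 0" for x
      proof (cases "x \<in> B")
        case False
        then have "Poly_Mapping.lookup (p x) m = 0" for m using p(1) by (auto simp: coord_space_def)
        then show ?thesis by (intro poly_mapping_eqI) simp
      qed (use p(2) B(1) in \<open>simp add: free_family_def\<close>)
      then show "p = 0" by (simp add: fun_eq_iff)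
    qed (auto intro: fd_coord_le fin)
    ultimately have "int (card B * nmon_le TYPE('v) N) \<le> int (fs.dim (syz i \<inter> flt (i - 1) ?T))"
      by (simp only: dim_coord_le[OF fin] of_nat_le_iff)
    also have "\<dots> = (int CARD('v) * int (hilb TYPE('v) (n - 1)) - int (hilb TYPE('v) (n - 2))) * int (nmon_le TYPE('v) (Suc (N + E)))
        - int (hilb TYPE('v) (n - 1)) * int (nmon_le TYPE('v) (N + E))"
      unfolding i_def nmon_le_def by (rule dim_syz_flt_hilb[OF d n])
    finally show "int (card B) * int (nmon_le TYPE('v) N) \<le>
      (int CARD('v) * int (hilb TYPE('v) (n - 1)) - int (hilb TYPE('v) (n - 2))) * int (nmon_le TYPE('v) (Suc (N + E)))
        - int (hilb TYPE('v) (n - 1)) * int (nmon_le TYPE('v) (N + E))" by simp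
  qed
qed

text \<open>Lifting component by component preserves degrees. As all generators have the same
  degree, this bounds the coefficients by \<open>N\<close>.\<close>

lemma graded_lift_flt:
  assumes i: "i \<ge> 1" and x: "x \<in> syz i" "x \<in> flt (i - 1) (int (n + i) - 1 + int N)"
  obtains y where "y \<in> coord_space ({..<b i} \<times> {m. mdeg m \<le> N})" "F i y = x"
proof -
  let ?D = "degs (i - 1) x"
  have "\<exists>z. z \<in> gfree i t \<and> F i z = comp (i - 1) t x" for t
    by (rule graded_lift[OF i comp_syz[OF i x(1)] comp_gfree]) blast
  then have "\<exists>z. \<forall>t. z t \<in> gfree i t \<and> F i (z t) = comp (i - 1) t x" by (intro choice allI)
  then obtain z where z: "\<And>t. z t \<in> gfree i t" "\<And>t. F i (z t) = comp (i - 1) t x" by blast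
  have "F i (\<Sum>t\<in>?D. z t) = (\<Sum>t\<in>?D. comp (i - 1) t x)" by (simp only: F_sum z)
  also have "\<dots> = x" by (rule sum_comp[OF syz_free[OF i x(1)]]) auto
  finally have "F i (\<Sum>t\<in>?D. z t) = x" .
  moreover have "(\<Sum>t\<in>?D. z t) \<in> coord_space ({..<b i} \<times> {m. mdeg m \<le> N})"
  proof (rule fs.subspace_sum[OF coord_space_subspace])
    fix t assume "t \<in> ?D"
    then have "t \<le> int (n + i) - 1 + int N" using degs_flt[OF x(2)] by blast
    then have "{(j, m :: 'v \<Rightarrow>\<^sub>0 nat). j < b i \<and> int (mdeg m) + a i j = t} \<subseteq> {..<b i} \<times> {m. mdeg m \<le> N}"
      using linear_resolution[OF i] by auto
    then show "z t \<in> coord_space ({..<b i} \<times> {m. mdeg m \<le> N})"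
      using z(1)[of t] coord_space_mono unfolding gfree_def by blast
  qed
  ultimately show ?thesis using that by blast
qed

lemma free_as_sum: "y \<in> free c \<Longrightarrow> y = (\<Sum>j<c. smul (y j) (unit_vec j))"
proof (rule ext)
  fix l assume y: "y \<in> free c"
  have "(\<Sum>j<c. smul (y j) (unit_vec j)) l = (\<Sum>j<c. if j = l then y l else 0)"
    unfolding sum_fun_apply by (intro sum.cong) (auto simp: smul_def unit_vec_def)
  then show "y l = (\<Sum>j<c. smul (y j) (unit_vec j)) l" using y by (simp add: free_def)
qed

text \<open>By maximality some nonzero multiple of each generator lies in the span of
  \<open>B\<close>, and a common multiplier S carries the whole syzygy module there. S is injective
  and raises the degrees of coefficients by a constant only, so a filtration step has at most the
  dimension of a slightly larger space of coefficients.\<close>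

lemma maximal_free_family_card_ge:
  assumes d: "CARD('v) \<ge> 2" and n: "n \<ge> 2"
    and B: "free_family B" "B \<subseteq> syz (CARD('v) - 1)"
    and max: "\<And>x. x \<in> syz (CARD('v) - 1) \<Longrightarrow> x \<notin> B \<Longrightarrow> \<not> free_family (insert x B)"
  shows "(int CARD('v) * int (hilb TYPE('v) (n - 1)) - int (hilb TYPE('v) (n - 2))) - int (hilb TYPE('v) (n - 1)) \<le> int (card B)"
proof -
  define i where "i = CARD('v) - 1"
  have i: "i \<ge> 1" using d by (simp add: i_def)
  have fin: "finite B" using B by (simp add: free_family_def)
  let ?g = "\<lambda>j. F i (unit_vec j)"
  have ex: "\<exists>s p. s \<noteq> 0 \<and> smul s x = lincomb_of B p" if "x \<in> syz i" for x
  proof (cases "x \<in> B")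
    case True
    have "lincomb_of B (\<lambda>y. if y = x then 1 else 0) = (\<Sum>y\<in>B. if y = x then x else 0)"
      unfolding lincomb_of_def by (intro sum.cong) auto
    also have "\<dots> = x" using True fin by simp
    finally have "smul 1 x = lincomb_of B (\<lambda>y. if y = x then 1 else 0)" by simp
    then show ?thesis using one_neq_zero by metis
  next
    case False
    then show ?thesis using free_family_dependent[OF B(1)] max that by (simp add: i_def)
  qed
  have "\<exists>s p. j < b i \<longrightarrow> s \<noteq> 0 \<and> smul s (?g j) = lincomb_of B p" for j
  proof (cases "j < b i")
    case True
    from ex[OF F_unit_vec_syz[OF this]] show ?thesis by simp
  qed simp
  then have "\<exists>s. \<forall>j. \<exists>p. j < b i \<longrightarrow> s j \<noteq> 0 \<and> smul (s j) (?g j) = lincomb_of B p" by (intro choice allI)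
  then obtain s where "\<forall>j. \<exists>p. j < b i \<longrightarrow> s j \<noteq> 0 \<and> smul (s j) (?g j) = lincomb_of B p" by blast
  then have "\<exists>p. \<forall>j. j < b i \<longrightarrow> s j \<noteq> 0 \<and> smul (s j) (?g j) = lincomb_of B (p j)" by (rule choice)
  then obtain p where sp: "\<And>j. j < b i \<Longrightarrow> s j \<noteq> 0" "\<And>j. j < b i \<Longrightarrow> smul (s j) (?g j) = lincomb_of B (p j)" by blast
  \<comment> \<open>A common denominator; each single denominator is completed by the product of the
    others, which enters \<open>q\<close>.\<close>
  define S where "S = (\<Prod>j<b i. s j)"
  have S0: "S \<noteq> 0" unfolding S_def using sp(1) by (intro mpoly_prod_nonzero) auto
  define q where "q j y = (\<Prod>l\<in>{..<b i} - {j}. s l) * p j y" for j y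
  have q: "smul S (?g j) = lincomb_of B (q j)" if "j < b i" for j
  proof -
    have "S = (\<Prod>l\<in>{..<b i} - {j}. s l) * s j"
      unfolding S_def using that by (subst prod.remove[of _ j]) (auto simp: mult.commute)
    then have "smul S (?g j) = smul (\<Prod>l\<in>{..<b i} - {j}. s l) (lincomb_of B (p j))"
      by (simp only: smul_smul[symmetric] sp(2)[OF that])
    then show ?thesis by (simp add: lincomb_of_def smul_sum smul_smul q_def)
  qed
  obtain C where C: "\<And>j y m. j < b i \<Longrightarrow> y \<in> B \<Longrightarrow> m \<in> Poly_Mapping.keys (q j y) \<Longrightarrow> mdeg m \<le> C"
  proof -
    let ?K = "\<Union>j\<in>{..<b i}. \<Union>y\<in>B. mdeg ` Poly_Mapping.keys (q j y)"
    have "finite ?K" using fin by auto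
    then have "k \<le> Max (insert 0 ?K)" if "k \<in> ?K" for k using that by (intro Max_ge) auto
    then show ?thesis using that[of "Max (insert 0 ?K)"] by blast
  qed
  show ?thesis
  proof (rule growth_ge[where C = "Suc C" and 'v = 'v])
    fix N
    let ?T = "int (n + i) - 1 + int (Suc N)"
    let ?W = "syz i \<inter> flt (i - 1) ?T"
    \<comment> \<open>The lift \<open>y\<close> has degree at most N + 1 and the coefficients
      \<open>q\<close> at most C.\<close>
    let ?C = "coord_space (B \<times> {m. mdeg m \<le> N + Suc C}) :: ((nat \<Rightarrow> ('v, 'k) mpoly) \<Rightarrow> ('v, 'k) mpoly) set"
    have linS: "Vector_Spaces.linear fscale fscale (smul S :: (nat \<Rightarrow> ('v, 'k) mpoly) \<Rightarrow> _)"
      by (rule linear_fscaleI) (simp_all add: smul_add_right smul_fscale)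
    have "smul S ` ?W \<subseteq> lincomb_of B ` ?C"
    proof clarify
      fix x assume "x \<in> syz i" "x \<in> flt (i - 1) ?T"
      then obtain y where y: "y \<in> coord_space ({..<b i} \<times> {m. mdeg m \<le> Suc N})" "F i y = x"
        using graded_lift_flt[OF i] by blast
      have yf: "y \<in> free (b i)"
        using y(1) by (fastforce simp: coord_space_def free_def intro!: poly_mapping_eqI)
      have "x = (\<Sum>j<b i. smul (y j) (?g j))"
        using arg_cong[OF free_as_sum[OF yf], of "F i"] by (simp only: y(2) F_sum F_smul)
      then have "smul S x = (\<Sum>j<b i. smul (y j) (smul S (?g j)))"
        by (simp add: smul_sum smul_smul mult.commute)
      also have "\<dots> = (\<Sum>j<b i. \<Sum>z\<in>B. smul (y j * q j z) z)"
        by (intro sum.cong) (auto simp: q lincomb_of_def smul_sum smul_smul)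
      also have "\<dots> = (\<Sum>z\<in>B. \<Sum>j<b i. smul (y j * q j z) z)" by (rule sum.swap)
      also have "\<dots> = lincomb_of B (\<lambda>z. if z \<in> B then \<Sum>j<b i. y j * q j z else 0)"
        unfolding lincomb_of_def
      proof (intro sum.cong refl)
        fix z assume "z \<in> B"
        have "(\<Sum>j<b i. smul (y j * q j z) z) = smul (\<Sum>j<b i. y j * q j z) z"
          by (rule ext) (simp add: sum_fun_apply smul_def sum_distrib_right)
        then show "(\<Sum>j<b i. smul (y j * q j z) z) = smul (if z \<in> B then \<Sum>j<b i. y j * q j z else 0) z"
          using \<open>z \<in> B\<close> by simp
      qed
      finally have "smul S x = lincomb_of B (\<lambda>z. if z \<in> B then \<Sum>j<b i. y j * q j z else 0)" .
      moreover have "(\<lambda>z. if z \<in> B then \<Sum>j<b i. y j * q j z else 0) \<in> ?C"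
        unfolding coord_space_def
      proof (clarify, goal_cases)
        case (1 z m)
        then have z: "z \<in> B" by (auto split: if_splits)
        have "(\<Sum>j<b i. Poly_Mapping.lookup (y j * q j z) m) \<noteq> 0"
          using 1 z by (simp add: lookup_sum)
        then obtain j where j: "j < b i" "Poly_Mapping.lookup (y j * q j z) m \<noteq> 0"
          by (meson lessThan_iff sum.not_neutral_contains_not_neutral)
        then have "m \<in> Poly_Mapping.keys (y j * q j z)" by (simp add: in_keys_iff)
        then obtain k l where kl: "m = k + l" "k \<in> Poly_Mapping.keys (y j)" "l \<in> Poly_Mapping.keys (q j z)"
          using keys_mult[of "y j" "q j z"] by auto
        have "(j, k) \<in> {..<b i} \<times> {m. mdeg m \<le> Suc N}"
          using y(1) kl(2) unfolding coord_space_def by (auto simp: in_keys_iff)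
        then show ?case using C[OF j(1) z kl(3)] z by (simp add: kl(1))
      qed
      ultimately show "smul S x \<in> lincomb_of B ` ?C" by (rule image_eqI)
    qed
    then have "fs.dim (smul S ` ?W) \<le> fs.dim (lincomb_of B ` ?C)"
      by (intro fs.dim_mono_fd fp.fd_image[OF linear_lincomb_of] fd_coord_le fin)
    also have "\<dots> \<le> fs.dim ?C"
      using fp.rank_nullity_fd[OF linear_lincomb_of[of B] coord_space_subspace fd_coord_le[OF fin, of "N + Suc C"]]
      by simp
    also have "\<dots> = card B * nmon_le TYPE('v) (N + Suc C)" by (rule dim_coord_le[OF fin])
    also have "fs.dim (smul S ` ?W) = fs.dim ?W"
      by (rule fp.dim_image_inj_fd[OF linS fs.subspace_inter[OF subspace_syz subspace_flt] fs.fd_subset[OF fd_flt]])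
        (use S0 in \<open>auto simp: smul_eq_0_iff\<close>)
    finally have "int (fs.dim ?W) \<le> int (card B) * int (nmon_le TYPE('v) (N + Suc C))"
      by (metis of_nat_le_iff of_nat_mult)
    then show "(int CARD('v) * int (hilb TYPE('v) (n - 1)) - int (hilb TYPE('v) (n - 2))) * int (nmon_le TYPE('v) (Suc N))
        - int (hilb TYPE('v) (n - 1)) * int (nmon_le TYPE('v) N) \<le> int (card B) * int (nmon_le TYPE('v) (N + Suc C))"
      unfolding i_def nmon_le_def by (simp only: dim_syz_flt_hilb[OF d n])
  qed
qed

text \<open>The upper bound on sizes ensures that the greatest one is attained. A family of greatest
  size admits no independent extension, so the lower bound applies to it.\<close>

theorem rank_syz:
  assumes d: "CARD('v) \<ge> 2" and n: "n \<ge> 2"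
  shows "int (GREATEST r. \<exists>B. card B = r \<and> free_family B \<and> B \<subseteq> syz (CARD('v) - 1)) =
    int CARD('v) * int (hilb TYPE('v) (n - 1)) - int (hilb TYPE('v) (n - 2)) - int (hilb TYPE('v) (n - 1))"
proof -
  let ?R = "int CARD('v) * int (hilb TYPE('v) (n - 1)) - int (hilb TYPE('v) (n - 2)) - int (hilb TYPE('v) (n - 1))"
  let ?P = "\<lambda>r. \<exists>B. card B = r \<and> free_family B \<and> B \<subseteq> syz (CARD('v) - 1)"
  have "?P 0" by (rule exI[of _ "{}"]) (simp add: free_family_def)
  moreover have bound: "r \<le> nat ?R" if "?P r" for r
    using that free_family_card_le[OF d n] by force
  ultimately have P: "?P (Greatest ?P)" by (rule GreatestI_nat)
  then obtain B where B: "card B = Greatest ?P" "free_family B" "B \<subseteq> syz (CARD('v) - 1)" by blast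
  have fin: "finite B" using B by (simp add: free_family_def)
  have "?R \<le> int (card B)"
  proof (rule maximal_free_family_card_ge[OF d n B(2,3)])
    fix x assume x: "x \<in> syz (CARD('v) - 1)" "x \<notin> B"
    show "\<not> free_family (insert x B)"
    proof
      assume "free_family (insert x B)"
      then have "?P (Suc (card B))"
        using x B fin by (intro exI[of _ "insert x B"]) simp
      then have "Suc (card B) \<le> Greatest ?P" using bound by (rule Greatest_le_nat)
      then show False using B(1) by simp
    qed
  qed
  moreover have "int (card B) \<le> ?R" by (rule free_family_card_le[OF d n B(2,3)])
  ultimately show ?thesis using B(1) by simp
qed

end

section \<open>The quotient ring\<close>

lemma cring_class_ring: "cring (class_ring :: 'a::comm_ring_1 ring)"
  by (rule class_cring.is_cring)

lemma ring_class_ring: "ring (class_ring :: 'a::comm_ring_1 ring)"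
  by (rule cring.axioms(1)[OF cring_class_ring])

lemma ideal_class_ringI:
  fixes I :: "'a::comm_ring_1 set"
  assumes "0 \<in> I" "\<And>x y. x \<in> I \<Longrightarrow> y \<in> I \<Longrightarrow> x + y \<in> I" "\<And>r x. x \<in> I \<Longrightarrow> r * x \<in> I"
  shows "ideal I class_ring"
proof (rule idealI[OF ring_class_ring])
  show "subgroup I (add_monoid class_ring)"
  proof (rule group.subgroupI)
    show "group (add_monoid (class_ring :: 'a ring))"
      using abelian_group.a_group[OF ring.is_abelian_group[OF ring_class_ring]] .
    fix x assume "x \<in> I"
    then have "- 1 * x \<in> I" by (rule assms(3))
    moreover have "inv\<^bsub>add_monoid class_ring\<^esub> x = - x"
      using class_ring_simps(8) by (metis a_inv_def)
    ultimately show "inv\<^bsub>add_monoid class_ring\<^esub> x \<in> I" by simp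
  qed (use assms in auto)
  fix x r assume "x \<in> I"
  then show "r \<otimes>\<^bsub>class_ring\<^esub> x \<in> I" "x \<otimes>\<^bsub>class_ring\<^esub> r \<in> I"
    using assms(3)[of x r] by (simp_all add: mult.commute)
qed

lemma ideal_class_ringD:
  fixes I :: "'a::comm_ring_1 set"
  assumes "ideal I class_ring"
  shows "0 \<in> I" "x \<in> I \<Longrightarrow> y \<in> I \<Longrightarrow> x + y \<in> I" "x \<in> I \<Longrightarrow> r * x \<in> I"
  using additive_subgroup.zero_closed[OF ideal.axioms(1)[OF assms]]
    additive_subgroup.a_closed[OF ideal.axioms(1)[OF assms], of x y]
    ideal.I_l_closed[OF assms, of x r]
  by simp_all

lemma ideal_ge_ideal: "ideal (ideal_ge n) class_ring"
  by (rule ideal_class_ringI) (auto intro: ideal_ge_add ideal_ge_mult)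

lemma max_ideal_eq: "max_ideal = (ideal_ge 1 :: ('v::finite, 'k::field) mpoly set)"
proof
  show "max_ideal \<subseteq> (ideal_ge 1 :: ('v, 'k) mpoly set)"
    unfolding max_ideal_def genideal_def using ideal_ge_ideal var_in_ideal_ge by fastforce
  show "ideal_ge 1 \<subseteq> (max_ideal :: ('v, 'k) mpoly set)"
    unfolding max_ideal_def genideal_def
  proof (intro subsetI InterI, clarify)
    fix p :: "('v, 'k) mpoly" and I :: "('v, 'k) mpoly set" assume p: "p \<in> ideal_ge 1"
      and I: "ideal I class_ring" "range (\<lambda>v. Poly_Mapping.single (Poly_Mapping.single v 1) 1) \<subseteq> I"
    obtain q where q: "p = (\<Sum>v\<in>UNIV. var v * q v)"
      using p by (auto elim: ideal_ge_Suc_decompose[of p 0])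
    have "q v * var v \<in> I" for v using I(2) by (intro ideal_class_ringD(3)[OF I(1)]) auto
    then have v: "var v * q v \<in> I" for v by (simp add: mult.commute)
    have "(\<Sum>v\<in>A. var v * q v) \<in> I" for A :: "'v set"
      by (induction A rule: infinite_finite_induct) (auto intro: ideal_class_ringD[OF I(1)] v)
    then show "p \<in> I" using q by simp
  qed
qed

text \<open>From here on membership in \<open>\<nn>\<^sup>n\<close> is a condition on monomials. The
  inductive step is the splitting along the variables.\<close>

lemma max_ideal_pow_eq: "max_ideal_pow n = (ideal_ge n :: ('v::finite, 'k::field) mpoly set)"
proof (induction n)
  case 0
  show ?case by (auto simp: max_ideal_pow_def ideals_set_def ideal_ge_def nat_pow_def)
next
  case (Suc n)
  have "max_ideal_pow (Suc n) = ideal_prod class_ring (ideal_ge n) (ideal_ge 1 :: ('v, 'k) mpoly set)"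
    using Suc by (simp add: max_ideal_pow_def max_ideal_eq nat_pow_def ideals_set_def)
  also have "\<dots> = ideal_ge (Suc n)"
  proof (intro equalityI subsetI)
    fix p :: "('v, 'k) mpoly" assume "p \<in> ideal_prod class_ring (ideal_ge n) (ideal_ge 1)"
    then show "p \<in> ideal_ge (Suc n)"
    proof (induction rule: ideal_prod.induct)
      case (prod i j)
      then show ?case using ideal_ge_mult2[of i n j 1] by simp
    next
      case (sum s t)
      then show ?case by (simp add: ideal_ge_add)
    qed
  next
    fix p :: "('v, 'k) mpoly" assume "p \<in> ideal_ge (Suc n)"
    then obtain q where q: "p = (\<Sum>v\<in>UNIV. var v * q v)" "\<And>v. q v \<in> ideal_ge n"
      by (rule ideal_ge_Suc_decompose) blast
    let ?I = "ideal_prod class_ring (ideal_ge n) (ideal_ge 1) :: ('v, 'k) mpoly set"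
    have v: "var v * q v \<in> ?I" for v
      using ideal_prod.prod[OF q(2)[of v] var_in_ideal_ge, of class_ring v] by (simp add: mult.commute)
    have z: "0 \<in> ?I" using ideal_prod.prod[of 0 "ideal_ge n" 0 "ideal_ge 1" class_ring] by simp
    have "(\<Sum>v\<in>A. var v * q v) \<in> ?I" for A :: "'v set"
    proof (induction A rule: infinite_finite_induct)
      case (insert v A)
      then show ?case using ideal_prod.sum[OF v[of v] insert.IH] by simp
    qed (use z in simp_all)
    then show "p \<in> ?I" using q by simp
  qed
  finally show ?case .
qed

lemma proj_def': "proj n p = (\<lambda>q. q + p) ` (ideal_ge n :: ('v::finite, 'k::field) mpoly set)"
  by (auto simp: proj_def max_ideal_pow_eq a_r_coset_def r_coset_def)

lemma proj_eq_iff: "proj n p = proj n q \<longleftrightarrow> p - q \<in> ideal_ge n"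
proof
  assume "proj n p = proj n q"
  then have "0 + p \<in> proj n q" unfolding proj_def' by (metis ideal_ge_zero imageI)
  then show "p - q \<in> ideal_ge n" by (auto simp: proj_def')
next
  assume pq: "p - q \<in> ideal_ge n"
  show "proj n p = proj n q"
  proof (intro equalityI subsetI)
    fix x assume "x \<in> proj n p"
    then obtain i where "i \<in> ideal_ge n" "x = (i + (p - q)) + q" by (auto simp: proj_def')
    then show "x \<in> proj n q" using ideal_ge_add[OF _ pq] unfolding proj_def' by blast
  next
    fix x assume "x \<in> proj n q"
    then obtain i where "i \<in> ideal_ge n" "x = (i - (p - q)) + p" by (auto simp: proj_def')
    then show "x \<in> proj n p" using ideal_ge_diff[OF _ pq] unfolding proj_def' by blast
  qed
qed

lemma in_proj_iff: "q \<in> proj n p \<longleftrightarrow> q - p \<in> ideal_ge n"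
proof
  assume "q - p \<in> ideal_ge n"
  then have "(q - p) + p \<in> proj n p" unfolding proj_def' by (rule imageI)
  then show "q \<in> proj n p" by simp
qed (auto simp: proj_def')

lemma truncated_ring_simps:
  "carrier (truncated_ring n) = range (proj n)"
  "\<zero>\<^bsub>truncated_ring n\<^esub> = proj n 0"
  "\<one>\<^bsub>truncated_ring n\<^esub> = proj n 1"
  "proj n p \<oplus>\<^bsub>truncated_ring n\<^esub> proj n q = proj n (p + q)"
  "proj n p \<otimes>\<^bsub>truncated_ring n\<^esub> proj n q = proj n (p * q)"
proof -
  note I = ideal_ge_ideal[of n, folded max_ideal_pow_eq]
  show "carrier (truncated_ring n) = range (proj n)"
    by (auto simp: truncated_ring_def FactRing_def A_RCOSETS_def RCOSETS_def proj_def a_r_coset_def)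
  show "\<zero>\<^bsub>truncated_ring n\<^esub> = proj n 0"
    by (auto simp: truncated_ring_def FactRing_def proj_def' max_ideal_pow_eq)
  show "\<one>\<^bsub>truncated_ring n\<^esub> = proj n 1"
    by (auto simp: truncated_ring_def FactRing_def proj_def)
  show "proj n p \<oplus>\<^bsub>truncated_ring n\<^esub> proj n q = proj n (p + q)"
    using ideal.a_rcos_sum[OF I, of p q] by (simp add: truncated_ring_def FactRing_def proj_def)
  show "proj n p \<otimes>\<^bsub>truncated_ring n\<^esub> proj n q = proj n (p * q)"
    using ideal.rcoset_mult_add[OF I, of p q] by (simp add: truncated_ring_def FactRing_def proj_def)
qed

lemma cring_truncated_ring: "cring (truncated_ring n :: ('v::finite, 'k::field) mpoly set ring)"
  unfolding truncated_ring_def max_ideal_pow_eq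
  by (rule ideal.quotient_is_cring[OF ideal_ge_ideal cring_class_ring])

text \<open>The inverse is a truncated geometric series.\<close>

lemma unit_mod_ideal_ge:
  fixes p :: "('v::finite, 'k::field) mpoly"
  assumes "Poly_Mapping.lookup p 0 \<noteq> 0"
  obtains u where "u * p - 1 \<in> ideal_ge n"
proof -
  define c where "c = Poly_Mapping.lookup p 0"
  define e where "e = Poly_Mapping.single (0 :: 'v \<Rightarrow>\<^sub>0 nat) (inverse c)"
  define q where "q = 1 - e * p"
  have "q \<in> ideal_ge 1"
    by (rule ideal_geI) (use assms in \<open>simp add: q_def e_def c_def lookup_minus lookup_one\<close>)
  then have "q ^ n \<in> ideal_ge n"
  proof (induction n)
    case (Suc n)
    then show ?case using ideal_ge_mult2[of q 1 "q ^ n" n] by simp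
  qed (simp add: ideal_ge_def)
  moreover have "(\<Sum>i<n. q ^ i) * e * p = 1 - q ^ n"
    using one_diff_power_eq[of q n] by (simp add: q_def algebra_simps)
  ultimately have "(\<Sum>i<n. q ^ i) * e * p - 1 \<in> ideal_ge n"
    using ideal_ge_uminus by fastforce
  then show ?thesis by (rule that)
qed

section \<open>Free modules as function spaces\<close>

text \<open>The function spaces are extensional, with \<open>undefined\<close> beyond the rank,
  while \<open>free\<close> uses 0 there; \<open>res\<close> and \<open>zext\<close> translate
  between the two.\<close>

definition res :: "nat \<Rightarrow> (nat \<Rightarrow> 'a) \<Rightarrow> nat \<Rightarrow> 'a" where
  "res c x = restrict x {..<c}"

definition zext :: "nat \<Rightarrow> (nat \<Rightarrow> 'a::zero) \<Rightarrow> nat \<Rightarrow> 'a" where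
  "zext c y = (\<lambda>i. if i < c then y i else 0)"

lemma free_module_simps:
  "carrier (free_module R c) = {..<c} \<rightarrow>\<^sub>E carrier R"
  "\<zero>\<^bsub>free_module R c\<^esub> = res c (\<lambda>_. \<zero>\<^bsub>R\<^esub>)"
  "x \<oplus>\<^bsub>free_module R c\<^esub> y = res c (\<lambda>i. x i \<oplus>\<^bsub>R\<^esub> y i)"
  "r \<odot>\<^bsub>free_module R c\<^esub> x = res c (\<lambda>i. r \<otimes>\<^bsub>R\<^esub> x i)"
  if "ring R" for R (structure)
  using that by (auto simp: ring.func_space_def res_def)

lemmas free_simps = free_module_simps[OF ring_class_ring, simplified]

lemma module_free_module: "cring R \<Longrightarrow> Module.module R (free_module R c)"
  by (rule cring.func_space_is_module)

lemma res_carrier: "res c (x :: nat \<Rightarrow> 'a::comm_ring_1) \<in> carrier (free_module class_ring c)"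
  by (simp add: free_simps res_def)

lemma zext_free: "zext c y \<in> free c"
  by (simp add: zext_def free_def)

lemma zext_res: "x \<in> free c \<Longrightarrow> zext c (res c x) = x"
  by (auto simp: zext_def res_def free_def)

lemma res_zext: "y \<in> carrier (free_module class_ring c) \<Longrightarrow> res c (zext c y) = (y :: nat \<Rightarrow> 'a::comm_ring_1)"
  by (auto simp: zext_def res_def free_simps PiE_def extensional_def restrict_def fun_eq_iff)

lemma res_ops:
  fixes x y :: "nat \<Rightarrow> ('v::finite, 'k::field) mpoly"
  shows "res c (x + y) = res c x \<oplus>\<^bsub>free_module class_ring c\<^esub> res c y"
  "res c (smul r x) = r \<odot>\<^bsub>free_module class_ring c\<^esub> res c x"
  "res c 0 = \<zero>\<^bsub>free_module class_ring c :: (('v, 'k) mpoly, nat \<Rightarrow> ('v, 'k) mpoly) module\<^esub>"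
  by (auto simp: free_simps res_def smul_def)

lemma zext_ops:
  fixes x y :: "nat \<Rightarrow> ('v::finite, 'k::field) mpoly"
  shows "zext c (x \<oplus>\<^bsub>free_module class_ring c\<^esub> y) = zext c x + zext c y"
  "zext c (r \<odot>\<^bsub>free_module class_ring c\<^esub> x) = smul r (zext c x)"
  "zext c \<zero>\<^bsub>free_module class_ring c :: (('v, 'k) mpoly, nat \<Rightarrow> ('v, 'k) mpoly) module\<^esub> = 0"
  by (auto simp: free_simps res_def zext_def smul_def)

lemma res_eq_iff: "x \<in> free c \<Longrightarrow> y \<in> free c \<Longrightarrow> res c x = res c y \<longleftrightarrow> x = y"
  by (metis zext_res)

lemma res_image: "res c ` free c = carrier (free_module class_ring c :: (('v::finite, 'k::field) mpoly, nat \<Rightarrow> ('v, 'k) mpoly) module)"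
  using res_carrier res_zext zext_free by (blast intro: sym)

lemma zext_image_Collect:
  "zext c ` {y \<in> carrier (free_module class_ring c). Q y} = {x \<in> free c. Q (res c (x :: nat \<Rightarrow> ('v::finite, 'k::field) mpoly))}"
proof (intro equalityI subsetI)
  fix x :: "nat \<Rightarrow> ('v, 'k) mpoly" assume x: "x \<in> {x \<in> free c. Q (res c x)}"
  then have "x = zext c (res c x)" by (simp add: zext_res)
  then show "x \<in> zext c ` {y \<in> carrier (free_module class_ring c). Q y}"
    using x res_carrier by blast
qed (auto simp: zext_free res_zext)

lemma zext_eq_0_iff:
  fixes y :: "nat \<Rightarrow> ('v::finite, 'k::field) mpoly"
  assumes "y \<in> carrier (free_module class_ring c)"
  shows "zext c y = 0 \<longleftrightarrow> y = \<zero>\<^bsub>free_module class_ring c\<^esub>"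
  using res_zext[OF assms] res_ops(3)[of c] zext_ops(3)[of c] by metis

lemma homogeneous_iff: "homogeneous t p \<longleftrightarrow> (\<forall>m. Poly_Mapping.lookup p m \<noteq> 0 \<longrightarrow> int (mdeg m) = t)"
  unfolding homogeneous_def mdeg_def by (auto simp: in_keys_iff)

lemma ideal_smult_subset:
  assumes "x \<in> ideal_smult class_ring max_ideal (free_module class_ring c)" "j < c"
  shows "Poly_Mapping.lookup (x j :: ('v::finite, 'k::field) mpoly) 0 = 0"
proof -
  let ?M = "free_module class_ring c :: (('v, 'k) mpoly, nat \<Rightarrow> ('v, 'k) mpoly) module"
  let ?N = "{x \<in> carrier ?M. \<forall>j<c. x j \<in> ideal_ge 1}"
  interpret M: Module.module class_ring ?M by (rule module_free_module[OF cring_class_ring])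
  have N: "submodule class_ring ?N ?M"
    by (rule submodule.intro, rule M.module_axioms)
      (auto simp: free_simps res_def ideal_ge_add ideal_ge_mult)
  have "M.span {a \<odot>\<^bsub>?M\<^esub> x | a x. a \<in> max_ideal \<and> x \<in> carrier ?M} \<subseteq> ?N"
  proof (rule M.span_is_subset[OF _ N], clarify)
    fix a :: "('v, 'k) mpoly" and x assume "a \<in> max_ideal" "x \<in> carrier ?M"
    then show "a \<odot>\<^bsub>?M\<^esub> x \<in> carrier ?M \<and> (\<forall>j<c. (a \<odot>\<^bsub>?M\<^esub> x) j \<in> ideal_ge 1)"
      using ideal_ge_mult[of a 1] by (auto simp: free_simps res_def max_ideal_eq mult.commute[of a])
  qed
  then have "x j \<in> ideal_ge 1" using assms unfolding ideal_smult_def by blast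
  then show ?thesis by (rule ideal_geD) simp
qed

section \<open>Minimal graded free resolutions over the polynomial ring\<close>

text \<open>The point is that minimality forces \<open>b 0 = 1\<close> and degree 0 for the
  generator. As R is local and cyclic, one basis vector maps to a unit; any second one would yield a
  relation with a constant entry.\<close>

lemma minimal_graded_free_resolutionD:
  fixes \<epsilon> :: "(nat \<Rightarrow> ('v::finite, 'k::field) mpoly) \<Rightarrow> ('v, 'k) mpoly set"
  assumes res: "minimal_graded_free_resolution n b a \<epsilon> f" and n: "n \<ge> 1"
  shows "graded_resolution n b a (\<lambda>i x. if i = 0 then 0 else zext (b (i - 1)) (f i (res (b i) x)))"
    and "i \<ge> 1 \<Longrightarrow> f i ` carrier (free_module class_ring (b i)) \<subseteq> carrier (free_module class_ring (b (i - 1)))"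
    and "i \<ge> 1 \<Longrightarrow> carrier (syzygy class_ring (truncated_ring_module n) b \<epsilon> f i) =
      f i ` carrier (free_module class_ring (b i))"
proof -
  let ?S = "class_ring :: ('v, 'k) mpoly ring"
  let ?E = "\<lambda>i. free_module ?S (b i)"
  let ?R = "truncated_ring_module n :: (('v, 'k) mpoly, ('v, 'k) mpoly set) module"
  \<comment> \<open>Index 0 gets the zero map: linearity is demanded for every index, the other
    conditions only from 1 on.\<close>
  let ?F = "\<lambda>i x. if i = 0 then 0 else zext (b (i - 1)) (f i (res (b i) x))"
  have fr: "free_resolution ?S ?R b \<epsilon> f" and
    eg: "\<And>t. \<epsilon> ` free_component (b 0) (a 0) t \<subseteq> proj n ` {p. homogeneous t p}" and
    fg: "\<And>i t. i \<ge> 1 \<Longrightarrow> f i ` free_component (b i) (a i) t \<subseteq> free_component (b (i - 1)) (a (i - 1)) t" and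
    fm: "\<And>i. i \<ge> 1 \<Longrightarrow> f i ` carrier (?E i) \<subseteq> ideal_smult ?S max_ideal (?E (i - 1))"
    using res unfolding minimal_graded_free_resolution_def by auto
  have eh: "\<epsilon> \<in> LinearCombinations.module_hom ?S (?E 0) ?R" and
    fh: "\<And>i. i \<ge> 1 \<Longrightarrow> f i \<in> LinearCombinations.module_hom ?S (?E i) (?E (i - 1))" and
    es: "\<epsilon> ` carrier (?E 0) = carrier ?R" and
    e1: "f 1 ` carrier (?E 1) = a_kernel (?E 0) ?R \<epsilon>" and
    ei: "\<And>i. i \<ge> 1 \<Longrightarrow> f (i + 1) ` carrier (?E (i + 1)) = a_kernel (?E i) (?E (i - 1)) (f i)"
    using fr unfolding free_resolution_def by auto
  have fc: "f i x \<in> carrier (?E (i - 1))" if "i \<ge> 1" "x \<in> carrier (?E i)" for i x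
    by (rule funcset_mem[OF module_hom_closed[OF fh[OF that(1)]] that(2)])
  show "i \<ge> 1 \<Longrightarrow> f i ` carrier (?E i) \<subseteq> carrier (?E (i - 1))" for i using fc by blast
  have fadd: "f i (x \<oplus>\<^bsub>?E i\<^esub> y) = f i x \<oplus>\<^bsub>?E (i - 1)\<^esub> f i y"
    if "i \<ge> 1" "x \<in> carrier (?E i)" "y \<in> carrier (?E i)" for i x y
    by (rule LinearCombinations.module_hom_add[OF fh[OF that(1)] that(2,3)])
  have fsm: "f i (r \<odot>\<^bsub>?E i\<^esub> x) = r \<odot>\<^bsub>?E (i - 1)\<^esub> f i x"
    if "i \<ge> 1" "x \<in> carrier (?E i)" for i x r
    by (rule module_hom_smult[OF fh[OF that(1)] _ that(2)]) simp
  have eadd: "\<epsilon> (res (b 0) (x + y)) = \<epsilon> (res (b 0) x) \<oplus>\<^bsub>?R\<^esub> \<epsilon> (res (b 0) y)" for x y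
    unfolding res_ops by (rule LinearCombinations.module_hom_add[OF eh res_carrier res_carrier])
  have esm: "\<epsilon> (res (b 0) (smul r x)) = r \<odot>\<^bsub>?R\<^esub> \<epsilon> (res (b 0) x)" for r x
    unfolding res_ops by (rule module_hom_smult[OF eh _ res_carrier]) simp
  have Rc: "carrier ?R = range (proj n)" and R0: "\<zero>\<^bsub>?R\<^esub> = proj n 0" and
    Radd: "proj n p \<oplus>\<^bsub>?R\<^esub> proj n q = proj n (p + q)" and
    Rsm: "r \<odot>\<^bsub>?R\<^esub> proj n p = proj n (r * p)" for p q r
    by (auto simp: truncated_ring_module_def restrict_scalars_def regular_module_def truncated_ring_simps)
  show "i \<ge> 1 \<Longrightarrow> carrier (syzygy ?S ?R b \<epsilon> f i) = f i ` carrier (?E i)" for i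
  proof -
    assume i: "i \<ge> 1"
    show ?thesis
    proof (cases "i = 1")
      case True
      then show ?thesis using e1 by (simp add: syzygy_def)
    next
      case False
      then have i': "i = (i - 1) + 1" "i - 1 \<ge> 1" "i - 1 - 1 = i - 2" using i by auto
      have "carrier (syzygy ?S ?R b \<epsilon> f i) = a_kernel (?E (i - 1)) (?E (i - 2)) (f (i - 1))"
        using False by (simp add: syzygy_def)
      also have "\<dots> = f (i - 1 + 1) ` carrier (?E (i - 1 + 1))" unfolding ei[OF i'(2)] i'(3) ..
      finally show ?thesis unfolding i'(1)[symmetric] .
    qed
  qed

  \<comment> \<open>Choosing polynomials P_j that represent the images of the basis vectors turns
    \<epsilon> into the explicit map sending x to the class of the sum of all x_j P_j.\<close>
  define ev where "ev j = (\<lambda>i. if i = j then 1 else 0 :: ('v, 'k) mpoly)" for j :: nat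
  have "\<exists>p. \<epsilon> (res (b 0) (ev j)) = proj n p" for j
  proof -
    have "\<epsilon> (res (b 0) (ev j)) \<in> \<epsilon> ` carrier (?E 0)" by (rule imageI[OF res_carrier])
    then have "\<epsilon> (res (b 0) (ev j)) \<in> range (proj n)" by (simp only: es Rc)
    then show ?thesis by (elim rangeE) (rule exI)
  qed
  then have "\<exists>P. \<forall>j. \<epsilon> (res (b 0) (ev j)) = proj n (P j)" by (intro choice allI)
  then obtain P where P: "\<And>j. \<epsilon> (res (b 0) (ev j)) = proj n (P j)" by blast
  have eps: "\<epsilon> (res (b 0) x) = proj n (\<Sum>j<b 0. x j * P j)" for x
  proof -
    have z: "\<epsilon> (res (b 0) 0) = proj n 0"
    proof -
      have "\<epsilon> (res (b 0) 0) \<in> \<epsilon> ` carrier (?E 0)" by (rule imageI[OF res_carrier])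
      then have "\<epsilon> (res (b 0) 0) \<in> range (proj n)" by (simp only: es Rc)
      then obtain p where "\<epsilon> (res (b 0) 0) = proj n p" by (elim rangeE)
      then show ?thesis using esm[of 0 0] by (simp add: Rsm)
    qed
    have A: "\<epsilon> (res (b 0) (\<Sum>j\<in>A. smul (x j) (ev j))) = proj n (\<Sum>j\<in>A. x j * P j)" if "finite A" for A
      using that
      by (rule finite_induct[of A "\<lambda>A. \<epsilon> (res (b 0) (\<Sum>j\<in>A. smul (x j) (ev j))) = proj n (\<Sum>j\<in>A. x j * P j)"])
        (simp_all add: z eadd esm P Rsm Radd)
    have B: "res (b 0) (\<Sum>j<b 0. smul (x j) (ev j)) = res (b 0) x"
      unfolding res_def
    proof (rule restrict_ext)
      fix i assume "i \<in> {..<b 0}"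
      then have "(\<Sum>j<b 0. smul (x j) (ev j)) i = (\<Sum>j<b 0. if j = i then x i else 0)"
        unfolding sum_fun_apply by (intro sum.cong) (auto simp: smul_def ev_def)
      then show "(\<Sum>j<b 0. smul (x j) (ev j)) i = x i" using \<open>i \<in> {..<b 0}\<close> by simp
    qed
    show ?thesis using A[OF finite_lessThan[of "b 0"]] unfolding B .
  qed
  have ker_min: "Poly_Mapping.lookup (x j) 0 = 0"
    if x: "(\<Sum>j<b 0. x j * P j) \<in> ideal_ge n" and j: "j < b 0" for x j
  proof -
    have "\<epsilon> (res (b 0) x) = \<zero>\<^bsub>?R\<^esub>" using x unfolding eps R0 proj_eq_iff by simp
    then have "res (b 0) x \<in> f 1 ` carrier (?E 1)" unfolding e1 by (simp add: a_kernel_def' res_carrier)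
    then have "res (b 0) x \<in> ideal_smult ?S max_ideal (?E 0)" using fm[of 1] by auto
    from ideal_smult_subset[OF this j] show ?thesis using j by (simp add: res_def)
  qed
  obtain x1 where x1: "1 - (\<Sum>j<b 0. x1 j * P j) \<in> ideal_ge n"
  proof -
    have "proj n 1 \<in> \<epsilon> ` carrier (?E 0)" unfolding es Rc by simp
    then obtain y where "y \<in> carrier (?E 0)" "\<epsilon> y = proj n 1" by auto
    then have "proj n 1 = proj n (\<Sum>j<b 0. zext (b 0) y j * P j)" using eps[of "zext (b 0) y"] by (simp add: res_zext)
    then have "1 - (\<Sum>j<b 0. zext (b 0) y j * P j) \<in> ideal_ge n" by (rule proj_eq_iff[THEN iffD1])
    then show ?thesis by (rule that)
  qed
  \<comment> \<open>If every P_j were in \<nn>, the class of 1 would not be in the image of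
    \<epsilon>.\<close>
  have "\<exists>j0<b 0. Poly_Mapping.lookup (P j0) 0 \<noteq> 0"
  proof (rule ccontr)
    assume "\<not> ?thesis"
    then have "P j \<in> ideal_ge 1" if "j < b 0" for j using that by (auto intro: ideal_geI)
    then have "(\<Sum>j<b 0. x1 j * P j) \<in> ideal_ge 1" by (intro ideal_ge_sum ideal_ge_mult) auto
    then have "Poly_Mapping.lookup (1 - (\<Sum>j<b 0. x1 j * P j)) 0 = 1"
      by (simp add: lookup_minus ideal_geD lookup_one)
    then show False using ideal_geD[OF x1, of 0] n by simp
  qed
  then obtain j0 where j0: "j0 < b 0" "Poly_Mapping.lookup (P j0) 0 \<noteq> 0" by blast
  obtain u where u: "u * P j0 - 1 \<in> ideal_ge n" using unit_mod_ideal_ge[OF j0(2)] by blast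
  have uniq: "j = j0" if j: "j < b 0" for j
  proof (rule ccontr)
    assume ne: "j \<noteq> j0"
    \<comment> \<open>With u inverse to P_j0, the vector e_j - P_j u e_j0 lies in the kernel of
      \<epsilon> and has the entry 1.\<close>
    let ?x = "\<lambda>i. if i = j then 1 else if i = j0 then - (P j * u) else 0"
    have "(\<Sum>i<b 0. ?x i * P i) = (\<Sum>i\<in>{j, j0}. ?x i * P i)"
      using j j0 by (intro sum.mono_neutral_right) auto
    also have "\<dots> = - (P j * (u * P j0 - 1))" using ne by (simp add: algebra_simps)
    also have "\<dots> \<in> ideal_ge n" by (intro ideal_ge_uminus ideal_ge_mult u)
    finally have "Poly_Mapping.lookup (?x j) 0 = 0" by (rule ker_min[OF _ j])
    then show False by (simp add: lookup_one)
  qed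
  have b0: "b 0 = 1"
  proof -
    have "{..<b 0} = {j0}" using uniq j0(1) by blast
    from arg_cong[OF this, of card] show ?thesis by simp
  qed
  have j00: "j0 = 0" using j0(1) b0 by simp
  have a0: "a 0 0 = 0"
  proof -
    have "res (b 0) (ev 0) \<in> free_component (b 0) (a 0) (a 0 0)"
      unfolding free_component_def
      by (intro CollectI conjI res_carrier) (auto simp: b0 res_def ev_def homogeneous_iff lookup_one when_def)
    then have "\<epsilon> (res (b 0) (ev 0)) \<in> proj n ` {p. homogeneous (a 0 0) p}" using eg by blast
    then obtain p where p: "proj n (P 0) = proj n p" "homogeneous (a 0 0) p" unfolding P by blast
    \<comment> \<open>\<open>p\<close> and \<open>P 0\<close> agree below degree n, in particular in
      the nonzero constant term, so the homogeneous \<open>p\<close> has degree 0.\<close>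
    have "Poly_Mapping.lookup p 0 = Poly_Mapping.lookup (P 0) 0"
      using ideal_geD[of "P 0 - p" n 0] p(1) n by (simp add: proj_eq_iff lookup_minus)
    then show ?thesis using p(2)[unfolded homogeneous_iff, rule_format, of 0] j0(2) j00 by simp
  qed
  show "graded_resolution n b a ?F"
  proof
    show "n \<ge> 1" "b 0 = 1" "a 0 0 = 0" by (fact n b0 a0)+
    fix i :: nat and x y r
    show "?F i (x + y) = ?F i x + ?F i y"
      by (simp add: res_ops fadd res_carrier zext_ops del: One_nat_def)
    show "?F i (smul r x) = smul r (?F i x)"
      by (simp add: res_ops fsm res_carrier zext_ops del: One_nat_def)
  next
    fix i :: nat and x j assume i: "i \<ge> 1"
    show "?F i x \<in> free (b (i - 1))" using i zext_free by simp
    have "f i (res (b i) x) \<in> ideal_smult ?S max_ideal (?E (i - 1))"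
      using fm[OF i] res_carrier by blast
    then show "Poly_Mapping.lookup (?F i x j) 0 = 0"
      using i ideal_smult_subset[of "f i (res (b i) x)" "b (i - 1)" j] by (auto simp: zext_def)
  next
    fix i :: nat and x :: "nat \<Rightarrow> ('v, 'k) mpoly" and t assume i: "i \<ge> 1"
      and x: "x \<in> coord_space {(j, m). j < b i \<and> int (mdeg m) + a i j = t}"
    have "homogeneous (t - a i j) (x j)" if "j < b i" for j
      unfolding homogeneous_iff
    proof (intro allI impI)
      fix m assume "Poly_Mapping.lookup (x j) m \<noteq> 0"
      then have "(j, m) \<in> {(j, m). j < b i \<and> int (mdeg m) + a i j = t}" using x unfolding coord_space_def by blast
      then show "int (mdeg m) = t - a i j" by auto
    qed
    then have "res (b i) x \<in> free_component (b i) (a i) t"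
      unfolding free_component_def by (intro CollectI conjI res_carrier) (auto simp: res_def)
    then have fx: "f i (res (b i) x) \<in> free_component (b (i - 1)) (a (i - 1)) t"
      using fg[OF i] by blast
    have "(j, m) \<in> {(j, m). j < b (i - 1) \<and> int (mdeg m) + a (i - 1) j = t}"
      if nz: "Poly_Mapping.lookup (?F i x j) m \<noteq> 0" for j m
    proof -
      have j: "j < b (i - 1)" "Poly_Mapping.lookup (f i (res (b i) x) j) m \<noteq> 0"
        using nz i by (auto simp: zext_def split: if_splits)
      then have "int (mdeg m) = t - a (i - 1) j"
        using fx unfolding free_component_def homogeneous_iff by blast
      then show ?thesis using j by simp
    qed
    then show "?F i x \<in> coord_space {(j, m). j < b (i - 1) \<and> int (mdeg m) + a (i - 1) j = t}"
      unfolding coord_space_def by blast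
  next
    have eq: "\<epsilon> (res (b 0) x) = proj n (x 0 * P 0)" for x using eps[of x] b0 by simp
    \<comment> \<open>\<open>P 0\<close> is invertible modulo \<open>\<nn>\<^sup>n\<close>, hence
      the kernel of \<epsilon> is exactly \<open>\<nn>\<^sup>n\<close>.\<close>
    have unit: "p * P 0 \<in> ideal_ge n \<longleftrightarrow> p \<in> ideal_ge n" for p
    proof
      assume "p * P 0 \<in> ideal_ge n"
      then have "u * (p * P 0) - p * (u * P 0 - 1) \<in> ideal_ge n"
        using ideal_ge_diff[OF ideal_ge_mult[of "p * P 0" n u] ideal_ge_mult[of _ n p]] u unfolding j00 by blast
      then show "p \<in> ideal_ge n" by (simp add: algebra_simps)
    qed (metis ideal_ge_mult mult.commute)
    have "?F 1 ` free (b 1) = zext 1 ` f 1 ` res (b 1) ` free (b 1)"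
      using b0 by (simp add: image_image)
    also have "res (b 1) ` free (b 1) = carrier (?E 1)" by (rule res_image)
    also have "f 1 ` carrier (?E 1) = {y \<in> carrier (?E 0). \<epsilon> y = proj n 0}"
      unfolding e1 a_kernel_def' R0 ..
    also have "zext 1 ` {y \<in> carrier (?E 0). \<epsilon> y = proj n 0} = {x \<in> free 1. \<epsilon> (res 1 x) = proj n 0}"
      unfolding b0 by (rule zext_image_Collect)
    also have "\<dots> = free_ge 1 n"
    proof -
      have "\<epsilon> (res 1 x) = proj n 0 \<longleftrightarrow> x 0 \<in> ideal_ge n" for x
        using eq[of x] by (simp only: b0 proj_eq_iff diff_zero unit)
      moreover have "x 0 \<in> ideal_ge n \<longleftrightarrow> (\<forall>i. x i \<in> ideal_ge n)" if "x \<in> free 1" for x :: "nat \<Rightarrow> ('v, 'k) mpoly"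
      proof
        assume "x 0 \<in> ideal_ge n"
        moreover have "x i = 0" if "i \<noteq> 0" for i using \<open>x \<in> free 1\<close> that by (simp add: free_def)
        ultimately show "\<forall>i. x i \<in> ideal_ge n" using ideal_ge_zero by metis
      qed blast
      ultimately show ?thesis unfolding free_ge_def by blast
    qed
    finally show "?F 1 ` free (b 1) = free_ge 1 n" .
  next
    fix i :: nat assume i: "i \<ge> 1"
    have "?F (i + 1) ` free (b (i + 1)) = zext (b i) ` f (i + 1) ` res (b (i + 1)) ` free (b (i + 1))"
      by (simp add: image_image)
    also have "res (b (i + 1)) ` free (b (i + 1)) = carrier (?E (i + 1))" by (rule res_image)
    also have "f (i + 1) ` carrier (?E (i + 1)) = {y \<in> carrier (?E i). f i y = \<zero>\<^bsub>?E (i - 1)\<^esub>}"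
      unfolding ei[OF i] a_kernel_def' ..
    also have "zext (b i) ` \<dots> = {x \<in> free (b i). f i (res (b i) x) = \<zero>\<^bsub>?E (i - 1)\<^esub>}"
      by (rule zext_image_Collect)
    also have "\<dots> = {x \<in> free (b i). ?F i x = 0}"
      using i zext_eq_0_iff[OF fc[OF i res_carrier]] by auto
    finally show "?F (i + 1) ` free (b (i + 1)) = {x \<in> free (b i). ?F i x = 0}" .
  qed
qed

lemma finsum_res:
  fixes B :: "(nat \<Rightarrow> ('v::finite, 'k::field) mpoly) set"
  assumes "B \<subseteq> free c" "finite B"
  shows "LinearCombinations.module.lincomb (free_module class_ring c) p (res c ` B) = res c (lincomb_of B (\<lambda>y. p (res c y)))"
proof -
  let ?M = "free_module class_ring c :: (('v, 'k) mpoly, nat \<Rightarrow> ('v, 'k) mpoly) module"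
  interpret M: Module.module class_ring ?M by (rule module_free_module[OF cring_class_ring])
  show ?thesis
    using assms(2,1)
  proof (induction B rule: finite_induct)
    case empty
    have "lincomb_of {} (\<lambda>y. p (res c y)) = 0" by (simp add: lincomb_of_def)
    then show ?case by (simp only: image_empty res_ops(3)) (simp add: M.lincomb_def)
  next
    case (insert x B)
    have x: "res c x \<notin> res c ` B" using insert.hyps insert.prems res_eq_iff[of x c] by blast
    have sub: "res c ` B \<subseteq> carrier ?M" using res_carrier by blast
    have "M.lincomb p (insert (res c x) (res c ` B)) = p (res c x) \<odot>\<^bsub>?M\<^esub> res c x \<oplus>\<^bsub>?M\<^esub> M.lincomb p (res c ` B)"
      using M.lincomb_insert[OF _ sub, of p "res c x"] insert.hyps x res_carrier[of c x] by simp
    also have "\<dots> = res c (smul (p (res c x)) x + lincomb_of B (\<lambda>y. p (res c y)))"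
      using insert by (simp add: res_ops)
    also have "smul (p (res c x)) x + lincomb_of B (\<lambda>y. p (res c y)) = lincomb_of (insert x B) (\<lambda>y. p (res c y))"
      using insert.hyps by (simp add: lincomb_of_def)
    finally show ?case by simp
  qed
qed

lemma lin_dep_iff_not_free_family:
  fixes B :: "(nat \<Rightarrow> ('v::finite, 'k::field) mpoly) set"
  assumes B: "B \<subseteq> free c" "finite B"
  shows "LinearCombinations.module.lin_dep class_ring (free_module class_ring c) (res c ` B) \<longleftrightarrow> \<not> free_family B"
proof -
  let ?M = "free_module class_ring c :: (('v, 'k) mpoly, nat \<Rightarrow> ('v, 'k) mpoly) module"
  interpret M: Module.module class_ring ?M by (rule module_free_module[OF cring_class_ring])
  have sub: "res c ` B \<subseteq> carrier ?M" using res_carrier by blast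
  have fc: "lincomb_of B p \<in> free c" for p
    unfolding lincomb_of_def using B(1) by (intro free_sum free_smul) auto
  have lc: "M.lincomb p (res c ` B) = \<zero>\<^bsub>?M\<^esub> \<longleftrightarrow> lincomb_of B (\<lambda>y. p (res c y)) = 0" for p
    unfolding finsum_res[OF B] res_ops(3)[symmetric] using res_eq_iff[OF fc free_zero] by blast
  have inj: "inj_on (res c) B" using B(1) res_eq_iff[of _ c] by (intro inj_onI) blast
  show ?thesis
  proof
    assume "M.lin_dep (res c ` B)"
    then obtain p v where p: "M.lincomb p (res c ` B) = \<zero>\<^bsub>?M\<^esub>" "v \<in> res c ` B" "p v \<noteq> 0"
      using M.finite_lin_dep[OF _ _ sub] B(2) by auto
    then show "\<not> free_family B" unfolding lc free_family_def by fastforce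
  next
    assume "\<not> free_family B"
    then obtain p x where p: "lincomb_of B p = 0" "x \<in> B" "p x \<noteq> 0" using B(2) by (auto simp: free_family_def)
    let ?p = "\<lambda>y. p (the_inv_into B (res c) y)"
    have "lincomb_of B (\<lambda>y. ?p (res c y)) = lincomb_of B p"
      unfolding lincomb_of_def by (intro sum.cong) (simp_all add: the_inv_into_f_f[OF inj])
    then have "M.lincomb ?p (res c ` B) = \<zero>\<^bsub>?M\<^esub>" using p(1) by (simp only: lc)
    then show "M.lin_dep (res c ` B)"
      using p(2,3) B(2) by (intro M.lin_dep_crit[of "res c ` B" _ ?p "res c x"]) (auto simp: the_inv_into_f_f[OF inj])
  qed
qed

theorem module_rank_syzygy:
  fixes \<epsilon> :: "(nat \<Rightarrow> ('v::finite, 'k::field) mpoly) \<Rightarrow> ('v, 'k) mpoly set"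
  assumes res: "minimal_graded_free_resolution n b a \<epsilon> f" and n: "n \<ge> 2" and d: "CARD('v) \<ge> 2"
  shows "int (module_rank class_ring (syzygy class_ring (truncated_ring_module n) b \<epsilon> f (CARD('v) - 1))) =
    int CARD('v) * int (hilb TYPE('v) (n - 1)) - int (hilb TYPE('v) (n - 2)) - int (hilb TYPE('v) (n - 1))"
proof -
  let ?F = "\<lambda>i x. if i = 0 then 0 else zext (b (i - 1)) (f i (res (b i) x))"
  have n1: "n \<ge> 1" using n by simp
  interpret g: graded_resolution n b a ?F by (rule minimal_graded_free_resolutionD(1)[OF assms(1) n1])
  define i where "i = CARD('v) - 1"
  have i: "i \<ge> 1" using d by (simp add: i_def)
  let ?c = "b (i - 1)"
  let ?M = "free_module class_ring ?c :: (('v, 'k) mpoly, nat \<Rightarrow> ('v, 'k) mpoly) module"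
  let ?Z = "syzygy class_ring (truncated_ring_module n) b \<epsilon> f i"
  have fc: "f i ` carrier (free_module class_ring (b i)) \<subseteq> carrier ?M"
    by (rule minimal_graded_free_resolutionD(2)[OF assms(1) n1 i])
  have car: "carrier ?Z = f i ` carrier (free_module class_ring (b i))"
    by (rule minimal_graded_free_resolutionD(3)[OF assms(1) n1 i])
  have Z: "?Z = ?M\<lparr>carrier := carrier ?Z\<rparr>" by (simp add: syzygy_def)
  have zs: "g.syz i = zext ?c ` carrier ?Z"
  proof -
    have "g.syz i = zext ?c ` f i ` res (b i) ` free (b i)"
      using i by (simp add: g.syz_def image_image)
    then show ?thesis by (simp only: res_image car)
  qed
  have rz: "res ?c ` g.syz i = carrier ?Z"
  proof -
    have "res ?c (zext ?c y) = y" if "y \<in> carrier ?Z" for y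
      using that fc car by (intro res_zext) auto
    then show ?thesis unfolding zs image_image by simp
  qed
  interpret M: Module.module class_ring ?M by (rule module_free_module[OF cring_class_ring])
  have sub: "submodule class_ring (carrier ?Z) ?M"
  proof (rule submodule.intro[OF M.module_axioms])
    show "carrier ?Z \<subseteq> carrier ?M" using fc car by simp
    show "\<zero>\<^bsub>?M\<^esub> \<in> carrier ?Z" unfolding rz[symmetric] res_ops(3)[symmetric] by (rule imageI[OF g.syz_zero])
    fix v w r assume "v \<in> carrier ?Z" "w \<in> carrier ?Z"
    then obtain x y where "x \<in> g.syz i" "y \<in> g.syz i" "v = res ?c x" "w = res ?c y" unfolding rz[symmetric] by blast
    then show "v \<oplus>\<^bsub>?M\<^esub> w \<in> carrier ?Z" "r \<odot>\<^bsub>?M\<^esub> v \<in> carrier ?Z"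
      unfolding rz[symmetric] by (simp_all add: res_ops(1,2)[symmetric] g.syz_add g.syz_smul imageI)
  qed
  \<comment> \<open>Dependence is moved to the ambient free module, where
    \<open>lin_dep_iff_not_free_family\<close> applies.\<close>
  have ld: "LinearCombinations.module.lin_dep class_ring ?Z B = M.lin_dep B" if "B \<subseteq> carrier ?Z" for B
    using M.span_li_not_depend(2)[OF that sub] Z by simp
  have fsyz: "x \<in> free ?c" if "x \<in> g.syz i" for x by (rule g.syz_free[OF i that])
  have inj: "inj_on (res ?c) (g.syz i)" using fsyz res_eq_iff[of _ ?c] by (intro inj_onI) blast
  have "(\<exists>B. finite B \<and> card B = r \<and> B \<subseteq> carrier ?Z \<and> \<not> LinearCombinations.module.lin_dep class_ring ?Z B) \<longleftrightarrow>
      (\<exists>B. card B = r \<and> free_family B \<and> B \<subseteq> g.syz i)" for r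
  proof
    assume "\<exists>B. finite B \<and> card B = r \<and> B \<subseteq> carrier ?Z \<and> \<not> LinearCombinations.module.lin_dep class_ring ?Z B"
    then obtain B where B: "finite B" "card B = r" "B \<subseteq> res ?c ` g.syz i" "\<not> M.lin_dep B" using ld unfolding rz by blast
    obtain C where C: "C \<subseteq> g.syz i" "B = res ?c ` C" using B(3) by (auto simp: subset_image_iff)
    have "inj_on (res ?c) C" by (rule inj_on_subset[OF inj C(1)])
    note injC = this
    have "finite C" by (rule finite_imageD[OF B(1)[unfolded C(2)] injC])
    moreover have "card C = r" using card_image[OF injC] B(2) unfolding C(2) by simp
    moreover have "free_family C"
      using lin_dep_iff_not_free_family[of C ?c] C fsyz B(4) \<open>finite C\<close> by blast
    ultimately show "\<exists>B. card B = r \<and> free_family B \<and> B \<subseteq> g.syz i" using C(1) by blast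
  next
    assume "\<exists>B. card B = r \<and> free_family B \<and> B \<subseteq> g.syz i"
    then obtain C where C: "card C = r" "free_family C" "C \<subseteq> g.syz i" by blast
    have fin: "finite C" using C(2) by (simp add: free_family_def)
    have "inj_on (res ?c) C" by (rule inj_on_subset[OF inj C(3)])
    then have "card (res ?c ` C) = r" using C(1) card_image by blast
    moreover have "\<not> M.lin_dep (res ?c ` C)"
      using lin_dep_iff_not_free_family[of C ?c] C fsyz fin by blast
    moreover have "res ?c ` C \<subseteq> carrier ?Z" using C(3) unfolding rz[symmetric] by (rule image_mono)
    ultimately show "\<exists>B. finite B \<and> card B = r \<and> B \<subseteq> carrier ?Z \<and> \<not> LinearCombinations.module.lin_dep class_ring ?Z B"
      using fin ld by blast
  qed
  then have "module_rank class_ring ?Z = (GREATEST r. \<exists>B. card B = r \<and> free_family B \<and> B \<subseteq> g.syz i)"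
    unfolding module_rank_def by presburger
  then show ?thesis using g.rank_syz[OF d n] unfolding i_def by (simp only:)
qed

section \<open>Dimensions of module records\<close>

text \<open>The bridge from module records to subspaces. The axioms for \<open>T\<close> are
  transported along the surjection \<open>h\<close>, and the part of a basis of \<open>V\<close>
  that extends a basis of the kernel maps to a basis of \<open>T\<close>.\<close>

lemma (in vecspace) dim_module_record:
  fixes T :: "('a, 't) module" and h :: "'b \<Rightarrow> 't"
  assumes V: "subspace V" "fd V"
    and onto: "h ` V = carrier T"
    and add: "\<And>x y. x \<in> V \<Longrightarrow> y \<in> V \<Longrightarrow> h (x + y) = h x \<oplus>\<^bsub>T\<^esub> h y"
    and sm: "\<And>c x. x \<in> V \<Longrightarrow> h (scale c x) = c \<odot>\<^bsub>T\<^esub> h x"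
    and zero: "h 0 = \<zero>\<^bsub>T\<^esub>"
  shows "dim V = dim {x \<in> V. h x = \<zero>\<^bsub>T\<^esub>} + vectorspace.dim class_ring T"
proof -
  let ?K = "{x \<in> V. h x = \<zero>\<^bsub>T\<^esub>}"
  note V0 = subspace_0[OF V(1)] and Vadd = subspace_add[OF V(1)] and Vsc = subspace_scale[OF V(1)]
  have hc: "h x \<in> carrier T" if "x \<in> V" for x using onto that by blast
  have ex: "\<exists>x\<in>V. t = h x" if "t \<in> carrier T" for t using that onto by blast
  have vs: "vectorspace class_ring T"
  proof (rule vs_criteria[OF class_field])
    show "\<zero>\<^bsub>T\<^esub> \<in> carrier T" using hc[OF V0] zero by simp
    show "\<forall>v w. v \<in> carrier T \<and> w \<in> carrier T \<longrightarrow> v \<oplus>\<^bsub>T\<^esub> w \<in> carrier T"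
      using ex hc Vadd add by metis
    show "\<forall>v\<in>carrier T. \<exists>w\<in>carrier T. v \<oplus>\<^bsub>T\<^esub> w = \<zero>\<^bsub>T\<^esub>"
    proof
      fix v assume "v \<in> carrier T"
      then obtain x where x: "x \<in> V" "v = h x" using ex by blast
      have "- x \<in> V" using subspace_neg[OF V(1) x(1)] .
      then show "\<exists>w\<in>carrier T. v \<oplus>\<^bsub>T\<^esub> w = \<zero>\<^bsub>T\<^esub>"
        using add[OF x(1), of "- x"] hc zero x(2) by (metis add.right_inverse)
    qed
    show "\<forall>c v. c \<in> carrier class_ring \<and> v \<in> carrier T \<longrightarrow> c \<odot>\<^bsub>T\<^esub> v \<in> carrier T"
      using ex hc Vsc sm by metis
    show "\<forall>v w. v \<in> carrier T \<and> w \<in> carrier T \<longrightarrow> v \<oplus>\<^bsub>T\<^esub> w = w \<oplus>\<^bsub>T\<^esub> v"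
      using ex add by (metis add.commute)
    show "\<forall>v w x. v \<in> carrier T \<and> w \<in> carrier T \<and> x \<in> carrier T \<longrightarrow>
        v \<oplus>\<^bsub>T\<^esub> w \<oplus>\<^bsub>T\<^esub> x = v \<oplus>\<^bsub>T\<^esub> (w \<oplus>\<^bsub>T\<^esub> x)"
    proof clarify
      fix u v w assume "u \<in> carrier T" "v \<in> carrier T" "w \<in> carrier T"
      then obtain x y z where x: "x \<in> V" "y \<in> V" "z \<in> V" "u = h x" "v = h y" "w = h z"
        using ex by metis
      show "u \<oplus>\<^bsub>T\<^esub> v \<oplus>\<^bsub>T\<^esub> w = u \<oplus>\<^bsub>T\<^esub> (v \<oplus>\<^bsub>T\<^esub> w)"
        using x(1-3) by (simp add: x(4-6) add[symmetric] Vadd add.assoc)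
    qed
    show "\<forall>v\<in>carrier T. v \<oplus>\<^bsub>T\<^esub> \<zero>\<^bsub>T\<^esub> = v"
      using ex add[OF _ V0] zero by (metis add.right_neutral)
    show "\<forall>a b v. a \<in> carrier class_ring \<and> b \<in> carrier class_ring \<and> v \<in> carrier T \<longrightarrow>
        a \<otimes>\<^bsub>class_ring\<^esub> b \<odot>\<^bsub>T\<^esub> v = a \<odot>\<^bsub>T\<^esub> (b \<odot>\<^bsub>T\<^esub> v)"
    proof clarify
      fix a b v assume "v \<in> carrier T"
      then obtain x where x: "x \<in> V" "v = h x" using ex by blast
      show "a \<otimes>\<^bsub>class_ring\<^esub> b \<odot>\<^bsub>T\<^esub> v = a \<odot>\<^bsub>T\<^esub> (b \<odot>\<^bsub>T\<^esub> v)"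
        using x(1) by (simp add: x(2) sm[symmetric] Vsc)
    qed
    show "\<forall>v\<in>carrier T. \<one>\<^bsub>class_ring\<^esub> \<odot>\<^bsub>T\<^esub> v = v"
      using ex sm by (metis scale_one monoid.select_convs(2))
    show "\<forall>a b v. a \<in> carrier class_ring \<and> b \<in> carrier class_ring \<and> v \<in> carrier T \<longrightarrow>
        (a \<oplus>\<^bsub>class_ring\<^esub> b) \<odot>\<^bsub>T\<^esub> v = a \<odot>\<^bsub>T\<^esub> v \<oplus>\<^bsub>T\<^esub> b \<odot>\<^bsub>T\<^esub> v"
    proof clarify
      fix a b v assume "v \<in> carrier T"
      then obtain x where x: "x \<in> V" "v = h x" using ex by blast
      show "(a \<oplus>\<^bsub>class_ring\<^esub> b) \<odot>\<^bsub>T\<^esub> v = a \<odot>\<^bsub>T\<^esub> v \<oplus>\<^bsub>T\<^esub> b \<odot>\<^bsub>T\<^esub> v"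
        using x(1) by (simp add: x(2) sm[symmetric] add[symmetric] Vsc scale_left_distrib)
    qed
    show "\<forall>a v w. a \<in> carrier class_ring \<and> v \<in> carrier T \<and> w \<in> carrier T \<longrightarrow>
        a \<odot>\<^bsub>T\<^esub> (v \<oplus>\<^bsub>T\<^esub> w) = a \<odot>\<^bsub>T\<^esub> v \<oplus>\<^bsub>T\<^esub> a \<odot>\<^bsub>T\<^esub> w"
    proof clarify
      fix a v w assume "v \<in> carrier T" "w \<in> carrier T"
      then obtain x y where x: "x \<in> V" "v = h x" "y \<in> V" "w = h y" using ex by metis
      show "a \<odot>\<^bsub>T\<^esub> (v \<oplus>\<^bsub>T\<^esub> w) = a \<odot>\<^bsub>T\<^esub> v \<oplus>\<^bsub>T\<^esub> a \<odot>\<^bsub>T\<^esub> w"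
        using x(1,3) by (simp add: x(2,4) sm[symmetric] add[symmetric] Vsc Vadd scale_right_distrib)
    qed
  qed
  interpret T: vectorspace class_ring T by (rule vs)
  have K: "subspace ?K"
  proof (rule subspaceI)
    show "0 \<in> ?K" using V0 zero by simp
    show "x + y \<in> ?K" if "x \<in> ?K" "y \<in> ?K" for x y using that Vadd[of x y] by (simp add: add)
    show "scale c x \<in> ?K" if "x \<in> ?K" for c x
    proof -
      have "h (scale c x) = c \<odot>\<^bsub>T\<^esub> h 0" using that sm zero by simp
      then have "h (scale c x) = h 0" using sm[OF V0, of c] by simp
      then show ?thesis using that Vsc zero by simp
    qed
  qed
  obtain B where B: "finite B" "B \<subseteq> ?K" "independent B" "span B = ?K" "card B = dim ?K"
    by (rule fd_basis[OF K fd_subset[OF V(2)]]) auto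
  obtain C where C: "finite C" "B \<subseteq> C" "C \<subseteq> V" "independent C" "span C = V" "card C = dim V"
    by (rule fd_basis_extend[OF V _ B(3)]) (use B(2) in auto)
  let ?D = "C - B"
  have finD: "finite ?D" using C(1) by simp
  have hsum: "h (\<Sum>x\<in>A. scale (u x) x) = (\<Oplus>\<^bsub>T\<^esub>x\<in>A. u x \<odot>\<^bsub>T\<^esub> h x) \<and> (\<Sum>x\<in>A. scale (u x) x) \<in> V"
    if "finite A" "A \<subseteq> V" for A u
    using that
  proof (induction A rule: finite_induct)
    case empty
    then show ?case using V0 zero by simp
  next
    case (insert x A)
    have "u y \<odot>\<^bsub>T\<^esub> h y \<in> carrier T" if "y \<in> V" for y using sm[OF that] hc[OF Vsc[OF that]] by metis
    then have "(\<Oplus>\<^bsub>T\<^esub>y\<in>insert x A. u y \<odot>\<^bsub>T\<^esub> h y) = u x \<odot>\<^bsub>T\<^esub> h x \<oplus>\<^bsub>T\<^esub> (\<Oplus>\<^bsub>T\<^esub>y\<in>A. u y \<odot>\<^bsub>T\<^esub> h y)"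
      using insert by (intro T.finsum_insert) auto
    then show ?case using insert Vsc Vadd add sm by simp
  qed
  \<comment> \<open>A combination over \<open>C - B\<close> killed by \<open>h\<close> also lies in
    the span of \<open>B\<close>, which is a relation on the basis \<open>C\<close>.\<close>
  have indep: "u x = 0" if u: "h (\<Sum>x\<in>?D. scale (u x) x) = \<zero>\<^bsub>T\<^esub>" and x: "x \<in> ?D" for u x
  proof -
    have "(\<Sum>x\<in>?D. scale (u x) x) \<in> ?K" using u hsum[OF finD, of u] C(3) by auto
    then have "(\<Sum>x\<in>?D. scale (u x) x) \<in> span B" using B(4) by simp
    then obtain w where w: "(\<Sum>x\<in>?D. scale (u x) x) = (\<Sum>x\<in>B. scale (w x) x)"
      using span_finite[OF B(1)] by auto
    let ?g = "\<lambda>v. if v \<in> B then - w v else u v"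
    have "(\<Sum>v\<in>C. scale (?g v) v) = (\<Sum>v\<in>?D. scale (?g v) v) + (\<Sum>v\<in>B. scale (?g v) v)"
      by (rule sum.subset_diff[OF C(2,1)])
    also have "(\<Sum>v\<in>?D. scale (?g v) v) = (\<Sum>x\<in>B. scale (w x) x)" unfolding w[symmetric] by (intro sum.cong) auto
    also have "(\<Sum>v\<in>B. scale (?g v) v) = - (\<Sum>x\<in>B. scale (w x) x)" by (simp add: sum_negf)
    finally have "(\<Sum>v\<in>C. scale (?g v) v) = 0" by simp
    then have "?g x = 0" using independentD[OF C(4,1) subset_refl, of ?g x] x by auto
    then show ?thesis using x by simp
  qed
  have sc0: "(\<Sum>y\<in>A. scale (if y = x then c else if y = x' then c' else 0) y) = scale c x + scale c' x'"
    if "finite A" "x \<in> A" "x' \<in> A" "x \<noteq> x'" for A x x' c c'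
  proof -
    have "(\<Sum>y\<in>A. scale (if y = x then c else if y = x' then c' else 0) y) =
       (\<Sum>y\<in>{x, x'}. scale (if y = x then c else if y = x' then c' else 0) y)"
      using that by (intro sum.mono_neutral_right) auto
    then show ?thesis using that(4) by simp
  qed
  have inj: "inj_on h ?D"
  proof (rule inj_onI, rule ccontr)
    fix x x' assume xx: "x \<in> ?D" "x' \<in> ?D" "h x = h x'" "x \<noteq> x'"
    have V': "x \<in> V" "x' \<in> V" using xx(1,2) C(3) by auto
    \<comment> \<open>Equal images of two basis vectors would make the combination with coefficients
      1 and -1 vanish. Injectivity is settled first, as the sums over the image are reindexed by
      it.\<close>
    let ?u = "\<lambda>y. if y = x then 1 else if y = x' then - 1 else (0 :: 'a)"
    have "h (\<Sum>y\<in>?D. scale (?u y) y) = h (scale 1 x + scale (- 1) x')"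
      by (simp only: sc0[OF finD xx(1,2,4)])
    also have "\<dots> = h (scale 1 x' + scale (- 1) x')"
      unfolding add[OF Vsc[OF V'(1)] Vsc[OF V'(2)]] add[OF Vsc[OF V'(2)] Vsc[OF V'(2)]]
        sm[OF V'(1)] sm[OF V'(2)] xx(3) ..
    also have "\<dots> = \<zero>\<^bsub>T\<^esub>" using zero by simp
    finally have "?u x = 0" by (rule indep[OF _ xx(1)])
    then show False by simp
  qed
  have lc: "T.lincomb g (h ` ?D) = h (\<Sum>x\<in>?D. scale (g (h x)) x)" for g
  proof -
    have "T.lincomb g (h ` ?D) = (\<Oplus>\<^bsub>T\<^esub>x\<in>?D. g (h x) \<odot>\<^bsub>T\<^esub> h x)"
      unfolding T.lincomb_def
    proof (rule T.add.finprod_reindex[OF _ inj])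
      show "(\<lambda>v. g v \<odot>\<^bsub>T\<^esub> v) \<in> h ` ?D \<rightarrow> carrier T"
      proof (rule Pi_I)
        fix v assume "v \<in> h ` ?D"
        then obtain x where x: "x \<in> V" "v = h x" using C(3) by blast
        show "g v \<odot>\<^bsub>T\<^esub> v \<in> carrier T" using hc[OF Vsc[OF x(1)], of "g v"] sm[OF x(1), of "g v"] x(2) by simp
      qed
    qed
    moreover have "?D \<subseteq> V" using C(3) by blast
    ultimately show ?thesis using hsum[OF finD, of "\<lambda>x. g (h x)"] by simp
  qed
  have sub: "h ` ?D \<subseteq> carrier T" using hc C(3) by blast
  have "T.basis (h ` ?D)"
    unfolding T.basis_def
  proof (intro conjI sub)
    show "T.lin_indpt (h ` ?D)"
    proof (rule T.finite_lin_indpt2[OF finite_imageI[OF finD] sub], rule ballI)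
      fix g v assume "T.lincomb g (h ` ?D) = \<zero>\<^bsub>T\<^esub>" "v \<in> h ` ?D"
      then show "g v = \<zero>\<^bsub>class_ring\<^esub>" unfolding lc using indep[of "\<lambda>x. g (h x)"] by auto
    qed
    show "T.span (h ` ?D) = carrier T"
    proof
      show "T.span (h ` ?D) \<subseteq> carrier T" by (rule T.span_is_subset2[OF sub])
      show "carrier T \<subseteq> T.span (h ` ?D)"
      proof
        fix t assume "t \<in> carrier T"
        then obtain x where x: "x \<in> V" "t = h x" using ex by blast
        then obtain u where u: "x = (\<Sum>v\<in>C. scale (u v) v)" using C(5) span_finite[OF C(1)] by auto
        have "x = (\<Sum>v\<in>?D. scale (u v) v) + (\<Sum>v\<in>B. scale (u v) v)"
          unfolding u by (rule sum.subset_diff[OF C(2,1)])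
        moreover have "(\<Sum>v\<in>B. scale (u v) v) \<in> ?K"
          using B(2) by (intro subspace_sum[OF K] subspace_scale[OF K]) auto
        moreover have D: "(\<Sum>v\<in>?D. scale (u v) v) \<in> V" using hsum[OF finD] C(3) by blast
        ultimately have "t = h (\<Sum>v\<in>?D. scale (u v) v) \<oplus>\<^bsub>T\<^esub> \<zero>\<^bsub>T\<^esub>" using x(2) add by auto
        then have "t = h (\<Sum>v\<in>?D. scale (u v) v)" using hc[OF D] by simp
        also have "\<dots> = T.lincomb (\<lambda>t. u (the_inv_into ?D h t)) (h ` ?D)"
          unfolding lc by (intro arg_cong[of _ _ h] sum.cong) (simp_all add: the_inv_into_f_f[OF inj])
        also have "\<dots> \<in> T.span (h ` ?D)"
          unfolding T.finite_span[OF finite_imageI[OF finD] sub] by auto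
        finally show "t \<in> T.span (h ` ?D)" .
      qed
    qed
  qed
  then have "T.dim = card (h ` ?D)" by (rule T.dim_basis[OF finite_imageI[OF finD]])
  also have "\<dots> = card C - card B" using card_image[OF inj] card_Diff_subset[OF B(1) C(2)] by simp
  finally show ?thesis using B(5) C(6) card_mono[OF C(1,2)] by simp
qed

section \<open>Reduction modulo the maximal ideal\<close>

definition kscale :: "'k::field \<Rightarrow> ('i \<Rightarrow> 'k) \<Rightarrow> 'i \<Rightarrow> 'k" where
  "kscale c x = (\<lambda>i. c * x i)"

lemma vecspace_kscale: "vecspace (kscale :: 'k::field \<Rightarrow> ('i \<Rightarrow> 'k) \<Rightarrow> _)"
  by unfold_locales (simp_all add: kscale_def fun_eq_iff algebra_simps)

interpretation ks: vecspace kscale by (rule vecspace_kscale)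
interpretation kk: vecspace_pair kscale kscale ..
interpretation fk: vecspace_pair fscale kscale ..

definition kfree :: "nat \<Rightarrow> (nat \<Rightarrow> 'k::field) set" where
  "kfree c = {x. \<forall>i\<ge>c. x i = 0}"

text \<open>The reduction from S^c to k^c; the Betti numbers only see matrices through it.\<close>

definition cterm :: "('i \<Rightarrow> ('v::finite, 'k::field) mpoly) \<Rightarrow> 'i \<Rightarrow> 'k" where
  "cterm x = (\<lambda>i. Poly_Mapping.lookup (x i) 0)"

lemma linear_fkI:
  fixes f :: "('i \<Rightarrow> ('v::finite, 'k::field) mpoly) \<Rightarrow> 'j \<Rightarrow> 'k"
  assumes "\<And>x y. f (x + y) = f x + f y" "\<And>c x. f (fscale c x) = kscale c (f x)"
  shows "Vector_Spaces.linear fscale kscale f"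
  by (intro Vector_Spaces.linear.intro module_hom.intro module_hom_axioms.intro
      fs.vector_space_axioms fs.module_axioms ks.vector_space_axioms ks.module_axioms assms)

lemma linear_kkI:
  fixes f :: "('i \<Rightarrow> 'k::field) \<Rightarrow> 'j \<Rightarrow> 'k"
  assumes "\<And>x y. f (x + y) = f x + f y" "\<And>c x. f (kscale c x) = kscale c (f x)"
  shows "Vector_Spaces.linear kscale kscale f"
  by (intro Vector_Spaces.linear.intro module_hom.intro module_hom_axioms.intro
      ks.vector_space_axioms ks.module_axioms assms)

lemma linear_cterm: "Vector_Spaces.linear fscale kscale cterm"
  by (rule linear_fkI) (auto simp: cterm_def fscale_def kscale_def fun_eq_iff lookup_add)

lemma subspace_kfree: "ks.subspace (kfree c)"
  by (rule ks.subspaceI) (auto simp: kfree_def kscale_def)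

lemma cterm_free_lt:
  assumes "n \<ge> 1"
  shows "cterm ` (free_lt c n :: (nat \<Rightarrow> ('v::finite, 'k::field) mpoly) set) = kfree c"
proof (intro equalityI subsetI)
  fix x :: "nat \<Rightarrow> 'k" assume x: "x \<in> kfree c"
  let ?y = "\<lambda>i. Poly_Mapping.single 0 (x i) :: ('v, 'k) mpoly"
  have "?y \<in> free_lt c n"
    using x assms by (auto simp: free_lt_def coord_space_def kfree_def lookup_single when_def not_less[symmetric])
  moreover have "x = cterm ?y" by (simp add: cterm_def)
  ultimately show "x \<in> cterm ` (free_lt c n :: (nat \<Rightarrow> ('v, 'k) mpoly) set)" by (simp only: image_eqI)
next
  fix x :: "nat \<Rightarrow> 'k" assume "x \<in> cterm ` (free_lt c n :: (nat \<Rightarrow> ('v, 'k) mpoly) set)"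
  then obtain y :: "nat \<Rightarrow> ('v, 'k) mpoly" where "y \<in> free_lt c n" "x = cterm y" by blast
  then show "x \<in> kfree c" using free_lt_subset[of c n] by (auto simp: cterm_def kfree_def free_def)
qed

lemma dim_kfree: "ks.dim (kfree c :: (nat \<Rightarrow> 'k::field) set) = c" "ks.fd (kfree c :: (nat \<Rightarrow> 'k::field) set)"
proof -
  \<comment> \<open>Polynomials of degree below 1 are constants; \<open>bool\<close> merely supplies
    some finite type of variables.\<close>
  have im: "cterm ` (free_lt c 1 :: (nat \<Rightarrow> (bool, 'k) mpoly) set) = kfree c" by (rule cterm_free_lt) simp
  have z: "x = 0" if "x \<in> free_lt c 1" "cterm x = 0" for x :: "nat \<Rightarrow> (bool, 'k) mpoly"
  proof -
    have "Poly_Mapping.lookup (x i) m = 0" for i m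
    proof (cases "m = 0")
      case True
      then show ?thesis using that(2) by (simp add: cterm_def fun_eq_iff)
    next
      case False
      then show ?thesis using that(1) by (auto simp: free_lt_def coord_space_def)
    qed
    then show ?thesis by (auto simp: fun_eq_iff intro!: poly_mapping_eqI)
  qed
  show "ks.dim (kfree c :: (nat \<Rightarrow> 'k::field) set) = c"
    using fk.dim_image_inj_fd[OF linear_cterm dim_free_lt(3,2)[of c 1] z] unfolding im
    by (simp add: dim_free_lt)
  show "ks.fd (kfree c :: (nat \<Rightarrow> 'k::field) set)"
    unfolding im[symmetric] by (rule fk.fd_image[OF linear_cterm dim_free_lt(2)])
qed

lemma (in vecspace) dim_quot_module:
  fixes M :: "('r, 'm) module" and \<tau> :: "'b \<Rightarrow> 'm" and \<rho> :: "'a \<Rightarrow> 'r"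
  assumes V: "subspace V" "fd V" and W: "subspace W" "W \<subseteq> V"
    and M: "carrier M = \<tau> ` V" "inj_on \<tau> V"
    and add: "\<And>x y. x \<in> V \<Longrightarrow> y \<in> V \<Longrightarrow> \<tau> x \<oplus>\<^bsub>M\<^esub> \<tau> y = \<tau> (x + y)"
    and sm: "\<And>c x. x \<in> V \<Longrightarrow> \<rho> c \<odot>\<^bsub>M\<^esub> \<tau> x = \<tau> (scale c x)"
  shows "dim V = dim W + vectorspace.dim class_ring (restrict_scalars \<rho> (quot_module M (\<tau> ` W)))"
proof -
  let ?T = "restrict_scalars \<rho> (quot_module M (\<tau> ` W))"
  let ?h = "\<lambda>x. \<tau> ` ((\<lambda>y. y + x) ` W)"
  have W0: "0 \<in> W" by (rule subspace_0[OF W(1)])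
  have coset: "\<tau> ` W +>\<^bsub>M\<^esub> \<tau> x = ?h x" if "x \<in> V" for x
  proof -
    have "\<tau> ` W +>\<^bsub>M\<^esub> \<tau> x = (\<Union>w\<in>W. {\<tau> w \<oplus>\<^bsub>M\<^esub> \<tau> x})" by (simp add: a_r_coset_def r_coset_def)
    also have "\<dots> = (\<Union>w\<in>W. {\<tau> (w + x)})" using that W(2) add by (intro SUP_cong refl) blast
    finally show ?thesis by auto
  qed
  have shift: "?h (x + w) = ?h x" if "w \<in> W" for x w
  proof -
    have "y + (x + w) \<in> (\<lambda>y. y + x) ` W" if "y \<in> W" for y
      using subspace_add[OF W(1) that \<open>w \<in> W\<close>] by (intro image_eqI[of _ _ "y + w"]) (auto simp: algebra_simps)
    moreover have "y + x \<in> (\<lambda>y. y + (x + w)) ` W" if "y \<in> W" for y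
      using subspace_diff[OF W(1) that \<open>w \<in> W\<close>] by (intro image_eqI[of _ _ "y - w"]) (auto simp: algebra_simps)
    ultimately have "(\<lambda>y. y + (x + w)) ` W = (\<lambda>y. y + x) ` W" by blast
    then show ?thesis by simp
  qed
  have VW: "y + x \<in> V" if "y \<in> W" "x \<in> V" for x y using that subspace_add[OF V(1)] W(2) by blast
  have "dim V = dim {x \<in> V. ?h x = \<zero>\<^bsub>?T\<^esub>} + vectorspace.dim class_ring ?T"
  proof (rule dim_module_record[OF V])
    show "?h ` V = carrier ?T"
    proof -
      have "carrier ?T = (\<lambda>x. \<tau> ` W +>\<^bsub>M\<^esub> \<tau> x) ` V"
        by (auto simp: restrict_scalars_def quot_module_def A_RCOSETS_def RCOSETS_def a_r_coset_def M(1))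
      also have "\<dots> = ?h ` V" by (rule image_cong[OF refl coset])
      finally show ?thesis ..
    qed
    show "?h (x + y) = ?h x \<oplus>\<^bsub>?T\<^esub> ?h y" if xy: "x \<in> V" "y \<in> V" for x y
    proof -
      have "?h x \<oplus>\<^bsub>?T\<^esub> ?h y = (\<Union>w\<in>W. \<Union>w'\<in>W. {\<tau> (w + x) \<oplus>\<^bsub>M\<^esub> \<tau> (w' + y)})"
        by (auto simp: restrict_scalars_def quot_module_def set_add_def set_mult_def)
      also have "\<dots> = (\<Union>w\<in>W. \<Union>w'\<in>W. {\<tau> (w' + ((x + y) + w))})"
        using add[OF VW[OF _ xy(1)] VW[OF _ xy(2)]] by (intro SUP_cong refl) (simp add: algebra_simps)
      also have "\<dots> = (\<Union>w\<in>W. ?h ((x + y) + w))" by blast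
      also have "\<dots> = (\<Union>w\<in>W. ?h (x + y))" using shift by (intro SUP_cong refl) blast
      finally show ?thesis using W0 by auto
    qed
    show "?h (scale c x) = c \<odot>\<^bsub>?T\<^esub> ?h x" if x: "x \<in> V" for c x
    proof -
      have "c \<odot>\<^bsub>?T\<^esub> ?h x = (\<Union>w\<in>W. \<tau> ` W +>\<^bsub>M\<^esub> (\<rho> c \<odot>\<^bsub>M\<^esub> \<tau> (w + x)))"
        by (auto simp: restrict_scalars_def quot_module_def)
      also have "\<dots> = (\<Union>w\<in>W. ?h (scale c x + scale c w))"
        using sm[OF VW[OF _ x]] coset[OF subspace_scale[OF V(1) VW[OF _ x]]]
        by (intro SUP_cong refl) (simp add: scale_right_distrib add.commute)
      also have "\<dots> = (\<Union>w\<in>W. ?h (scale c x))"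
        using shift[OF subspace_scale[OF W(1)]] by (intro SUP_cong refl) blast
      finally show ?thesis using W0 by auto
    qed
    show "?h 0 = \<zero>\<^bsub>?T\<^esub>" by (simp add: restrict_scalars_def quot_module_def)
  qed
  also have "{x \<in> V. ?h x = \<zero>\<^bsub>?T\<^esub>} = W"
  proof (intro equalityI subsetI)
    fix x assume "x \<in> {x \<in> V. ?h x = \<zero>\<^bsub>?T\<^esub>}"
    then have x: "x \<in> V" "?h x = \<tau> ` W" by (auto simp: restrict_scalars_def quot_module_def)
    have "\<tau> (0 + x) \<in> ?h x" using W0 by blast
    then obtain w where "w \<in> W" "\<tau> x = \<tau> w" using x(2) by auto
    then show "x \<in> W" using inj_onD[OF M(2), of x w] x(1) W(2) by auto
  next
    fix x assume x: "x \<in> W"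
    then have "?h (0 + x) = ?h 0" by (rule shift)
    then show "x \<in> {x \<in> V. ?h x = \<zero>\<^bsub>?T\<^esub>}"
      using x W(2) by (auto simp: restrict_scalars_def quot_module_def)
  qed
  finally show ?thesis .
qed

section \<open>Tensoring with the residue field\<close>

definition rsd :: "('v::finite, 'k::field) mpoly set \<Rightarrow> 'k" where
  "rsd X = the_elem ((\<lambda>p. Poly_Mapping.lookup p 0) ` X)"

lemma rsd_proj: "n \<ge> 1 \<Longrightarrow> rsd (proj n p) = Poly_Mapping.lookup (p :: ('v::finite, 'k::field) mpoly) 0"
proof -
  assume "n \<ge> 1"
  then have "Poly_Mapping.lookup q 0 = Poly_Mapping.lookup p 0" if "q \<in> proj n p" for q
    using ideal_geD[of "q - p" n 0] that by (simp add: in_proj_iff lookup_minus)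
  then have "(\<lambda>p. Poly_Mapping.lookup p 0) ` proj n p = (\<lambda>_. Poly_Mapping.lookup p 0) ` proj n p"
    by (rule image_cong[OF refl])
  also have "\<dots> = {Poly_Mapping.lookup p 0}"
    by (rule image_constant[of p]) (simp add: in_proj_iff)
  finally have "(\<lambda>p. Poly_Mapping.lookup p 0) ` proj n p = {Poly_Mapping.lookup p 0}" .
  then show ?thesis by (simp add: rsd_def)
qed

lemma residue_module_simps:
  "carrier (residue_module n) = UNIV"
  "x \<oplus>\<^bsub>residue_module n\<^esub> y = x + y"
  "\<zero>\<^bsub>residue_module n\<^esub> = 0"
  "r \<odot>\<^bsub>residue_module n\<^esub> x = rsd r * x"
  by (simp_all add: residue_module_def restrict_scalars_def regular_module_def rsd_def)

abbreviation tfree :: "nat \<Rightarrow> nat \<Rightarrow> (('v::finite, 'k::field) mpoly set, nat \<Rightarrow> ('v, 'k) mpoly set) module" where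
  "tfree n c \<equiv> free_module (truncated_ring n) c"

definition pj :: "nat \<Rightarrow> nat \<Rightarrow> (nat \<Rightarrow> ('v::finite, 'k::field) mpoly) \<Rightarrow> nat \<Rightarrow> ('v, 'k) mpoly set" where
  "pj n c x = res c (\<lambda>i. proj n (x i))"

lemmas tfree_simps = free_module_simps[OF cring.axioms(1)[OF cring_truncated_ring]]

lemma pj_image: "pj n c ` free c = carrier (tfree n c :: (('v::finite, 'k::field) mpoly set, _) module)"
proof (intro equalityI subsetI)
  fix y :: "nat \<Rightarrow> ('v::finite, 'k::field) mpoly set" assume y: "y \<in> carrier (tfree n c)"
  then have "\<forall>i. \<exists>p. i < c \<longrightarrow> y i = proj n p" by (auto simp: tfree_simps truncated_ring_simps PiE_def Pi_def image_iff)
  then obtain p where p: "\<And>i. i < c \<Longrightarrow> y i = proj n (p i)" by (metis choice)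
  have "y = pj n c (zext c p)"
    using y p by (auto simp: pj_def res_def zext_def tfree_simps PiE_def extensional_def fun_eq_iff)
  then show "y \<in> pj n c ` free c" using zext_free by blast
qed (auto simp: pj_def res_def tfree_simps truncated_ring_simps)

lemma pj_carrier: "pj n c x \<in> carrier (tfree n c)"
  by (auto simp: pj_def res_def tfree_simps truncated_ring_simps)

lemma pj_ops:
  "pj n c x \<oplus>\<^bsub>tfree n c\<^esub> pj n c y = pj n c (x + y)"
  "proj n r \<odot>\<^bsub>tfree n c\<^esub> pj n c x = pj n c (smul r x)"
  "\<zero>\<^bsub>tfree n c\<^esub> = pj n c 0"
  by (simp_all add: pj_def res_def tfree_simps truncated_ring_simps smul_def cong: restrict_cong)

lemma pj_eq_iff: "x \<in> free c \<Longrightarrow> y \<in> free c \<Longrightarrow> pj n c x = pj n c y \<longleftrightarrow> x - y \<in> free_ge c n"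
proof -
  assume xy: "x \<in> free c" "y \<in> free c"
  have "pj n c x = pj n c y \<longleftrightarrow> (\<forall>i<c. proj n (x i) = proj n (y i))"
    by (auto simp: pj_def res_def fun_eq_iff restrict_def)
  also have "\<dots> \<longleftrightarrow> x - y \<in> free_ge c n"
    using xy by (auto simp: proj_eq_iff free_ge_def free_def) (metis cancel_comm_monoid_add_class.diff_cancel ideal_ge_zero not_le)
  finally show ?thesis .
qed

text \<open>The homomorphism from the free abelian group on all pairs to the field that extends the
  weights.\<close>

definition wsum :: "('q \<Rightarrow> 'k::field) \<Rightarrow> ('q \<Rightarrow>\<^sub>0 int) \<Rightarrow> 'k" where
  "wsum w z = (\<Sum>q\<in>Poly_Mapping.keys z. of_int (Poly_Mapping.lookup z q) * w q)"

lemma wsum_superset: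
  assumes "finite A" "Poly_Mapping.keys z \<subseteq> A"
  shows "wsum w z = (\<Sum>q\<in>A. of_int (Poly_Mapping.lookup z q) * w q)"
  unfolding wsum_def using assms by (intro sum.mono_neutral_left) (auto simp: in_keys_iff)

lemma wsum_simps:
  "wsum w 0 = 0" "wsum w (z + z') = wsum w z + wsum w z'" "wsum w (z - z') = wsum w z - wsum w z'"
  "wsum w (- z) = - wsum w z" "wsum w (frag_of q) = w q"
proof -
  have add: "wsum w (z + z') = wsum w z + wsum w z'" for z z'
  proof -
    let ?A = "Poly_Mapping.keys z \<union> Poly_Mapping.keys z'"
    have A: "finite ?A" by simp
    show ?thesis
      using wsum_superset[OF A, of z w] wsum_superset[OF A, of z' w]
        wsum_superset[OF A Poly_Mapping.keys_add, of w]
      by (simp add: sum.distrib lookup_add distrib_right)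
  qed
  have neg: "wsum w (- z) = - wsum w z" for z by (simp add: wsum_def sum_negf)
  show "wsum w (z + z') = wsum w z + wsum w z'" "wsum w (- z) = - wsum w z" by (rule add, rule neg)
  show "wsum w (z - z') = wsum w z - wsum w z'" using add[of z "- z'"] neg by simp
  show "wsum w 0 = 0" by (simp add: wsum_def)
  show "wsum w (frag_of q) = w q" by (simp add: wsum_def)
qed

text \<open>The isomorphism from the tensor product of the residue field with a free module of
  rank \<open>c\<close> to \<open>k\<^sup>c\<close>, on the level of the free abelian group.\<close>

definition tval :: "nat \<Rightarrow> ('k \<times> (nat \<Rightarrow> ('v::finite, 'k::field) mpoly set) \<Rightarrow>\<^sub>0 int) \<Rightarrow> nat \<Rightarrow> 'k" where
  "tval c z = (\<lambda>j. if j < c then wsum (\<lambda>(a, x). a * rsd (x j)) z else 0)"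

lemma tval_simps:
  "tval c 0 = 0" "tval c (z + z') = tval c z + tval c z'" "tval c (z - z') = tval c z - tval c z'"
  "tval c (- z) = - tval c z"
  "tval c (frag_of (a, x)) = (\<lambda>j. if j < c then a * rsd (x j) else 0)"
  by (auto simp: tval_def wsum_simps fun_eq_iff)

lemma tval_kfree: "tval c z \<in> kfree c"
  by (simp add: tval_def kfree_def)

definition rvec :: "nat \<Rightarrow> (nat \<Rightarrow> ('v::finite, 'k::field) mpoly set) \<Rightarrow> nat \<Rightarrow> 'k" where
  "rvec c x = (\<lambda>j. if j < c then rsd (x j) else 0)"

lemma tval_frag_of: "tval c (frag_of (a, x)) = kscale a (rvec c x)"
  by (auto simp: tval_simps kscale_def rvec_def)

lemma lookup_mult_0: "Poly_Mapping.lookup (p * q) 0 = Poly_Mapping.lookup p 0 * Poly_Mapping.lookup (q :: ('v::finite, 'k::field) mpoly) 0"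
proof -
  let ?c = "Poly_Mapping.single 0 (Poly_Mapping.lookup p 0) :: ('v, 'k) mpoly"
  have "p - ?c \<in> ideal_ge 1" by (rule ideal_geI) (simp add: lookup_minus)
  then have "(p - ?c) * q \<in> ideal_ge 1" using ideal_ge_mult[of "p - ?c" 1 q] by (simp add: mult.commute)
  then have "Poly_Mapping.lookup ((p - ?c) * q) 0 = 0" by (rule ideal_geD) simp
  moreover have "p * q = (p - ?c) * q + ?c * q" by (simp add: algebra_simps)
  ultimately have "Poly_Mapping.lookup (p * q) 0 = Poly_Mapping.lookup (?c * q) 0" by (metis add_0 lookup_add)
  then show ?thesis using lookup_single_mult[of 0 _ q 0] by simp
qed

context
  fixes n :: nat and R :: "('v::finite, 'k::field) mpoly set ring"
    and M :: "nat \<Rightarrow> (('v, 'k) mpoly set, nat \<Rightarrow> ('v, 'k) mpoly set) module"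
    and K :: "(('v, 'k) mpoly set, 'k) module"
  defines "R \<equiv> truncated_ring n" and "M \<equiv> free_module R" and "K \<equiv> residue_module n"
  assumes n: "n \<ge> 1"
begin

definition tpairs :: "nat \<Rightarrow> ('k \<times> (nat \<Rightarrow> ('v, 'k) mpoly set) \<Rightarrow>\<^sub>0 int) set" where
  "tpairs c = {z. Poly_Mapping.keys z \<subseteq> UNIV \<times> carrier (M c)}"

lemma tensor_gens_simps:
  "carrier (tensor_gens K (M c)) = tpairs c"
  "monoid.mult (tensor_gens K (M c)) = (+)"
  "\<one>\<^bsub>tensor_gens K (M c)\<^esub> = 0"
  by (auto simp: tensor_gens_def tpairs_def K_def residue_module_simps carrier_free_Abelian_group_iff
      free_Abelian_group_def)

lemma tpairs_simps:
  "0 \<in> tpairs c" "z \<in> tpairs c \<Longrightarrow> z' \<in> tpairs c \<Longrightarrow> z + z' \<in> tpairs c"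
  "z \<in> tpairs c \<Longrightarrow> z' \<in> tpairs c \<Longrightarrow> z - z' \<in> tpairs c"
  "z \<in> tpairs c \<Longrightarrow> - z \<in> tpairs c"
  "x \<in> carrier (M c) \<Longrightarrow> frag_of (a, x) \<in> tpairs c"
  using Poly_Mapping.keys_add[of z z'] keys_diff[of z z'] by (auto simp: tpairs_def)

lemma rvec_pj: "rvec c (pj n c x) = (\<lambda>j. if j < c then Poly_Mapping.lookup (x j) 0 else 0)"
  using n by (auto simp: rvec_def pj_def res_def rsd_proj fun_eq_iff)

lemma rvec_add: "x \<in> carrier (M c) \<Longrightarrow> y \<in> carrier (M c) \<Longrightarrow> rvec c (x \<oplus>\<^bsub>M c\<^esub> y) = rvec c x + rvec c y"
  unfolding M_def R_def pj_image[symmetric] by (auto simp: pj_ops rvec_pj lookup_add fun_eq_iff)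

lemma rvec_smult: "r \<in> carrier R \<Longrightarrow> x \<in> carrier (M c) \<Longrightarrow> rvec c (r \<odot>\<^bsub>M c\<^esub> x) = kscale (rsd r) (rvec c x)"
  unfolding M_def R_def pj_image[symmetric] truncated_ring_simps
  by (auto simp: pj_ops rvec_pj smul_def kscale_def rsd_proj[OF n] lookup_mult_0 fun_eq_iff)

lemma module_M: "Module.module R (M c)"
  unfolding M_def R_def by (rule module_free_module[OF cring_truncated_ring])

lemma tensor_rels_mem:
  "x \<in> carrier (M c) \<Longrightarrow> frag_of (a + a', x) - frag_of (a, x) - frag_of (a', x) \<in> tensor_rels R K (M c)"
  "x \<in> carrier (M c) \<Longrightarrow> y \<in> carrier (M c) \<Longrightarrow>
    frag_of (a, x \<oplus>\<^bsub>M c\<^esub> y) - frag_of (a, x) - frag_of (a, y) \<in> tensor_rels R K (M c)"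
  "r \<in> carrier R \<Longrightarrow> x \<in> carrier (M c) \<Longrightarrow>
    frag_of (rsd r * a, x) - frag_of (a, r \<odot>\<^bsub>M c\<^esub> x) \<in> tensor_rels R K (M c)"
  unfolding tensor_rels_def K_def
  by (rule generate.incl, force simp: residue_module_simps)+

lemma tensor_rels_closed:
  "0 \<in> tensor_rels R K (M c)"
  "z \<in> tensor_rels R K (M c) \<Longrightarrow> z' \<in> tensor_rels R K (M c) \<Longrightarrow> z + z' \<in> tensor_rels R K (M c)"
  unfolding tensor_rels_def
  using generate.one[of "tensor_gens K (M c)"] generate.eng[of z "tensor_gens K (M c)" _ z']
  by (simp_all add: tensor_gens_simps)

lemma tensor_rels_subset: "tensor_rels R K (M c) \<subseteq> {z \<in> tpairs c. tval c z = 0}"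
proof
  let ?G = "{frag_of (a \<oplus>\<^bsub>K\<^esub> a', x) - frag_of (a, x) - frag_of (a', x) | a a' x.
         a \<in> carrier K \<and> a' \<in> carrier K \<and> x \<in> carrier (M c)} \<union>
      {frag_of (a, x \<oplus>\<^bsub>M c\<^esub> x') - frag_of (a, x) - frag_of (a, x') | a x x'.
         a \<in> carrier K \<and> x \<in> carrier (M c) \<and> x' \<in> carrier (M c)} \<union>
      {frag_of (r \<odot>\<^bsub>K\<^esub> a, x) - frag_of (a, r \<odot>\<^bsub>M c\<^esub> x) | r a x.
         r \<in> carrier R \<and> a \<in> carrier K \<and> x \<in> carrier (M c)}"
  interpret M: Module.module R "M c" by (rule module_M)
  have 1: "frag_of (a \<oplus>\<^bsub>K\<^esub> a', x) - frag_of (a, x) - frag_of (a', x) \<in> {z \<in> tpairs c. tval c z = 0}"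
    if "x \<in> carrier (M c)" for a a' x
    using that by (simp add: K_def residue_module_simps tpairs_simps tval_frag_of tval_simps(1-4)
        kscale_def fun_eq_iff algebra_simps)
  have 2: "frag_of (a, x \<oplus>\<^bsub>M c\<^esub> x') - frag_of (a, x) - frag_of (a, x') \<in> {z \<in> tpairs c. tval c z = 0}"
    if "x \<in> carrier (M c)" "x' \<in> carrier (M c)" for a x x'
    using that by (simp add: tpairs_simps tval_frag_of tval_simps(1-4)
        rvec_add kscale_def fun_eq_iff algebra_simps)
  have 3: "frag_of (r \<odot>\<^bsub>K\<^esub> a, x) - frag_of (a, r \<odot>\<^bsub>M c\<^esub> x) \<in> {z \<in> tpairs c. tval c z = 0}"
    if "r \<in> carrier R" "x \<in> carrier (M c)" for a r x
    using that by (simp add: K_def residue_module_simps tpairs_simps tval_frag_of tval_simps(1-4)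
        rvec_smult kscale_def fun_eq_iff algebra_simps)
  have gen: "h \<in> {z \<in> tpairs c. tval c z = 0}" if "h \<in> ?G" for h
    using that by (elim UnE CollectE exE conjE) (simp_all only: 1 2 3)
  fix z assume "z \<in> tensor_rels R K (M c)"
  then show "z \<in> {z \<in> tpairs c. tval c z = 0}"
    unfolding tensor_rels_def
  proof (induction rule: generate.induct)
    case (incl h)
    then show ?case by (rule gen)
  next
    case (inv h)
    then have h: "h \<in> tpairs c" "tval c h = 0" using gen[OF inv] by simp_all
    then have "inv\<^bsub>tensor_gens K (M c)\<^esub> h = - h"
      unfolding tensor_gens_def by (simp add: tpairs_def K_def residue_module_simps)
    then show ?case using h by (simp add: tpairs_simps tval_simps(4) fun_eq_iff)
  qed (auto simp: tensor_gens_simps tpairs_simps tval_simps)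
qed

lemma tensor_rels_uminus: "z \<in> tensor_rels R K (M c) \<Longrightarrow> - z \<in> tensor_rels R K (M c)"
proof -
  assume z: "z \<in> tensor_rels R K (M c)"
  have g: "group (tensor_gens K (M c))" by (simp add: tensor_gens_def)
  have zc: "z \<in> tpairs c" using z tensor_rels_subset by blast
  have "inv\<^bsub>tensor_gens K (M c)\<^esub> z \<in> tensor_rels R K (M c)"
    unfolding tensor_rels_def
  proof (rule group.generate_m_inv_closed[OF g _ z[unfolded tensor_rels_def]], rule subsetI)
    fix h assume "h \<in> {frag_of (a \<oplus>\<^bsub>K\<^esub> a', x) - frag_of (a, x) - frag_of (a', x) | a a' x.
         a \<in> carrier K \<and> a' \<in> carrier K \<and> x \<in> carrier (M c)} \<union>
      {frag_of (a, x \<oplus>\<^bsub>M c\<^esub> x') - frag_of (a, x) - frag_of (a, x') | a x x'.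
         a \<in> carrier K \<and> x \<in> carrier (M c) \<and> x' \<in> carrier (M c)} \<union>
      {frag_of (r \<odot>\<^bsub>K\<^esub> a, x) - frag_of (a, r \<odot>\<^bsub>M c\<^esub> x) | r a x.
         r \<in> carrier R \<and> a \<in> carrier K \<and> x \<in> carrier (M c)}"
    then have "h \<in> tensor_rels R K (M c)" unfolding tensor_rels_def by (rule generate.incl)
    then show "h \<in> carrier (tensor_gens K (M c))"
      using tensor_rels_subset unfolding tensor_gens_simps by blast
  qed
  moreover have "inv\<^bsub>tensor_gens K (M c)\<^esub> z = - z"
    using zc unfolding tensor_gens_def by (simp add: tpairs_def K_def residue_module_simps)
  ultimately show ?thesis by simp
qed

lemma tensor_rels_diff:
  "z \<in> tensor_rels R K (M c) \<Longrightarrow> z' \<in> tensor_rels R K (M c) \<Longrightarrow> z - z' \<in> tensor_rels R K (M c)"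
  using tensor_rels_closed(2)[OF _ tensor_rels_uminus, of z c z'] by simp

lemma tensor_rels_sum:
  "(\<And>i. i \<in> A \<Longrightarrow> F i \<in> tensor_rels R K (M c)) \<Longrightarrow> (\<Sum>i\<in>A. F i) \<in> tensor_rels R K (M c)"
  by (induction A rule: infinite_finite_induct) (auto intro: tensor_rels_closed)

definition tbasis :: "nat \<Rightarrow> nat \<Rightarrow> nat \<Rightarrow> ('v, 'k) mpoly set" where
  "tbasis c j = pj n c (\<lambda>i. if i = j then 1 else 0)"

text \<open>The representative of x given by one pure tensor per coordinate, the sum of all x_j
  \<otimes> e_j.\<close>

definition tnormal :: "nat \<Rightarrow> (nat \<Rightarrow> 'k) \<Rightarrow> ('k \<times> (nat \<Rightarrow> ('v, 'k) mpoly set) \<Rightarrow>\<^sub>0 int)" where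
  "tnormal c x = (\<Sum>j<c. frag_of (x j, tbasis c j))"

lemma tbasis_carrier: "tbasis c j \<in> carrier (M c)"
  unfolding tbasis_def M_def R_def by (rule pj_carrier)

lemma frag_of_zero_rels: "x \<in> carrier (M c) \<Longrightarrow> frag_of (0, x) \<in> tensor_rels R K (M c)"
  using tensor_rels_uminus[OF tensor_rels_mem(1)[of x c 0 0]] by simp

lemma frag_of_diff_rels:
  "x \<in> carrier (M c) \<Longrightarrow> frag_of (a - a', x) - (frag_of (a, x) - frag_of (a', x)) \<in> tensor_rels R K (M c)"
  using tensor_rels_uminus[OF tensor_rels_mem(1)[of x c "a - a'" a']] by (simp add: algebra_simps)

lemma tnormal_diff_rels: "tnormal c (x - y) - (tnormal c x - tnormal c y) \<in> tensor_rels R K (M c)"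
proof -
  have "tnormal c (x - y) - (tnormal c x - tnormal c y) = (\<Sum>j<c. frag_of (x j - y j, tbasis c j) -
      (frag_of (x j, tbasis c j) - frag_of (y j, tbasis c j)))"
    by (simp add: tnormal_def sum_subtractf)
  then show ?thesis by (simp only: tensor_rels_sum frag_of_diff_rels tbasis_carrier)
qed

text \<open>A pure tensor is rewritten coordinate by coordinate: additivity splits off r e_m, and
  the scalar r moves to the left factor, where it acts through its residue.\<close>

lemma frag_of_tnormal_rels:
  assumes "x \<in> carrier (M c)"
  shows "frag_of (a, x) - tnormal c (tval c (frag_of (a, x))) \<in> tensor_rels R K (M c)"
proof -
  obtain P where P: "x = pj n c P" using assms unfolding M_def R_def pj_image[symmetric] by blast
  define X where "X m = pj n c (\<lambda>i. if i < m then P i else 0)" for m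
  have Xc: "X m \<in> carrier (M c)" for m unfolding X_def M_def R_def by (rule pj_carrier)
  have Xs: "X (Suc m) = X m \<oplus>\<^bsub>M c\<^esub> proj n (P m) \<odot>\<^bsub>M c\<^esub> tbasis c m" for m
    unfolding X_def M_def R_def tbasis_def pj_ops
    by (rule arg_cong[of _ _ "pj n c"]) (auto simp: smul_def fun_eq_iff less_Suc_eq)
  have PR: "proj n (P m) \<in> carrier R" for m unfolding R_def truncated_ring_simps by simp
  have tc: "proj n (P m) \<odot>\<^bsub>M c\<^esub> tbasis c m \<in> carrier (M c)" for m
    unfolding tbasis_def M_def R_def pj_ops by (rule pj_carrier)
  let ?t = "\<lambda>m. frag_of (rsd (proj n (P m)) * a, tbasis c m)"
  have fin: "frag_of (a, X m) - (\<Sum>j<m. ?t j) \<in> tensor_rels R K (M c)" for m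
  proof (induction m)
    case 0
    \<comment> \<open>\<open>X 0\<close> is the zero vector; additivity applied to X 0 + X 0 = X 0
      puts a \<otimes> 0 among the relations.\<close>
    have "X 0 \<oplus>\<^bsub>M c\<^esub> X 0 = X 0" unfolding X_def M_def R_def pj_ops
      by (rule arg_cong[of _ _ "pj n c"]) (auto simp: fun_eq_iff)
    then show ?case using tensor_rels_uminus[OF tensor_rels_mem(2)[OF Xc[of 0] Xc[of 0], of a]] by simp
  next
    case (Suc m)
    let ?e = "proj n (P m) \<odot>\<^bsub>M c\<^esub> tbasis c m"
    have "(frag_of (a, X (Suc m)) - frag_of (a, X m) - frag_of (a, ?e)) + (frag_of (a, X m) - (\<Sum>j<m. ?t j))
       - (?t m - frag_of (a, ?e)) \<in> tensor_rels R K (M c)"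
      unfolding Xs
      by (rule tensor_rels_diff[OF tensor_rels_closed(2)[OF tensor_rels_mem(2)[OF Xc tc] Suc]
          tensor_rels_mem(3)[OF PR tbasis_carrier]])
    then show ?case by (simp add: algebra_simps)
  qed
  have "X c = x" unfolding X_def P pj_def by (simp add: res_def cong: restrict_cong)
  moreover have "tnormal c (tval c (frag_of (a, x))) = (\<Sum>j<c. ?t j)"
    unfolding tnormal_def tval_simps P by (intro sum.cong refl) (simp add: pj_def res_def mult.commute)
  ultimately show ?thesis using fin[of c] by simp
qed

lemma tnormal_rels: "z \<in> tpairs c \<Longrightarrow> z - tnormal c (tval c z) \<in> tensor_rels R K (M c)"
  unfolding tpairs_def mem_Collect_eq
proof (induction z rule: frag_induction)
  case zero
  show ?case using frag_of_zero_rels[OF tbasis_carrier]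
    by (auto simp: tval_simps tnormal_def intro!: tensor_rels_uminus tensor_rels_sum)
next
  case (one q)
  then show ?case using frag_of_tnormal_rels by (cases q) auto
next
  case (diff z z')
  have "(z - tnormal c (tval c z)) - (z' - tnormal c (tval c z')) -
      (tnormal c (tval c z - tval c z') - (tnormal c (tval c z) - tnormal c (tval c z'))) \<in> tensor_rels R K (M c)"
    by (rule tensor_rels_diff[OF tensor_rels_diff[OF diff] tnormal_diff_rels])
  then show ?case by (simp add: tval_simps algebra_simps fun_diff_def)
qed

text \<open>Modulo relations every element equals its normal form, which depends on
  \<open>tval\<close> only; value 0 therefore implies being a relation.\<close>

theorem tensor_rels_eq: "tensor_rels R K (M c) = {z \<in> tpairs c. tval c z = 0}"
proof
  show "{z \<in> tpairs c. tval c z = 0} \<subseteq> tensor_rels R K (M c)"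
  proof clarify
    fix z assume z: "z \<in> tpairs c" "tval c z = 0"
    have "tnormal c 0 \<in> tensor_rels R K (M c)"
      using frag_of_zero_rels[OF tbasis_carrier] by (auto simp: tnormal_def intro!: tensor_rels_sum)
    then show "z \<in> tensor_rels R K (M c)"
      using tensor_rels_closed(2)[OF tnormal_rels[OF z(1)]] z(2) by force
  qed
qed (rule tensor_rels_subset)

text \<open>The fibres of \<open>tval\<close> are the cosets of the relations, so vectors of k^c
  name the elements of the tensor product.\<close>

definition tcos :: "nat \<Rightarrow> (nat \<Rightarrow> 'k) \<Rightarrow> ('k \<times> (nat \<Rightarrow> ('v, 'k) mpoly set) \<Rightarrow>\<^sub>0 int) set" where
  "tcos c x = {z \<in> tpairs c. tval c z = x}"

lemma tensor_coset:
  assumes "z \<in> tpairs c"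
  shows "tensor_rels R K (M c) #>\<^bsub>tensor_gens K (M c)\<^esub> z = tcos c (tval c z)"
proof (intro equalityI subsetI)
  fix w assume "w \<in> tensor_rels R K (M c) #>\<^bsub>tensor_gens K (M c)\<^esub> z"
  then show "w \<in> tcos c (tval c z)"
    using assms by (auto simp: r_coset_def tensor_gens_simps tensor_rels_eq tcos_def tpairs_simps tval_simps)
next
  fix w assume "w \<in> tcos c (tval c z)"
  then have "w - z \<in> tensor_rels R K (M c)" "w = (w - z) + z"
    using assms by (auto simp: tensor_rels_eq tcos_def tpairs_simps tval_simps)
  then show "w \<in> tensor_rels R K (M c) #>\<^bsub>tensor_gens K (M c)\<^esub> z"
    unfolding r_coset_def tensor_gens_simps by blast
qed

lemma tpairs_sum: "(\<And>i. i \<in> A \<Longrightarrow> F i \<in> tpairs c) \<Longrightarrow> (\<Sum>i\<in>A. F i) \<in> tpairs c"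
  by (induction A rule: infinite_finite_induct) (auto intro: tpairs_simps)

lemma tval_sum: "tval c (\<Sum>i\<in>A. F i) = (\<Sum>i\<in>A. tval c (F i))"
proof -
  have "tval c (sum F A) = sum (\<lambda>i. tval c (F i)) A"
    by (rule infinite_finite_induct[of "\<lambda>A. tval c (sum F A) = sum (\<lambda>i. tval c (F i)) A"])
      (simp_all add: tval_simps)
  then show ?thesis .
qed

lemma tnormal_mem:
  assumes "x \<in> kfree c"
  shows "tnormal c x \<in> tcos c x"
proof -
  have "rvec c (tbasis c j) i = (if i = j then 1 else 0)" if "j < c" for i j
    using that by (simp add: tbasis_def rvec_pj)
  then have "tval c (tnormal c x) i = (\<Sum>j<c. if j = i then x j else 0)" for i
    unfolding tnormal_def tval_sum sum_fun_apply
    by (intro sum.cong refl) (simp add: tval_frag_of kscale_def)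
  also have "(\<Sum>j<c. if j = i then x j else 0) = x i" for i using assms by (auto simp: kfree_def)
  finally have "tval c (tnormal c x) = x" by (rule ext)
  moreover have "tnormal c x \<in> tpairs c"
    unfolding tnormal_def by (intro tpairs_sum tpairs_simps(5) tbasis_carrier)
  ultimately show ?thesis by (simp add: tcos_def)
qed

lemma inj_tcos: "inj_on (tcos c) (kfree c)"
proof (rule inj_onI)
  fix x y assume "x \<in> kfree c" "y \<in> kfree c" "tcos c x = tcos c y"
  then have "tnormal c x \<in> tcos c x" "tnormal c x \<in> tcos c y" using tnormal_mem[of x c] by auto
  then show "x = y" by (simp add: tcos_def)
qed

text \<open>One induction for two uses: \<open>h\<close> scales the left factor in the module
  structure, and \<open>m\<close> acts on the right factor in the induced maps.\<close>

lemma tpairs_frag_extend: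
  assumes z: "z \<in> tpairs c"
    and m: "\<And>a x. x \<in> carrier (M c) \<Longrightarrow> m (a, x) \<in> carrier (M c')"
    and G0: "\<And>x y. G (x - y) = G x - G y"
    and v: "\<And>a x. x \<in> carrier (M c) \<Longrightarrow> kscale (h (a, x)) (rvec c' (m (a, x))) = G (kscale a (rvec c x))"
  shows "frag_extend (\<lambda>q. frag_of (h q, m q)) z \<in> tpairs c' \<and>
    tval c' (frag_extend (\<lambda>q. frag_of (h q, m q)) z) = G (tval c z)"
  using z unfolding tpairs_def mem_Collect_eq
proof (induction z rule: frag_induction)
  case zero
  show ?case using G0[of 0 0] unfolding frag_extend_0 tval_simps(1) by (simp add: zero_fun_def)
next
  case (one q)
  obtain a x where q: "q = (a, x)" by (cases q)
  then have x: "x \<in> carrier (M c)" using one by simp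
  have "frag_of (h (a, x), m (a, x)) \<in> tpairs c'" by (rule tpairs_simps(5)[OF m[OF x]])
  then show ?case using v[OF x, of a] unfolding q frag_extend_of tval_frag_of tpairs_def by simp
next
  case (diff z z')
  let ?e = "frag_extend (\<lambda>q. frag_of (h q, m q))"
  have "tval c' (?e (z - z')) = G (tval c (z - z'))"
    unfolding frag_extend_diff tval_simps(3) G0 using diff by simp
  moreover have "?e (z - z') \<in> tpairs c'"
    unfolding frag_extend_diff by (rule tpairs_simps(3)) (use diff in \<open>simp_all add: tpairs_def\<close>)
  ultimately show ?case by (simp add: tpairs_def)
qed

lemma tensor_simps:
  "carrier (tensor R K (M c)) = tcos c ` kfree c"
  "\<zero>\<^bsub>tensor R K (M c)\<^esub> = tcos c 0"
  "x \<in> kfree c \<Longrightarrow> y \<in> kfree c \<Longrightarrow> tcos c x \<oplus>\<^bsub>tensor R K (M c)\<^esub> tcos c y = tcos c (x + y)"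
  "r \<in> carrier R \<Longrightarrow> x \<in> kfree c \<Longrightarrow> r \<odot>\<^bsub>tensor R K (M c)\<^esub> tcos c x = tcos c (kscale (rsd r) x)"
proof -
  let ?F = "tensor_gens K (M c)" and ?N = "tensor_rels R K (M c)"
  show "carrier (tensor R K (M c)) = tcos c ` kfree c"
  proof -
    have "carrier (tensor R K (M c)) = (\<lambda>z. tcos c (tval c z)) ` tpairs c"
      using tensor_coset by (auto simp: tensor_def Let_def RCOSETS_def tensor_gens_simps)
    also have "\<dots> = tcos c ` (tval c ` tpairs c)" by (simp add: image_image)
    also have "tval c ` tpairs c = kfree c"
    proof (intro equalityI subsetI)
      fix x :: "nat \<Rightarrow> 'k" assume "x \<in> kfree c"
      then have "tnormal c x \<in> tpairs c" "tval c (tnormal c x) = x" using tnormal_mem by (auto simp: tcos_def)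
      then show "x \<in> tval c ` tpairs c" by (metis imageI)
    qed (use tval_kfree in blast)
    finally show ?thesis .
  qed
  show "\<zero>\<^bsub>tensor R K (M c)\<^esub> = tcos c 0"
    by (simp add: tensor_def Let_def tensor_rels_eq tcos_def)
  show "tcos c x \<oplus>\<^bsub>tensor R K (M c)\<^esub> tcos c y = tcos c (x + y)" if xy: "x \<in> kfree c" "y \<in> kfree c"
  proof -
    have "tcos c x \<oplus>\<^bsub>tensor R K (M c)\<^esub> tcos c y = (\<Union>z\<in>tcos c x. \<Union>w\<in>tcos c y. {z + w})"
      by (simp add: tensor_def Let_def set_mult_def tensor_gens_simps)
    also have "\<dots> = tcos c (x + y)"
    proof (intro equalityI subsetI)
      fix z assume "z \<in> tcos c (x + y)"
      then have "z - tnormal c y \<in> tcos c x" "tnormal c y \<in> tcos c y" "z = (z - tnormal c y) + tnormal c y"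
        using tnormal_mem[OF xy(2)] by (auto simp: tcos_def tpairs_simps tval_simps)
      then show "z \<in> (\<Union>z\<in>tcos c x. \<Union>w\<in>tcos c y. {z + w})" by blast
    qed (auto simp: tcos_def tpairs_simps tval_simps)
    finally show ?thesis .
  qed
  show "r \<odot>\<^bsub>tensor R K (M c)\<^esub> tcos c x = tcos c (kscale (rsd r) x)" if r: "r \<in> carrier R" "x \<in> kfree c"
  proof -
    let ?e = "frag_extend (\<lambda>(a, x). frag_of (r \<odot>\<^bsub>K\<^esub> a, x))"
    have e: "?e z \<in> tpairs c \<and> tval c (?e z) = kscale (rsd r) (tval c z)" if "z \<in> tpairs c" for z
      using tpairs_frag_extend[OF that, of snd c "kscale (rsd r)" "\<lambda>q. r \<odot>\<^bsub>K\<^esub> fst q"]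
      by (simp add: K_def residue_module_simps kscale_def fun_eq_iff algebra_simps case_prod_beta')
    have "r \<odot>\<^bsub>tensor R K (M c)\<^esub> tcos c x = (\<Union>z\<in>tcos c x. ?N #>\<^bsub>?F\<^esub> ?e z)"
      by (simp add: tensor_def Let_def)
    also have "\<dots> = (\<Union>z\<in>tcos c x. tcos c (kscale (rsd r) x))"
      using e tensor_coset by (intro SUP_cong refl) (simp add: tcos_def)
    also have "\<dots> = tcos c (kscale (rsd r) x)" using tnormal_mem[OF r(2)] by auto
    finally show ?thesis .
  qed
qed

lemma tensor_map_tcos:
  assumes g: "\<And>x. x \<in> carrier (M c) \<Longrightarrow> g x \<in> carrier (M c')"
    and G: "Vector_Spaces.linear kscale kscale G"
    and gG: "\<And>x. x \<in> carrier (M c) \<Longrightarrow> rvec c' (g x) = G (rvec c x)"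
    and x: "x \<in> kfree c"
  shows "tensor_map R K (M c') g (tcos c x) = tcos c' (G x)"
proof -
  let ?e = "frag_extend (\<lambda>(a, x). frag_of (a, g x))"
  note G' = Vector_Spaces.linear.axioms(3)[OF G]
  have e: "?e z \<in> tpairs c' \<and> tval c' (?e z) = G (tval c z)" if "z \<in> tpairs c" for z
    using tpairs_frag_extend[OF that, of "\<lambda>q. g (snd q)" c' G "fst"] g gG
      module_hom.diff[OF G'] module_hom.scale[OF G'] by (simp add: case_prod_beta')
  have "tensor_map R K (M c') g (tcos c x) =
      (\<Union>z\<in>tcos c x. tensor_rels R K (M c') #>\<^bsub>tensor_gens K (M c')\<^esub> ?e z)"
    by (simp add: tensor_map_def)
  also have "\<dots> = (\<Union>z\<in>tcos c x. tcos c' (G x))"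
    using e tensor_coset by (intro SUP_cong refl) (simp add: tcos_def)
  also have "\<dots> = tcos c' (G x)" using tnormal_mem[OF x] by auto
  finally show ?thesis .
qed

end

section \<open>Betti numbers\<close>

text \<open>\<open>G l\<close> is column \<open>l\<close> of a matrix over S; \<open>mat_bar\<close>
  is the same matrix reduced modulo the maximal ideal.\<close>

definition mat_lin :: "nat \<Rightarrow> (nat \<Rightarrow> 'i \<Rightarrow> ('v::finite, 'k::field) mpoly) \<Rightarrow> (nat \<Rightarrow> ('v, 'k) mpoly) \<Rightarrow> 'i \<Rightarrow> ('v, 'k) mpoly" where
  "mat_lin c G P = (\<Sum>l<c. smul (P l) (G l))"

definition mat_bar :: "nat \<Rightarrow> (nat \<Rightarrow> 'i \<Rightarrow> ('v::finite, 'k::field) mpoly) \<Rightarrow> (nat \<Rightarrow> 'k) \<Rightarrow> 'i \<Rightarrow> 'k" where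
  "mat_bar c G x = (\<Sum>l<c. kscale (x l) (cterm (G l)))"

lemma mat_lin_simps:
  "mat_lin c G (P + Q) = mat_lin c G P + mat_lin c G Q"
  "mat_lin c G (smul r P) = smul r (mat_lin c G P)"
  "mat_lin c G (fscale a P) = fscale a (mat_lin c G P)"
  by (auto simp: mat_lin_def fun_eq_iff sum_fun_apply smul_def fscale_def sum.distrib sum_distrib_left
      algebra_simps)

lemma mat_lin_0: "mat_lin 0 G P = 0" and mat_lin_Suc: "mat_lin (Suc m) G P = mat_lin m G P + smul (P m) (G m)"
  by (simp_all only: mat_lin_def sum.lessThan_Suc lessThan_0 sum.empty)

lemma linear_mat_lin: "Vector_Spaces.linear fscale fscale (mat_lin c G)"
  by (rule linear_fscaleI) (auto simp: mat_lin_simps)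

lemma mat_lin_free: "(\<And>l. l < c \<Longrightarrow> G l \<in> free c') \<Longrightarrow> mat_lin c G P \<in> free c'"
  by (auto simp: mat_lin_def free_def sum_fun_apply smul_def)

lemma linear_mat_bar: "Vector_Spaces.linear kscale kscale (mat_bar c G)"
  by (rule linear_kkI)
    (auto simp: mat_bar_def fun_eq_iff sum_fun_apply kscale_def sum.distrib sum_distrib_left algebra_simps)

lemma cterm_mat_lin: "cterm (mat_lin c G P) = mat_bar c G (cterm P)"
  by (auto simp: mat_lin_def mat_bar_def cterm_def sum_fun_apply smul_def kscale_def lookup_sum
      lookup_mult_0 fun_eq_iff)

lemma rvec_pj_free: "n \<ge> 1 \<Longrightarrow> x \<in> free c \<Longrightarrow> rvec c (pj n c x) = cterm x"
  by (auto simp: rvec_pj cterm_def free_def fun_eq_iff)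

text \<open>A map between free modules over R is determined by the images of the basis vectors, and
  these lift to S.\<close>

lemma module_hom_tfree:
  fixes h :: "(nat \<Rightarrow> ('v::finite, 'k::field) mpoly set) \<Rightarrow> (nat \<Rightarrow> ('v, 'k) mpoly set)"
  assumes h: "h \<in> LinearCombinations.module_hom (truncated_ring n) (tfree n c) (tfree n c')"
  obtains G where "\<And>l. G l \<in> free c'" "\<And>P. P \<in> free c \<Longrightarrow> h (pj n c P) = pj n c' (mat_lin c G P)"
proof -
  let ?e = "\<lambda>l i. if i = l then 1 else 0 :: ('v, 'k) mpoly"
  have hc: "h (pj n c P) \<in> carrier (tfree n c')" for P
    by (rule funcset_mem[OF module_hom_closed[OF h] pj_carrier])
  have hadd: "h (pj n c (P + Q)) = h (pj n c P) \<oplus>\<^bsub>tfree n c'\<^esub> h (pj n c Q)" for P Q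
    unfolding pj_ops[symmetric] by (rule LinearCombinations.module_hom_add[OF h pj_carrier pj_carrier])
  have hsm: "h (pj n c (smul r P)) = proj n r \<odot>\<^bsub>tfree n c'\<^esub> h (pj n c P)" for P r
    unfolding pj_ops[symmetric]
    by (rule LinearCombinations.module_hom_smult[OF h _ pj_carrier]) (simp add: truncated_ring_simps)
  have "\<exists>x. x \<in> free c' \<and> h (pj n c (?e l)) = pj n c' x" for l
    using hc[of "?e l"] unfolding pj_image[symmetric] by blast
  then obtain G where G: "\<And>l. G l \<in> free c'" "\<And>l. h (pj n c (?e l)) = pj n c' (G l)" by metis
  show ?thesis
  proof (rule that[of G])
    fix P :: "nat \<Rightarrow> ('v, 'k) mpoly" assume "P \<in> free c"
    \<comment> \<open>\<open>Q m\<close> keeps the first \<open>m\<close> coordinates, so linearity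
      is used one basis vector at a time.\<close>
    define Q where "Q m = (\<lambda>i. if i < m then P i else 0)" for m
    have "h (pj n c (Q m)) = pj n c' (mat_lin m G P)" for m
    proof (induction m)
      case 0
      have "Q 0 = smul 0 (Q 0)" "smul 0 x = 0" for x :: "nat \<Rightarrow> ('v, 'k) mpoly"
        by (auto simp: Q_def smul_def fun_eq_iff)
      then have "h (pj n c (Q 0)) = proj n 0 \<odot>\<^bsub>tfree n c'\<^esub> h (pj n c (Q 0))" using hsm[of 0 "Q 0"] by metis
      moreover obtain y where "h (pj n c (Q 0)) = pj n c' y" using hc[of "Q 0"] unfolding pj_image[symmetric] by blast
      ultimately have "h (pj n c (Q 0)) = pj n c' (smul 0 y)" unfolding pj_ops[symmetric] by simp
      then show ?case unfolding \<open>\<And>x. smul 0 x = 0\<close> by (simp only: mat_lin_0)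
    next
      case (Suc m)
      have "Q (Suc m) = Q m + smul (P m) (?e m)"
        by (auto simp: Q_def smul_def fun_eq_iff less_Suc_eq)
      then have "h (pj n c (Q (Suc m))) = pj n c' (mat_lin m G P + smul (P m) (G m))"
        unfolding pj_ops[symmetric] using Suc G(2)[of m] hadd[of "Q m"] hsm[of "P m"] by metis
      then show ?case by (simp only: mat_lin_Suc)
    qed
    moreover have "Q c = P" using \<open>P \<in> free c\<close> by (auto simp: Q_def free_def fun_eq_iff)
    ultimately show "h (pj n c P) = pj n c' (mat_lin c G P)" by metis
  qed (rule G(1))
qed

lemma rvec_module_hom:
  assumes n: "n \<ge> 1" and G: "\<And>l. G l \<in> free c'" "\<And>P. P \<in> free c \<Longrightarrow> h (pj n c P) = pj n c' (mat_lin c G P)"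
    and x: "x \<in> carrier (tfree n c)"
  shows "rvec c' (h x) = mat_bar c G (rvec c x)"
proof -
  obtain P where "P \<in> free c" "x = pj n c P" using x unfolding pj_image[symmetric] by blast
  then show ?thesis using n G by (simp add: rvec_pj_free mat_lin_free cterm_mat_lin)
qed

lemma rvec_surj: "n \<ge> 1 \<Longrightarrow> x \<in> kfree c \<Longrightarrow> \<exists>y\<in>carrier (tfree n c :: (('v::finite, 'k::field) mpoly set, _) module). x = rvec c y"
proof -
  assume n: "n \<ge> 1" and "x \<in> kfree c"
  then obtain P :: "nat \<Rightarrow> ('v, 'k) mpoly" where "P \<in> free c" "x = cterm P"
    using cterm_free_lt[OF n, of c] free_lt_subset[of c n] by blast
  then show ?thesis using rvec_pj_free[OF n] pj_carrier by metis
qed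

context
  fixes n :: nat and c :: "nat \<Rightarrow> nat"
    and g :: "nat \<Rightarrow> (nat \<Rightarrow> ('v::finite, 'k::field) mpoly set) \<Rightarrow> (nat \<Rightarrow> ('v, 'k) mpoly set)"
    and gb :: "nat \<Rightarrow> (nat \<Rightarrow> 'k) \<Rightarrow> nat \<Rightarrow> 'k"
  assumes n: "n \<ge> 1"
    and g: "\<And>i x. i \<ge> 1 \<Longrightarrow> x \<in> carrier (tfree n (c i)) \<Longrightarrow> g i x \<in> carrier (tfree n (c (i - 1)))"
    and lin: "\<And>i. Vector_Spaces.linear kscale kscale (gb i)"
    and gb: "\<And>i x. i \<ge> 1 \<Longrightarrow> x \<in> carrier (tfree n (c i)) \<Longrightarrow> rvec (c (i - 1)) (g i x) = gb i (rvec (c i) x)"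
begin

lemma gb_kfree: "i \<ge> 1 \<Longrightarrow> x \<in> kfree (c i) \<Longrightarrow> gb i x \<in> kfree (c (i - 1))"
proof -
  assume i: "i \<ge> 1" and "x \<in> kfree (c i)"
  then obtain y where "y \<in> carrier (tfree n (c i) :: (('v, 'k) mpoly set, _) module)" "x = rvec (c i) y"
    using rvec_surj[OF n] by blast
  then have "gb i x = rvec (c (i - 1)) (g i y)" using gb[OF i] by simp
  then show ?thesis by (simp add: rvec_def kfree_def)
qed

text \<open>Through \<open>tcos\<close> the tensored complex becomes \<open>kfree (c i)\<close> with
  the maps \<open>gb i\<close>, and Tor becomes kernel modulo image. In index 0 the whole space
  takes the place of the kernel.\<close>

lemma betti_kernel_image:
  assumes V: "V = (if i = 0 then kfree (c 0) else {x \<in> kfree (c i). gb i x = 0})"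
    and im: "gb (i + 1) ` kfree (c (i + 1)) \<subseteq> V"
  shows "ks.dim V = ks.dim (gb (i + 1) ` kfree (c (i + 1))) + betti n c g i"
proof -
  let ?R = "truncated_ring n :: ('v, 'k) mpoly set ring" and ?K = "residue_module n :: (('v, 'k) mpoly set, 'k) module"
  let ?C = "\<lambda>j. tensor ?R ?K (tfree n (c j))"
  let ?\<delta> = "\<lambda>j. tensor_map ?R ?K (tfree n (c (j - 1))) (g j)"
  have \<delta>: "?\<delta> j (tcos n (c j) x) = tcos n (c (j - 1)) (gb j x)" if "j \<ge> 1" "x \<in> kfree (c j)" for j x
    by (rule tensor_map_tcos[OF n g[OF that(1)] lin gb[OF that(1)] that(2)])
  let ?M = "(?C i)\<lparr>carrier := (if i = 0 then carrier (?C 0) else a_kernel (?C i) (?C (i - 1)) (?\<delta> i))\<rparr>"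
  have Vs: "V \<subseteq> kfree (c i)" using V by auto
  have Vk: "ks.subspace V"
    using subspace_kfree[of "c i"] module_hom.add[OF Vector_Spaces.linear.axioms(3)[OF lin[of i]]]
      module_hom.scale[OF Vector_Spaces.linear.axioms(3)[OF lin[of i]]]
      module_hom.zero[OF Vector_Spaces.linear.axioms(3)[OF lin[of i]]]
    unfolding V by (cases "i = 0") (auto simp: ks.subspace_def kscale_def)
  have W: "ks.subspace (gb (i + 1) ` kfree (c (i + 1)))"
    by (rule module_hom.subspace_image[OF Vector_Spaces.linear.axioms(3)[OF lin] subspace_kfree])
  have Mc: "carrier ?M = tcos n (c i) ` V"
  proof (cases "i = 0")
    case False
    have "a_kernel (?C i) (?C (i - 1)) (?\<delta> i) = {X \<in> carrier (?C i). ?\<delta> i X = \<zero>\<^bsub>?C (i - 1)\<^esub>}"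
      by (simp add: a_kernel_def kernel_def)
    also have "\<dots> = tcos n (c i) ` {x \<in> kfree (c i). ?\<delta> i (tcos n (c i) x) = \<zero>\<^bsub>?C (i - 1)\<^esub>}"
      unfolding tensor_simps(1)[OF n] by blast
    also have "{x \<in> kfree (c i). ?\<delta> i (tcos n (c i) x) = \<zero>\<^bsub>?C (i - 1)\<^esub>} = {x \<in> kfree (c i). gb i x = 0}"
    proof (intro Collect_cong conj_cong refl)
      fix x :: "nat \<Rightarrow> 'k" assume x: "x \<in> kfree (c i)"
      show "(?\<delta> i (tcos n (c i) x) = \<zero>\<^bsub>?C (i - 1)\<^esub>) = (gb i x = 0)"
        unfolding tensor_simps(2)[OF n]
        using \<delta>[of i x] False x inj_on_eq_iff[OF inj_tcos[OF n] gb_kfree[of i x] ks.subspace_0[OF subspace_kfree]]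
        by simp
    qed
    finally show ?thesis using False V by simp
  qed (simp add: V tensor_simps[OF n])
  have Wc: "?\<delta> (i + 1) ` carrier (?C (i + 1)) = tcos n (c i) ` gb (i + 1) ` kfree (c (i + 1))"
    unfolding tensor_simps(1)[OF n] image_image using \<delta>[of "i + 1"] by (intro image_cong) auto
  have "ks.dim V = ks.dim (gb (i + 1) ` kfree (c (i + 1))) + vectorspace.dim class_ring
      (restrict_scalars (\<lambda>s::'k. proj n (Poly_Mapping.single 0 s))
        (quot_module ?M (tcos n (c i) ` gb (i + 1) ` kfree (c (i + 1)))))"
  proof (rule ks.dim_quot_module[OF Vk ks.fd_subset[OF dim_kfree(2) Vs] W im Mc inj_on_subset[OF inj_tcos[OF n] Vs]])
    fix x y assume "x \<in> V" "y \<in> V"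
    then show "tcos n (c i) x \<oplus>\<^bsub>?M\<^esub> tcos n (c i) y = tcos n (c i) (x + y)"
      using tensor_simps(3)[OF n, of x "c i" y] Vs by auto
  next
    fix s and x assume "x \<in> V"
    then show "proj n (Poly_Mapping.single 0 s) \<odot>\<^bsub>?M\<^esub> tcos n (c i) x = tcos n (c i) (kscale s x)"
      using tensor_simps(4)[OF n, of "proj n (Poly_Mapping.single 0 s)" x "c i"] Vs
      by (auto simp: truncated_ring_simps rsd_proj[OF n])
  qed
  then show ?thesis
    unfolding betti_def k_dim_def Tor_def Let_def Wc .
qed

text \<open>The rank of \<open>gb 1\<close> is subtracted in both Betti numbers and cancels, so the
  formula holds for every resolution, minimal or not.\<close>

lemma betti_diff:
  assumes "\<And>x. x \<in> kfree (c 2) \<Longrightarrow> gb 1 (gb 2 x) = 0"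
  shows "int (betti n c g 1) - int (betti n c g 0) = int (c 1) - int (c 0) - int (ks.dim (gb 2 ` kfree (c 2)))"
proof -
  have 1: "ks.dim (kfree (c 0) :: (nat \<Rightarrow> 'k) set) = ks.dim (gb 1 ` kfree (c 1)) + betti n c g 0"
    using betti_kernel_image[of "kfree (c 0)" 0] gb_kfree[of 1] by (auto simp del: One_nat_def)
  have "gb 2 x \<in> kfree (c 1)" if "x \<in> kfree (c 2)" for x using gb_kfree[of 2 x] that by simp
  then have 2: "ks.dim {x \<in> kfree (c 1). gb 1 x = 0} = ks.dim (gb 2 ` kfree (c 2)) + betti n c g 1"
    using betti_kernel_image[of "{x \<in> kfree (c 1). gb 1 x = 0}" 1] assms
    by (simp del: One_nat_def add: image_subset_iff one_add_one)
  show ?thesis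
    using 1 2 kk.rank_nullity_fd[OF lin[of 1] subspace_kfree dim_kfree(2), of "c 1"] by (simp add: dim_kfree(1))
qed

end

lemma mat_lin_diff: "mat_lin c G (P - Q) = mat_lin c G P - mat_lin c G Q"
  using mat_lin_simps(1)[of c G "P - Q" Q] by simp

lemma mat_lin_sum: "mat_lin c G (\<Sum>v\<in>A. P v) = (\<Sum>v\<in>A. mat_lin c G (P v))"
proof -
  have "mat_lin c G 0 = 0" using mat_lin_diff[of c G 0 0] by simp
  then show ?thesis
    by (rule_tac infinite_finite_induct[of "\<lambda>A. mat_lin c G (sum P A) = sum (\<lambda>v. mat_lin c G (P v)) A"])
      (simp_all add: mat_lin_simps(1))
qed

lemma subspace_free_ge: "fs.subspace (free_ge c n)"
  by (rule fs.subspaceI) (auto intro: free_ge_add free_ge_smul simp: smul_const_eq[symmetric])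

lemma mat_lin_free_ge:
  assumes "\<And>l. G l \<in> free c'" "P \<in> free_ge c n"
  shows "mat_lin c G P \<in> free_ge c' n"
proof -
  have "(\<Sum>l<c. smul (P l) (G l)) \<in> free_ge c' n"
    using assms by (intro fs.subspace_sum[OF subspace_free_ge] free_ge_smul_ideal) (auto simp: free_ge_def)
  then show ?thesis by (simp only: mat_lin_def)
qed

lemma cterm_eq_0_decompose:
  assumes "cterm P = 0" "P \<in> free c"
  obtains Q :: "'v::finite \<Rightarrow> nat \<Rightarrow> ('v, 'k::field) mpoly"
  where "\<And>v. Q v \<in> free c" "P = (\<Sum>v\<in>UNIV. smul (var v) (Q v))"
proof -
  have P: "P i \<in> ideal_ge (Suc 0)" for i
    using assms(1) by (intro ideal_geI) (simp add: cterm_def fun_eq_iff)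
  have "\<exists>q. P i = (\<Sum>v\<in>UNIV. var v * q v)" for i by (rule ideal_ge_Suc_decompose[OF P]) blast
  then have "\<exists>q. \<forall>i. P i = (\<Sum>v\<in>UNIV. var v * q i v)" by (intro choice allI)
  then obtain q where q: "\<And>i. P i = (\<Sum>v\<in>UNIV. var v * q i v)" by blast
  show ?thesis
  proof (rule that[of "\<lambda>v i. if i < c then q i v else 0"])
    show "P = (\<Sum>v\<in>UNIV. smul (var v) (\<lambda>i. if i < c then q i v else 0))"
    proof
      fix i
      show "P i = (\<Sum>v\<in>UNIV. smul (var v) (\<lambda>i. if i < c then q i v else 0)) i"
        using q[of i] assms(2) by (cases "i < c") (auto simp: sum_fun_apply smul_def free_def)
    qed
  qed (simp add: free_def)
qed

lemma (in dual_pairing) rker_smul: "x \<in> rker \<Longrightarrow> smul r x \<in> rker"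
  by (auto simp: rker_def free_smul smul_smul)

lemma (in dual_pairing) mrker_subset_rker: "mrker \<subseteq> rker"
proof
  fix x assume "x \<in> mrker"
  then obtain y where y: "\<And>v. y v \<in> rker" "x - (\<Sum>v\<in>UNIV. smul (var v) (y v)) \<in> free_ge c n"
    by (auto simp: mrker_def)
  have "(\<Sum>v\<in>UNIV. smul (var v) (y v)) \<in> rker" by (intro fs.subspace_sum[OF subspace_rker] rker_smul y(1))
  then show "x \<in> rker" using rker_add[OF free_ge_rker[OF y(2)]] by fastforce
qed

text \<open>The minimal number of generators of the right kernel, read off a presentation of it.\<close>

lemma (in dual_pairing) dim_rker_presentation:
  assumes G: "\<And>l. G l \<in> free c" and H: "\<And>l. H l \<in> free c1"
    and im: "\<And>P. P \<in> free c1 \<Longrightarrow> mat_lin c1 G P \<in> rker"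
    and onto: "\<And>x. x \<in> rker \<Longrightarrow> \<exists>P\<in>free c1. x - mat_lin c1 G P \<in> free_ge c n"
    and exact: "\<And>P. P \<in> free c1 \<Longrightarrow> mat_lin c1 G P \<in> free_ge c n \<longleftrightarrow> (\<exists>Q\<in>free c2. P - mat_lin c2 H Q \<in> free_ge c1 n)"
  shows "fs.dim (rker \<inter> free_lt c n) + ks.dim (mat_bar c2 H ` kfree c2) = fs.dim (mrker \<inter> free_lt c n) + c1"
proof -
  have n1: "n \<ge> 1" using n by simp
  let ?I = "mat_bar c2 H ` kfree c2"
  let ?T = "\<lambda>x i. trunc n ((x :: nat \<Rightarrow> ('v, 'k) mpoly) i)"
  define \<Phi> where "\<Phi> P = ?T (mat_lin c1 G P)" for P
  have lin: "Vector_Spaces.linear fscale fscale \<Phi>"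
    using Vector_Spaces.linear_compose[OF linear_mat_lin linear_trunc] unfolding \<Phi>_def comp_def .
  have Gf: "mat_lin c1 G P \<in> free c" for P by (rule mat_lin_free[OF G])
  have \<Phi>_lt: "\<Phi> P \<in> free_lt c n" for P unfolding \<Phi>_def by (rule trunc_in_free_lt[OF Gf])
  have \<Phi>_ge: "mat_lin c1 G P - \<Phi> P \<in> free_ge c n" for P unfolding \<Phi>_def by (rule diff_trunc_in_free_ge[OF Gf])
  have lt_free: "P \<in> free c1" if "P \<in> free_lt c1 n" for P :: "nat \<Rightarrow> ('v, 'k) mpoly" using that free_lt_subset by blast
  have \<Phi>_rker: "\<Phi> P \<in> rker" if "P \<in> free c1" for P
  proof -
    have "\<Phi> P = mat_lin c1 G P - (mat_lin c1 G P - \<Phi> P)" by simp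
    then show ?thesis using fs.subspace_diff[OF subspace_rker im[OF that] free_ge_rker[OF \<Phi>_ge[of P]]] by metis
  qed
  have im_eq: "\<Phi> ` free_lt c1 n = rker \<inter> free_lt c n"
  proof (intro equalityI subsetI)
    fix x assume x: "x \<in> rker \<inter> free_lt c n"
    then obtain P where P: "P \<in> free c1" "x - mat_lin c1 G P \<in> free_ge c n" using onto by blast
    have "mat_lin c1 G (P - ?T P) \<in> free_ge c n"
      by (rule mat_lin_free_ge[OF G diff_trunc_in_free_ge[OF P(1)]])
    from free_ge_add[OF free_ge_add[OF P(2) this] \<Phi>_ge[of "?T P"]]
    have "x - \<Phi> (?T P) \<in> free_ge c n" by (simp add: mat_lin_diff)
    moreover have "x - \<Phi> (?T P) \<in> free_lt c n"
      using x fs.subspace_diff[OF dim_free_lt(3) _ \<Phi>_lt] by blast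
    ultimately have "x - \<Phi> (?T P) = 0" using free_lt_ge_eq_0 by blast
    then have "x = \<Phi> (?T P)" by simp
    then show "x \<in> \<Phi> ` free_lt c1 n" using trunc_in_free_lt[OF P(1)] by blast
  qed (use \<Phi>_rker \<Phi>_lt lt_free in auto)
  \<comment> \<open>\<open>P\<close> maps into m K exactly if it differs from an element of the
    kernel by something in \<nn> S^c1 (modulo \<open>\<nn>\<^sup>n\<close>), and the constant parts
    of kernel elements are those in \<open>?I\<close>.\<close>
  have mem: "mat_lin c1 G P \<in> mrker \<longleftrightarrow> cterm P \<in> ?I" if P: "P \<in> free c1" for P
  proof
    assume "mat_lin c1 G P \<in> mrker"
    then obtain y where y: "\<And>v. y v \<in> rker" "mat_lin c1 G P - (\<Sum>v\<in>UNIV. smul (var v) (y v)) \<in> free_ge c n"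
      by (auto simp: mrker_def)
    have "\<forall>v. \<exists>Q\<in>free c1. y v - mat_lin c1 G Q \<in> free_ge c n" using onto y(1) by blast
    then obtain Q where Q: "\<And>v. Q v \<in> free c1" "\<And>v. y v - mat_lin c1 G (Q v) \<in> free_ge c n" by metis
    let ?S = "\<Sum>v\<in>UNIV. smul (var v) (Q v)"
    have "mat_lin c1 G (P - ?S) = (mat_lin c1 G P - (\<Sum>v\<in>UNIV. smul (var v) (y v))) +
        (\<Sum>v\<in>UNIV. smul (var v) (y v - mat_lin c1 G (Q v)))"
      by (simp add: mat_lin_diff mat_lin_sum mat_lin_simps smul_diff_right sum_subtractf)
    also have "\<dots> \<in> free_ge c n"
      by (intro free_ge_add y(2) fs.subspace_sum[OF subspace_free_ge] free_ge_smul Q(2))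
    finally have "mat_lin c1 G (P - ?S) \<in> free_ge c n" .
    moreover have "P - ?S \<in> free c1" by (intro free_diff P free_sum free_smul Q(1))
    ultimately obtain U where U: "U \<in> free c2" "(P - ?S) - mat_lin c2 H U \<in> free_ge c1 n" using exact by blast
    have "cterm ((P - ?S) - mat_lin c2 H U) = 0"
      using U(2) n1 by (auto simp: cterm_def free_ge_def fun_eq_iff intro!: ideal_geD[of _ n])
    moreover have "cterm ?S = 0"
      by (auto simp: cterm_def fun_eq_iff sum_fun_apply smul_def lookup_sum lookup_var_mult_eq_0)
    ultimately have "cterm P = mat_bar c2 H (cterm U)"
      unfolding cterm_mat_lin[symmetric] by (auto simp: cterm_def fun_eq_iff lookup_minus)
    moreover have "cterm U \<in> kfree c2" using U(1) by (auto simp: cterm_def kfree_def free_def)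
    ultimately show "cterm P \<in> ?I" by blast
  next
    assume "cterm P \<in> ?I"
    then obtain u where u: "u \<in> kfree c2" "cterm P = mat_bar c2 H u" by blast
    obtain U where U: "U \<in> free c2" "u = cterm (U :: nat \<Rightarrow> ('v, 'k) mpoly)"
      using u(1) cterm_free_lt[OF n1, of c2] free_lt_subset[of c2 n] by blast
    have "cterm (P - mat_lin c2 H U) = 0"
      using u(2) unfolding U(2) cterm_mat_lin[symmetric] by (auto simp: cterm_def fun_eq_iff lookup_minus)
    then obtain Q where Q: "\<And>v. Q v \<in> free c1" "P - mat_lin c2 H U = (\<Sum>v\<in>UNIV. smul (var v) (Q v))"
      by (rule cterm_eq_0_decompose[OF _ free_diff[OF P mat_lin_free[OF H]]]) blast
    have "mat_lin c1 G (mat_lin c2 H U) \<in> free_ge c n"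
      unfolding exact[OF mat_lin_free[OF H]] using U(1) by (intro bexI[of _ U]) auto
    moreover have "mat_lin c1 G P - (\<Sum>v\<in>UNIV. smul (var v) (mat_lin c1 G (Q v))) = mat_lin c1 G (mat_lin c2 H U)"
      using arg_cong[OF Q(2), of "mat_lin c1 G"] by (simp add: mat_lin_diff mat_lin_sum mat_lin_simps algebra_simps)
    ultimately show "mat_lin c1 G P \<in> mrker"
      unfolding mrker_def mem_Collect_eq using im[OF Q(1)] Gf
      by (intro conjI exI[of _ "\<lambda>v. mat_lin c1 G (Q v)"]) simp_all
  qed
  have "\<Phi> P \<in> mrker \<inter> free_lt c n \<longleftrightarrow> cterm P \<in> ?I" if "P \<in> free_lt c1 n" for P
  proof -
    have "\<Phi> P \<in> mrker \<longleftrightarrow> mat_lin c1 G P \<in> mrker"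
      using mrker_cong[OF \<Phi>_ge[of P]] mrker_cong[of "\<Phi> P" "mat_lin c1 G P"]
        free_ge_diff[OF free_ge_zero \<Phi>_ge[of P]] by auto
    then show ?thesis using mem[OF lt_free[OF that]] \<Phi>_lt[of P] by blast
  qed
  \<comment> \<open>One space is counted twice, as the preimage of m K and as the preimage of
    \<open>?I\<close> under constant terms; its dimension is then eliminated.\<close>
  then have Y: "{P \<in> free_lt c1 n. \<Phi> P \<in> mrker \<inter> free_lt c n} = {P \<in> free_lt c1 n. cterm P \<in> ?I}" by blast
  have "fs.dim (free_lt c1 n :: (nat \<Rightarrow> ('v, 'k) mpoly) set) + fs.dim (mrker \<inter> free_lt c n) =
      fs.dim {P \<in> free_lt c1 n. \<Phi> P \<in> mrker \<inter> free_lt c n} + fs.dim (rker \<inter> free_lt c n)"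
    unfolding im_eq[symmetric]
  proof (rule fp.dim_preimage_fd[OF lin dim_free_lt(3,2)])
    show "fs.subspace (mrker \<inter> free_lt c n)" by (rule fs.subspace_inter[OF subspace_mrker dim_free_lt(3)])
    show "mrker \<inter> free_lt c n \<subseteq> \<Phi> ` free_lt c1 n" unfolding im_eq using mrker_subset_rker by blast
  qed
  moreover have "fs.dim (free_lt c1 n :: (nat \<Rightarrow> ('v, 'k) mpoly) set) + ks.dim ?I =
      fs.dim {P \<in> free_lt c1 n :: (nat \<Rightarrow> ('v, 'k) mpoly) set. cterm P \<in> ?I} + ks.dim (kfree c1 :: (nat \<Rightarrow> 'k) set)"
    unfolding cterm_free_lt[OF n1, where 'v = 'v, of c1, symmetric]
  proof (rule fk.dim_preimage_fd[OF linear_cterm dim_free_lt(3,2)])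
    show "ks.subspace ?I"
      by (rule module_hom.subspace_image[OF Vector_Spaces.linear.axioms(3)[OF linear_mat_bar] subspace_kfree])
    have "mat_bar c2 H x \<in> kfree c1" for x
      using H by (auto simp: mat_bar_def kfree_def sum_fun_apply kscale_def cterm_def free_def)
    then show "?I \<subseteq> cterm ` (free_lt c1 n :: (nat \<Rightarrow> ('v, 'k) mpoly) set)" unfolding cterm_free_lt[OF n1] by blast
  qed
  ultimately show ?thesis unfolding Y dim_kfree(1) by linarith
qed

section \<open>The canonical module as a dual\<close>

lemma (in vecspace) functional_separating:
  assumes V: "subspace V" and x: "x \<notin> V"
  obtains f where "Vector_Spaces.linear scale (*) f" "f x = 1" "\<And>y. y \<in> V \<Longrightarrow> f y = 0"
proof -
  interpret k: vecspace "(*) :: 'a \<Rightarrow> 'a \<Rightarrow> 'a" by (rule vecspace_field)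
  interpret p: vecspace_pair scale "(*) :: 'a \<Rightarrow> 'a \<Rightarrow> 'a" ..
  obtain B where B: "B \<subseteq> V" "independent B" "V \<subseteq> span B" by (rule maximal_independent_subset)
  have "span B \<subseteq> V" by (rule span_minimal[OF B(1) V])
  then have "x \<notin> span B" using x by blast
  then have "independent (insert x B)" "x \<notin> B" using B(2) independent_insert span_base by auto
  then obtain f where f: "Vector_Spaces.linear scale (*) f" "\<And>y. y \<in> insert x B \<Longrightarrow> f y = (if y = x then 1 else 0)"
    using p.linear_independent_extend[of "insert x B" "\<lambda>y. if y = x then 1 else 0"] by blast
  have "f y = 0" if "y \<in> V" for y
    using p.linear_eq_0_on_span[OF f(1), of B y] f(2) \<open>x \<notin> B\<close> B(3) that by fastforce
  then show ?thesis using f by (intro that[of f]) auto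
qed

lemma module_regular_module:
  fixes R (structure)
  assumes "cring R"
  shows "Module.module R (regular_module R)"
proof -
  interpret cring R by fact
  show ?thesis
    by (rule moduleI[OF assms], rule abelian_groupI)
      (auto simp: regular_module_def a_ac l_distr r_distr m_assoc intro!: bexI[of _ "\<ominus> x" for x] l_neg)
qed

text \<open>A monomial of least degree in \<open>r\<close> is raised to degree exactly n - 1 by a
  power of a variable, so the class of u r is a nonzero element of the socle of R.\<close>

lemma ideal_ge_not_mem:
  fixes r :: "('v::finite, 'k::field) mpoly"
  assumes "r \<notin> ideal_ge n"
  obtains u M where "u * r \<in> ideal_ge (n - 1)" "mdeg M = n - 1" "Poly_Mapping.lookup (u * r) M \<noteq> 0" "n \<ge> 1"
proof -
  have "\<exists>m. mdeg m < n \<and> Poly_Mapping.lookup r m \<noteq> 0" using assms by (auto simp: ideal_ge_def)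
  then obtain m where m: "mdeg m < n" "Poly_Mapping.lookup r m \<noteq> 0"
      "\<And>m'. mdeg m' < mdeg m \<Longrightarrow> \<not> (mdeg m' < n \<and> Poly_Mapping.lookup r m' \<noteq> 0)"
    using ex_has_least_nat[of "\<lambda>m. mdeg m < n \<and> Poly_Mapping.lookup r m \<noteq> 0" _ mdeg]
    by (metis linorder_not_less)
  define a where "a = Poly_Mapping.single (undefined :: 'v) (n - 1 - mdeg m)"
  have a: "mdeg a = n - 1 - mdeg m" by (simp add: a_def mdeg_single)
  let ?u = "Poly_Mapping.single a 1 :: ('v, 'k) mpoly"
  have "r \<in> ideal_ge (mdeg m)" using m by (intro ideal_geI) (metis less_trans)
  moreover have "?u \<in> ideal_ge (mdeg a)" by (intro ideal_geI) (auto simp: lookup_single when_def)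
  ultimately have "?u * r \<in> ideal_ge (n - 1)" using ideal_ge_mult2[of ?u "mdeg a" r "mdeg m"] a m(1) by simp
  then show ?thesis
    using m(1,2) a by (intro that[of ?u "a + m"]) (auto simp: lookup_single_mult mdeg_add)
qed

text \<open>Each half of being an injective hull gives one half of the pairing. Essentiality gives
  the right kernel: a nonzero submodule meets the socle, where \<open>lam\<close> does not vanish.
  Injectivity gives faithfulness: the map from a socle line of R to the socle of \<omega> extends to
  R, so no element outside \<open>\<nn>\<^sup>n\<close> can annihilate \<omega>.\<close>

theorem canonical_module_dual_pairing:
  fixes \<omega> :: "(('v::finite, 'k::field) mpoly set, 'w) module"
  assumes n: "n \<ge> 2" and card: "CARD('v) \<ge> 2"
    and can: "canonical_module n \<omega>" and \<eta>: "\<eta> \<in> LinearCombinations.module_hom (truncated_ring n) (tfree n c) \<omega>"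
    and onto: "\<eta> ` carrier (tfree n c) = carrier \<omega>"
  obtains lam where "dual_pairing n c (lam :: (nat \<Rightarrow> ('v, 'k) mpoly) \<Rightarrow> 'k)"
    "\<And>x. x \<in> free c \<Longrightarrow> \<eta> (pj n c x) = \<zero>\<^bsub>\<omega>\<^esub> \<longleftrightarrow> (\<forall>r. lam (smul r x) = 0)"
proof -
  let ?R = "truncated_ring n :: ('v, 'k) mpoly set ring"
  let ?K = "residue_module n :: (('v, 'k) mpoly set, 'k) module"
  have n1: "n \<ge> 1" using n by simp
  have inj: "injective_module ?R \<omega>" and hull: "\<exists>\<iota> \<in> LinearCombinations.module_hom ?R ?K \<omega>. inj_on \<iota> (carrier ?K) \<and>
       (\<forall>N. LinearCombinations.submodule ?R N \<omega> \<and> N \<noteq> {\<zero>\<^bsub>\<omega>\<^esub>} \<longrightarrow> N \<inter> \<iota> ` carrier ?K \<noteq> {\<zero>\<^bsub>\<omega>\<^esub>})"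
    using can unfolding canonical_module_def injective_hull_def by blast+
  obtain \<iota> where \<iota>: "\<iota> \<in> LinearCombinations.module_hom ?R ?K \<omega>" "inj \<iota>"
      "\<And>N. LinearCombinations.submodule ?R N \<omega> \<Longrightarrow> N \<noteq> {\<zero>\<^bsub>\<omega>\<^esub>} \<Longrightarrow> N \<inter> range \<iota> \<noteq> {\<zero>\<^bsub>\<omega>\<^esub>}"
    using hull unfolding residue_module_simps by blast
  interpret W: Module.module ?R \<omega> using inj unfolding injective_module_def by blast
  have Rc: "proj n r \<in> carrier ?R" for r by (simp add: truncated_ring_simps)
  define E where "E x = \<eta> (pj n c x)" for x
  have Ec: "E x \<in> carrier \<omega>" for x unfolding E_def by (rule funcset_mem[OF module_hom_closed[OF \<eta>] pj_carrier])
  have Eadd: "E (x + y) = E x \<oplus>\<^bsub>\<omega>\<^esub> E y" for x y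
    unfolding E_def pj_ops[symmetric] by (rule LinearCombinations.module_hom_add[OF \<eta> pj_carrier pj_carrier])
  have Esm: "E (smul r x) = proj n r \<odot>\<^bsub>\<omega>\<^esub> E x" for r x
    unfolding E_def pj_ops[symmetric] by (rule LinearCombinations.module_hom_smult[OF \<eta> Rc pj_carrier])
  have Esc: "E (fscale a x) = proj n (Poly_Mapping.single 0 a) \<odot>\<^bsub>\<omega>\<^esub> E x" for a x
    unfolding smul_const_eq[symmetric] by (rule Esm)
  have E0: "E 0 = \<zero>\<^bsub>\<omega>\<^esub>" using Eadd[of 0 0] Ec[of 0] W.add.l_cancel_one' by simp
  have Eonto: "\<exists>x\<in>free c. w = E x" if "w \<in> carrier \<omega>" for w
    using that unfolding onto[symmetric] pj_image[symmetric] E_def by blast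
  have \<iota>c: "\<iota> a \<in> carrier \<omega>" for a
    using funcset_mem[OF module_hom_closed[OF \<iota>(1)], of a] by (simp add: residue_module_simps)
  have \<iota>add: "\<iota> (a + b) = \<iota> a \<oplus>\<^bsub>\<omega>\<^esub> \<iota> b" for a b
    using LinearCombinations.module_hom_add[OF \<iota>(1), of a b] by (simp add: residue_module_simps)
  have \<iota>sm: "\<iota> (Poly_Mapping.lookup r 0 * a) = proj n r \<odot>\<^bsub>\<omega>\<^esub> \<iota> a" for r a
    using LinearCombinations.module_hom_smult[OF \<iota>(1) Rc, of a r] by (simp add: residue_module_simps rsd_proj[OF n1])
  have \<iota>0: "\<iota> 0 = \<zero>\<^bsub>\<omega>\<^esub>" using \<iota>add[of 0 0] \<iota>c[of 0] W.add.l_cancel_one' by simp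
  define Kt where "Kt = {x \<in> free c. E x = \<zero>\<^bsub>\<omega>\<^esub>}"
  have Kt: "fs.subspace Kt"
    by (rule fs.subspaceI) (auto simp: Kt_def E0 Eadd Esc free_add free_fscale Rc)
  \<comment> \<open>\<open>x0\<close> lifts a generator of the copy of the residue field;
    \<open>lam\<close> is normalised on it and vanishes on the kernel \<open>Kt\<close>.\<close>
  obtain x0 where x0: "x0 \<in> free c" "\<iota> 1 = E x0" using Eonto[OF \<iota>c] by blast
  have "\<iota> 1 \<noteq> \<zero>\<^bsub>\<omega>\<^esub>" using injD[OF \<iota>(2), of 1 0] \<iota>0 by auto
  then have "x0 \<notin> Kt" by (simp add: Kt_def x0)
  then obtain lam where lam: "Vector_Spaces.linear fscale (*) lam" "lam x0 = (1 :: 'k)" "\<And>y. y \<in> Kt \<Longrightarrow> lam y = 0"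
    by (rule fs.functional_separating[OF Kt]) blast
  note lam_hom = Vector_Spaces.linear.axioms(3)[OF lam(1)]
  have Kt_smul: "smul r x \<in> Kt" if "x \<in> Kt" for r x
    using that Rc by (auto simp: Kt_def Esm free_smul)
  have \<iota>E: "\<iota> a = E (fscale a x0)" for a
    using \<iota>sm[of "Poly_Mapping.single 0 a" 1] by (simp add: Esc x0(2)[symmetric])
  have Kt_iff: "x \<in> Kt \<longleftrightarrow> (\<forall>r. lam (smul r x) = 0)" if x: "x \<in> free c" for x
  proof
    assume all: "\<forall>r. lam (smul r x) = 0"
    show "x \<in> Kt"
    proof (rule ccontr)
      assume nx: "x \<notin> Kt"
      \<comment> \<open>The cyclic submodule generated by the image of \<open>x\<close>; a nonzero
        element of it in the residue field gives a multiple of \<open>x\<close> on which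
        \<open>lam\<close> is nonzero.\<close>
      let ?N = "range (\<lambda>r. E (smul r x))"
      have sub: "LinearCombinations.submodule ?R ?N \<omega>"
      proof (rule submodule.intro[OF W.module_axioms])
        show "?N \<subseteq> carrier \<omega>" using Ec by blast
        show "v \<oplus>\<^bsub>\<omega>\<^esub> w \<in> ?N" if "v \<in> ?N" "w \<in> ?N" for v w
          using that by (auto simp: Eadd[symmetric] smul_add_left[symmetric])
        show "\<zero>\<^bsub>\<omega>\<^esub> \<in> ?N" using E0 by (metis rangeI smul_zero(2))
        show "a \<odot>\<^bsub>\<omega>\<^esub> v \<in> ?N" if "a \<in> carrier ?R" "v \<in> ?N" for a v
          using that by (auto simp: truncated_ring_simps Esm[symmetric] smul_smul)
      qed
      have "E (smul 1 x) \<in> ?N" by blast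
      then have "E x \<in> ?N" by simp
      moreover have "E x \<noteq> \<zero>\<^bsub>\<omega>\<^esub>" using nx x by (simp add: Kt_def)
      ultimately have "?N \<noteq> {\<zero>\<^bsub>\<omega>\<^esub>}" by blast
      then have "?N \<inter> range \<iota> \<noteq> {\<zero>\<^bsub>\<omega>\<^esub>}" by (rule \<iota>(3)[OF sub])
      moreover have "\<zero>\<^bsub>\<omega>\<^esub> \<in> ?N \<inter> range \<iota>" using submodule.zero_closed[OF sub] \<iota>0 by (metis IntI rangeI)
      ultimately have "\<exists>y. y \<in> ?N \<inter> range \<iota> \<and> y \<noteq> \<zero>\<^bsub>\<omega>\<^esub>" by auto
      then obtain r a where ra: "E (smul r x) = \<iota> a" "\<iota> a \<noteq> \<zero>\<^bsub>\<omega>\<^esub>" by (auto simp: image_iff)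
      then have "a \<noteq> 0" using \<iota>0 by blast
      have "E (smul r x + fscale (- a) x0) = \<iota> a \<oplus>\<^bsub>\<omega>\<^esub> \<iota> (- a)" by (simp only: Eadd ra(1) \<iota>E)
      also have "\<dots> = \<zero>\<^bsub>\<omega>\<^esub>" by (simp add: \<iota>add[symmetric] \<iota>0)
      finally have "smul r x + fscale (- a) x0 \<in> Kt" 
        unfolding Kt_def by (intro CollectI conjI free_add free_smul free_fscale x x0(1))
      then have "lam (smul r x + fscale (- a) x0) = 0" by (rule lam(3))
      then have "lam (smul r x) = a"
        unfolding module_hom.add[OF lam_hom] module_hom.scale[OF lam_hom] lam(2) by simp
      then show False using all \<open>a \<noteq> 0\<close> by simp
    qed
  qed (use lam(3) Kt_smul in blast)
  have faithful: "r \<in> ideal_ge n" if r: "\<And>x. x \<in> free c \<Longrightarrow> lam (smul r x) = 0" for r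
  proof (rule ccontr)
    assume "r \<notin> ideal_ge n"
    then obtain u M where q: "u * r \<in> ideal_ge (n - 1)" "mdeg M = n - 1" "Poly_Mapping.lookup (u * r) M \<noteq> 0"
      by (rule ideal_ge_not_mem)
    have kill: "proj n r \<odot>\<^bsub>\<omega>\<^esub> w = \<zero>\<^bsub>\<omega>\<^esub>" if "w \<in> carrier \<omega>" for w
    proof -
      obtain x where x: "x \<in> free c" "w = E x" using Eonto[OF \<open>w \<in> carrier \<omega>\<close>] by blast
      have "lam (smul s (smul r x)) = 0" for s
        using r[OF free_smul[OF x(1), of s]] by (simp add: smul_smul mult.commute)
      then have "smul r x \<in> Kt" using Kt_iff[OF free_smul[OF x(1)]] by blast
      then show ?thesis by (simp add: Kt_def Esm x(2))
    qed
    let ?B = "regular_module ?R"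
    let ?q = "u * r"
    \<comment> \<open>The coefficient at M, normalised to be 1 on u r. It is well defined on classes
      because M has degree n - 1, so \<open>h\<close> may use any representative.\<close>
    define co where "co p = Poly_Mapping.lookup p M / Poly_Mapping.lookup ?q M" for p
    have co_cong: "co p = co p'" if "proj n p = proj n p'" for p p'
      using that ideal_geD[of "p - p'" n M] q(2) n1 by (simp add: co_def proj_eq_iff lookup_minus)
    define h where "h X = \<iota> (co (SOME p. X = proj n p))" for X
    have h: "h (proj n p) = \<iota> (co p)" for p
    proof -
      have "proj n p = proj n (SOME p'. proj n p = proj n p')" by (rule someI) simp
      then show ?thesis unfolding h_def using co_cong by metis
    qed
    \<comment> \<open>The line spanned by u r is an ideal of R: u r has order at least n - 1, so
      \<nn> multiplies it into \<open>\<nn>\<^sup>n\<close>.\<close>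
    let ?A = "range (\<lambda>a. proj n (Poly_Mapping.single 0 a * ?q))"
    have absorb: "proj n (p * (Poly_Mapping.single 0 a * ?q)) = proj n (Poly_Mapping.single 0 (Poly_Mapping.lookup p 0 * a) * ?q)"
      for p a
    proof -
      have "p - Poly_Mapping.single 0 (Poly_Mapping.lookup p 0) \<in> ideal_ge 1"
        by (rule ideal_geI) (simp add: lookup_minus)
      from ideal_ge_mult[OF ideal_ge_mult2[OF this q(1)], of "Poly_Mapping.single 0 a"] n1
      have "Poly_Mapping.single 0 a * ((p - Poly_Mapping.single 0 (Poly_Mapping.lookup p 0)) * ?q) \<in> ideal_ge n" by simp
      moreover have "p * (Poly_Mapping.single 0 a * ?q) - Poly_Mapping.single 0 (Poly_Mapping.lookup p 0 * a) * ?q =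
        Poly_Mapping.single 0 a * ((p - Poly_Mapping.single 0 (Poly_Mapping.lookup p 0)) * ?q)"
        unfolding mult_single[of 0 "Poly_Mapping.lookup p 0" 0 a, simplified, symmetric] by (simp add: algebra_simps)
      ultimately show ?thesis by (simp add: proj_eq_iff)
    qed
    have B: "Module.module ?R ?B" by (rule module_regular_module[OF cring_truncated_ring])
    have Bs: "proj n p \<oplus>\<^bsub>?B\<^esub> proj n p' = proj n (p + p')" "proj n p \<odot>\<^bsub>?B\<^esub> proj n p' = proj n (p * p')" for p p'
      by (simp_all add: regular_module_def truncated_ring_simps)
    have sub: "LinearCombinations.submodule ?R ?A ?B"
    proof (rule submodule.intro[OF B])
      show "?A \<subseteq> carrier ?B" by (auto simp: regular_module_def truncated_ring_simps)
      show "v \<oplus>\<^bsub>?B\<^esub> w \<in> ?A" if "v \<in> ?A" "w \<in> ?A" for v w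
        using that by (auto simp: Bs distrib_right[symmetric] single_add[symmetric])
      show "\<zero>\<^bsub>?B\<^esub> \<in> ?A" by (auto simp: regular_module_def truncated_ring_simps intro!: image_eqI[of _ _ 0])
      show "a \<odot>\<^bsub>?B\<^esub> v \<in> ?A" if "a \<in> carrier ?R" "v \<in> ?A" for a v
        using that by (auto simp: Bs truncated_ring_simps absorb)
    qed
    have "h \<in> LinearCombinations.module_hom ?R (?B\<lparr>carrier := ?A\<rparr>) \<omega>"
      unfolding LinearCombinations.module_hom_def
    proof (intro CollectI conjI allI impI)
      show "h \<in> carrier (?B\<lparr>carrier := ?A\<rparr>) \<rightarrow> carrier \<omega>" using h \<iota>c by auto
    next
      fix X Y assume "X \<in> carrier (?B\<lparr>carrier := ?A\<rparr>) \<and> Y \<in> carrier (?B\<lparr>carrier := ?A\<rparr>)"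
      then obtain p p' where XY: "X = proj n p" "Y = proj n p'" by auto
      have "co (p + p') = co p + co p'" by (simp add: co_def lookup_add add_divide_distrib)
      then show "h (X \<oplus>\<^bsub>?B\<lparr>carrier := ?A\<rparr>\<^esub> Y) = h X \<oplus>\<^bsub>\<omega>\<^esub> h Y" using Bs h \<iota>add by (simp add: XY)
    next
      fix Y X assume "Y \<in> carrier ?R \<and> X \<in> carrier (?B\<lparr>carrier := ?A\<rparr>)"
      then obtain p a where XY: "Y = proj n p" "X = proj n (Poly_Mapping.single 0 a * ?q)"
        by (auto simp: truncated_ring_simps)
      have "co (Poly_Mapping.single 0 a * ?q) = a" for a
        using lookup_single_mult[of 0 a ?q M] q(3) by (simp add: co_def)
      then show "h (Y \<odot>\<^bsub>?B\<lparr>carrier := ?A\<rparr>\<^esub> X) = Y \<odot>\<^bsub>\<omega>\<^esub> h X"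
        using Bs(2)[of p "Poly_Mapping.single 0 a * ?q"] by (simp add: XY absorb h \<iota>sm[symmetric])
    qed
    \<comment> \<open>The extension writes the generator of the residue field as u r times the image
      of 1, which is 0 because r annihilates \<omega>.\<close>
    then obtain h' where h': "h' \<in> LinearCombinations.module_hom ?R ?B \<omega>" "\<And>X. X \<in> ?A \<Longrightarrow> h' X = h X"
      using inj B sub unfolding injective_module_def by blast
    have 1: "proj n 1 \<in> carrier ?B" by (simp add: regular_module_def truncated_ring_simps)
    have w: "h' (proj n 1) \<in> carrier \<omega>" by (rule funcset_mem[OF module_hom_closed[OF h'(1)] 1])
    have "\<iota> 1 = h (proj n ?q)" using q(3) by (simp add: h co_def)
    also have "proj n ?q \<in> ?A" by (rule range_eqI[of _ _ 1]) simp
    then have "h (proj n ?q) = h' (proj n ?q)" using h'(2) by simp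
    also have "\<dots> = h' (proj n ?q \<odot>\<^bsub>?B\<^esub> proj n 1)" by (simp add: Bs)
    also have "\<dots> = proj n ?q \<odot>\<^bsub>\<omega>\<^esub> h' (proj n 1)" by (rule LinearCombinations.module_hom_smult[OF h'(1) Rc 1])
    also have "\<dots> = proj n u \<odot>\<^bsub>\<omega>\<^esub> (proj n r \<odot>\<^bsub>\<omega>\<^esub> h' (proj n 1))"
      using W.smult_assoc1[OF Rc Rc w, of u r] by (simp add: truncated_ring_simps)
    also have "\<dots> = \<zero>\<^bsub>\<omega>\<^esub>" unfolding kill[OF w] using Rc by simp
    finally show False using \<open>\<iota> 1 \<noteq> \<zero>\<^bsub>\<omega>\<^esub>\<close> by blast
  qed
  have ge: "lam x = 0" if "x \<in> free_ge c n" for x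
  proof -
    have "pj n c x = pj n c 0" using pj_eq_iff[of x c 0 n] that by (simp add: free_ge_def)
    then have "x \<in> Kt" using that E0 by (simp add: Kt_def E_def free_ge_def)
    then show ?thesis by (rule lam(3))
  qed
  have dp: "dual_pairing n c lam"
    by unfold_locales (use n card faithful ge module_hom.add[OF lam_hom] module_hom.scale[OF lam_hom] in auto)
  show ?thesis
    by (rule that[OF dp]) (use Kt_iff in \<open>auto simp: Kt_def E_def\<close>)
qed

section \<open>Betti numbers of the canonical module\<close>

text \<open>The rank of the second reduced differential occurs both in \<open>betti_diff\<close> and
  in the count of generators of the right kernel; eliminating it leaves
  \<open>dim_rker_mrker\<close>.\<close>

theorem betti_canonical_module:
  fixes \<omega> :: "(('v::finite, 'k::field) mpoly set, 'w) module"
  assumes n: "n \<ge> 2" and card: "CARD('v) \<ge> 2"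
    and can: "canonical_module n \<omega>" and fr: "free_resolution (truncated_ring n) \<omega> c \<eta> g"
  shows "int (betti n c g 1) - int (betti n c g 0) =
    int CARD('v) * int (hilb TYPE('v) (n - 1)) - int (hilb TYPE('v) (n - 1)) - int (hilb TYPE('v) (n - 2))"
proof -
  let ?R = "truncated_ring n :: ('v, 'k) mpoly set ring"
  have n1: "n \<ge> 1" using n by simp
  have \<eta>: "\<eta> \<in> LinearCombinations.module_hom ?R (tfree n (c 0)) \<omega>"
    and \<eta>s: "\<eta> ` carrier (tfree n (c 0)) = carrier \<omega>"
    and g: "\<And>i. i \<ge> 1 \<Longrightarrow> g i \<in> LinearCombinations.module_hom ?R (tfree n (c i)) (tfree n (c (i - 1)))"
    and k0: "g 1 ` carrier (tfree n (c 1)) = a_kernel (tfree n (c 0)) \<omega> \<eta>"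
    using fr unfolding free_resolution_def by blast+
  have k1: "g 2 ` carrier (tfree n (c 2)) = a_kernel (tfree n (c 1)) (tfree n (c 0)) (g 1)"
    using fr unfolding free_resolution_def by (auto simp: numeral_2_eq_2)
  have "\<exists>G. i \<ge> 1 \<longrightarrow> (\<forall>l. G l \<in> free (c (i - 1))) \<and> (\<forall>P\<in>free (c i). g i (pj n (c i) P) = pj n (c (i - 1)) (mat_lin (c i) G P))" for i
  proof (cases "i \<ge> 1")
    case True
    show ?thesis by (rule module_hom_tfree[OF g[OF True]]) blast
  qed simp
  then have "\<exists>G. \<forall>i. i \<ge> 1 \<longrightarrow> (\<forall>l. G i l \<in> free (c (i - 1))) \<and> (\<forall>P\<in>free (c i). g i (pj n (c i) P) = pj n (c (i - 1)) (mat_lin (c i) (G i) P))"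
    by (intro choice allI)
  then obtain G where G: "\<And>i l. i \<ge> 1 \<Longrightarrow> G i l \<in> free (c (i - 1))"
      "\<And>i P. i \<ge> 1 \<Longrightarrow> P \<in> free (c i) \<Longrightarrow> g i (pj n (c i) P) = pj n (c (i - 1)) (mat_lin (c i) (G i) P)"
    by blast
  have G1: "G 1 l \<in> free (c 0)" and G2: "G 2 l \<in> free (c 1)" for l using G(1)[of 1 l] G(1)[of 2 l] by simp_all
  have g1: "g 1 (pj n (c 1) P) = pj n (c 0) (mat_lin (c 1) (G 1) P)" if "P \<in> free (c 1)" for P
    using G(2)[of 1 P] that by simp
  have g2: "g 2 (pj n (c 2) P) = pj n (c 1) (mat_lin (c 2) (G 2) P)" if "P \<in> free (c 2)" for P
    using G(2)[of 2 P] that by simp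
  have ker0: "\<eta> (pj n (c 0) x) = \<zero>\<^bsub>\<omega>\<^esub> \<longleftrightarrow> (\<exists>P\<in>free (c 1). x - mat_lin (c 1) (G 1) P \<in> free_ge (c 0) n)"
    if x: "x \<in> free (c 0)" for x
  proof -
    have "\<eta> (pj n (c 0) x) = \<zero>\<^bsub>\<omega>\<^esub> \<longleftrightarrow> pj n (c 0) x \<in> g 1 ` carrier (tfree n (c 1))"
      unfolding k0 using pj_carrier by (auto simp: a_kernel_def kernel_def)
    also have "\<dots> \<longleftrightarrow> (\<exists>P\<in>free (c 1). pj n (c 0) x = pj n (c 0) (mat_lin (c 1) (G 1) P))"
      unfolding pj_image[symmetric] using g1 by (auto simp: image_iff)
    finally show ?thesis using pj_eq_iff[OF x mat_lin_free[OF G1]] by simp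
  qed
  have ker1: "mat_lin (c 1) (G 1) P \<in> free_ge (c 0) n \<longleftrightarrow> (\<exists>Q\<in>free (c 2). P - mat_lin (c 2) (G 2) Q \<in> free_ge (c 1) n)"
    if P: "P \<in> free (c 1)" for P
  proof -
    have "mat_lin (c 1) (G 1) P \<in> free_ge (c 0) n \<longleftrightarrow> g 1 (pj n (c 1) P) = \<zero>\<^bsub>tfree n (c 0)\<^esub>"
      unfolding g1[OF P] pj_ops using pj_eq_iff[OF mat_lin_free[OF G1] free_zero] by simp
    also have "\<dots> \<longleftrightarrow> pj n (c 1) P \<in> g 2 ` carrier (tfree n (c 2))"
      unfolding k1 using pj_carrier by (auto simp: a_kernel_def kernel_def)
    also have "\<dots> \<longleftrightarrow> (\<exists>Q\<in>free (c 2). pj n (c 1) P = pj n (c 1) (mat_lin (c 2) (G 2) Q))"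
      unfolding pj_image[symmetric] using g2 by (auto simp: image_iff)
    finally show ?thesis using pj_eq_iff[OF P mat_lin_free[OF G2]] by simp
  qed
  obtain lam where lam: "dual_pairing n (c 0) (lam :: (nat \<Rightarrow> ('v, 'k) mpoly) \<Rightarrow> 'k)"
    "\<And>x. x \<in> free (c 0) \<Longrightarrow> \<eta> (pj n (c 0) x) = \<zero>\<^bsub>\<omega>\<^esub> \<longleftrightarrow> (\<forall>r. lam (smul r x) = 0)"
    by (rule canonical_module_dual_pairing[OF n card can \<eta> \<eta>s]) blast
  interpret dual_pairing n "c 0" lam by (rule lam(1))
  have rk: "x \<in> rker \<longleftrightarrow> (\<exists>P\<in>free (c 1). x - mat_lin (c 1) (G 1) P \<in> free_ge (c 0) n)" if "x \<in> free (c 0)" for x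
    using lam(2)[OF that] ker0[OF that] that by (simp add: rker_def)
  let ?I = "mat_bar (c 2) (G 2) ` kfree (c 2)"
  have "fs.dim (rker \<inter> free_lt (c 0) n) + ks.dim ?I = fs.dim (mrker \<inter> free_lt (c 0) n) + c 1"
  proof (rule dim_rker_presentation[OF G1 G2])
    show "mat_lin (c 1) (G 1) P \<in> rker" if "P \<in> free (c 1)" for P
      unfolding rk[OF mat_lin_free[OF G1]] using that by (intro bexI[of _ P]) simp_all
    show "\<exists>P\<in>free (c 1). x - mat_lin (c 1) (G 1) P \<in> free_ge (c 0) n" if "x \<in> rker" for x
      using rk[OF rker_free[OF that]] that by blast
  qed (rule ker1)
  moreover have "int (betti n c g 1) - int (betti n c g 0) = int (c 1) - int (c 0) - int (ks.dim ?I)"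
  proof (rule betti_diff[OF n1, where gb = "\<lambda>i. mat_bar (c i) (G i)"])
    show "g i x \<in> carrier (tfree n (c (i - 1)))" if "i \<ge> 1" "x \<in> carrier (tfree n (c i))" for i x
      by (rule funcset_mem[OF module_hom_closed[OF g[OF that(1)]] that(2)])
    show "Vector_Spaces.linear kscale kscale (mat_bar (c i) (G i))" for i by (rule linear_mat_bar)
    show "rvec (c (i - 1)) (g i x) = mat_bar (c i) (G i) (rvec (c i) x)"
      if "i \<ge> 1" "x \<in> carrier (tfree n (c i))" for i x
      by (rule rvec_module_hom[OF n1 G(1)[OF that(1)] G(2)[OF that(1)] that(2)])
    show "mat_bar (c 1) (G 1) (mat_bar (c 2) (G 2) x) = 0" if "x \<in> kfree (c 2)" for x
    proof -
      have "x \<in> cterm ` (free_lt (c 2) n :: (nat \<Rightarrow> ('v, 'k) mpoly) set)"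
        unfolding cterm_free_lt[OF n1] by (rule that)
      then obtain Q where Q: "Q \<in> free (c 2)" "x = cterm (Q :: nat \<Rightarrow> ('v, 'k) mpoly)"
        using free_lt_subset by blast
      have "mat_lin (c 1) (G 1) (mat_lin (c 2) (G 2) Q) \<in> free_ge (c 0) n"
        unfolding ker1[OF mat_lin_free[OF G2]] using Q(1) by (intro bexI[of _ Q]) simp_all
      then have "cterm (mat_lin (c 1) (G 1) (mat_lin (c 2) (G 2) Q)) = 0"
        using n1 by (auto simp: cterm_def free_ge_def fun_eq_iff intro!: ideal_geD[of _ n])
      then show ?thesis unfolding cterm_mat_lin Q(2) .
    qed
  qed
  ultimately show ?thesis using dim_rker_mrker by linarith
qed

text \<open>With h_j for the Hilbert function, the right side is (d - 2) h_(n-1) + (h_(n-1) -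
  h_(n-2)). The first summand is nonnegative, and by Pascal's rule the second is a count in one
  variable less.\<close>

lemma hilb_bound:
  assumes n: "n \<ge> 2" and d: "CARD('v::finite) \<ge> 2"
  shows "int CARD('v) - 1 \<le> int CARD('v) * int (hilb TYPE('v) (n - 1)) - int (hilb TYPE('v) (n - 2)) - int (hilb TYPE('v) (n - 1))"
proof -
  let ?v = "undefined :: 'v"
  have "hnum (UNIV :: 'v set) (n - 1) = hnum (UNIV - {?v}) (n - 1) + hnum (UNIV :: 'v set) (n - 2)"
    using hnum_insert[of ?v "UNIV - {?v}" "n - 1"] n by (simp add: insert_absorb numeral_2_eq_2)
  moreover have "CARD('v) - 1 \<le> hnum (UNIV - {?v}) (n - 1)"
    using hnum_ge_card[of "n - 1" "UNIV - {?v}"] n by (simp add: card_Diff_singleton)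
  ultimately have h: "int CARD('v) - 1 \<le> int (hilb TYPE('v) (n - 1)) - int (hilb TYPE('v) (n - 2))" using d by linarith
  have "0 \<le> (int CARD('v) - 2) * int (hilb TYPE('v) (n - 1))" using d by (intro mult_nonneg_nonneg) auto
  then show ?thesis using h by (simp add: algebra_simps)
qed

theorem mainTheorem3:
  fixes d n :: nat
    and \<omega> :: "(('v::finite, 'k::field) mpoly set, 'w) module"
    and c :: "nat \<Rightarrow> nat"
    and \<eta> :: "(nat \<Rightarrow> ('v, 'k) mpoly set) \<Rightarrow> 'w"
    and g :: "nat \<Rightarrow> (nat \<Rightarrow> ('v, 'k) mpoly set) \<Rightarrow> (nat \<Rightarrow> ('v, 'k) mpoly set)"
    and b :: "nat \<Rightarrow> nat"
    and a :: "nat \<Rightarrow> nat \<Rightarrow> int"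
    and \<epsilon> :: "(nat \<Rightarrow> ('v, 'k) mpoly) \<Rightarrow> ('v, 'k) mpoly set"
    and f :: "nat \<Rightarrow> (nat \<Rightarrow> ('v, 'k) mpoly) \<Rightarrow> (nat \<Rightarrow> ('v, 'k) mpoly)"
  assumes "CARD('v) = d" and "d > 1" and "n > 1"
    and "canonical_module n \<omega>"
    and "free_resolution (truncated_ring n) \<omega> c \<eta> g"
    and "minimal_graded_free_resolution n b a \<epsilon> f"
  shows "int (betti n c g 1) - int (betti n c g 0) =
           int (module_rank class_ring (syzygy class_ring (truncated_ring_module n) b \<epsilon> f (d - 1)))
         \<and> module_rank class_ring (syzygy class_ring (truncated_ring_module n) b \<epsilon> f (d - 1)) \<ge> d - 1"
proof -
  have n: "n \<ge> 2" and d: "CARD('v) \<ge> 2" using assms(1-3) by simp_all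
  note rank = module_rank_syzygy[OF assms(6) n d, unfolded assms(1)]
  note bound = hilb_bound[where 'v = 'v, OF n d, unfolded assms(1)]
  show ?thesis
    using betti_canonical_module[OF n d assms(4,5), unfolded assms(1)] rank bound assms(2) by linarith
qed

end
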